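(* Let $\mathbb{F}$ be an algebraically closed pointed group and let $\Sigma$ be a fan in a finite dimensional $\mathbb{R}$-vector space $N_{\mathbb{R}}=N\otimes_{\mathbb{Z}}\mathbb{R}$ ($N$ a free abelian group of finite rank). Let $X(\Sigma)$ be the toric monoid scheme associated to $\Sigma$ and let $Y=\mathrm{SCong}_{\mathbb{F}}\big(X(\Sigma)\times_{\mathbb{F}_1}\mathrm{MSpec}\,\mathbb{F}\big)$ be the strong $\mathbb{F}$-congruence space of $X(\Sigma)\times_{\mathbb{F}_1}\mathrm{MSpec}\,\mathbb{F}$. Then $Y$ is a catenary topological space whose Krull dimension equals the dimension of the complex toric variety $X(\Sigma)_{\mathbb{C}}$.
   Context: All monoids are commutative. A pointed monoid is a multiplicative monoid $A$ with unit $1$ and absorbing element $0$; morphisms preserve products, $0$ and $1$. $\mathbb{F}_1=\{0,1\}$. A pointed group is a pointed monoid with $A^\times=A\setminus\{0\}$. A pointed group $\mathbb{F}$ is algebraically closed if for every $\alpha\in\mathbb{F}^\times$ and every $n\ge 1$ the set $\{x\in\mathbb{F}: x^n=\alpha\}$ has exactly $n$ elements. A $k$-algebra is a pointed monoid $A$ with a morphism $k\to A$. For a ring $R$, $R^\bullet$ is its multiplicative pointed monoid. A domain is a pointed monoid isomorphic to a pointed submonoid of $K^\bullet$ for some field $K$. Congruences: a congruence on $A$ is an equivalence relation $\mathfrak{c}\subseteq A\times A$ such that $(a,b)\in\mathfrak{c}$ implies $(\lambda a,\lambda b)\in\mathfrak{c}$ for all $\lambda\in A$; then $A/\mathfrak{c}$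 is a pointed monoid. For a $k$-algebra $A$, a $k$-congruence is a congruence $\mathfrak{c}$ with $A/\mathfrak{c}$ a domain and $k\to A/\mathfrak{c}$ injective. $\mathrm{SCong}_kA$ is the set of $k$-congruences of $A$ with the topology generated by the sets $\{\mathfrak{c}: (a,b)\notin\mathfrak{c}\}$, $a,b\in A$. A morphism $f:A\to B$ of $k$-algebras induces a continuous map $f^*:\mathrm{SCong}_kB\to\mathrm{SCong}_kA$, $f^*(\mathfrak{d})=\{(x,y): (f(x),f(y))\in\mathfrak{d}\}$. Monoid schemes: an ideal is a subset $I\ni 0$ with $AI\subseteq I$; it is prime if it is proper and $ab\in I$ implies $a\in I$ or $b\in I$. $\mathrm{MSpec}\,A$ is the set of prime ideals with basis of opens $U_h=\{P: h\notin P\}$ and sheaf of pointed monoids with $\Gamma(U_h)=A[h^{-1}]$. A monoid scheme is a topological space with a sheaf of pointed monoids locally isomorphic to such $\mathrm{MSpec}\,A$ (morphisms are local on stalks). A $k$-scheme is a monoid scheme with a morphism to $\mathrm{MSpec}\,k$. The strong $k$-congruence space of a $k$-scheme $X$ is $\mathrm{SCong}_kX=\mathrm{colim}_U\,\mathrm{SCong}_k\Gamma U$, over the affine opens $U\subseteq X$ with inclusions, the transition maps being the pullback maps. Toric notation: $M=\mathrm{Hom}(N,\mathbb{Z})$, with pairing $\langle\cdot,\cdot\rangle: M_{\mathbb{R}}\times N_{\mathbb{R}}\to\mathbb{R}$. A rational polyhedral cone in $N_{\mathbb{R}}$ is a set of nonnegative real combinations of finitely many elements of $N$; its dual is $\sigma^\vee=\{x\in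 M_{\mathbb{R}}:\langle x,y\rangle\ge0\ \forall y\in\sigma\}$; a face of $\sigma$ is $\sigma\cap\{u:\langle m,u\rangle=0\}$ with $m\in\sigma^\vee$; $\sigma$ is strongly convex if it contains no nonzero linear subspace. A fan is a finite collection $\Sigma$ of strongly convex rational polyhedral cones in $N_{\mathbb{R}}$, closed under taking faces, such that the intersection of any two of its cones is a face of both. $S_\sigma=\sigma^\vee\cap M$. For a pointed monoid $k$ and a monoid $S$ (written additively), $k[S]=\{\lambda\chi^s:\lambda\in k\setminus\{0\},s\in S\}\cup\{0\}$ with $(\lambda\chi^s)(\mu\chi^t)=(\lambda\mu)\chi^{s+t}$. $X(\Sigma)=\mathrm{colim}_{\sigma\in\Sigma}\mathrm{MSpec}\,\mathbb{F}_1[S_\sigma]$ along the open embeddings $\mathrm{MSpec}\,\mathbb{F}_1[S_\tau]\to\mathrm{MSpec}\,\mathbb{F}_1[S_\sigma]$ for $\tau$ a face of $\sigma$; $X(\Sigma)\times_{\mathbb{F}_1}\mathrm{MSpec}\,\mathbb{F}$ is the $\mathbb{F}$-scheme glued in the same way from the affine opens $\mathrm{MSpec}\,\mathbb{F}[S_\sigma]$. $X(\Sigma)_{\mathbb{C}}$ is the usual complex toric variety of $\Sigma$, glued from the affine schemes $\mathrm{Spec}\,\mathbb{C}[S_\sigma]$ (monoid rings). Topology: the Krull dimension of a topological space is the supremum of lengths of chains of irreducible closed subsets; a space is catenary if for all irreducible closed $T\subseteq T'$ the maximal chains of irreducible closed subsets from $T$ to $T'$ are finite and all have the same length. *)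

theory Defs
  imports
    "HOL-Analysis.Analysis"
    "HOL-Algebra.Generated_Fields"
    "HOL-Algebra.Weak_Morphisms"
    "HOL-Library.Poly_Mapping"
    "HOL-Library.Function_Algebras"
begin

section \<open>Pointed monoids\<close>

record 'a pmonoid = "'a monoid" +
  pzero :: 'a

locale pointed_monoid = comm_monoid A for A :: "'a pmonoid" (structure) +
  assumes pzero_closed: "pzero A \<in> carrier A"
    and pzero_absorb: "a \<in> carrier A \<Longrightarrow> pzero A \<otimes> a = pzero A"

definition pmon_hom :: "'a pmonoid \<Rightarrow> 'b pmonoid \<Rightarrow> ('a \<Rightarrow> 'b) set" where
  "pmon_hom A B = {f \<in> hom A B. f \<one>\<^bsub>A\<^esub> = \<one>\<^bsub>B\<^esub> \<and> f (pzero A) = pzero B}"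

definition pmon_iso :: "'a pmonoid \<Rightarrow> 'b pmonoid \<Rightarrow> ('a \<Rightarrow> 'b) set" where
  "pmon_iso A B = {f \<in> pmon_hom A B. bij_betw f (carrier A) (carrier B)}"

definition pointed_submonoid :: "'a set \<Rightarrow> 'a pmonoid \<Rightarrow> bool" where
  "pointed_submonoid B A \<longleftrightarrow> B \<subseteq> carrier A \<and> \<one>\<^bsub>A\<^esub> \<in> B \<and> pzero A \<in> B \<and>
     (\<forall>x\<in>B. \<forall>y\<in>B. x \<otimes>\<^bsub>A\<^esub> y \<in> B)"

definition pointed_group :: "'a pmonoid \<Rightarrow> bool" where
  "pointed_group F \<longleftrightarrow> pointed_monoid F \<and> Units F = carrier F - {pzero F}"

definition alg_closed_pgroup :: "'a pmonoid \<Rightarrow> bool" where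
  "alg_closed_pgroup F \<longleftrightarrow> pointed_group F \<and>
     (\<forall>\<alpha>\<in>Units F. \<forall>n\<ge>1. card {x \<in> carrier F. x [^]\<^bsub>F\<^esub> (n::nat) = \<alpha>} = n)"

definition ring_pmonoid :: "'a ring \<Rightarrow> 'a pmonoid" where
  "ring_pmonoid R = \<lparr>carrier = carrier R, mult = mult R, one = \<one>\<^bsub>R\<^esub>, pzero = \<zero>\<^bsub>R\<^esub>\<rparr>"

text \<open>The field ranges over the fields with elements in the type \<^typ>\<open>nat \<times> 'a\<close>. This is no
  restriction: a field containing \<open>A\<close> may be replaced by the subfield generated by \<open>A\<close>, whose
  cardinality is at most that of \<^typ>\<open>nat \<times> 'a\<close>. See \<open>pmon_domainI\<close> below.\<close>

definition pmon_domain :: "'a pmonoid \<Rightarrow> bool" where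
  "pmon_domain A \<longleftrightarrow> (\<exists>(K :: (nat \<times> 'a) ring) B f. field K \<and>
     pointed_submonoid B (ring_pmonoid K) \<and> f \<in> pmon_iso A ((ring_pmonoid K)\<lparr>carrier := B\<rparr>))"

lemma (in field) generate_field_card:
  includes cardinal_syntax
  fixes D :: "'d set"
  assumes H: "|H| \<le>o |D|" and inf: "infinite D"
  shows "|generate_field R H| \<le>o |D|"
proof -
  define G where "G = (\<lambda>L. L \<union> insert \<one> H \<union> (\<lambda>x. \<ominus> x) ` L \<union> (\<lambda>x. inv x) ` L \<union>
    (\<lambda>(x, y). x \<oplus> y) ` (L \<times> L) \<union> (\<lambda>(x, y). x \<otimes> y) ` (L \<times> L))"
  define L where "L = (\<lambda>n. (G ^^ n) {})"
  have L_Suc: "L (Suc n) = G (L n)" for n by (simp add: L_def)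
  have L_mono: "L m \<subseteq> L n" if "m \<le> n" for m n
    using that by (rule lift_Suc_mono_le[rotated]) (auto simp: L_Suc G_def)
  have card_un: "|A \<union> B| \<le>o |D|" if "|A| \<le>o |D|" "|B| \<le>o |D|" for A B :: "'a set"
    using card_of_Un_ordLeq_infinite_Field[of "|D|" A B] that inf
    by (metis Field_card_of card_of_Card_order)
  have card_times: "|A \<times> B| \<le>o |D|" if "|A| \<le>o |D|" "|B| \<le>o |D|" for A B :: "'a set"
    using card_of_Times_ordLeq_infinite_Field[of "|D|" A B] that inf
    by (metis Field_card_of card_of_Card_order)
  have card_im: "|f ` A| \<le>o |D|" if "|A| \<le>o |D|" for f :: "'z \<Rightarrow> 'a" and A
    using card_of_image that ordLeq_transitive by blast
  have "|{\<one>}| \<le>o |D|"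
    using inf by (metis card_of_singl_ordLeq finite.emptyI)
  then have base: "|insert \<one> H| \<le>o |D|"
    using card_un[of "{\<one>}" H] H by simp
  have "|L n| \<le>o |D|" for n
  proof (induction n)
    case 0
    show ?case by (simp add: L_def card_of_empty)
  next
    case (Suc n)
    show ?case unfolding L_Suc G_def
      by (intro card_un card_im card_times base Suc)
  qed
  moreover have "|UNIV :: nat set| \<le>o |D|"
    using inf infinite_iff_card_of_nat by blast
  ultimately have "|\<Union>n. L n| \<le>o |D|"
    using card_of_UNION_ordLeq_infinite[OF inf, of UNIV L] by simp
  moreover have "generate_field R H \<subseteq> (\<Union>n. L n)"
  proof
    fix x assume "x \<in> generate_field R H"
    then show "x \<in> (\<Union>n. L n)"
    proof induction
      case one
      have "\<one> \<in> L (Suc 0)" by (simp add: L_Suc G_def)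
      then show ?case by blast
    next
      case (incl h)
      then have "h \<in> L (Suc 0)" by (simp add: L_Suc G_def)
      then show ?case by blast
    next
      case (a_inv h)
      then obtain n where "h \<in> L n" by blast
      then have "\<ominus> h \<in> L (Suc n)" by (simp add: L_Suc G_def)
      then show ?case by blast
    next
      case (m_inv h)
      then obtain n where "h \<in> L n" by blast
      then have "inv h \<in> L (Suc n)" by (simp add: L_Suc G_def)
      then show ?case by blast
    next
      case (eng_add h1 h2)
      then obtain m n where "h1 \<in> L m" "h2 \<in> L n" by blast
      then have "h1 \<in> L (max m n)" "h2 \<in> L (max m n)"
        using L_mono[of m "max m n"] L_mono[of n "max m n"] by auto
      then have "h1 \<oplus> h2 \<in> L (Suc (max m n))" by (auto simp add: L_Suc G_def)
      then show ?case by blast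
    next
      case (eng_mult h1 h2)
      then obtain m n where "h1 \<in> L m" "h2 \<in> L n" by blast
      then have "h1 \<in> L (max m n)" "h2 \<in> L (max m n)"
        using L_mono[of m "max m n"] L_mono[of n "max m n"] by auto
      then have "h1 \<otimes> h2 \<in> L (Suc (max m n))" by (auto simp add: L_Suc G_def)
      then show ?case by blast
    qed
  qed
  ultimately show ?thesis
    using card_of_mono1 ordLeq_transitive by blast
qed

lemma pmon_domainI:
  fixes A :: "'a pmonoid" and K :: "'b ring"
  assumes K: "field K" and f: "f \<in> pmon_hom A (ring_pmonoid K)" "inj_on f (carrier A)"
    and A: "pointed_monoid A"
  shows "pmon_domain A"
proof -
  include cardinal_syntax
  interpret K: field K by (rule K)
  interpret A: pointed_monoid A by (rule A)
  have fh: "f x \<in> carrier K" "f (x \<otimes>\<^bsub>A\<^esub> y) = f x \<otimes>\<^bsub>K\<^esub> f y"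
    if "x \<in> carrier A" "y \<in> carrier A" for x y
    using f(1) that by (auto simp: pmon_hom_def hom_def ring_pmonoid_def)
  have f1: "f \<one>\<^bsub>A\<^esub> = \<one>\<^bsub>K\<^esub>" "f (pzero A) = \<zero>\<^bsub>K\<^esub>"
    using f(1) by (auto simp: pmon_hom_def ring_pmonoid_def)
  define H where "H = f ` carrier A"
  have HK: "H \<subseteq> carrier K" using fh(1) by (auto simp: H_def)
  define L where "L = generate_field K H"
  have field_L: "field (K\<lparr>carrier := L\<rparr>)"
    unfolding L_def by (rule K.generate_field_is_field[OF HK])
  have HL: "H \<subseteq> L" by (auto simp: L_def intro: generate_field.incl)
  have inf: "infinite (UNIV :: (nat \<times> 'a) set)" by (simp add: finite_prod)
  have "inj (\<lambda>a. (0::nat, a) :: nat \<times> 'a)" by (auto intro: injI)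
  then have "|UNIV :: 'a set| \<le>o |UNIV :: (nat \<times> 'a) set|"
    by (metis card_of_ordLeq subset_UNIV)
  moreover have "|H| \<le>o |UNIV :: 'a set|"
    unfolding H_def using card_of_image card_of_mono1 ordLeq_transitive subset_UNIV by metis
  ultimately have "|L| \<le>o |UNIV :: (nat \<times> 'a) set|"
    unfolding L_def using K.generate_field_card[OF _ inf] ordLeq_transitive by blast
  then obtain g :: "'b \<Rightarrow> nat \<times> 'a" where g: "inj_on g L"
    by (metis card_of_ordLeq)
  define K' where "K' = image_ring g (K\<lparr>carrier := L\<rparr>)"
  have field_K': "field K'"
    unfolding K'_def using field.inj_imp_image_ring_is_field[OF field_L] g by simp
  have iso: "g \<in> ring_iso (K\<lparr>carrier := L\<rparr>) K'"
    unfolding K'_def by (rule inj_imp_image_ring_iso) (use g in simp)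
  have gm: "g x \<in> carrier K'" "g (x \<otimes>\<^bsub>K\<^esub> y) = g x \<otimes>\<^bsub>K'\<^esub> g y" if "x \<in> L" "y \<in> L" for x y
    using iso that by (auto simp: ring_iso_def ring_hom_def)
  have g1: "g \<one>\<^bsub>K\<^esub> = \<one>\<^bsub>K'\<^esub>" "g \<zero>\<^bsub>K\<^esub> = \<zero>\<^bsub>K'\<^esub>"
    by (simp_all add: K'_def image_ring_one image_ring_zero)
  define B where "B = (g \<circ> f) ` carrier A"
  have fL: "f x \<in> L" if "x \<in> carrier A" for x using HL that by (auto simp: H_def)
  have mult: "(g \<circ> f) (x \<otimes>\<^bsub>A\<^esub> y) = (g \<circ> f) x \<otimes>\<^bsub>K'\<^esub> (g \<circ> f) y"
    if "x \<in> carrier A" "y \<in> carrier A" for x y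
    using that fL by (simp add: fh gm)
  have "pointed_submonoid B (ring_pmonoid K')"
    unfolding pointed_submonoid_def
  proof (intro conjI ballI)
    show "B \<subseteq> carrier (ring_pmonoid K')"
      using fL gm(1) by (fastforce simp: B_def ring_pmonoid_def simp del: split_paired_All)
    have "(g \<circ> f) \<one>\<^bsub>A\<^esub> \<in> B" unfolding B_def by (rule imageI) simp
    then show "\<one>\<^bsub>ring_pmonoid K'\<^esub> \<in> B" by (simp add: f1 g1 ring_pmonoid_def)
    have "(g \<circ> f) (pzero A) \<in> B" unfolding B_def by (rule imageI) (rule A.pzero_closed)
    then show "pzero (ring_pmonoid K') \<in> B" by (simp add: f1 g1 ring_pmonoid_def)
    fix x y assume "x \<in> B" "y \<in> B"
    then obtain a b where ab: "a \<in> carrier A" "b \<in> carrier A" "x = (g \<circ> f) a" "y = (g \<circ> f) b"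
      unfolding B_def by blast
    have "x \<otimes>\<^bsub>K'\<^esub> y = (g \<circ> f) (a \<otimes>\<^bsub>A\<^esub> b)" using mult ab by simp
    also have "\<dots> \<in> B" unfolding B_def by (rule imageI) (use ab in simp)
    finally show "x \<otimes>\<^bsub>ring_pmonoid K'\<^esub> y \<in> B" by (simp add: ring_pmonoid_def)
  qed
  moreover have "g \<circ> f \<in> pmon_iso A ((ring_pmonoid K')\<lparr>carrier := B\<rparr>)"
  proof -
    have "inj_on (g \<circ> f) (carrier A)"
      using f(2) inj_on_subset[OF g, of "f ` carrier A"] fL by (intro comp_inj_on) auto
    then have "bij_betw (g \<circ> f) (carrier A) B" by (simp add: B_def bij_betw_def)
    then show ?thesis using mult
      by (auto simp: pmon_iso_def pmon_hom_def hom_def B_def ring_pmonoid_def f1 g1)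
  qed
  ultimately show ?thesis using field_K' unfolding pmon_domain_def by blast
qed


section \<open>Congruences\<close>

definition congruence :: "'a pmonoid \<Rightarrow> ('a \<times> 'a) set \<Rightarrow> bool" where
  "congruence A c \<longleftrightarrow> equiv (carrier A) c \<and>
     (\<forall>(a, b)\<in>c. \<forall>l\<in>carrier A. (l \<otimes>\<^bsub>A\<^esub> a, l \<otimes>\<^bsub>A\<^esub> b) \<in> c)"

definition quot_pmonoid :: "'a pmonoid \<Rightarrow> ('a \<times> 'a) set \<Rightarrow> 'a set pmonoid" where
  "quot_pmonoid A c = \<lparr>carrier = carrier A // c,
     mult = (\<lambda>X Y. \<Union>x\<in>X. \<Union>y\<in>Y. c `` {x \<otimes>\<^bsub>A\<^esub> y}),
     one = c `` {\<one>\<^bsub>A\<^esub>}, pzero = c `` {pzero A}\<rparr>"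

text \<open>A \<open>k\<close>-algebra is given by a pointed monoid \<open>A\<close> and its structure morphism \<open>\<eta>\<close> from \<open>k\<close>.\<close>

definition SCong :: "'k pmonoid \<Rightarrow> ('k \<Rightarrow> 'a) \<Rightarrow> 'a pmonoid \<Rightarrow> ('a \<times> 'a) set set" where
  "SCong k \<eta> A = {c. congruence A c \<and> pmon_domain (quot_pmonoid A c) \<and>
     inj_on (\<lambda>l. c `` {\<eta> l}) (carrier k)}"

text \<open>The sets below cover \<^const>\<open>SCong\<close>, since \<open>(0, 1)\<close> is in no congruence with a domain as
  quotient. Hence the topological space has \<^const>\<open>SCong\<close> as its set of points.\<close>

definition SCong_top ::
  "'k pmonoid \<Rightarrow> ('k \<Rightarrow> 'a) \<Rightarrow> 'a pmonoid \<Rightarrow> ('a \<times> 'a) set topology" where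
  "SCong_top k \<eta> A = topology_generated_by
     {{c \<in> SCong k \<eta> A. (a, b) \<notin> c} | a b. a \<in> carrier A \<and> b \<in> carrier A}"

lemma topspace_SCong_top:
  assumes "pointed_monoid A"
  shows "topspace (SCong_top k \<eta> A) = SCong k \<eta> A"
proof -
  interpret pointed_monoid A by fact
  have "(pzero A, \<one>\<^bsub>A\<^esub>) \<notin> c" if c: "c \<in> SCong k \<eta> A" for c
  proof
    assume "(pzero A, \<one>\<^bsub>A\<^esub>) \<in> c"
    then have eq: "c `` {pzero A} = c `` {\<one>\<^bsub>A\<^esub>}"
      using c equiv_class_eq unfolding SCong_def congruence_def by fast
    from c obtain K :: "(nat \<times> 'a set) ring" and f B where "field K"
      and "f \<in> pmon_iso (quot_pmonoid A c) ((ring_pmonoid K)\<lparr>carrier := B\<rparr>)"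
      by (auto simp: SCong_def pmon_domain_def)
    then have "f (c `` {\<one>\<^bsub>A\<^esub>}) = \<one>\<^bsub>K\<^esub>" "f (c `` {pzero A}) = \<zero>\<^bsub>K\<^esub>"
      by (auto simp: pmon_iso_def pmon_hom_def quot_pmonoid_def ring_pmonoid_def)
    then show False using eq \<open>field K\<close> by (metis domain.one_not_zero field.axioms(1))
  qed
  then show ?thesis using pzero_closed one_closed by (auto simp: SCong_top_def)
qed

definition cong_pullback ::
  "'a pmonoid \<Rightarrow> ('a \<Rightarrow> 'b) \<Rightarrow> ('b \<times> 'b) set \<Rightarrow> ('a \<times> 'a) set" where
  "cong_pullback A f d = {(x, y) \<in> carrier A \<times> carrier A. (f x, f y) \<in> d}"


section \<open>Colimits of topological spaces\<close>

text \<open>A pair \<open>(j, i) \<in> R\<close> stands for a transition map \<open>f j i\<close> from \<open>X j\<close> to \<open>X i\<close>. The colimit is the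
  disjoint union modulo the equivalence relation generated by these maps, with the quotient
  topology.\<close>

definition colim_rel :: "'i set \<Rightarrow> ('i \<times> 'i) set \<Rightarrow> ('i \<Rightarrow> 'x topology) \<Rightarrow> ('i \<Rightarrow> 'i \<Rightarrow> 'x \<Rightarrow> 'x)
    \<Rightarrow> (('i \<times> 'x) \<times> ('i \<times> 'x)) set" where
  "colim_rel I R X f =
     {(p, q). p \<in> topspace (sum_topology X I) \<and> q \<in> topspace (sum_topology X I) \<and>
        equivclp (\<lambda>p q. \<exists>j i x. (j, i) \<in> R \<and> j \<in> I \<and> i \<in> I \<and> x \<in> topspace (X j) \<and>
                    p = (j, x) \<and> q = (i, f j i x)) p q}"

definition top_colim :: "'i set \<Rightarrow> ('i \<times> 'i) set \<Rightarrow> ('i \<Rightarrow> 'x topology) \<Rightarrow> ('i \<Rightarrow> 'i \<Rightarrow> 'x \<Rightarrow> 'x)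
    \<Rightarrow> ('i \<times> 'x) set topology" where
  "top_colim I R X f = topology (\<lambda>U.
     U \<subseteq> topspace (sum_topology X I) // colim_rel I R X f \<and> openin (sum_topology X I) (\<Union>U))"

lemma equiv_colim_rel: "equiv (topspace (sum_topology \<X> I)) (colim_rel I R \<X> f)"
  by (rule equivI)
    (auto simp: colim_rel_def refl_on_def sym_def trans_def
      intro: equivclp_sym equivclp_trans)

lemma openin_top_colim:
  "openin (top_colim I R \<X> f) U \<longleftrightarrow>
     U \<subseteq> topspace (sum_topology \<X> I) // colim_rel I R \<X> f \<and> openin (sum_topology \<X> I) (\<Union>U)"
proof -
  let ?Q = "topspace (sum_topology \<X> I) // colim_rel I R \<X> f"
  have inter: "\<Union>(U \<inter> V) = \<Union>U \<inter> \<Union>V" if "U \<subseteq> ?Q" "V \<subseteq> ?Q" for U V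
  proof (intro equalityI subsetI)
    fix x assume "x \<in> \<Union>U \<inter> \<Union>V"
    then obtain c d where cd: "c \<in> U" "d \<in> V" "x \<in> c" "x \<in> d" by blast
    then have "c = d"
      using quotient_disj[OF equiv_colim_rel, of c \<X> I R f d] that by blast
    then show "x \<in> \<Union>(U \<inter> V)" using cd by blast
  qed blast
  have "istopology (\<lambda>U. U \<subseteq> ?Q \<and> openin (sum_topology \<X> I) (\<Union>U))"
    unfolding istopology_def
  proof (intro conjI allI impI)
    fix U V assume "U \<subseteq> ?Q \<and> openin (sum_topology \<X> I) (\<Union>U)"
      "V \<subseteq> ?Q \<and> openin (sum_topology \<X> I) (\<Union>V)"
    then show "openin (sum_topology \<X> I) (\<Union>(U \<inter> V))" "U \<inter> V \<subseteq> ?Q"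
      by (auto simp: inter)
  next
    fix \<K> assume a: "\<forall>K\<in>\<K>. K \<subseteq> ?Q \<and> openin (sum_topology \<X> I) (\<Union>K)"
    then show "\<Union>\<K> \<subseteq> ?Q" by blast
    have "\<Union>(\<Union>\<K>) = (\<Union>K\<in>\<K>. \<Union>K)" by blast
    then show "openin (sum_topology \<X> I) (\<Union>(\<Union>\<K>))" using a by (metis (mono_tags, lifting) openin_Union imageE)
  qed
  then show ?thesis by (simp add: top_colim_def topology_inverse')
qed

lemma topspace_top_colim:
  "topspace (top_colim I R \<X> f) = topspace (sum_topology \<X> I) // colim_rel I R \<X> f"
proof -
  have "openin (top_colim I R \<X> f) (topspace (sum_topology \<X> I) // colim_rel I R \<X> f)"
    unfolding openin_top_colim
    using Union_quotient[OF equiv_colim_rel] by (metis openin_topspace order_refl)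
  then show ?thesis
    by (meson openin_top_colim openin_subset openin_topspace subset_antisym)
qed

definition colim_inj :: "'i set \<Rightarrow> ('i \<times> 'i) set \<Rightarrow> ('i \<Rightarrow> 'x topology) \<Rightarrow> ('i \<Rightarrow> 'i \<Rightarrow> 'x \<Rightarrow> 'x)
    \<Rightarrow> 'i \<Rightarrow> 'x \<Rightarrow> ('i \<times> 'x) set" where
  "colim_inj I R X f i x = colim_rel I R X f `` {(i, x)}"


section \<open>Monoid schemes\<close>

text \<open>A topological space together with a sheaf of pointed monoids: \<open>sections X U\<close> are the sections
  over the open set \<open>U\<close>, and \<open>restr X U V\<close> restricts them to \<open>V \<subseteq> U\<close>.\<close>

record ('p, 's) monoidal_space =
  pts :: "'p topology"
  sections :: "'p set \<Rightarrow> 's pmonoid"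
  restr :: "'p set \<Rightarrow> 'p set \<Rightarrow> 's \<Rightarrow> 's"

definition open_subspace :: "('p, 's) monoidal_space \<Rightarrow> 'p set \<Rightarrow> ('p, 's) monoidal_space" where
  "open_subspace X U = X\<lparr>pts := subtopology (pts X) U\<rparr>"

text \<open>An isomorphism of spaces with sheaves induces isomorphisms on stalks, so it is automatically
  local.\<close>

definition monoidal_space_isomorphic ::
  "('p, 's) monoidal_space \<Rightarrow> ('q, 't) monoidal_space \<Rightarrow> bool" where
  "monoidal_space_isomorphic X Y \<longleftrightarrow> (\<exists>\<phi> \<theta>. homeomorphic_map (pts X) (pts Y) \<phi> \<and>
     (let pre = (\<lambda>V. {x \<in> topspace (pts X). \<phi> x \<in> V}) in
       (\<forall>V. openin (pts Y) V \<longrightarrow> \<theta> V \<in> pmon_iso (sections Y V) (sections X (pre V))) \<and>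
       (\<forall>V W. openin (pts Y) V \<and> openin (pts Y) W \<and> W \<subseteq> V \<longrightarrow>
          (\<forall>s\<in>carrier (sections Y V).
             \<theta> W (restr Y V W s) = restr X (pre V) (pre W) (\<theta> V s)))))"

subsection \<open>Localization\<close>

definition loc_rel :: "'a pmonoid \<Rightarrow> 'a set \<Rightarrow> (('a \<times> 'a) \<times> ('a \<times> 'a)) set" where
  "loc_rel A S = {((a, s), (b, t)). a \<in> carrier A \<and> b \<in> carrier A \<and> s \<in> S \<and> t \<in> S \<and>
     (\<exists>u\<in>S. u \<otimes>\<^bsub>A\<^esub> (t \<otimes>\<^bsub>A\<^esub> a) = u \<otimes>\<^bsub>A\<^esub> (s \<otimes>\<^bsub>A\<^esub> b))}"

definition frac :: "'a pmonoid \<Rightarrow> 'a set \<Rightarrow> 'a \<Rightarrow> 'a \<Rightarrow> ('a \<times> 'a) set" where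
  "frac A S a s = loc_rel A S `` {(a, s)}"

definition localization :: "'a pmonoid \<Rightarrow> 'a set \<Rightarrow> ('a \<times> 'a) set pmonoid" where
  "localization A S = \<lparr>carrier = (carrier A \<times> S) // loc_rel A S,
     mult = (\<lambda>X Y. \<Union>(a, s)\<in>X. \<Union>(b, t)\<in>Y. frac A S (a \<otimes>\<^bsub>A\<^esub> b) (s \<otimes>\<^bsub>A\<^esub> t)),
     one = frac A S \<one>\<^bsub>A\<^esub> \<one>\<^bsub>A\<^esub>, pzero = frac A S (pzero A) \<one>\<^bsub>A\<^esub>\<rparr>"

text \<open>The map on localizations induced by a morphism \<open>f\<close> into \<open>B\<close>; \<open>T\<close> is the set of denominators
  in \<open>B\<close>.\<close>

definition loc_map :: "'b pmonoid \<Rightarrow> 'b set \<Rightarrow> ('a \<Rightarrow> 'b) \<Rightarrow> ('a \<times> 'a) set \<Rightarrow> ('b \<times> 'b) set" where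
  "loc_map B T f X = (\<Union>(a, s)\<in>X. frac B T (f a) (f s))"

subsection \<open>Affine monoid schemes\<close>

definition prime_pideal :: "'a set \<Rightarrow> 'a pmonoid \<Rightarrow> bool" where
  "prime_pideal P A \<longleftrightarrow> P \<subseteq> carrier A \<and> pzero A \<in> P \<and>
     (\<forall>a\<in>carrier A. \<forall>p\<in>P. a \<otimes>\<^bsub>A\<^esub> p \<in> P) \<and> P \<noteq> carrier A \<and>
     (\<forall>a\<in>carrier A. \<forall>b\<in>carrier A. a \<otimes>\<^bsub>A\<^esub> b \<in> P \<longrightarrow> a \<in> P \<or> b \<in> P)"

definition MSpec_top :: "'a pmonoid \<Rightarrow> 'a set topology" where
  "MSpec_top A = topology_generated_by {{P. prime_pideal P A \<and> h \<notin> P} | h. h \<in> carrier A}"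

lemma topspace_MSpec_top: "pointed_monoid A \<Longrightarrow> topspace (MSpec_top A) = {P. prime_pideal P A}"
proof -
  assume "pointed_monoid A"
  then interpret pointed_monoid A .
  have "\<one>\<^bsub>A\<^esub> \<notin> P" if "prime_pideal P A" for P
  proof
    assume "\<one>\<^bsub>A\<^esub> \<in> P"
    then have "carrier A \<subseteq> P" using that by (metis prime_pideal_def r_one subsetI)
    then show False using that by (auto simp: prime_pideal_def)
  qed
  then show ?thesis by (auto simp: MSpec_top_def)
qed

text \<open>Sections over \<open>U\<close> are the functions with values in the stalks \<open>A\<^sub>P\<close>, \<open>P \<in> U\<close>, that are locally given
  by a fraction. Over the basic open set of \<open>h\<close> these form \<open>A[h\<^sup>-\<^sup>1]\<close>: if nonempty, this set has
  a unique closed point, whose only neighbourhood in the set is the whole set, and the stalk at this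
  point is \<open>A[h\<^sup>-\<^sup>1]\<close>.\<close>

definition MSpec_sections :: "'a pmonoid \<Rightarrow> 'a set set \<Rightarrow> ('a set \<Rightarrow> ('a \<times> 'a) set) pmonoid" where
  "MSpec_sections A U =
    \<lparr>carrier = {s \<in> (\<Pi>\<^sub>E P\<in>U. carrier (localization A (carrier A - P))).
       \<forall>P\<in>U. \<exists>V a h. openin (MSpec_top A) V \<and> P \<in> V \<and> V \<subseteq> U \<and> a \<in> carrier A \<and> h \<in> carrier A \<and>
         (\<forall>Q\<in>V. h \<notin> Q \<and> s Q = frac A (carrier A - Q) a h)},
     mult = (\<lambda>s t. \<lambda>P\<in>U. s P \<otimes>\<^bsub>localization A (carrier A - P)\<^esub> t P),
     one = (\<lambda>P\<in>U. \<one>\<^bsub>localization A (carrier A - P)\<^esub>),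
     pzero = (\<lambda>P\<in>U. pzero (localization A (carrier A - P)))\<rparr>"

definition MSpec :: "'a pmonoid \<Rightarrow> ('a set, 'a set \<Rightarrow> ('a \<times> 'a) set) monoidal_space" where
  "MSpec A = \<lparr>pts = MSpec_top A, sections = MSpec_sections A, restr = (\<lambda>U V s. restrict s V)\<rparr>"

text \<open>The morphism \<open>MSpec B \<rightarrow> MSpec A\<close> of a morphism \<open>f\<close> from \<open>A\<close> to \<open>B\<close>: on points, and from sections
  over \<open>V\<close> to sections over its preimage.\<close>

definition MSpec_map :: "'a pmonoid \<Rightarrow> ('a \<Rightarrow> 'b) \<Rightarrow> 'b set \<Rightarrow> 'a set" where
  "MSpec_map A f Q = {a \<in> carrier A. f a \<in> Q}"

definition MSpec_map_sections :: "'a pmonoid \<Rightarrow> 'b pmonoid \<Rightarrow> ('a \<Rightarrow> 'b) \<Rightarrow> 'a set set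
    \<Rightarrow> ('a set \<Rightarrow> ('a \<times> 'a) set) \<Rightarrow> ('b set \<Rightarrow> ('b \<times> 'b) set)" where
  "MSpec_map_sections A B f V s =
     (\<lambda>Q\<in>{Q. prime_pideal Q B \<and> MSpec_map A f Q \<in> V}.
        loc_map B (carrier B - Q) f (s (MSpec_map A f Q)))"

text \<open>If \<open>U\<close> is isomorphic to some \<open>MSpec A\<close>, then \<open>A\<close> is isomorphic to the monoid of sections over
  \<open>U\<close>, so it is enough to consider monoids with elements in the type of the sections.\<close>

definition affine_open :: "('p, 's) monoidal_space \<Rightarrow> 'p set \<Rightarrow> bool" where
  "affine_open X U \<longleftrightarrow> openin (pts X) U \<and>
     (\<exists>A :: 's pmonoid. pointed_monoid A \<and>
        monoidal_space_isomorphic (open_subspace X U) (MSpec A))"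

subsection \<open>Gluing\<close>

text \<open>The colimit of a diagram of monoidal spaces. For \<open>(j, i) \<in> R\<close> the transition morphism from
  \<open>X j\<close> to \<open>X i\<close> is \<open>f j i\<close> on points, and \<open>g j i V\<close> on sections over \<open>V\<close>. A section of the colimit is a
  compatible family of sections over the preimages of \<open>U\<close> in the \<open>X i\<close>.\<close>

definition ms_colim :: "'i set \<Rightarrow> ('i \<times> 'i) set \<Rightarrow> ('i \<Rightarrow> ('p, 's) monoidal_space)
    \<Rightarrow> ('i \<Rightarrow> 'i \<Rightarrow> 'p \<Rightarrow> 'p) \<Rightarrow> ('i \<Rightarrow> 'i \<Rightarrow> 'p set \<Rightarrow> 's \<Rightarrow> 's)
    \<Rightarrow> (('i \<times> 'p) set, 'i \<Rightarrow> 's) monoidal_space" where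
  "ms_colim I R X f g =
    (let pre = (\<lambda>i U. {x \<in> topspace (pts (X i)). colim_inj I R (\<lambda>i. pts (X i)) f i x \<in> U}) in
     \<lparr>pts = top_colim I R (\<lambda>i. pts (X i)) f,
      sections = (\<lambda>U.
        \<lparr>carrier = {s \<in> (\<Pi>\<^sub>E i\<in>I. carrier (sections (X i) (pre i U))).
           \<forall>j\<in>I. \<forall>i\<in>I. (j, i) \<in> R \<longrightarrow> g j i (pre i U) (s i) = s j},
         mult = (\<lambda>s t. \<lambda>i\<in>I. s i \<otimes>\<^bsub>sections (X i) (pre i U)\<^esub> t i),
         one = (\<lambda>i\<in>I. \<one>\<^bsub>sections (X i) (pre i U)\<^esub>),
         pzero = (\<lambda>i\<in>I. pzero (sections (X i) (pre i U)))\<rparr>),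
      restr = (\<lambda>U V s. \<lambda>i\<in>I. restr (X i) (pre i U) (pre i V) (s i))\<rparr>)"

subsection \<open>Strong congruence spaces\<close>

text \<open>Morphisms from \<open>X\<close> to \<open>MSpec k\<close> correspond to morphisms from \<open>k\<close> to the global sections
  of \<open>X\<close>. So the \<open>k\<close>-scheme structure of \<open>X\<close> is given as a map \<open>\<eta>\<close> from \<open>k\<close> to the global sections.\<close>

definition SCong_scheme :: "'k pmonoid \<Rightarrow> ('k \<Rightarrow> 's) \<Rightarrow> ('p, 's) monoidal_space
    \<Rightarrow> ('p set \<times> ('s \<times> 's) set) set topology" where
  "SCong_scheme k \<eta> X = top_colim {U. affine_open X U} {(U, V). U \<subseteq> V}
     (\<lambda>U. SCong_top k (\<lambda>l. restr X (topspace (pts X)) U (\<eta> l)) (sections X U))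
     (\<lambda>U V. cong_pullback (sections X V) (restr X V U))"


section \<open>Fans\<close>

text \<open>\<open>N\<close> is a lattice of full rank in the real vector space \<^typ>\<open>'v\<close>, which thus is \<open>N\<^sub>\<real>\<close>. The rank
  may be zero. The dual space consists of the linear functionals, and the pairing is evaluation.\<close>

definition full_lattice :: "'v::real_vector set \<Rightarrow> bool" where
  "full_lattice N \<longleftrightarrow> (\<exists>B. finite B \<and> independent B \<and> span B = UNIV \<and>
     N = {\<Sum>b\<in>B. of_int (c b) *\<^sub>R b | c :: 'v \<Rightarrow> int. True})"

definition dual_lattice :: "'v::real_vector set \<Rightarrow> ('v \<Rightarrow> real) set" where
  "dual_lattice N = {m. linear m \<and> m ` N \<subseteq> \<int>}"

definition rational_polyhedral_cone :: "'v::real_vector set \<Rightarrow> 'v set \<Rightarrow> bool" where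
  "rational_polyhedral_cone N \<sigma> \<longleftrightarrow> (\<exists>G. finite G \<and> G \<subseteq> N \<and>
     \<sigma> = {\<Sum>g\<in>G. c g *\<^sub>R g | c. \<forall>g\<in>G. c g \<ge> 0})"

definition dual_cone :: "'v::real_vector set \<Rightarrow> ('v \<Rightarrow> real) set" where
  "dual_cone \<sigma> = {m. linear m \<and> (\<forall>u\<in>\<sigma>. m u \<ge> 0)}"

definition cone_face :: "'v::real_vector set \<Rightarrow> 'v set \<Rightarrow> bool" where
  "cone_face \<tau> \<sigma> \<longleftrightarrow> (\<exists>m\<in>dual_cone \<sigma>. \<tau> = \<sigma> \<inter> {u. m u = 0})"

definition strongly_convex :: "'v::real_vector set \<Rightarrow> bool" where
  "strongly_convex \<sigma> \<longleftrightarrow> (\<forall>V. subspace V \<and> V \<subseteq> \<sigma> \<longrightarrow> V = {0})"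

definition fan :: "'v::real_vector set \<Rightarrow> 'v set set \<Rightarrow> bool" where
  "fan N \<Delta> \<longleftrightarrow> finite \<Delta> \<and>
     (\<forall>\<sigma>\<in>\<Delta>. rational_polyhedral_cone N \<sigma> \<and> strongly_convex \<sigma>) \<and>
     (\<forall>\<sigma>\<in>\<Delta>. \<forall>\<tau>. cone_face \<tau> \<sigma> \<longrightarrow> \<tau> \<in> \<Delta>) \<and>
     (\<forall>\<sigma>\<in>\<Delta>. \<forall>\<tau>\<in>\<Delta>. cone_face (\<sigma> \<inter> \<tau>) \<sigma> \<and> cone_face (\<sigma> \<inter> \<tau>) \<tau>)"

definition cone_monoid :: "'v::real_vector set \<Rightarrow> 'v set \<Rightarrow> ('v \<Rightarrow> real) set" where
  "cone_monoid N \<sigma> = dual_cone \<sigma> \<inter> dual_lattice N"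


section \<open>Toric monoid schemes\<close>

text \<open>\<^term>\<open>Some (l, s)\<close> stands for \<open>l \<chi>\<^sup>s\<close>, and \<^const>\<open>None\<close> for \<open>0\<close>.\<close>

definition monoid_alg :: "'k pmonoid \<Rightarrow> 'm::comm_monoid_add set \<Rightarrow> ('k \<times> 'm) option pmonoid" where
  "monoid_alg k S =
    \<lparr>carrier = insert None (Some ` ((carrier k - {pzero k}) \<times> S)),
     mult = (\<lambda>x y. case (x, y) of
       (Some (l, s), Some (m, t)) \<Rightarrow>
         if l \<otimes>\<^bsub>k\<^esub> m = pzero k then None else Some (l \<otimes>\<^bsub>k\<^esub> m, s + t)
       | _ \<Rightarrow> None),
     one = (if \<one>\<^bsub>k\<^esub> = pzero k then None else Some (\<one>\<^bsub>k\<^esub>, 0)),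
     pzero = None\<rparr>"

definition monoid_alg_const :: "'k pmonoid \<Rightarrow> 'k \<Rightarrow> ('k \<times> 'm::comm_monoid_add) option" where
  "monoid_alg_const k l = (if l = pzero k then None else Some (l, 0))"

text \<open>The fan enters as the diagram of its cones and the face inclusions. For \<open>\<tau>\<close> a face of \<open>\<sigma>\<close>, the
  morphism from \<open>k[S\<^sub>\<sigma>]\<close> to \<open>k[S\<^sub>\<tau>]\<close> is the inclusion. For \<open>k = {0, 1}\<close> the
  scheme below is \<open>X(\<Delta>)\<close>, and for general \<open>k\<close> it is the base change of \<open>X(\<Delta>)\<close> to \<open>k\<close>.\<close>

definition face_rel :: "'v::real_vector set set \<Rightarrow> ('v set \<times> 'v set) set" where
  "face_rel \<Delta> = {(\<tau>, \<sigma>) \<in> \<Delta> \<times> \<Delta>. cone_face \<tau> \<sigma>}"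

definition toric_scheme :: "'k pmonoid \<Rightarrow> 'v::real_vector set \<Rightarrow> 'v set set
    \<Rightarrow> (('v set \<times> ('k \<times> ('v \<Rightarrow> real)) option set) set,
        'v set \<Rightarrow> ('k \<times> ('v \<Rightarrow> real)) option set \<Rightarrow>
          (('k \<times> ('v \<Rightarrow> real)) option \<times> ('k \<times> ('v \<Rightarrow> real)) option) set) monoidal_space" where
  "toric_scheme k N \<Delta> =
    (let A = (\<lambda>\<sigma>. monoid_alg k (cone_monoid N \<sigma>)) in
     ms_colim \<Delta> (face_rel \<Delta>) (\<lambda>\<sigma>. MSpec (A \<sigma>))
       (\<lambda>\<tau> \<sigma>. MSpec_map (A \<sigma>) id)
       (\<lambda>\<tau> \<sigma>. MSpec_map_sections (A \<sigma>) (A \<tau>) id))"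

text \<open>The structure of a \<open>k\<close>-scheme: \<open>l\<close> is sent to the global section \<open>l \<chi>\<^sup>0\<close>.\<close>

definition toric_structure :: "'k pmonoid \<Rightarrow> 'v::real_vector set \<Rightarrow> 'v set set \<Rightarrow> 'k
    \<Rightarrow> 'v set \<Rightarrow> ('k \<times> ('v \<Rightarrow> real)) option set \<Rightarrow>
      (('k \<times> ('v \<Rightarrow> real)) option \<times> ('k \<times> ('v \<Rightarrow> real)) option) set" where
  "toric_structure k N \<Delta> l =
    (\<lambda>\<sigma>\<in>\<Delta>. let A = monoid_alg k (cone_monoid N \<sigma>) in
       (\<lambda>P\<in>{P. prime_pideal P A}. frac A (carrier A - P) (monoid_alg_const k l) \<one>\<^bsub>A\<^esub>))"


section \<open>The complex toric variety\<close>

definition monoid_ring :: "'m::comm_monoid_add set \<Rightarrow> ('m \<Rightarrow>\<^sub>0 'c::comm_ring_1) ring" where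
  "monoid_ring S = \<lparr>carrier = {p. Poly_Mapping.keys p \<subseteq> S},
     mult = (*), one = 1, zero = 0, add = (+)\<rparr>"

definition Spec_top :: "'a ring \<Rightarrow> 'a set topology" where
  "Spec_top R = topology_generated_by {{P. primeideal P R \<and> h \<notin> P} | h. h \<in> carrier R}"

text \<open>The underlying topological space of the scheme glued from the spectra of \<open>\<complex>[S\<^sub>\<sigma>]\<close>.\<close>

definition toric_variety_top :: "'v::real_vector set \<Rightarrow> 'v set set
    \<Rightarrow> ('v set \<times> (('v \<Rightarrow> real) \<Rightarrow>\<^sub>0 complex) set) set topology" where
  "toric_variety_top N \<Delta> = top_colim \<Delta> (face_rel \<Delta>)
     (\<lambda>\<sigma>. Spec_top (monoid_ring (cone_monoid N \<sigma>)))
     (\<lambda>\<tau> \<sigma> Q. Q \<inter> carrier (monoid_ring (cone_monoid N \<sigma>)))"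


section \<open>Dimension\<close>

definition irreducible_closed :: "'x topology \<Rightarrow> 'x set \<Rightarrow> bool" where
  "irreducible_closed X T \<longleftrightarrow> closedin X T \<and> T \<noteq> {} \<and>
     (\<forall>A B. closedin X A \<and> closedin X B \<and> T = A \<union> B \<longrightarrow> T = A \<or> T = B)"

text \<open>A chain with \<open>n + 1\<close> members has length \<open>n\<close>. The empty space has dimension \<open>-\<infinity>\<close>.\<close>

definition krull_dim :: "'x topology \<Rightarrow> ereal" where
  "krull_dim X = (SUP C\<in>{C. subset.chain {T. irreducible_closed X T} C \<and> finite C \<and> C \<noteq> {}}.
     ereal (real (card C) - 1))"

definition catenary :: "'x topology \<Rightarrow> bool" where
  "catenary X \<longleftrightarrow> (\<forall>T T'. irreducible_closed X T \<and> irreducible_closed X T' \<and> T \<subseteq> T' \<longrightarrow>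
     (let chains = {C. subset.maxchain {Z. irreducible_closed X Z \<and> T \<subseteq> Z \<and> Z \<subseteq> T'} C} in
       (\<forall>C\<in>chains. finite C) \<and> (\<forall>C\<in>chains. \<forall>D\<in>chains. card C = card D)))"

end

theory Submission
 imports Defs "HOL-Algebra.Polynomial_Divisibility"
begin

text \<open>A point of the congruence space of \<open>F[S]\<close> is the kernel of a homomorphism into a field. As
\<open>F\<close> contains all roots of its elements, it is given by a face \<open>T\<close> of \<open>S\<close>, a saturated subgroup
\<open>L\<close> of the group spanned by \<open>T\<close> and a homomorphism \<open>L \<rightarrow> F\<^sup>\<times>\<close>. Every such triple occurs: in the
quotient group the number of elements killed by \<open>n\<close> is at most \<open>n\<close>, so the group embeds into the units
of an ultraproduct of fields. Ultraproducts of points also give generic points of irreducible closed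
sets. Inclusion of points is graded by \<open>rank (\<langle>T\<rangle> / L)\<close>, whence catenarity and the bound by the rank
of \<open>N\<close>, which is attained at the zero cone. Each point of the monoid scheme has a smallest
neighbourhood \<open>U\<^sub>\<sigma>\<close>, a section on it is an element of \<open>F[M]\<close>, and the space of the scheme is glued
from the open subspaces belonging to the cones. On the complex side, elements that witness a chain of
primes are algebraically independent, and counting monomials in a box bounds their number by the rank of
\<open>N\<close>; kernels of coordinate projections form a chain of that length.\<close>

text \<open>Embedding a group with at most \<open>n\<close> solutions of \<open>x^n = 1\<close> into
  the units of a field rests on separating finitely many elements from 1 by one complex character.
  For each prime \<open>p\<close> there is at most one subgroup of order \<open>p\<close>, so
  elements of different prime orders can be treated one after the other; elements of infinite order
  are moved off 1 by a positive real twist. Such a character is found for finitely many elements at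
  a time, and \<open>F\<close> may be larger than the complex numbers, hence the ultraproduct over
  all characters. The exact number of roots in \<open>F\<close> is used in the other direction too:
  a field containing \<open>F\<close> has no further roots of unity, so the subgroup
  \<open>L\<close> of a point is saturated.

  The obstacle to catenarity is a step from \<open>T\<close> to a smaller face \<open>T'\<close>. A
  point strictly between may have to keep \<open>T\<close> and add one relation, and this must not
  link \<open>T'\<close> with its complement in \<open>T\<close>. Stiemke's alternative supplies a
  lattice functional that is zero on \<open>L\<close> and, within \<open>T\<close>, exactly on
  \<open>T'\<close>; relations in its kernel keep the two apart, and a rank gap of two leaves room
  for one.\<close>

abbreviation mult_in ("_ *[_] _" [70, 0, 71] 70) where "x *[G] y \<equiv> x \<otimes>\<^bsub>G\<^esub> y"
abbreviation pow_in ("_ ^[_] _" [75, 0, 75] 75) where "x ^[G] n \<equiv> x [^]\<^bsub>G\<^esub> n"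
abbreviation one_in ("1[_]") where "1[G] \<equiv> \<one>\<^bsub>G\<^esub>"
abbreviation zero_in ("0[_]") where "0[G] \<equiv> \<zero>\<^bsub>G\<^esub>"
abbreviation inv_in ("inv[_] _" [0, 81] 80) where "inv[G] x \<equiv> inv\<^bsub>G\<^esub> x"

section \<open>Irreducible closed sets and gradings\<close>

lemma irreducible_closed_closed: "irreducible_closed S T ==> closedin S T"
 and irreducible_closed_nonempty: "irreducible_closed S T ==> T ~= {}"
 and irreducible_closed_Un:
  "irreducible_closed S T ==> closedin S A ==> closedin S B ==> T = A Un B ==> T = A \<or> T = B"
 by (simp_all add: irreducible_closed_def)

lemma irreducible_closed_subset: "irreducible_closed S T ==> T <= topspace S"
 by (rule closedin_subset) (rule irreducible_closed_closed)

lemma irreducible_closed_cases: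
 assumes "irreducible_closed S T" "closedin S A" "closedin S B" "T <= A Un B"
 shows "T <= A \<or> T <= B"
proof -
 have "closedin S (T Int A)" "closedin S (T Int B)"
  using irreducible_closed_closed[OF assms(1)] assms(2,3) by (simp_all add: closedin_Int)
 moreover have "T = (T Int A) Un (T Int B)" using assms(4) by blast
 ultimately have "T = T Int A \<or> T = T Int B" by (rule irreducible_closed_Un[OF assms(1)])
 thus ?thesis by auto
qed

text \<open>A maximal chain takes every rank between those of \<open>T\<close> and
  \<open>T'\<close>: if a value were skipped, the two members with the nearest ranks would differ by
  at least 2, and the set supplied by \<open>gap\<close> could be added. So \<rho> maps the chain
  bijectively onto an interval of integers.\<close>

lemma graded_maxchain:
 fixes \<rho> :: "'a set => nat"
 assumes T: "T : \<A>" "T' : \<A>" "!!Z. Z : \<A> ==> T <= Z & Z <= T'"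
  and mono: "!!Z Z'. Z : \<A> ==> Z' : \<A> ==> Z < Z' ==> \<rho> Z < \<rho> Z'"
  and gap: "!!Z Z'. Z : \<A> ==> Z' : \<A> ==> Z < Z' ==> \<rho> Z + 2 <= \<rho> Z' ==>
   EX W:\<A>. Z < W & W < Z'"
  and C: "subset.maxchain \<A> C"
 shows "finite C & card C = Suc (\<rho> T') - \<rho> T"
proof -
 have CA: "C <= \<A>" and lin: "!!x y. x : C ==> y : C ==> x < y \<or> x = y \<or> y < x"
  using C unfolding subset.maxchain_def subset_chain_def by blast+
 have max: "Z : C" if "Z : \<A>" "!!x. x : C ==> x <= Z \<or> Z <= x" for Z
 proof (rule ccontr)
  assume "Z ~: C"
  moreover have "subset.chain \<A> (insert Z C)" using that CA lin unfolding subset_chain_def by blast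
  ultimately show False using C unfolding subset.maxchain_def by blast
 qed
 have TC: "T : C" "T' : C" using max T CA by blast+
 have inj: "inj_on \<rho> C"
 proof (rule inj_onI)
  fix x y assume xy: "x : C" "y : C" "\<rho> x = \<rho> y"
  hence "x : \<A>" "y : \<A>" using CA by auto
  thus "x = y" using lin[OF xy(1,2)] mono[of x y] mono[of y x] xy(3) by auto
 qed
 have mono': "\<rho> x <= \<rho> y \<longleftrightarrow> x <= y" if "x : C" "y : C" for x y
 proof -
  have "x : \<A>" "y : \<A>" using that CA by auto
  thus ?thesis using lin[OF that]
  proof (elim disjE)
   assume "y < x"
   hence "~ x <= y" "\<rho> y < \<rho> x" using mono[of y x] \<open>x : \<A>\<close> \<open>y : \<A>\<close> by auto
   thus ?thesis by simp
  qed (use mono[of x y] \<open>x : \<A>\<close> \<open>y : \<A>\<close> in auto)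
 qed
 have "\<rho> ` C = {\<rho> T..\<rho> T'}"
 proof (intro equalityI subsetI)
  fix v assume "v : \<rho> ` C"
  then obtain x where x: "x : C" "v = \<rho> x" by auto
  hence "T <= x & x <= T'" using T(3) CA by auto
  thus "v : {\<rho> T..\<rho> T'}" using mono' TC x by simp
 next
  fix v assume v: "v : {\<rho> T..\<rho> T'}"
  show "v : \<rho> ` C"
  proof (rule ccontr)
   assume nv: "v ~: \<rho> ` C"
   \<comment> \<open>\<open>Z\<close> and \<open>Z'\<close> will be the members of the chain whose
     ranks are next to the missing value \<open>v\<close>.\<close>
   define lo where "lo = Max {\<rho> x | x. x : C & \<rho> x < v}"
   define hi where "hi = (LEAST k. EX x:C. \<rho> x = k & v < k)"
   have fin: "finite {\<rho> x | x. x : C & \<rho> x < v}" by (rule finite_subset[of _ "{..<v}"]) auto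
   have "\<rho> T < v" "v < \<rho> T'" using v nv TC by (auto simp: le_less)
   hence ne: "{\<rho> x | x. x : C & \<rho> x < v} ~= {}" using TC by blast
   obtain Z where Z: "Z : C" "\<rho> Z < v" "\<rho> Z = lo" using Max_in[OF fin ne] unfolding lo_def by auto
   have Zmax: "\<rho> x <= \<rho> Z" if "x : C" "\<rho> x < v" for x
   proof -
    have "\<rho> x : {\<rho> x | x. x : C & \<rho> x < v}" using that by auto
    from Max_ge[OF fin this] show ?thesis using Z(3) by (simp add: lo_def)
   qed
   have "EX x:C. \<rho> x = \<rho> T' & v < \<rho> T'" using TC \<open>v < \<rho> T'\<close> by blast
   hence "EX x:C. \<rho> x = hi & v < hi" unfolding hi_def by (rule LeastI)
   then obtain Z' where Z': "Z' : C" "\<rho> Z' = hi" "v < \<rho> Z'" by blast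
   have Zmin: "\<rho> Z' <= \<rho> x" if "x : C" "v < \<rho> x" for x
    unfolding Z'(2) hi_def by (rule Least_le) (use that in blast)
   have "Z < Z'" using lin[OF Z(1) Z'(1)] mono CA Z Z' by (metis less_trans not_less_iff_gr_or_eq subsetD)
   then obtain W where W: "W : \<A>" "Z < W" "W < Z'"
    using gap[of Z Z'] Z Z' CA by (metis Suc_leI add_2_eq_Suc' le_less_trans less_trans_Suc subsetD)
   have "W : C"
   proof (rule max[OF W(1)])
    fix x assume x: "x : C"
    hence "\<rho> x < v \<or> v < \<rho> x" using nv by (metis image_eqI linorder_neqE_nat)
    thus "x <= W \<or> W <= x" using Zmax Zmin mono' x Z Z' W by (metis psubset_imp_subset subset_trans)
   qed
   hence "\<rho> Z < \<rho> W" "\<rho> W < \<rho> Z'" using mono W Z Z' CA by blast+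
   moreover have "\<rho> W < v \<or> v < \<rho> W" using nv \<open>W : C\<close> by (metis image_eqI linorder_neqE_nat)
   ultimately show False using Zmax Zmin \<open>W : C\<close> by (meson leD)
  qed
 qed
 thus ?thesis using inj by (metis card_atLeastAtMost card_image finite_atLeastAtMost finite_imageD)
qed

text \<open>The witness \<open>W\<close> is not asked to lie in \<A>. For the up-sets used below it
  does, since it contains a member of \<A>.\<close>

definition grading :: "'x topology => ('x set => nat) => 'x set set => bool" where
 "grading S \<rho> \<A> \<longleftrightarrow> (ALL Z:\<A>. ALL Z':\<A>. Z < Z' --> \<rho> Z < \<rho> Z' &
   (\<rho> Z + 2 <= \<rho> Z' --> (EX W. irreducible_closed S W & Z < W & W < Z')))"

lemma gradingD:
 assumes "grading S \<rho> \<A>" "Z : \<A>" "Z' : \<A>" "Z < Z'"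
 shows "\<rho> Z < \<rho> Z'"
  and "\<rho> Z + 2 <= \<rho> Z' ==> EX W. irreducible_closed S W & Z < W & W < Z'"
 using assms unfolding grading_def by simp_all

text \<open>The grading may depend on the smallest set \<open>T\<close>. This is what allows a
  single chart that meets \<open>T\<close> to decide about all chains above
  \<open>T\<close>.\<close>

lemma catenaryI:
 assumes "!!T. irreducible_closed S T ==>
  \<exists>\<rho>. grading S \<rho> {Z. irreducible_closed S Z & T <= Z}"
 shows "catenary S" unfolding catenary_def Let_def
proof (intro allI impI)
 fix T T' assume T: "irreducible_closed S T & irreducible_closed S T' & T <= T'"
 define \<A> where "\<A> = {Z. irreducible_closed S Z & T <= Z & Z <= T'}"
 from assms T obtain \<rho> where \<rho>: "grading S \<rho> {Z. irreducible_closed S Z & T <= Z}" by blast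
 have *: "finite C & card C = Suc (\<rho> T') - \<rho> T" if "subset.maxchain \<A> C" for C
 proof (rule graded_maxchain[OF _ _ _ _ _ that])
  show "T : \<A>" "T' : \<A>" using T by (auto simp: \<A>_def)
  show "T <= Z & Z <= T'" if "Z : \<A>" for Z using that by (auto simp: \<A>_def)
  fix Z Z' assume Z: "Z : \<A>" "Z' : \<A>" "Z < Z'"
  hence Z': "Z : {Z. irreducible_closed S Z & T <= Z}" "Z' : {Z. irreducible_closed S Z & T <= Z}"
   by (auto simp: \<A>_def)
  show "\<rho> Z < \<rho> Z'" using gradingD(1)[OF \<rho> Z' Z(3)] .
  assume "\<rho> Z + 2 <= \<rho> Z'"
  then obtain W where W: "irreducible_closed S W" "Z < W" "W < Z'"
   using gradingD(2)[OF \<rho> Z' Z(3)] by auto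
  moreover have "T <= W" "W <= T'" using W Z by (auto simp: \<A>_def)
  ultimately have "W : \<A>" by (simp add: \<A>_def)
  thus "EX W:\<A>. Z < W & W < Z'" using W by auto
 qed
 thus "(ALL C:{C. subset.maxchain {Z. irreducible_closed S Z & T <= Z & Z <= T'} C}. finite C) &
  (ALL C:{C. subset.maxchain {Z. irreducible_closed S Z & T <= Z & Z <= T'} C}.
   ALL D:{C. subset.maxchain {Z. irreducible_closed S Z & T <= Z & Z <= T'} C}. card C = card D)"
  unfolding \<A>_def[symmetric] by simp
qed

lemma krull_dim_leI:
 assumes "!!C. subset.chain {T. irreducible_closed S T} C ==> finite C ==> C ~= {} ==>
  ereal (real (card C) - 1) <= d"
 shows "krull_dim S <= d" unfolding krull_dim_def by (rule SUP_least) (use assms in blast)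

lemma krull_dim_geI:
 assumes "subset.chain {T. irreducible_closed S T} C" "finite C" "C ~= {}"
 shows "ereal (real (card C) - 1) <= krull_dim S"
 unfolding krull_dim_def by (rule SUP_upper) (use assms in blast)

lemma strict_chain_card:
 fixes T :: "nat => 'a set"
 assumes "!!i. i <= n ==> irreducible_closed S (T i)" "!!i. i < n ==> T i < T (Suc i)"
 shows "ereal (real n) <= krull_dim S"
proof -
 have lt: "i < j ==> j <= n ==> T i < T j" for i j
 proof (induction j)
  case (Suc j)
  thus ?case using assms(2)[of j] by (cases "i = j") auto
 qed simp
 have inj: "inj_on T {..n}" by (rule inj_onI) (metis atMost_iff linorder_neqE_nat lt psubset_eq)
 have ch: "subset.chain {T. irreducible_closed S T} (T ` {..n})" unfolding subset_chain_def using assms(1) lt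
  by (auto simp: image_iff) (metis linorder_neqE_nat psubset_imp_subset subset_iff order_refl)
 have "card (T ` {..n}) = Suc n" using card_image[OF inj] by simp
 thus ?thesis using krull_dim_geI[OF ch] by simp
qed

lemma krull_dim_le_gradedI:
 fixes \<rho> :: "'x set => nat"
 assumes mono: "!!Z Z'. irreducible_closed S Z ==> irreducible_closed S Z' ==> Z < Z' ==> \<rho> Z < \<rho> Z'"
  and le: "!!Z. irreducible_closed S Z ==> \<rho> Z <= n"
 shows "krull_dim S <= ereal (real n)"
proof (rule krull_dim_leI)
 fix C assume C: "subset.chain {T. irreducible_closed S T} C" "finite C" "C ~= {}"
 have "inj_on \<rho> C"
 proof (rule inj_onI)
  fix x y assume xy: "x : C" "y : C" "\<rho> x = \<rho> y"
  hence "irreducible_closed S x" "irreducible_closed S y" "x <= y \<or> y <= x"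
   using C(1) unfolding subset_chain_def by auto
  thus "x = y" using mono[of x y] mono[of y x] xy(3) by auto
 qed
 moreover have "\<rho> ` C <= {..n}" using C(1) le unfolding subset_chain_def by auto
 ultimately have "card C <= Suc n" by (metis card_atMost card_image card_mono finite_atMost)
 thus "ereal (real (card C) - 1) <= ereal (real n)" by simp
qed

section \<open>Topologies generated by non-membership\<close>

text \<open>The common shape of the prime spectra of monoids and rings and of the congruence spaces:
  a point is a set, and the subbasic open sets consist of the points that miss a given element.
  Specialization is then inclusion.\<close>

definition avoid_top :: "'e set set => 'e set => 'e set topology" where
 "avoid_top P E = topology_generated_by {{x : P. e ~: x} | e. e : E}"

locale avoid_space =
 fixes P :: "'e set set" and E :: "'e set"
 assumes proper: "x : P ==> EX e:E. e ~: x"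
  and points_sub: "x : P ==> x <= E"
begin

lemma topspace_avoid [simp]: "topspace (avoid_top P E) = P"
proof -
 have "\<Union> {{x : P. e ~: x} | e. e : E} = (UN e:E. {x : P. e ~: x})" by auto
 also have "\<dots> = P" using proper by auto
 finally have "\<Union> {{x : P. e ~: x} | e. e : E} = P" .
 thus ?thesis by (simp add: avoid_top_def)
qed

lemma openin_avoid_basic: "e : E ==> openin (avoid_top P E) {x : P. e ~: x}"
 unfolding avoid_top_def by (rule topology_generated_by_Basis) blast

lemma openin_avoid_basic_finite:
 "finite F ==> F <= E ==> openin (avoid_top P E) {x : P. F Int x = {}}"
proof (induction F rule: finite_induct)
 case empty
 thus ?case using openin_topspace[of "avoid_top P E"] by simp
next
 case (insert e F)
 have "{x : P. insert e F Int x = {}} = {x : P. e ~: x} Int {x : P. F Int x = {}}" by blast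
 moreover have "openin (avoid_top P E) {x : P. e ~: x}" using insert.prems openin_avoid_basic by simp
 moreover have "openin (avoid_top P E) {x : P. F Int x = {}}" using insert by simp
 ultimately show ?case by (simp only: openin_Int)
qed

lemma openin_avoid:
 "openin (avoid_top P E) U \<longleftrightarrow> U <= P &
  (ALL x:U. EX F. finite F & F <= E & F Int x = {} & {y : P. F Int y = {}} <= U)" (is "?l = ?r")
proof
 assume U: ?l
 hence "U <= P" using openin_subset topspace_avoid by blast
 moreover have "generate_topology_on {{x : P. e ~: x} | e. e : E} U"
  using U by (simp add: avoid_top_def openin_topology_generated_by_iff)
 hence "ALL x:U. EX F. finite F & F <= E & F Int x = {} & {y : P. F Int y = {}} <= U"
 proof induction
  case (Int a b)
  show ?case
  proof
   fix x assume "x : a Int b"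
   hence x: "x : a" "x : b" by auto
   obtain F where F: "finite F" "F <= E" "F Int x = {}" "{y : P. F Int y = {}} <= a"
    using bspec[OF Int.IH(1) x(1)] by auto
   obtain G where G: "finite G" "G <= E" "G Int x = {}" "{y : P. G Int y = {}} <= b"
    using bspec[OF Int.IH(2) x(2)] by auto
   have "{y : P. (F Un G) Int y = {}} <= {y : P. F Int y = {}} Int {y : P. G Int y = {}}" by auto
   hence "{y : P. (F Un G) Int y = {}} <= a Int b" using F(4) G(4) by auto
   thus "EX F. finite F & F <= E & F Int x = {} & {y : P. F Int y = {}} <= a Int b"
    using F G by (intro exI[of _ "F Un G"]) auto
  qed
 next
  case (UN K)
  thus ?case by (meson Union_iff Union_upper subset_trans)
 next
  case (Basis s)
  then obtain e where e: "e : E" "s = {x : P. e ~: x}" by blast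
  thus ?case by (intro ballI exI[of _ "{e}"]) blast
 qed simp
 ultimately show ?r by blast
next
 assume r: ?r
 show ?l
 proof (subst openin_subopen, intro ballI)
  fix x assume "x : U"
  then obtain F where F: "finite F" "F <= E" "F Int x = {}" "{y : P. F Int y = {}} <= U" using r by blast
  moreover have "x : {y : P. F Int y = {}}" using r \<open>x : U\<close> F(3) by auto
  ultimately show "EX T. openin (avoid_top P E) T & x : T & T <= U"
   using openin_avoid_basic_finite[OF F(1,2)] by (intro exI[of _ "{y : P. F Int y = {}}"]) auto
 qed
qed

text \<open>Irreducibility in finite form: elements that are missed separately by members of
  \<open>T\<close> are missed by one member. Otherwise two closed sets, one for \<open>e\<close> and
  one for the rest of \<open>F\<close>, would cover \<open>T\<close>. Both the ultraproducts and the
  primality of intersections start from this.\<close>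

lemma irreducible_avoid_finite:
 assumes T: "irreducible_closed (avoid_top P E) T" and F: "finite F" "F <= E" "F Int \<Inter>T = {}"
 shows "EX x:T. F Int x = {}" using F
proof (induction F rule: finite_induct)
 case empty
 thus ?case using T by (auto simp: irreducible_closed_def)
next
 case (insert e F)
 then obtain x where x: "x : T" "F Int x = {}" by auto
 have TP: "T <= P" using T closedin_subset unfolding irreducible_closed_def by (metis topspace_avoid)
 show ?case
 proof (rule ccontr)
  assume "~ ?thesis"
  hence sub: "T <= (P - {y : P. e ~: y}) Un (P - {y : P. F Int y = {}})" using TP by blast
  have "closedin (avoid_top P E) (P - {y : P. e ~: y})"
   "closedin (avoid_top P E) (P - {y : P. F Int y = {}})"
   using closedin_diff[OF closedin_topspace openin_avoid_basic[of e]] insert.prems insert.hyps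
    closedin_diff[OF closedin_topspace openin_avoid_basic_finite[of F]] by simp_all
  from irreducible_closed_cases[OF T this sub] show False
  proof
   assume "T <= P - {y : P. e ~: y}"
   hence "e : \<Inter>T" by blast
   thus False using insert.prems by blast
  qed (use x TP in blast)
 qed
qed

text \<open>A point outside \<open>T\<close> has a neighbourhood given by a finite \<open>F\<close>
  that \<open>T\<close> misses. If the point contained the intersection, \<open>F\<close> would be
  disjoint from it and \<open>irreducible_avoid_finite\<close> would give a member of
  \<open>T\<close> in that neighbourhood.\<close>

lemma irreducible_avoid_eq:
 assumes T: "irreducible_closed (avoid_top P E) T"
 shows "T = {x : P. \<Inter>T <= x}"
proof (intro equalityI subsetI)
 have cl: "closedin (avoid_top P E) T" using T by (simp add: irreducible_closed_def)
 hence TP: "T <= P" using closedin_subset by fastforce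
 thus "x : {x : P. \<Inter>T <= x}" if "x : T" for x using that by blast
 fix x assume x: "x : {x : P. \<Inter>T <= x}"
 show "x : T"
 proof (rule ccontr)
  assume "x ~: T"
  moreover have "openin (avoid_top P E) (P - T)" using openin_diff[OF openin_topspace cl] by simp
  ultimately obtain F where F: "finite F" "F <= E" "F Int x = {}" "{y : P. F Int y = {}} <= P - T"
   using x unfolding openin_avoid by blast
  hence "F Int \<Inter>T = {}" using x by blast
  thus False using irreducible_avoid_finite[OF T F(1,2)] F(4) TP by blast
 qed
qed

lemma irreducible_avoid_point:
 assumes p: "p : P"
 shows "irreducible_closed (avoid_top P E) {x : P. p <= x}" unfolding irreducible_closed_def
proof (intro conjI allI impI)
 have "openin (avoid_top P E) (P - {x : P. p <= x})" unfolding openin_avoid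
 proof (intro conjI ballI)
  fix x assume "x : P - {x : P. p <= x}"
  then obtain e where "e : p" "e ~: x" by blast
  thus "EX F. finite F & F <= E & F Int x = {} & {y : P. F Int y = {}} <= P - {x : P. p <= x}"
   using points_sub[OF p] by (intro exI[of _ "{e}"]) blast
 qed blast
 thus "closedin (avoid_top P E) {x : P. p <= x}" by (simp add: closedin_def)
 show "{x : P. p <= x} ~= {}" using p by blast
 have up: "{x : P. p <= x} <= A" if A: "closedin (avoid_top P E) A" "p : A" for A
 proof (rule ccontr)
  assume "~ ?thesis"
  then obtain x where x: "x : P" "p <= x" "x ~: A" by blast
  have "openin (avoid_top P E) (P - A)" using openin_diff[OF openin_topspace A(1)] by simp
  then obtain F where F: "F Int x = {}" "{y : P. F Int y = {}} <= P - A"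
   using x unfolding openin_avoid by blast
  hence "p : P - A" using p x by blast
  thus False using A by blast
 qed
 fix A B
 assume AB: "closedin (avoid_top P E) A & closedin (avoid_top P E) B & {x : P. p <= x} = A Un B"
 hence "p : A \<or> p : B" using p by blast
 thus "{x : P. p <= x} = A \<or> {x : P. p <= x} = B" using AB up by blast
qed

end

text \<open>By \<open>irreducible_avoid_eq\<close>, soberness reduces to the question whether the
  intersection of an irreducible closed set is a point.\<close>

locale sober_avoid_space = avoid_space +
 assumes sober: "irreducible_closed (avoid_top P E) T ==> \<Inter>T : P"
begin

lemma irreducible_iff:
 "irreducible_closed (avoid_top P E) T \<longleftrightarrow> (EX p:P. T = {x : P. p <= x})"
proof
 assume T: "irreducible_closed (avoid_top P E) T"
 show "EX p:P. T = {x : P. p <= x}"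
  using irreducible_avoid_eq[OF T] sober[OF T] by (intro bexI[of _ "\<Inter>T"])
next
 assume "EX p:P. T = {x : P. p <= x}"
 thus "irreducible_closed (avoid_top P E) T" using irreducible_avoid_point by auto
qed

lemma Inter_point: "p : P ==> \<Inter>{x : P. p <= x} = p" by blast

lemma Inter_psubset:
 assumes "irreducible_closed (avoid_top P E) T" "irreducible_closed (avoid_top P E) T'" "T < T'"
 shows "\<Inter>T' < \<Inter>T"
proof -
 obtain p q where pq: "p : P" "q : P" "T = {x : P. p <= x}" "T' = {x : P. q <= x}"
  using assms irreducible_iff by meson
 thus ?thesis using assms(3) Inter_point by blast
qed

text \<open>Inclusion of points reverses inclusion of their closures, so \<open>r\<close> is largest
  at the most generic points.\<close>

lemma grading_points:
 assumes mono: "!!p q. p : P ==> q : P ==> p < q ==> r q < r p"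
  and gap: "!!p q. p : P ==> q : P ==> p < q ==> r q + 2 <= r p ==> EX s:P. p < s & s < q"
 shows "grading (avoid_top P E) (%T. r (\<Inter>T)) {T. irreducible_closed (avoid_top P E) T}"
 unfolding grading_def
proof (intro ballI impI)
 fix Z Z' assume Z: "Z : {T. irreducible_closed (avoid_top P E) T}"
  "Z' : {T. irreducible_closed (avoid_top P E) T}" "Z < Z'"
 hence "EX p:P. Z = {x : P. p <= x}" "EX p:P. Z' = {x : P. p <= x}" by (simp_all add: irreducible_iff)
 then obtain p q where pq: "p : P" "q : P" "Z = {x : P. p <= x}" "Z' = {x : P. q <= x}" by auto
 have "q < p" using Z(3) pq by blast
 have "EX W. irreducible_closed (avoid_top P E) W & Z < W & W < Z'" if "r p + 2 <= r q"
 proof -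
  obtain s where s: "s : P" "q < s" "s < p" using gap[OF pq(2,1) \<open>q < p\<close> \<open>r p + 2 <= r q\<close>] by blast
  have "Z < {x : P. s <= x}" "{x : P. s <= x} < Z'" using s pq by blast+
  thus ?thesis using irreducible_avoid_point[OF s(1)] by blast
 qed
 thus "r (\<Inter>Z) < r (\<Inter>Z') & (r (\<Inter>Z) + 2 <= r (\<Inter>Z') -->
   (EX W. irreducible_closed (avoid_top P E) W & Z < W & W < Z'))"
  using mono[OF pq(2,1) \<open>q < p\<close>] pq by (simp add: Inter_point)
qed

lemma krull_dim_le_points:
 assumes mono: "!!p q. p : P ==> q : P ==> p < q ==> r q < r p"
  and le: "!!p. p : P ==> r p <= n"
 shows "krull_dim (avoid_top P E) <= ereal (real (n::nat))"
proof (rule krull_dim_le_gradedI[where \<rho> = "%T. r (\<Inter>T)"])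
 show "r (\<Inter>Z) < r (\<Inter>Z')"
  if "irreducible_closed (avoid_top P E) Z" "irreducible_closed (avoid_top P E) Z'" "Z < Z'" for Z Z'
  using mono[OF sober[OF that(2)] sober[OF that(1)] Inter_psubset[OF that]] .
 show "r (\<Inter>Z) <= n" if "irreducible_closed (avoid_top P E) Z" for Z using le[OF sober[OF that]] .
qed

end

lemma (in avoid_space) krull_dim_ge_points:
 fixes p :: "nat => 'e set"
 assumes p: "!!i. i <= n ==> p i : P" and lt: "!!i. i < n ==> p (Suc i) < p i"
 shows "ereal (real n) <= krull_dim (avoid_top P E)"
proof (rule strict_chain_card[where T = "%i. {x : P. p i <= x}"])
 show "irreducible_closed (avoid_top P E) {x : P. p i <= x}" if "i <= n" for i
  using p[OF that] by (rule irreducible_avoid_point)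
 show "{x : P. p i <= x} < {x : P. p (Suc i) <= x}" if "i < n" for i
  using p[of "Suc i"] lt[OF that] that by auto
qed

text \<open>Localization: a point of the target is in the image if and only if it avoids \<open>h\<close>, and up to \<open>h\<close>
 every condition on the source comes from the target and vice versa.\<close>

lemma avoid_open_embedding:
 assumes "avoid_space P E" "avoid_space P' E'"
  and f: "inj_on f P'" "f ` P' = {x : P. h ~: x}" "h : E"
  and up: "!!e. e : E' ==> EX e':E. ALL x:P'. e : x \<longleftrightarrow> e' : f x"
  and down: "!!e. e : E ==> EX e':E'. ALL x:P'. e : f x \<longleftrightarrow> e' : x"
 shows "continuous_map (avoid_top P' E') (avoid_top P E) f & open_map (avoid_top P' E') (avoid_top P E) f"
proof
 interpret A: avoid_space P E by fact
 interpret B: avoid_space P' E' by fact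
 have fP: "f x : P" if "x : P'" for x using f(2) that by blast
 show "continuous_map (avoid_top P' E') (avoid_top P E) f"
 proof (unfold avoid_top_def[of P E], rule continuous_on_generated_topo)
  fix U assume "U : {{x : P. e ~: x} | e. e : E}"
  then obtain e where e: "e : E" "U = {x : P. e ~: x}" by blast
  then obtain e' where "e' : E'" "ALL x:P'. e : f x \<longleftrightarrow> e' : x" using down by blast
  hence "f -` U Int topspace (avoid_top P' E') = {x : P'. e' ~: x}" using e fP by auto
  thus "openin (avoid_top P' E') (f -` U Int topspace (avoid_top P' E'))"
   using B.openin_avoid_basic \<open>e' : E'\<close> by simp
 next
  show "f ` topspace (avoid_top P' E') <= \<Union> {{x : P. e ~: x} | e. e : E}"
  proof
   fix y assume "y : f ` topspace (avoid_top P' E')"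
   hence "y : P" using fP by auto
   with A.proper[OF this] show "y : \<Union> {{x : P. e ~: x} | e. e : E}" by auto
  qed
 qed
 show "open_map (avoid_top P' E') (avoid_top P E) f" unfolding open_map_def
 proof (intro allI impI)
  fix U assume U: "openin (avoid_top P' E') U"
  show "openin (avoid_top P E) (f ` U)" unfolding A.openin_avoid
  proof (intro conjI ballI)
   show "f ` U <= P" using U fP B.openin_avoid by blast
   fix y assume "y : f ` U"
   then obtain x where x: "x : U" "y = f x" by blast
   with U obtain F where F: "finite F" "F <= E'" "F Int x = {}" "{z : P'. F Int z = {}} <= U" "x : P'"
    unfolding B.openin_avoid by blast
   obtain \<epsilon> where \<epsilon>: "!!e. e : E' ==> \<epsilon> e : E & (ALL x:P'. e : x \<longleftrightarrow> \<epsilon> e : f x)"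
    using up by metis
   have "insert h (\<epsilon> ` F) Int y = {}" using \<epsilon> F x f(2) by fast
   moreover have "{z : P. insert h (\<epsilon> ` F) Int z = {}} <= f ` U"
   proof
    fix z assume z: "z : {z : P. insert h (\<epsilon> ` F) Int z = {}}"
    hence "z : f ` P'" using f(2) by blast
    then obtain w where w: "w : P'" "z = f w" by blast
    hence "F Int w = {}" using z \<epsilon> F(2) by blast
    thus "z : f ` U" using F w by blast
   qed
   moreover have "insert h (\<epsilon> ` F) <= E" using \<epsilon> F f(3) by blast
   ultimately show "EX G. finite G & G <= E & G Int y = {} & {z : P. G Int z = {}} <= f ` U"
    using F(1) by (intro exI[of _ "insert h (\<epsilon> ` F)"]) simp
  qed
 qed
qed

section \<open>Spaces covered by open embeddings\<close>

locale open_embedding =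
 fixes S :: "'x topology" and Y :: "'y topology" and q :: "'x => 'y"
 assumes cont: "continuous_map S Y q" and opn: "open_map S Y q" and inj: "inj_on q (topspace S)"
begin

definition pull :: "'y set => 'x set" where
 "pull Z = {x : topspace S. q x : Z}"

lemma pull_closed: "closedin Y Z ==> closedin S (pull Z)"
 unfolding pull_def by (rule closedin_continuous_map_preimage[OF cont])

lemma range: "q ` topspace S <= topspace Y" using cont by (simp add: continuous_map_image_subset_topspace)

text \<open>As \<open>q\<close> is open and injective, the image of the complement of
  \<open>A\<close> is an open set disjoint from the image of \<open>A\<close>, hence from its
  closure.\<close>

lemma pull_closure: 
 assumes A: "closedin S A"
 shows "pull (Y closure_of (q ` A)) = A"
proof (intro equalityI subsetI)
 have AX: "A <= topspace S" using A closedin_subset by blast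
 show "x : pull (Y closure_of (q ` A))" if "x : A" for x
  using closure_of_subset[of "q ` A" Y] range AX that unfolding pull_def by blast
 fix x assume x: "x : pull (Y closure_of (q ` A))"
 show "x : A"
 proof (rule ccontr)
  assume "x ~: A"
  hence "q x : q ` (topspace S - A)" using x by (auto simp: pull_def)
  moreover have "openin Y (q ` (topspace S - A))" using opn A by (simp add: open_map_def openin_diff)
  moreover have "q x : Y closure_of (q ` A)" using x by (simp add: pull_def)
  ultimately have "EX y. y : q ` A & y : q ` (topspace S - A)" unfolding in_closure_of by simp
  thus False using inj AX unfolding inj_on_def by blast
 qed
qed

lemma closure_irreducible:
 assumes T: "irreducible_closed S T"
 shows "irreducible_closed Y (Y closure_of (q ` T))" unfolding irreducible_closed_def
proof (intro conjI allI impI)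
 have TX: "closedin S T" "T <= topspace S" "T ~= {}"
  using T closedin_subset by (auto simp: irreducible_closed_def)
 have sub: "q ` T <= Y closure_of (q ` T)" using closure_of_subset TX range by (metis image_mono subset_trans)
 show "closedin Y (Y closure_of (q ` T))" by simp
 show "Y closure_of (q ` T) ~= {}" using sub TX by blast
 fix A B assume AB: "closedin Y A & closedin Y B & Y closure_of (q ` T) = A Un B"
 have "T <= pull A Un pull B" using sub AB TX by (auto simp: pull_def)
 hence "T <= pull A \<or> T <= pull B" using irreducible_closed_cases[OF T] AB pull_closed by blast
 hence "q ` T <= A \<or> q ` T <= B" by (auto simp: pull_def)
 hence "Y closure_of (q ` T) <= A \<or> Y closure_of (q ` T) <= B" using AB closure_of_minimal by metis
 thus "Y closure_of (q ` T) = A \<or> Y closure_of (q ` T) = B" using AB by blast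
qed

text \<open>\<open>Z\<close> is covered by the closure of its part in the chart and by the
  complement of the open chart. It is irreducible and meets the chart, so the first set is all of
  \<open>Z\<close>.\<close>

lemma closure_pull:
 assumes Z: "irreducible_closed Y Z" and ne: "pull Z ~= {}"
 shows "Y closure_of (q ` pull Z) = Z"
proof -
 have cl: "closedin Y Z" using Z by (simp add: irreducible_closed_def)
 have op: "openin Y (q ` topspace S)" using opn by (simp add: open_map_def)
 have ZY: "Z <= topspace Y" using cl closedin_subset by blast
 have "Z <= Y closure_of (q ` pull Z) Un (topspace Y - q ` topspace S)"
 proof
  fix z assume z: "z : Z"
  show "z : Y closure_of (q ` pull Z) Un (topspace Y - q ` topspace S)"
  proof (cases "z : q ` topspace S")
   case True
   hence "z : q ` pull Z" using z by (auto simp: pull_def)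
   moreover have "q ` pull Z <= topspace Y" using range by (auto simp: pull_def)
   ultimately show ?thesis using closure_of_subset by blast
  qed (use z ZY in blast)
 qed
 hence "Z <= Y closure_of (q ` pull Z) \<or> Z <= topspace Y - q ` topspace S"
  using irreducible_closed_cases[OF Z] op by (metis closedin_closure_of closedin_diff closedin_topspace)
 hence "Z <= Y closure_of (q ` pull Z)" using ne by (auto simp: pull_def)
 moreover have "Y closure_of (q ` pull Z) <= Z" by (rule closure_of_minimal[OF _ cl]) (auto simp: pull_def)
 ultimately show ?thesis by blast
qed

lemma pull_irreducible:
 assumes Z: "irreducible_closed Y Z" and ne: "pull Z ~= {}"
 shows "irreducible_closed S (pull Z)" unfolding irreducible_closed_def
proof (intro conjI allI impI)
 show "closedin S (pull Z)" using Z pull_closed by (simp add: irreducible_closed_def)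
 show "pull Z ~= {}" by fact
 fix A B assume AB: "closedin S A & closedin S B & pull Z = A Un B"
 have "Z = Y closure_of (q ` A) Un Y closure_of (q ` B)"
  using closure_pull[OF Z ne] AB by (simp add: image_Un closure_of_Un)
 hence "Z = Y closure_of (q ` A) \<or> Z = Y closure_of (q ` B)"
  by (rule irreducible_closed_Un[OF Z closedin_closure_of closedin_closure_of])
 thus "pull Z = A \<or> pull Z = B" using pull_closure AB by metis
qed

lemma pull_psubset:
 assumes "irreducible_closed Y Z" "irreducible_closed Y Z'" "pull Z ~= {}" "Z < Z'"
 shows "pull Z < pull Z'"
proof -
 have "pull Z <= pull Z'" using assms(4) by (auto simp: pull_def)
 moreover have "pull Z' ~= {}" using calculation assms(3) by blast
 ultimately show ?thesis using closure_pull assms by (metis psubset_eq)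
qed

lemma closure_psubset:
 assumes "irreducible_closed S T" "irreducible_closed S T'" "T < T'"
 shows "Y closure_of (q ` T) < Y closure_of (q ` T')"
 using assms pull_closure closure_of_mono[of "q ` T" "q ` T'" Y]
 unfolding irreducible_closed_def by (metis image_mono psubset_eq)

lemma krull_dim_le: "krull_dim S <= krull_dim Y"
proof (rule krull_dim_leI)
 fix C assume C: "subset.chain {T. irreducible_closed S T} C" "finite C" "C ~= {}"
 let ?D = "(%T. Y closure_of (q ` T)) ` C"
 have "subset.chain {T. irreducible_closed Y T} ?D" unfolding subset_chain_def
 proof (intro conjI ballI)
  show "?D <= {T. irreducible_closed Y T}" using C(1) closure_irreducible unfolding subset_chain_def by auto
  fix a b assume "a : ?D" "b : ?D"
  then obtain T T' where T: "T : C" "T' : C" "a = Y closure_of (q ` T)" "b = Y closure_of (q ` T')" by auto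
  hence "T <= T' \<or> T' <= T" using C(1) unfolding subset_chain_def by auto
  thus "a <= b \<or> b <= a"
   unfolding T(3,4) using closure_of_mono[OF image_mono, of T T' Y q] closure_of_mono[OF image_mono, of T' T Y q] by metis
 qed
 moreover have "inj_on (%T. Y closure_of (q ` T)) C"
 proof (rule inj_on_inverseI)
  fix T assume "T : C"
  hence "irreducible_closed S T" using C(1) unfolding subset_chain_def by auto
  thus "pull (Y closure_of (q ` T)) = T" by (intro pull_closure irreducible_closed_closed)
 qed
 ultimately show "ereal (real (card C) - 1) <= krull_dim Y"
  using krull_dim_geI[of Y ?D] C by (simp add: card_image)
qed

end

text \<open>A finite chain has a smallest member. A chart through a point of that member meets all
  members, and pulling back along it is injective on them.\<close>

lemma krull_dim_open_cover:
 assumes emb: "!!i. i : I ==> open_embedding (S i) Y (q i)"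
  and cov: "topspace Y <= (UN i:I. q i ` topspace (S i))"
 shows "krull_dim Y = (SUP i\<in>I. krull_dim (S i))"
proof (rule antisym)
 show "(SUP i\<in>I. krull_dim (S i)) <= krull_dim Y"
  by (rule SUP_least) (rule open_embedding.krull_dim_le[OF emb])
 show "krull_dim Y <= (SUP i\<in>I. krull_dim (S i))"
 proof (rule krull_dim_leI)
  fix C assume C: "subset.chain {T. irreducible_closed Y T} C" "finite C" "C ~= {}"
  have ch: "!!x y. x : C ==> y : C ==> x <= y \<or> y <= x" using C(1) unfolding subset_chain_def by blast
  have "\<Inter>C : C" using C(2,3) ch by (metis (no_types, lifting) Inter_in_chain subset_chain_def subsetI)
  hence irr: "irreducible_closed Y (\<Inter>C)" using C(1) unfolding subset_chain_def by blast
  then obtain y where y: "y : \<Inter>C" "y : topspace Y"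
   using irreducible_closed_nonempty irreducible_closed_subset by (metis ex_in_conv subsetD)
  then obtain i x where i: "i : I" "x : topspace (S i)" "y = q i x" using cov by blast
  interpret open_embedding "S i" Y "q i" by (rule emb[OF i(1)])
  have ne: "pull Z ~= {}" if "Z : C" for Z using i y that by (auto simp: pull_def)
  have irrC: "irreducible_closed Y Z" if "Z : C" for Z using C(1) that unfolding subset_chain_def by blast
  have "subset.chain {T. irreducible_closed (S i) T} (pull ` C)" unfolding subset_chain_def
  proof (intro conjI ballI)
   show "pull ` C <= {T. irreducible_closed (S i) T}" using pull_irreducible ne irrC by blast
   fix a b assume "a : pull ` C" "b : pull ` C"
   then obtain Z Z' where Z: "Z : C" "Z' : C" "a = pull Z" "b = pull Z'" by blast
   hence "Z <= Z' \<or> Z' <= Z" using ch by blast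
   thus "a <= b \<or> b <= a" unfolding Z(3,4) pull_def by blast
  qed
  moreover have "inj_on pull C" using closure_pull irrC ne by (metis inj_onI)
  ultimately have "ereal (real (card C) - 1) <= krull_dim (S i)"
   using krull_dim_geI[of "S i" "pull ` C"] C by (simp add: card_image)
  thus "ereal (real (card C) - 1) <= (SUP i\<in>I. krull_dim (S i))"
   using i(1) by (meson SUP_upper order_trans)
 qed
qed

text \<open>The grading above \<open>T\<close> is transported from one chart that meets
  \<open>T\<close>; all irreducible closed sets above \<open>T\<close> meet this chart as
  well.\<close>

lemma catenary_open_cover:
 assumes emb: "!!i. i : I ==> open_embedding (S i) Y (q i)"
  and cov: "topspace Y <= (UN i:I. q i ` topspace (S i))"
  and gr: "!!i. i : I ==> \<exists>\<rho>. grading (S i) \<rho> {T. irreducible_closed (S i) T}"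
 shows "catenary Y"
proof (rule catenaryI)
 fix T assume T: "irreducible_closed Y T"
 then obtain y where y: "y : T" "y : topspace Y"
  using irreducible_closed_nonempty irreducible_closed_subset by (metis ex_in_conv subsetD)
 then obtain i x where i: "i : I" "x : topspace (S i)" "y = q i x" using cov by blast
 interpret open_embedding "S i" Y "q i" by (rule emb[OF i(1)])
 obtain \<rho> where \<rho>: "grading (S i) \<rho> {T. irreducible_closed (S i) T}" using gr[OF i(1)] by blast
 have "grading Y (%Z. \<rho> (pull Z)) {Z. irreducible_closed Y Z & T <= Z}" unfolding grading_def
 proof (intro ballI impI)
  fix Z Z' assume "Z : {Z. irreducible_closed Y Z & T <= Z}"
   "Z' : {Z. irreducible_closed Y Z & T <= Z}" and ZZ: "Z < Z'"
  hence Z: "irreducible_closed Y Z" "T <= Z" "irreducible_closed Y Z'" "T <= Z'" by auto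
  have ne: "pull Z ~= {}" "pull Z' ~= {}" using Z i y by (auto simp: pull_def)
  have irr: "irreducible_closed (S i) (pull Z)" "irreducible_closed (S i) (pull Z')"
   using pull_irreducible[OF Z(1) ne(1)] pull_irreducible[OF Z(3) ne(2)] .
  have lt: "pull Z < pull Z'" using pull_psubset[OF Z(1,3) ne(1) ZZ] .
  have irr': "pull Z : {T. irreducible_closed (S i) T}" "pull Z' : {T. irreducible_closed (S i) T}"
   using irr by simp_all
  have "EX W. irreducible_closed Y W & Z < W & W < Z'" if gap: "\<rho> (pull Z) + 2 <= \<rho> (pull Z')"
  proof -
   obtain W where W: "irreducible_closed (S i) W" "pull Z < W" "W < pull Z'"
    using gradingD(2)[OF \<rho> irr' lt gap] by auto
   have "Y closure_of (q i ` pull Z) < Y closure_of (q i ` W)"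
    "Y closure_of (q i ` W) < Y closure_of (q i ` pull Z')"
    using closure_psubset[OF irr(1) W(1,2)] closure_psubset[OF W(1) irr(2) W(3)] .
   thus ?thesis using closure_irreducible[OF W(1)] closure_pull Z ne by auto
  qed
  thus "\<rho> (pull Z) < \<rho> (pull Z') & (\<rho> (pull Z) + 2 <= \<rho> (pull Z') -->
   (EX W. irreducible_closed Y W & Z < W & W < Z'))" using gradingD(1)[OF \<rho> irr' lt] by simp
 qed
 thus "\<exists>\<rho>. grading Y \<rho> {Z. irreducible_closed Y Z & T <= Z}" by blast
qed

section \<open>Gluing along open subspaces\<close>

text \<open>\<open>amalg\<close> says that two points with the same image in a third piece come from
  a common point of a piece below both. It makes the relation of having a common preimage
  transitive, so that the equivalence relation of the colimit becomes explicit.\<close>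

locale gluing =
 fixes I :: "'i set" and R :: "('i \<times> 'i) set" and S :: "'i => 'x topology"
  and f :: "'i => 'i => 'x => 'x"
 assumes R_sub: "R <= I \<times> I"
  and R_refl: "i : I ==> (i, i) : R"
  and R_trans: "(k, j) : R ==> (j, i) : R ==> (k, i) : R"
  and f_id: "i : I ==> x : topspace (S i) ==> f i i x = x"
  and f_comp: "(k, j) : R ==> (j, i) : R ==> x : topspace (S k) ==> f j i (f k j x) = f k i x"
  and f_cont: "(j, i) : R ==> continuous_map (S j) (S i) (f j i)"
  and f_open: "(j, i) : R ==> open_map (S j) (S i) (f j i)"
  and amalg: "(j, i) : R ==> (k, i) : R ==> x : topspace (S j) ==> y : topspace (S k) ==>
   f j i x = f k i y ==>
   EX m z. (m, j) : R & (m, k) : R & z : topspace (S m) & f m j z = x & f m k z = y"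
begin

lemma f_range: "(j, i) : R ==> x : topspace (S j) ==> f j i x : topspace (S i)"
 using f_cont continuous_map_image_subset_topspace by blast

definition rel :: "('i \<times> 'x) => ('i \<times> 'x) => bool" where
 "rel p p' \<longleftrightarrow> (EX k z. (k, fst p) : R & (k, fst p') : R & z : topspace (S k) &
   f k (fst p) z = snd p & f k (fst p') z = snd p')"

text \<open>A common preimage survives a step along a transition map by composition, and a step
  against one by \<open>amalg\<close>.\<close>

lemma colim_rel_iff: "(p, p') : colim_rel I R S f \<longleftrightarrow> rel p p'"
proof
 assume "(p, p') : colim_rel I R S f"
 hence p: "fst p : I" "snd p : topspace (S (fst p))"
  and eq: "equivclp (%p q. EX j i x. (j, i) : R & j : I & i : I & x : topspace (S j) &
          p = (j, x) & q = (i, f j i x)) p p'" by (auto simp: colim_rel_def topspace_sum_topology)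
 from eq show "rel p p'"
 proof (induction rule: equivclp_induct)
  case base
  show ?case unfolding rel_def using p R_refl f_id by blast
 next
  case (step y z)
  then obtain k w where k: "(k, fst p) : R" "(k, fst y) : R" "w : topspace (S k)"
   "f k (fst p) w = snd p" "f k (fst y) w = snd y" unfolding rel_def by blast
  from step.hyps(2) show ?case
  proof
   assume "EX j i x. (j, i) : R & j : I & i : I & x : topspace (S j) & y = (j, x) & z = (i, f j i x)"
   then obtain j i x where "(j, i) : R" "x : topspace (S j)" "y = (j, x)" "z = (i, f j i x)" by blast
   hence "(k, fst z) : R" "f k (fst z) w = snd z" using k R_trans[of k j i] f_comp[of k j i w] by simp_all
   thus ?case unfolding rel_def using k by (intro exI[of _ k] exI[of _ w]) simp
  next
   assume "EX j i x. (j, i) : R & j : I & i : I & x : topspace (S j) & z = (j, x) & y = (i, f j i x)"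
   then obtain j i x where j: "(j, i) : R" "x : topspace (S j)" "z = (j, x)" "y = (i, f j i x)" by blast
   then obtain m t where "(m, k) : R" "(m, j) : R" "t : topspace (S m)" "f m k t = w" "f m j t = x"
    using amalg[of k i j w x] k by auto
   hence "(m, fst p) : R & (m, fst z) : R & t : topspace (S m) & f m (fst p) t = snd p & f m (fst z) t = snd z"
    using k j R_trans f_comp by (metis fst_conv snd_conv)
   thus ?case unfolding rel_def by blast
  qed
 qed
next
 assume "rel p p'"
 then obtain k z where k: "(k, fst p) : R" "(k, fst p') : R" "z : topspace (S k)"
  "f k (fst p) z = snd p" "f k (fst p') z = snd p'" unfolding rel_def by blast
 let ?r = "%p q. EX j i x. (j, i) : R & j : I & i : I & x : topspace (S j) &
          p = (j, x) & q = (i, f j i x)"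
 have *: "?r (k, z) p" "?r (k, z) p'" using k R_sub by (metis SigmaD1 SigmaD2 prod.collapse subsetD)+
 have "equivclp ?r (k, z) p" "equivclp ?r (k, z) p'" using *[THEN r_into_equivclp[of ?r]] by simp_all
 hence "equivclp ?r p p'" by (metis (no_types, lifting) equivclp_sym equivclp_trans)
 moreover have "p : topspace (sum_topology S I)" "p' : topspace (sum_topology S I)"
  using k R_sub f_range[OF k(1,3)] f_range[OF k(2,3)]
  by (cases p, cases p', auto simp: topspace_sum_topology)+
 ultimately show "(p, p') : colim_rel I R S f" by (simp add: colim_rel_def)
qed

abbreviation "colim \<equiv> top_colim I R S f"
abbreviation "chart \<equiv> colim_inj I R S f"

lemma chart_eq_iff:
 assumes "i : I" "x : topspace (S i)" "j : I" "y : topspace (S j)"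
 shows "chart i x = chart j y \<longleftrightarrow>
  (EX k z. (k, i) : R & (k, j) : R & z : topspace (S k) & f k i z = x & f k j z = y)"
proof -
 have "chart i x = chart j y \<longleftrightarrow> ((i, x), (j, y)) : colim_rel I R S f"
  unfolding colim_inj_def
  by (rule eq_equiv_class_iff[OF equiv_colim_rel]) (use assms in \<open>auto simp: topspace_sum_topology\<close>)
 thus ?thesis by (simp add: colim_rel_iff rel_def)
qed

lemma chart_f: "(j, i) : R ==> x : topspace (S j) ==> chart i (f j i x) = chart j x"
 using chart_eq_iff[of i "f j i x" j x] R_sub R_refl f_id f_range by blast

lemma topspace_colim: "topspace colim = (UN i:I. chart i ` topspace (S i))"
 unfolding topspace_top_colim quotient_def colim_inj_def topspace_sum_topology by fastforce

lemma openin_colim: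
 assumes "U <= topspace colim"
 shows "openin colim U \<longleftrightarrow> (ALL i:I. openin (S i) {x : topspace (S i). chart i x : U})"
proof -
 have mem: "(i, x) : \<Union>U \<longleftrightarrow> i : I & x : topspace (S i) & chart i x : U" for i x
 proof
  assume "(i, x) : \<Union>U"
  then obtain c where c: "c : U" "(i, x) : c" by blast
  hence "c : topspace (sum_topology S I) // colim_rel I R S f"
   using assms unfolding topspace_top_colim by blast
  then obtain p where p: "c = colim_rel I R S f `` {p}" by (auto simp: quotient_def)
  hence "(p, (i, x)) : colim_rel I R S f" using c by blast
  hence "c = chart i x" "(i, x) : topspace (sum_topology S I)"
   using p equiv_class_eq[OF equiv_colim_rel] unfolding colim_inj_def by (metis, auto simp: colim_rel_def)
  thus "i : I & x : topspace (S i) & chart i x : U" using c by (auto simp: topspace_sum_topology)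
 next
  assume a: "i : I & x : topspace (S i) & chart i x : U"
  hence "(i, x) : chart i x" unfolding colim_inj_def
   by (intro equiv_class_self[OF equiv_colim_rel]) (auto simp: topspace_sum_topology)
  thus "(i, x) : \<Union>U" using a by blast
 qed
 have "{x. (i, x) : \<Union>U} = {x : topspace (S i). chart i x : U}" if "i : I" for i using mem that by blast
 moreover have "\<Union>U <= Sigma I (topspace \<circ> S)" using mem by fastforce
 ultimately show ?thesis
  using assms unfolding openin_top_colim openin_sum_topology topspace_top_colim by (auto simp: o_def)
qed

text \<open>Two points of the same piece that are identified come from one point by the same
  transition map, so the chart is injective. It is open because the part of its image that is
  visible in piece \<open>j\<close> is a union of images under open transition maps from pieces
  below both.\<close>

lemma open_embedding_chart:
 assumes i: "i : I"
 shows "open_embedding (S i) colim (chart i)"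
proof
 have sub: "chart i ` topspace (S i) <= topspace colim" using i topspace_colim by blast
 show "continuous_map (S i) colim (chart i)"
  unfolding continuous_map_def using sub openin_colim openin_subset i by blast
 show "inj_on (chart i) (topspace (S i))" using chart_eq_iff[OF i _ i] by (auto simp: inj_on_def)
 show "open_map (S i) colim (chart i)" unfolding open_map_def
 proof (intro allI impI)
  fix V assume V: "openin (S i) V"
  have VX: "V <= topspace (S i)" using V openin_subset by blast
  have "openin (S j) {y : topspace (S j). chart j y : chart i ` V}" if j: "j : I" for j
  proof -
   have "{y : topspace (S j). chart j y : chart i ` V} =
    (UN k:{k. (k, i) : R & (k, j) : R}. f k j ` {z : topspace (S k). f k i z : V})"
   proof (intro equalityI subsetI)
    fix y assume "y : {y : topspace (S j). chart j y : chart i ` V}"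
    then obtain v where v: "y : topspace (S j)" "v : V" "chart i v = chart j y" by force
    hence "v : topspace (S i)" using VX by blast
    then obtain k z where "(k, i) : R" "(k, j) : R" "z : topspace (S k)" "f k i z = v" "f k j z = y"
     using chart_eq_iff[OF i _ j] v by metis
    thus "y : (UN k:{k. (k, i) : R & (k, j) : R}. f k j ` {z : topspace (S k). f k i z : V})"
     using v(2) by blast
   next
    fix y assume "y : (UN k:{k. (k, i) : R & (k, j) : R}. f k j ` {z : topspace (S k). f k i z : V})"
    then obtain k z where k: "(k, i) : R" "(k, j) : R" "z : topspace (S k)" "f k i z : V" "y = f k j z"
     by blast
    hence "chart j y = chart i (f k i z)" using chart_f by metis
    thus "y : {y : topspace (S j). chart j y : chart i ` V}" using k f_range by blast
   qed
   also have "openin (S j) \<dots>"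
   proof (rule openin_Union, safe)
    fix k assume k: "(k, i) : R" "(k, j) : R"
    have "openin (S k) {z : topspace (S k). f k i z : V}"
     using openin_continuous_map_preimage[OF f_cont[OF k(1)] V] .
    thus "openin (S j) (f k j ` {z : topspace (S k). f k i z : V})"
     using f_open[OF k(2)] by (simp add: open_map_def)
   qed
   finally show ?thesis .
  qed
  moreover have "chart i ` V <= topspace colim" using sub VX by auto
  ultimately show "openin colim (chart i ` V)" using openin_colim by auto
 qed
qed

lemma krull_dim_colim: "krull_dim colim = (SUP i\<in>I. krull_dim (S i))"
 by (rule krull_dim_open_cover[OF open_embedding_chart]) (simp_all add: topspace_colim)

end

section \<open>Congruences as kernels\<close>

definition pkernel :: "'a pmonoid => ('a => 'b) => ('a \<times> 'a) set" where
 "pkernel A h = {(x, y) : carrier A \<times> carrier A. h x = h y}"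

lemma pkernel_iff: "(x, y) : pkernel A h \<longleftrightarrow> x : carrier A & y : carrier A & h x = h y"
 by (simp add: pkernel_def)

lemma pmon_homD:
 assumes "h : pmon_hom A B"
 shows "x : carrier A ==> h x : carrier B" "h 1[A] = 1[B]" "h (pzero A) = pzero B"
  "x : carrier A ==> y : carrier A ==> h (x *[A] y) = h x *[B] h y"
 using assms by (auto simp: pmon_hom_def hom_def)

lemma pmon_homI:
 assumes "!!x. x : carrier A ==> h x : carrier B" "h 1[A] = 1[B]" "h (pzero A) = pzero B"
  "!!x y. x : carrier A ==> y : carrier A ==> h (x *[A] y) = h x *[B] h y"
 shows "h : pmon_hom A B" using assms by (auto simp: pmon_hom_def hom_def)

lemma pmon_hom_comp: "g : pmon_hom A B ==> h : pmon_hom B C ==> h \<circ> g : pmon_hom A C"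
 by (rule pmon_homI) (simp_all add: pmon_homD)

lemma ring_pmonoid_simps [simp]:
 "carrier (ring_pmonoid K) = carrier K" "mult (ring_pmonoid K) = mult K"
 "1[ring_pmonoid K] = 1[K]" "pzero (ring_pmonoid K) = 0[K]" by (simp_all add: ring_pmonoid_def)

lemma quot_pmonoid_simps [simp]:
 "carrier (quot_pmonoid A c) = carrier A // c"
 "1[quot_pmonoid A c] = c `` {1[A]}" "pzero (quot_pmonoid A c) = c `` {pzero A}"
 by (simp_all add: quot_pmonoid_def)

context pointed_monoid
begin

lemma congruence_mult:
 assumes c: "congruence A c" and "(a, a') : c" "(b, b') : c"
 shows "(a \<otimes> b, a' \<otimes> b') : c"
proof -
 have eq: "equiv (carrier A) c" using c by (simp add: congruence_def)
 have st: "(l \<otimes> x, l \<otimes> y) : c" if "(x, y) : c" "l : carrier A" for l x y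
  using c that unfolding congruence_def by auto
 have car: "a : carrier A" "a' : carrier A" "b : carrier A" "b' : carrier A"
  using eq assms(2,3) unfolding equiv_def refl_on_def by auto
 have "(b \<otimes> a, b \<otimes> a') : c" "(a' \<otimes> b, a' \<otimes> b') : c" using st assms(2,3) car by auto
 hence "(a \<otimes> b, a' \<otimes> b) : c" "(a' \<otimes> b, a' \<otimes> b') : c" using car m_comm by auto
 thus ?thesis using eq unfolding equiv_def by (meson transD)
qed

lemma quot_mult:
 assumes c: "congruence A c" and xy: "x : carrier A" "y : carrier A"
 shows "c `` {x} *[quot_pmonoid A c] c `` {y} = c `` {x \<otimes> y}"
proof -
 have eq: "equiv (carrier A) c" using c by (simp add: congruence_def)
 have "c `` {x' \<otimes> y'} = c `` {x \<otimes> y}" if "x' : c `` {x}" "y' : c `` {y}" for x' y'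
  using equiv_class_eq[OF eq congruence_mult[OF c, of x x' y y']] that by auto
 hence "(UN x':c `` {x}. UN y':c `` {y}. c `` {x' \<otimes> y'}) = (UN x':c `` {x}. UN y':c `` {y}. c `` {x \<otimes> y})"
  by (intro SUP_cong refl) simp
 moreover have "c `` {x} ~= {}" "c `` {y} ~= {}"
  using equiv_class_self[OF eq xy(1)] equiv_class_self[OF eq xy(2)] by (metis empty_iff)+
 ultimately show ?thesis unfolding quot_pmonoid_def by simp
qed

lemma quot_pointed_monoid:
 assumes c: "congruence A c"
 shows "pointed_monoid (quot_pmonoid A c)"
proof -
 have eq: "equiv (carrier A) c" using c by (simp add: congruence_def)
 note [simp] = quot_mult[OF c]
 have q: "EX x:carrier A. S = c `` {x}" if "S : carrier (quot_pmonoid A c)" for S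
  using that by (auto simp: quotient_def)
 have cl: "c `` {x} : carrier A // c" if "x : carrier A" for x using that by (rule quotientI)
 show ?thesis
 proof
  fix S Y Z
  assume S: "S : carrier (quot_pmonoid A c)"
  then obtain x where x: "x : carrier A" "S = c `` {x}" using q by auto
  show "1[quot_pmonoid A c] *[quot_pmonoid A c] S = S"
   "S *[quot_pmonoid A c] 1[quot_pmonoid A c] = S" using x by simp_all
  show "pzero (quot_pmonoid A c) *[quot_pmonoid A c] S = pzero (quot_pmonoid A c)"
   using x by (simp add: pzero_closed pzero_absorb)
  assume Y: "Y : carrier (quot_pmonoid A c)"
  then obtain y where y: "y : carrier A" "Y = c `` {y}" using q by auto
  show "S *[quot_pmonoid A c] Y : carrier (quot_pmonoid A c)" using x y cl by simp
  show "S *[quot_pmonoid A c] Y = Y *[quot_pmonoid A c] S" using x y by (simp add: m_comm)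
  assume Z: "Z : carrier (quot_pmonoid A c)"
  then obtain z where z: "z : carrier A" "Z = c `` {z}" using q by auto
  show "S *[quot_pmonoid A c] Y *[quot_pmonoid A c] Z = S *[quot_pmonoid A c] (Y *[quot_pmonoid A c] Z)"
   using x y z by (simp add: m_assoc)
 qed (use cl pzero_closed in auto)
qed

lemma pkernel_congruence:
 assumes h: "h : pmon_hom A B"
 shows "congruence A (pkernel A h)"
proof -
 have "equiv (carrier A) (pkernel A h)" by (rule equivI) (auto simp: pkernel_def refl_on_def sym_def trans_def)
 thus ?thesis unfolding congruence_def by (auto simp: pkernel_def pmon_homD(4)[OF h])
qed

text \<open>The field may have any type, since \<open>pmon_domainI\<close> finds a copy of the
  relevant subfield in the type fixed by \<open>pmon_domain\<close>. The ultraproducts below live in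
  larger types.\<close>

lemma SCong_kernelI:
 fixes K :: "'b ring"
 assumes K: "field K" and h: "h : pmon_hom A (ring_pmonoid K)"
  and \<eta>: "!!l. l : carrier k ==> \<eta> l : carrier A" "inj_on (h \<circ> \<eta>) (carrier k)"
 shows "pkernel A h : SCong k \<eta> A"
proof -
 let ?c = "pkernel A h"
 have c: "congruence A ?c" by (rule pkernel_congruence[OF h])
 hence eq: "equiv (carrier A) ?c" by (simp add: congruence_def)
 define f where "f S = h (SOME x. x : S)" for S
 have f: "f (?c `` {x}) = h x" if "x : carrier A" for x
 proof -
  have "x : ?c `` {x}" using equiv_class_self[OF eq that] .
  hence "(SOME y. y : ?c `` {x}) : ?c `` {x}" by (rule someI)
  hence "(x, SOME y. y : ?c `` {x}) : ?c" by (rule Image_singleton_iff[THEN iffD1])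
  hence "h x = h (SOME y. y : ?c `` {x})" unfolding pkernel_iff by (elim conjE)
  thus ?thesis unfolding f_def by (rule sym)
 qed
 have q: "EX x:carrier A. S = ?c `` {x}" if "S : carrier A // ?c" for S using that by (auto simp: quotient_def)
 have "f : pmon_hom (quot_pmonoid A ?c) (ring_pmonoid K)"
 proof (rule pmon_homI)
  fix S assume "S : carrier (quot_pmonoid A ?c)"
  then obtain x where x: "x : carrier A" "S = ?c `` {x}" using q by auto
  thus "f S : carrier (ring_pmonoid K)" using f pmon_homD(1)[OF h] by simp
  fix Y assume "Y : carrier (quot_pmonoid A ?c)"
  then obtain y where y: "y : carrier A" "Y = ?c `` {y}" using q by auto
  show "f (S *[quot_pmonoid A ?c] Y) = f S *[ring_pmonoid K] f Y"
   using x y f pmon_homD(4)[OF h] by (simp add: quot_mult[OF c])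
 qed (use f pzero_closed pmon_homD[OF h] in auto)
 moreover have "inj_on f (carrier (quot_pmonoid A ?c))"
 proof (rule inj_onI)
  fix S Y assume "S : carrier (quot_pmonoid A ?c)" "Y : carrier (quot_pmonoid A ?c)" and XY: "f S = f Y"
  hence "EX x:carrier A. S = ?c `` {x}" "EX y:carrier A. Y = ?c `` {y}" using q by simp_all
  then obtain x y where xy: "x : carrier A" "S = ?c `` {x}" "y : carrier A" "Y = ?c `` {y}" by auto
  hence "(x, y) : ?c" using XY f by (simp add: pkernel_iff)
  thus "S = Y" using equiv_class_eq[OF eq] xy by simp
 qed
 ultimately have dom: "pmon_domain (quot_pmonoid A ?c)"
  by (rule pmon_domainI[OF K _ _ quot_pointed_monoid[OF c]])
 have "inj_on (%l. ?c `` {\<eta> l}) (carrier k)"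
 proof (rule inj_onI)
  fix l m assume lm: "l : carrier k" "m : carrier k" "?c `` {\<eta> l} = ?c `` {\<eta> m}"
  hence "h (\<eta> l) = h (\<eta> m)" using f \<eta>(1) by metis
  thus "l = m" using inj_onD[OF \<eta>(2), of l m] lm by simp
 qed
 thus ?thesis using c dom by (simp add: SCong_def)
qed

lemma SCong_kernelE:
 assumes c: "c : SCong k \<eta> A" and \<eta>: "!!l. l : carrier k ==> \<eta> l : carrier A"
 obtains K :: "(nat \<times> 'a set) ring" and h where "field K" "h : pmon_hom A (ring_pmonoid K)"
  "c = pkernel A h" "inj_on (h \<circ> \<eta>) (carrier k)"
proof -
 have cc: "congruence A c" and eq: "equiv (carrier A) c" using c by (auto simp: SCong_def congruence_def)
 from c obtain K :: "(nat \<times> 'a set) ring" and f B where K: "field K"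
  and B: "pointed_submonoid B (ring_pmonoid K)"
  and f: "f : pmon_iso (quot_pmonoid A c) ((ring_pmonoid K)\<lparr>carrier := B\<rparr>)"
  by (auto simp: SCong_def pmon_domain_def)
 define h where "h x = f (c `` {x})" for x
 have BK: "B <= carrier K" using B by (auto simp: pointed_submonoid_def)
 have fh: "f : pmon_hom (quot_pmonoid A c) ((ring_pmonoid K)\<lparr>carrier := B\<rparr>)"
  and fi: "inj_on f (carrier A // c)" using f by (auto simp: pmon_iso_def bij_betw_def)
 have cl: "c `` {x} : carrier A // c" if "x : carrier A" for x using that by (rule quotientI)
 have "h : pmon_hom A (ring_pmonoid K)"
 proof (rule pmon_homI)
  fix x assume x: "x : carrier A"
  show "h x : carrier (ring_pmonoid K)"
   using pmon_homD(1)[OF fh, of "c `` {x}"] cl[OF x] BK by (auto simp: h_def)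
  fix y assume y: "y : carrier A"
  show "h (x \<otimes> y) = h x *[ring_pmonoid K] h y"
   using pmon_homD(4)[OF fh, of "c `` {x}" "c `` {y}"] cl x y by (simp add: h_def quot_mult[OF cc])
 qed (use pmon_homD(2,3)[OF fh] in \<open>simp_all add: h_def\<close>)
 moreover have ker: "h x = h y \<longleftrightarrow> (x, y) : c" if "x : carrier A" "y : carrier A" for x y
  using inj_on_eq_iff[OF fi cl[OF that(1)] cl[OF that(2)]] eq_equiv_class_iff[OF eq that] by (simp add: h_def)
 have "c <= carrier A \<times> carrier A" using eq by (simp add: equiv_def refl_on_def)
 hence "c = pkernel A h" using ker by (auto simp: pkernel_iff)
 moreover have "inj_on (h \<circ> \<eta>) (carrier k)"
 proof (rule inj_onI)
  fix l m assume lm: "l : carrier k" "m : carrier k" "(h \<circ> \<eta>) l = (h \<circ> \<eta>) m"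
  hence "c `` {\<eta> l} = c `` {\<eta> m}" using ker \<eta> equiv_class_eq[OF eq] by simp
  thus "l = m" using c lm by (auto simp: SCong_def dest: inj_onD)
 qed
 ultimately show thesis using that K by blast
qed

end

section \<open>Ultraproducts\<close>

definition prod_ring :: "'i set => ('i => 'b ring) => ('i => 'b) ring" where
 "prod_ring I K = \<lparr>carrier = (\<Pi>\<^sub>E i\<in>I. carrier (K i)), mult = (%a b. \<lambda>i\<in>I. a i *[K i] b i),
   one = (\<lambda>i\<in>I. 1[K i]), zero = (\<lambda>i\<in>I. 0[K i]), add = (%a b. \<lambda>i\<in>I. a i \<oplus>\<^bsub>K i\<^esub> b i)\<rparr>"

lemma prod_ring_simps [simp]:
 "carrier (prod_ring I K) = (\<Pi>\<^sub>E i\<in>I. carrier (K i))"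
 "a *[prod_ring I K] b = (\<lambda>i\<in>I. a i *[K i] b i)"
 "a \<oplus>\<^bsub>prod_ring I K\<^esub> b = (\<lambda>i\<in>I. a i \<oplus>\<^bsub>K i\<^esub> b i)"
 "1[prod_ring I K] = (\<lambda>i\<in>I. 1[K i])" "0[prod_ring I K] = (\<lambda>i\<in>I. 0[K i])"
 by (simp_all add: prod_ring_def)

lemma cring_prod_ring:
 assumes K: "!!i. i : I ==> cring (K i)"
 shows "cring (prod_ring I K)"
proof -
 have ring: "ring (K i)" if "i : I" for i using K[OF that] by (rule cring.axioms)
 note rules = ring.ring_simprules[OF ring] cring.cring_simprules(14)[OF K]
 have mem: "a i : carrier (K i)" if "a : (\<Pi>\<^sub>E i\<in>I. carrier (K i))" "i : I" for a i
  using that by (rule PiE_mem)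
 have ext: "a = b" if "a : (\<Pi>\<^sub>E i\<in>I. carrier (K i))" "b : (\<Pi>\<^sub>E i\<in>I. carrier (K i))"
  "!!i. i : I ==> a i = b i" for a b using that by (rule PiE_ext)
 show ?thesis
 proof (rule cringI)
  show "abelian_group (prod_ring I K)"
  proof (rule abelian_groupI)
   fix x y z
   assume x: "x : carrier (prod_ring I K)"
   show "0[prod_ring I K] \<oplus>\<^bsub>prod_ring I K\<^esub> x = x"
    by (rule ext) (use x mem rules in auto)
   show "EX y:carrier (prod_ring I K). y \<oplus>\<^bsub>prod_ring I K\<^esub> x = 0[prod_ring I K]"
    by (rule bexI[of _ "\<lambda>i\<in>I. \<ominus>\<^bsub>K i\<^esub> x i"]) (use x mem rules in \<open>auto intro!: ext\<close>)
   assume y: "y : carrier (prod_ring I K)"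
   show "x \<oplus>\<^bsub>prod_ring I K\<^esub> y : carrier (prod_ring I K)" using x y mem rules by auto
   show "x \<oplus>\<^bsub>prod_ring I K\<^esub> y = y \<oplus>\<^bsub>prod_ring I K\<^esub> x"
    by (rule ext) (use x y mem rules in auto)
   assume z: "z : carrier (prod_ring I K)"
   show "x \<oplus>\<^bsub>prod_ring I K\<^esub> y \<oplus>\<^bsub>prod_ring I K\<^esub> z = x \<oplus>\<^bsub>prod_ring I K\<^esub> (y \<oplus>\<^bsub>prod_ring I K\<^esub> z)"
    by (rule ext) (use x y z mem rules in auto)
  qed (use rules in auto)
  show "Group.comm_monoid (prod_ring I K)"
  proof (rule comm_monoidI)
   fix x y z
   assume x: "x : carrier (prod_ring I K)"
   show "1[prod_ring I K] *[prod_ring I K] x = x" by (rule ext) (use x mem rules in auto)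
   assume y: "y : carrier (prod_ring I K)"
   show "x *[prod_ring I K] y : carrier (prod_ring I K)" using x y mem rules by auto
   show "x *[prod_ring I K] y = y *[prod_ring I K] x" by (rule ext) (use x y mem rules in auto)
   assume z: "z : carrier (prod_ring I K)"
   show "x *[prod_ring I K] y *[prod_ring I K] z = x *[prod_ring I K] (y *[prod_ring I K] z)"
    by (rule ext) (use x y z mem rules in auto)
  qed (use rules in auto)
  fix x y z
  assume x: "x : carrier (prod_ring I K)" and y: "y : carrier (prod_ring I K)"
   and z: "z : carrier (prod_ring I K)"
  show "(x \<oplus>\<^bsub>prod_ring I K\<^esub> y) *[prod_ring I K] z =
   x *[prod_ring I K] z \<oplus>\<^bsub>prod_ring I K\<^esub> y *[prod_ring I K] z"
   by (rule ext) (use x y z mem rules in auto)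
 qed
qed

lemma (in cring) ideal_by_elements:
 assumes J: "J <= carrier R" "\<zero> : J"
  and add: "!!a b. a : J ==> b : J ==> a \<oplus> b : J"
  and mult: "!!a b. a : J ==> b : carrier R ==> b \<otimes> a : J"
 shows "ideal J R"
proof (rule idealI)
 show "ring R" by (rule ring_axioms)
 have inv: "\<ominus> a : J" if "a : J" for a
 proof -
  have "\<ominus> a = (\<ominus> \<one>) \<otimes> a" using that J by (metis l_minus l_one one_closed subsetD)
  thus ?thesis using mult that by simp
 qed
 show "subgroup J (add_monoid R)"
  by (rule add.subgroupI) (use J add inv in \<open>auto simp: a_inv_def\<close>)
 fix a x assume "a : J" "x : carrier R"
 thus "x \<otimes> a : J" "a \<otimes> x : J" using mult J m_comm by (auto, metis subsetD)
qed

lemma (in cring) exists_maximal_ideal: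
 assumes J: "ideal J R" "\<one> ~: J"
 shows "EX M. maximalideal M R & J <= M"
proof -
 define \<J> where "\<J> = {I. ideal I R & J <= I & \<one> ~: I}"
 have "EX M:\<J>. ALL S:\<J>. M <= S --> S = M"
 proof (rule subset_Zorn_nonempty)
  show "\<J> ~= {}" using J by (auto simp: \<J>_def)
  fix C assume C: "C ~= {}" "subset.chain \<J> C"
  have id: "ideal I R" "\<one> ~: I" "J <= I" if "I : C" for I
   using C that by (auto simp: subset_chain_def \<J>_def)
  have cl: "a : carrier R" if "I : C" "a : I" for I a using ideal.Icarr[OF id(1)[OF that(1)] that(2)] .
  have "ideal (\<Union>C) R"
  proof (rule ideal_by_elements)
   show "\<Union>C <= carrier R" using cl by auto
   show "\<zero> : \<Union>C" using C(1) id(1) by (meson Union_iff additive_subgroup.zero_closed ex_in_conv ideal.axioms(1))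
   fix a b assume "a : \<Union>C"
   then obtain I where I: "I : C" "a : I" by auto
   show "b \<otimes> a : \<Union>C" if "b : carrier R" using ideal.I_l_closed[OF id(1)[OF I(1)] I(2) that] I by auto
   assume "b : \<Union>C"
   then obtain I' where I': "I' : C" "b : I'" by auto
   hence "I <= I' \<or> I' <= I" using C(2) I unfolding subset_chain_def by auto
   then obtain I'' where "I'' : C" "a : I''" "b : I''" using I I' by auto
   thus "a \<oplus> b : \<Union>C" using additive_subgroup.a_closed[OF ideal.axioms(1)[OF id(1)]] by auto
  qed
  moreover obtain I where "I : C" using C(1) by auto
  hence "J <= \<Union>C" using id(3) by (meson Union_upper subset_trans)
  ultimately show "\<Union>C : \<J>" using id(2) unfolding \<J>_def by auto
 qed
 then obtain M where M: "M : \<J>" "!!S. S : \<J> ==> M <= S ==> S = M" by auto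
 have "maximalideal M R"
 proof (rule maximalidealI)
  show "ideal M R" using M by (simp add: \<J>_def)
  show "carrier R ~= M" using M by (auto simp: \<J>_def)
  fix I assume I: "ideal I R" "M <= I" "I <= carrier R"
  show "I = M \<or> I = carrier R"
  proof (cases "\<one> : I")
   case True
   thus ?thesis using ideal.one_imp_carrier[OF I(1)] by simp
  next
   case False
   hence "I : \<J>" using I M(1) by (auto simp: \<J>_def)
   thus ?thesis using M(2) I by auto
  qed
 qed
 thus ?thesis using M(1) by (auto simp: \<J>_def)
qed

text \<open>The ultraproduct appears as the quotient of the product ring by a maximal ideal. The
  ideal has to contain all families that vanish wherever a suitable finite set of pairs is
  separated; \<open>sep\<close> says that these families do not include 1.\<close>

lemma ultraproduct_hom:
 fixes K :: "'i => 'b ring" and h :: "'i => 'a => 'b"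
 assumes K: "!!i. i : I ==> field (K i)"
  and h: "!!i. i : I ==> h i : pmon_hom A (ring_pmonoid (K i))"
  and A: "pointed_monoid A"
  and sep: "!!P. finite P ==> P <= carrier A \<times> carrier A - c ==>
   EX i:I. ALL (x, y):P. h i x ~= h i y"
  and ker: "!!i x y. i : I ==> (x, y) : c ==> h i x = h i y"
 shows "EX (L :: ('i => 'b) set ring) g. field L & g : pmon_hom A (ring_pmonoid L) &
  (ALL x:carrier A. ALL y:carrier A. g x = g y \<longleftrightarrow> (x, y) : c)"
proof -
 let ?R = "prod_ring I K"
 have Kd: "domain (K i)" if "i : I" for i using K[OF that] by (rule field.axioms)
 have Kc: "cring (K i)" if "i : I" for i using Kd[OF that] by (rule domain.axioms)
 have Kr: "ring (K i)" if "i : I" for i using Kc[OF that] by (rule cring.axioms)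
 note rules = ring.ring_simprules[OF Kr] cring.cring_simprules(14)[OF Kc]
 interpret R: cring ?R by (rule cring_prod_ring[OF Kc])
 have mem: "a i : carrier (K i)" if "a : (\<Pi>\<^sub>E i\<in>I. carrier (K i))" "i : I" for a i
  using that by (rule PiE_mem)
 define good where "good P i \<longleftrightarrow> (ALL (x, y):P. h i x ~= h i y)" for P i
 define \<P> where "\<P> = {P. finite P & P <= carrier A \<times> carrier A - c}"
 \<comment> \<open>The finite sets of pairs are directed by union, so \<open>J\<close> is closed
   under addition.\<close>
 define J where "J = {a : carrier ?R. EX P:\<P>. ALL i:I. good P i --> a i = 0[K i]}"
 have sep: "EX i:I. good P i" if "P : \<P>" for P using sep that by (auto simp: \<P>_def good_def)
 have JI: "a : J" if "a : carrier ?R" "P : \<P>" "!!i. i : I ==> good P i ==> a i = 0[K i]" for a P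
  using that unfolding J_def by blast
 have JE: "EX P:\<P>. ALL i:I. good P i --> a i = 0[K i]" "a : carrier ?R" if "a : J" for a
  using that unfolding J_def by auto
 have J: "ideal J ?R"
 proof (rule R.ideal_by_elements)
  show "J <= carrier ?R" by (auto simp: J_def)
  show "0[?R] : J" by (rule JI[OF R.zero_closed, of "{}"]) (auto simp: \<P>_def)
  fix a b assume a: "a : J"
  obtain P where P: "P : \<P>" "!!i. i : I ==> good P i ==> a i = 0[K i]" using JE(1)[OF a] by auto
  show "b *[?R] a : J" if b: "b : carrier ?R"
  proof (rule JI[OF R.m_closed[OF b JE(2)[OF a]] P(1)])
   fix i assume i: "i : I" "good P i"
   have "b i : carrier (K i)" using mem[of b] b i by simp
   hence "b i *[K i] 0[K i] = 0[K i]" using ring.ring_simprules[OF Kr[OF i(1)]] by simp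
   thus "(b *[?R] a) i = 0[K i]" using P(2)[OF i] i by simp
  qed
  assume b: "b : J"
  obtain Q where Q: "Q : \<P>" "!!i. i : I ==> good Q i ==> b i = 0[K i]" using JE(1)[OF b] by auto
  show "a \<oplus>\<^bsub>?R\<^esub> b : J"
  proof (rule JI[OF R.a_closed[OF JE(2)[OF a] JE(2)[OF b]], of "P Un Q"])
   show "P Un Q : \<P>" using P(1) Q(1) by (auto simp: \<P>_def)
   fix i assume i: "i : I" and *: "good (P Un Q) i"
   hence "a i = 0[K i]" "b i = 0[K i]" using P(2) Q(2) by (auto simp: good_def)
   thus "(a \<oplus>\<^bsub>?R\<^esub> b) i = 0[K i]" using i ring.ring_simprules[OF Kr[OF i]] by simp
  qed
 qed
 have "1[?R] ~: J"
 proof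
  assume "1[?R] : J"
  then obtain P where P: "P : \<P>" "!!i. i : I ==> good P i ==> 1[?R] i = 0[K i]" using JE(1) by blast
  then obtain i where "i : I" "good P i" using sep by auto
  hence "1[K i] = 0[K i]" using P(2)[of i] by auto
  thus False using domain.one_not_zero[OF Kd[OF \<open>i : I\<close>]] by simp
 qed
 then obtain M where M: "maximalideal M ?R" "J <= M" using R.exists_maximal_ideal[OF J] by auto
 interpret M: maximalideal M ?R by (rule M(1))
 define L where "L = ?R Quot M"
 define u where "u x = (\<lambda>i\<in>I. h i x)" for x
 define g where "g x = M +>\<^bsub>?R\<^esub> u x" for x
 have L: "field L" unfolding L_def by (rule M.quotient_is_field) (rule R.cring_axioms)
 have uR: "u x : carrier ?R" if "x : carrier A" for x using pmon_homD(1)[OF h] that by (auto simp: u_def)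
 have hom: "((+>\<^bsub>?R\<^esub>) M) : ring_hom ?R L" unfolding L_def by (rule M.rcos_ring_hom)
 interpret A: pointed_monoid A by (rule A)
 have "g : pmon_hom A (ring_pmonoid L)"
 proof (rule pmon_homI)
  fix x assume x: "x : carrier A"
  show "g x : carrier (ring_pmonoid L)" using ring_hom_closed[OF hom uR[OF x]] by (simp add: g_def)
  fix y assume y: "y : carrier A"
  have "u (x *[A] y) = u x *[?R] u y" using pmon_homD(4)[OF h] x y by (auto simp: u_def)
  thus "g (x *[A] y) = g x *[ring_pmonoid L] g y"
   using ring_hom_mult[OF hom uR[OF x] uR[OF y]] by (simp add: g_def del: prod_ring_simps)
 next
  have "u 1[A] = 1[?R]" using pmon_homD(2)[OF h] by (auto simp: u_def)
  thus "g 1[A] = 1[ring_pmonoid L]" using ring_hom_one[OF hom] by (simp add: g_def del: prod_ring_simps)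
  have "u (pzero A) = 0[?R]" using pmon_homD(3)[OF h] by (auto simp: u_def)
  thus "g (pzero A) = pzero (ring_pmonoid L)" using ring_hom_zero[OF hom R.ring_axioms] L
   by (simp add: g_def field_def domain_def cring_def del: prod_ring_simps)
 qed
 moreover have "g x = g y \<longleftrightarrow> (x, y) : c" if x: "x : carrier A" and y: "y : carrier A" for x y
 proof
  assume "(x, y) : c"
  hence "u x = u y" using ker unfolding u_def by (intro restrict_ext) auto
  thus "g x = g y" by (simp add: g_def)
 next
  assume g: "g x = g y"
  show "(x, y) : c"
  proof (rule ccontr)
   assume nc: "(x, y) ~: c"
   define d where "d = u x \<ominus>\<^bsub>?R\<^esub> u y"
   \<comment> \<open>The pointwise inverse of the difference, with 0 where there is none. At indices
     that separate \<open>x\<close> and \<open>y\<close> the product of \<open>d'\<close> and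
     \<open>d\<close> is 1, so 1 minus the product lies in \<open>J\<close>, and \<open>d\<close>
     cannot lie in the proper ideal \<open>M\<close>.\<close>
   define d' where "d' = (\<lambda>i\<in>I. if d i = 0[K i] then 0[K i] else inv[K i] (d i))"
   have dR: "d : carrier ?R" unfolding d_def using uR x y by (simp del: prod_ring_simps)
   have dM: "d : M" unfolding d_def
    using R.quotient_eq_iff_same_a_r_cos[OF M.is_ideal uR[OF x] uR[OF y]] g by (simp add: g_def)
   have unit: "d i : Units (K i)" if "i : I" "d i ~= 0[K i]" for i
    using field.field_Units[OF K[OF that(1)]] mem[of d i] dR that by auto
   have d'R: "d' : carrier ?R"
    using unit rules mem dR unfolding d'_def by (auto simp: monoid.Units_inv_closed ring.is_monoid[OF Kr])
   have "(1[?R] \<ominus>\<^bsub>?R\<^esub> d' *[?R] d) : J"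
   proof (rule JI)
    show cl: "1[?R] \<ominus>\<^bsub>?R\<^esub> d' *[?R] d : carrier ?R" using dR d'R by (simp del: prod_ring_simps)
    show "{(x, y)} : \<P>" using x y nc by (auto simp: \<P>_def)
    fix i assume i: "i : I" and "good {(x, y)} i"
    hence ne: "h i x ~= h i y" by (auto simp: good_def)
    interpret Ki: ring "K i" by (rule Kr[OF i])
    have eq1: "(d \<oplus>\<^bsub>?R\<^esub> u y) = u x" unfolding d_def using uR x y
     by (simp add: R.minus_eq R.a_assoc R.l_neg del: prod_ring_simps)
    have "d i \<oplus>\<^bsub>K i\<^esub> h i y = h i x" using fun_cong[OF eq1, of i] i by (simp add: u_def)
    hence "d i ~= 0[K i]" using ne rules(8)[OF i, of "h i y"] pmon_homD(1)[OF h[OF i] y] by auto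
    hence "(d' *[?R] d) i = 1[K i]"
     using unit[OF i] i by (simp add: d'_def monoid.Units_l_inv ring.is_monoid[OF Kr])
    moreover
    have "((1[?R] \<ominus>\<^bsub>?R\<^esub> d' *[?R] d) \<oplus>\<^bsub>?R\<^esub> d' *[?R] d) = 1[?R]"
     using dR d'R by (simp add: R.minus_eq R.a_assoc R.l_neg del: prod_ring_simps)
    from fun_cong[OF this, of i]
    have "(1[?R] \<ominus>\<^bsub>?R\<^esub> d' *[?R] d) i \<oplus>\<^bsub>K i\<^esub> (d' *[?R] d) i = 1[K i]"
     using i by (simp only: prod_ring_simps(3,4) restrict_apply' if_True)
    ultimately have eq2: "(1[?R] \<ominus>\<^bsub>?R\<^esub> d' *[?R] d) i \<oplus>\<^bsub>K i\<^esub> 1[K i] = 1[K i]"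
     by (simp only:)
    have "(1[?R] \<ominus>\<^bsub>?R\<^esub> d' *[?R] d) i : carrier (K i)"
     using cl mem[OF _ i] by (simp only: prod_ring_simps(1))
    thus "(1[?R] \<ominus>\<^bsub>?R\<^esub> d' *[?R] d) i = 0[K i]"
     using eq2 Ki.add.r_cancel_one[of "1[K i]"] by simp
   qed
   hence "1[?R] \<ominus>\<^bsub>?R\<^esub> d' *[?R] d : M" using M(2) by auto
   moreover have "d' *[?R] d : M" using M.I_l_closed[OF dM d'R] .
   ultimately have "(1[?R] \<ominus>\<^bsub>?R\<^esub> d' *[?R] d) \<oplus>\<^bsub>?R\<^esub> d' *[?R] d : M"
    by (rule M.a_closed)
   moreover have "((1[?R] \<ominus>\<^bsub>?R\<^esub> d' *[?R] d) \<oplus>\<^bsub>?R\<^esub> d' *[?R] d) = 1[?R]"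
     using dR d'R by (simp add: R.minus_eq R.a_assoc R.l_neg del: prod_ring_simps)
   ultimately have "1[?R] : M" by simp
   thus False using M.one_imp_carrier M.I_notcarr by simp
  qed
 qed
 ultimately show ?thesis using L by blast
qed

section \<open>Strong congruence spaces are sober\<close>

locale kalgebra = A: pointed_monoid A for k :: "'k pmonoid" and \<eta> :: "'k => 'a" and A :: "'a pmonoid" +
 assumes \<eta>_closed: "l : carrier k ==> \<eta> l : carrier A"
begin

lemma SCong_top_avoid: "SCong_top k \<eta> A = avoid_top (SCong k \<eta> A) (carrier A \<times> carrier A)"
 unfolding SCong_top_def avoid_top_def by (rule arg_cong[of _ _ topology_generated_by]) auto

lemma SCong_zero_one:
 assumes c: "c : SCong k \<eta> A"
 shows "(pzero A, 1[A]) ~: c"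
proof -
 obtain K :: "(nat \<times> 'a set) ring" and h where K: "field K" "h : pmon_hom A (ring_pmonoid K)"
  "c = pkernel A h" using A.SCong_kernelE[OF c \<eta>_closed] by metis
 thus ?thesis using pmon_homD(2,3)[OF K(2)] domain.one_not_zero[OF field.axioms(1)[OF K(1)]]
  by (auto simp: pkernel_iff)
qed

lemma SCong_subset: "c : SCong k \<eta> A ==> c <= carrier A \<times> carrier A"
 by (auto simp: SCong_def congruence_def equiv_def refl_on_def)

sublocale avoid_space "SCong k \<eta> A" "carrier A \<times> carrier A"
 using SCong_zero_one SCong_subset A.pzero_closed A.one_closed by unfold_locales blast+

text \<open>\<open>irreducible_avoid_finite\<close> is the separation hypothesis of
  \<open>ultraproduct_hom\<close> with the members of \<open>T\<close> as indices. So the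
  intersection is again the kernel of a homomorphism into a field.\<close>

sublocale sober_avoid_space "SCong k \<eta> A" "carrier A \<times> carrier A"
proof
 fix T assume T: "irreducible_closed (avoid_top (SCong k \<eta> A) (carrier A \<times> carrier A)) T"
 have TS: "T <= SCong k \<eta> A" using irreducible_closed_subset[OF T] by simp
 have "EX (K :: (nat \<times> 'a set) ring) h. field K & h : pmon_hom A (ring_pmonoid K) &
   c = pkernel A h & inj_on (h \<circ> \<eta>) (carrier k)" if "c : T" for c
  using A.SCong_kernelE[of c k \<eta>] \<eta>_closed TS that by (metis subsetD)
 then obtain K :: "('a \<times> 'a) set => (nat \<times> 'a set) ring" and h where
  Kh: "!!c. c : T ==> field (K c) & h c : pmon_hom A (ring_pmonoid (K c)) &
   c = pkernel A (h c) & inj_on (h c \<circ> \<eta>) (carrier k)" by metis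
 have ker: "h c x = h c y \<longleftrightarrow> (x, y) : c" if "c : T" "x : carrier A" "y : carrier A" for c x y
  using Kh[OF that(1)] that by (metis pkernel_iff)
 obtain c0 where c0: "c0 : T" using irreducible_closed_nonempty[OF T] by auto
 have sub: "\<Inter>T <= carrier A \<times> carrier A" using c0 TS SCong_subset by blast
 have "EX (L :: (('a \<times> 'a) set => nat \<times> 'a set) set ring) g. field L & g : pmon_hom A (ring_pmonoid L) &
  (ALL x:carrier A. ALL y:carrier A. g x = g y \<longleftrightarrow> (x, y) : \<Inter>T)"
 proof (rule ultraproduct_hom[where I = T and K = K and h = h])
  fix P assume P: "finite P" "P <= carrier A \<times> carrier A - \<Inter>T"
  then obtain c where c: "c : T" "P Int c = {}" using irreducible_avoid_finite[OF T, of P] by auto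
  have "ALL (x, y):P. h c x ~= h c y" using ker[OF c(1)] P(2) c(2) by auto
  thus "EX c:T. ALL (x, y):P. h c x ~= h c y" using c(1) by auto
 next
  fix c x y assume "c : T" "(x, y) : \<Inter>T"
  thus "h c x = h c y" using ker sub by auto
 qed (use Kh in auto, rule A.pointed_monoid_axioms)
 then obtain L :: "(('a \<times> 'a) set => nat \<times> 'a set) set ring" and g where
  L: "field L" "g : pmon_hom A (ring_pmonoid L)"
  and g: "!!x y. x : carrier A ==> y : carrier A ==> g x = g y \<longleftrightarrow> (x, y) : \<Inter>T" by auto
 have "p : \<Inter>T \<longleftrightarrow> p : pkernel A g" for p
  using g[of "fst p" "snd p"] sub by (cases p) (auto simp: pkernel_iff simp del: Inter_iff)
 hence "\<Inter>T = pkernel A g" by (rule Set.set_eqI)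
 \<comment> \<open>The intersection identifies no more constants than any single member
   \<open>c0\<close> does.\<close>
 moreover have "inj_on (g \<circ> \<eta>) (carrier k)"
 proof (rule inj_onI)
  fix l m assume lm: "l : carrier k" "m : carrier k" "(g \<circ> \<eta>) l = (g \<circ> \<eta>) m"
  hence "(\<eta> l, \<eta> m) : c0" using g[OF \<eta>_closed \<eta>_closed] c0 by auto
  hence "h c0 (\<eta> l) = h c0 (\<eta> m)" using ker[OF c0 \<eta>_closed \<eta>_closed] lm by simp
  moreover have "inj_on (h c0 \<circ> \<eta>) (carrier k)" using Kh[OF c0] by simp
  ultimately show "l = m" using inj_onD[of "h c0 \<circ> \<eta>" "carrier k" l m] lm by simp
 qed
 ultimately show "\<Inter>T : SCong k \<eta> A" using A.SCong_kernelI[OF L \<eta>_closed] by simp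
qed

end

section \<open>Extending homomorphisms to divisible groups\<close>

text \<open>Partial homomorphisms as graphs, so that unions of chains are plain unions of sets. The
  graph is closed under products and inverses, hence uniqueness of the value at 1 gives uniqueness
  everywhere.\<close>

locale hom_graph = D: comm_group D + E: comm_group E
 for D :: "('d, 'x) monoid_scheme" and E :: "('e, 'y) monoid_scheme" +
 fixes \<Gamma> :: "('d \<times> 'e) set"
 assumes sub: "\<Gamma> <= carrier D \<times> carrier E"
  and one: "(1[D], 1[E]) : \<Gamma>"
  and mult: "(x, y) : \<Gamma> ==> (x', y') : \<Gamma> ==> (x *[D] x', y *[E] y') : \<Gamma>"
  and inv: "(x, y) : \<Gamma> ==> (inv[D] x, inv[E] y) : \<Gamma>"
  and functional_one: "(1[D], y) : \<Gamma> ==> y = 1[E]"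
begin

lemma functional:
 assumes "(x, y) : \<Gamma>" "(x, y') : \<Gamma>"
 shows "y = y'"
proof -
 have cl: "x : carrier D" "y : carrier E" "y' : carrier E" using assms sub by auto
 have "(x *[D] inv[D] x, y *[E] inv[E] y') : \<Gamma>" by (intro mult inv assms)
 hence "y *[E] inv[E] y' = 1[E]" using functional_one cl by simp
 hence "y = inv[E] (inv[E] y')" using cl E.inv_equality[of y "inv[E] y'"] by simp
 thus ?thesis using cl by simp
qed

lemma pow: "(x, y) : \<Gamma> ==> (x ^[D] (n::nat), y ^[E] n) : \<Gamma>"
 by (induction n) (auto intro: one mult)

lemma int_pow: "(x, y) : \<Gamma> ==> (x ^[D] (n::int), y ^[E] n) : \<Gamma>"
 unfolding int_pow_def2 by (auto intro: pow inv simp del: pow_nat)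

text \<open>If some positive power of \<open>a\<close> is in the domain, take the least one and send
  \<open>a\<close> to a root of its value. Otherwise no nontrivial power is in the domain and 1 will
  do. In both cases the powers of \<open>a\<close> in the domain already have the right values,
  which makes the enlarged graph functional.\<close>

lemma extend_step:
 assumes div: "!!y n. y : carrier E ==> 0 < n ==> EX z:carrier E. z ^[E] (n::nat) = y"
  and a: "a : carrier D"
 shows "\<exists>\<Gamma>' e. hom_graph D E \<Gamma>' & \<Gamma> <= \<Gamma>' & (a, e) : \<Gamma>'"
proof -
 have "EX e:carrier E. ALL j::int. ALL w. (a ^[D] j, w) : \<Gamma> --> w = e ^[E] j"
 proof (cases "EX n::nat. 0 < n & (EX y. (a ^[D] n, y) : \<Gamma>)")
  case False
  have "w = 1[E] ^[E] j" if w: "(a ^[D] j, w) : \<Gamma>" for j :: int and w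
  proof -
   have "~ 0 < j"
   proof
    assume j: "0 < j"
    hence "(a ^[D] nat j, w) : \<Gamma>" using w by simp
    thus False using False j by (meson zero_less_nat_eq)
   qed
   moreover have "~ j < 0"
   proof
    assume j: "j < 0"
    have "(a ^[D] (- j), inv[E] w) : \<Gamma>" using inv[OF w] a by (simp add: D.int_pow_neg)
    hence "(a ^[D] nat (- j), inv[E] w) : \<Gamma>" using j by simp
    thus False using False j by (meson neg_0_less_iff_less zero_less_nat_eq)
   qed
   ultimately have "j = 0" by simp
   thus ?thesis using w functional_one by simp
  qed
  thus ?thesis by (rule_tac bexI[of _ "1[E]"]) (blast, simp)
 next
  case True
  define n where "n = (LEAST n::nat. 0 < n & (EX y. (a ^[D] n, y) : \<Gamma>))"
  from LeastI_ex[OF True] obtain y where n: "0 < n" "(a ^[D] n, y) : \<Gamma>" unfolding n_def by auto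
  have least: "n <= m" if "0 < m" "(a ^[D] m, y) : \<Gamma>" for m y
   unfolding n_def by (rule Least_le) (use that in auto)
  from n sub have "y : carrier E" by auto
  then obtain e where e: "e : carrier E" "e ^[E] n = y" using div n(1) by blast
  have "w = e ^[E] j" if w: "(a ^[D] j, w) : \<Gamma>" for j :: int and w
  proof -
   \<comment> \<open>Minimality of \<open>n\<close> forces the remainder to be 0, so every exponent
     of \<open>a\<close> in the domain is a multiple of \<open>n\<close>.\<close>
   define q r where "q = j div int n" and "r = j mod int n"
   have j: "j = int n * q + r" and r: "0 <= r" "r < int n" using n(1) by (auto simp: q_def r_def)
   have pn: "(a ^[D] (int n * q), e ^[E] (int n * q)) : \<Gamma>"
   proof -
    have "(a ^[D] int n) ^[D] q = a ^[D] (int n * q)" "(e ^[E] int n) ^[E] q = e ^[E] (int n * q)"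
     by (rule D.int_pow_pow[OF a], rule E.int_pow_pow[OF e(1)])
    thus ?thesis using int_pow[OF n(2), of q] e(2) by (simp add: int_pow_int)
   qed
   hence "(a ^[D] j *[D] inv[D] (a ^[D] (int n * q)), w *[E] inv[E] (e ^[E] (int n * q))) : \<Gamma>"
    by (intro mult inv w)
   moreover have "a ^[D] j *[D] inv[D] (a ^[D] (int n * q)) = a ^[D] r"
    using a j by (metis D.int_pow_diff add_diff_cancel_left')
   ultimately have "(a ^[D] nat r, w *[E] inv[E] (e ^[E] (int n * q))) : \<Gamma>" using r by simp
   hence "0 < nat r ==> n <= nat r" using least[of "nat r"] by simp
   hence "r = 0" using r by linarith
   thus ?thesis using functional[OF w] pn j by simp
  qed
  thus ?thesis using e by auto
 qed
 then obtain e where e: "e : carrier E" "!!j::int. !!w. (a ^[D] j, w) : \<Gamma> ==> w = e ^[E] j" by auto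
 define \<Gamma>' where "\<Gamma>' = {(x *[D] a ^[D] j, y *[E] e ^[E] j) | x y j. (x, y) : \<Gamma> & j : (UNIV :: int set)}"
 have cl: "x : carrier D" "y : carrier E" if "(x, y) : \<Gamma>" for x y using that sub by auto
 have I: "(x *[D] a ^[D] j, y *[E] e ^[E] j) : \<Gamma>'" if "(x, y) : \<Gamma>" for x y and j :: int
  unfolding \<Gamma>'_def using that by auto
 have "hom_graph D E \<Gamma>'"
 proof
  show "\<Gamma>' <= carrier D \<times> carrier E" using cl a e(1) by (auto simp: \<Gamma>'_def)
  show "(1[D], 1[E]) : \<Gamma>'" using I[OF one, of 0] by simp
  fix x y assume "(x, y) : \<Gamma>'"
  then obtain u v j where u: "(u, v) : \<Gamma>" "x = u *[D] a ^[D] (j::int)" "y = v *[E] e ^[E] j"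
   unfolding \<Gamma>'_def by auto
  show "(inv[D] x, inv[E] y) : \<Gamma>'" using I[OF inv[OF u(1)], of "- j"] u cl[OF u(1)] a e(1)
   by (simp add: D.inv_mult E.inv_mult D.int_pow_neg E.int_pow_neg)
  fix x' y' assume "(x', y') : \<Gamma>'"
  then obtain u' v' j' where u': "(u', v') : \<Gamma>" "x' = u' *[D] a ^[D] (j'::int)" "y' = v' *[E] e ^[E] j'"
   unfolding \<Gamma>'_def by auto
  have "(u *[D] u') *[D] a ^[D] (j + j') = x *[D] x'" using u u' cl a by (simp add: D.int_pow_mult D.m_ac)
  moreover have "(v *[E] v') *[E] e ^[E] (j + j') = y *[E] y'"
   using u u' cl e(1) by (simp add: E.int_pow_mult E.m_ac)
  ultimately show "(x *[D] x', y *[E] y') : \<Gamma>'" using I[OF mult[OF u(1) u'(1)], of "j + j'"] by simp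
 next
  fix y assume "(1[D], y) : \<Gamma>'"
  then obtain u v j where u: "(u, v) : \<Gamma>" "u *[D] a ^[D] (j::int) = 1[D]" "y = v *[E] e ^[E] j"
   unfolding \<Gamma>'_def by auto
  hence "u = a ^[D] (- j)" using cl[OF u(1)] a D.inv_equality[of u "a ^[D] j"] by (simp add: D.int_pow_neg)
  hence "v = e ^[E] (- j)" using e(2) u(1) by simp
  thus "y = 1[E]" using u(3) e(1) by (simp add: E.int_pow_neg)
 qed
 moreover have "\<Gamma> <= \<Gamma>'"
 proof
  fix p assume "p : \<Gamma>"
  thus "p : \<Gamma>'" using I[of "fst p" "snd p" 0] cl[of "fst p" "snd p"] by (cases p) simp
 qed
 moreover have "(a, e) : \<Gamma>'" using I[OF one, of 1] a e by (simp add: D.int_pow_1 E.int_pow_1)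
 ultimately show ?thesis by blast
qed

lemma extend:
 assumes div: "!!y n. y : carrier E ==> 0 < n ==> EX z:carrier E. z ^[E] (n::nat) = y"
 shows "EX g:hom D E. ALL (x, y):\<Gamma>. g x = y"
proof -
 define \<G> where "\<G> = {\<Gamma>'. hom_graph D E \<Gamma>' & \<Gamma> <= \<Gamma>'}"
 have "EX M:\<G>. ALL S:\<G>. M <= S --> S = M"
 proof (rule subset_Zorn_nonempty)
  show "\<G> ~= {}" using hom_graph_axioms by (auto simp: \<G>_def)
  fix C assume C: "C ~= {}" "subset.chain \<G> C"
  have gr: "hom_graph D E G" "\<Gamma> <= G" if "G : C" for G
   using C that by (auto simp: subset_chain_def \<G>_def)
  have "hom_graph D E (\<Union>C)"
  proof
   show "\<Union>C <= carrier D \<times> carrier E" using hom_graph.sub[OF gr(1)] by auto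
   obtain G0 where "G0 : C" using C(1) by auto
   thus "(1[D], 1[E]) : \<Union>C" using hom_graph.one[OF gr(1)] by auto
   show "y = 1[E]" if "(1[D], y) : \<Union>C" for y using that hom_graph.functional_one[OF gr(1)] by auto
   show "(inv[D] x, inv[E] y) : \<Union>C" if "(x, y) : \<Union>C" for x y
    using that hom_graph.inv[OF gr(1)] by auto
   fix x y x' y' assume "(x, y) : \<Union>C" "(x', y') : \<Union>C"
   then obtain G G' where G: "G : C" "(x, y) : G" "G' : C" "(x', y') : G'" by auto
   hence "G <= G' \<or> G' <= G" using C(2) unfolding subset_chain_def by auto
   then obtain H where "H : C" "(x, y) : H" "(x', y') : H" using G by auto
   thus "(x *[D] x', y *[E] y') : \<Union>C" using hom_graph.mult[OF gr(1)[of H]] by (meson UnionI)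
  qed
  moreover obtain G where "G : C" using C(1) by auto
  hence "\<Gamma> <= \<Union>C" using gr(2) by (meson Union_upper subset_trans)
  ultimately show "\<Union>C : \<G>" by (simp add: \<G>_def)
 qed
 then obtain M where M: "M : \<G>" "!!S. S : \<G> ==> M <= S ==> S = M" by auto
 interpret M: hom_graph D E M using M(1) by (simp add: \<G>_def)
 have total: "EX e. (a, e) : M" if a: "a : carrier D" for a
 proof -
  obtain M' e where M': "hom_graph D E M'" "M <= M'" "(a, e) : M'"
   using M.extend_step[OF div \<open>a : carrier D\<close>] by auto
  hence "M' : \<G>" using M(1) by (auto simp: \<G>_def)
  thus ?thesis using M(2) M' by auto
 qed
 define g where "g x = (THE y. (x, y) : M)" for x
 have g: "g x = y" if "(x, y) : M" for x y unfolding g_def using that M.functional by (intro the_equality) auto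
 have "g : hom D E"
 proof (rule homI)
  fix x assume "x : carrier D"
  then obtain y where y: "(x, y) : M" using total by auto
  thus "g x : carrier E" using g M.sub by auto
  fix x' assume "x' : carrier D"
  then obtain y' where y': "(x', y') : M" using total by auto
  show "g (x *[D] x') = g x *[E] g x'" using g[OF M.mult[OF y y']] g[OF y] g[OF y'] by simp
 qed
 moreover have "ALL (x, y):\<Gamma>. g x = y" using g M(1) by (auto simp: \<G>_def)
 ultimately show ?thesis by blast
qed

end

section \<open>Complex characters\<close>

definition cunits :: "complex monoid" where
 "cunits = \<lparr>carrier = {z. z ~= 0}, mult = (*), one = 1\<rparr>"

definition cfield :: "complex ring" where
 "cfield = \<lparr>carrier = UNIV, mult = (*), one = 1, zero = 0, add = (+)\<rparr>"

lemma cunits_simps [simp]: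
 "carrier cunits = {z. z ~= 0}" "x *[cunits] y = x * y" "1[cunits] = 1" by (simp_all add: cunits_def)

lemma comm_group_cunits: "comm_group cunits"
proof (rule comm_groupI)
 fix x assume "x : carrier cunits"
 thus "EX y:carrier cunits. y *[cunits] x = 1[cunits]" by (intro bexI[of _ "inverse x"]) auto
qed auto

interpretation cunits: comm_group cunits by (rule comm_group_cunits)

lemma cunits_pow [simp]: "x ^[cunits] (n::nat) = x ^ n" by (induction n) (simp_all add: mult.commute)

lemma field_cfield: "field cfield"
proof -
 have "cring cfield" by (intro cringI abelian_groupI comm_monoidI)
   (auto simp: cfield_def algebra_simps intro: exI[of _ "- _"] left_minus)
 thus ?thesis
 proof (rule cring.cring_fieldI)
  show "Units cfield = carrier cfield - {0[cfield]}"
  proof -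
   have "EX y. y * x = 1 & x * y = 1" if "x ~= 0" for x :: complex
    using that by (intro exI[of _ "inverse x"]) auto
   thus ?thesis by (auto simp: Units_def cfield_def)
  qed
 qed
qed

lemma cunits_divisible:
 assumes "y : carrier cunits" "0 < n"
 shows "EX z:carrier cunits. z ^[cunits] (n::nat) = y"
proof -
 have "exp (Ln y / of_nat n) ^ n = exp (of_nat n * (Ln y / of_nat n))" by (rule exp_of_nat_mult[symmetric])
 also have "\<dots> = y" using assms by simp
 finally show ?thesis by (intro bexI[of _ "exp (Ln y / of_nat n)"]) auto
qed

lemma hom_cunits:
 assumes "\<xi> : hom D cunits" "x : carrier D"
 shows "\<xi> x ~= 0" "y : carrier D ==> \<xi> (x *[D] y) = \<xi> x * \<xi> y"
 using assms by (auto simp: hom_def)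

context comm_group
begin

lemma hom_cunits_one: "\<xi> : hom G cunits ==> \<xi> \<one> = 1"
 using hom_one[OF _ group_axioms cunits.group_axioms] by simp

lemma hom_cunits_pow: "\<xi> : hom G cunits ==> x : carrier G ==> \<xi> (x [^] (n::nat)) = \<xi> x ^ n"
 by (induction n) (auto simp: hom_cunits_one hom_cunits)

text \<open>The condition on \<open>w\<close> makes sending powers of \<open>a\<close> to powers of
  \<open>w\<close> well defined; divisibility of the nonzero complex numbers extends this to the
  whole group.\<close>

lemma character_at:
 assumes a: "a : carrier G" and w: "w ~= 0" "!!n::nat. 0 < n ==> a [^] n = \<one> ==> w ^ n = 1"
 shows "\<exists>\<xi>\<in>hom G cunits. \<xi> a = w"
proof -
 define \<Gamma> where "\<Gamma> = range (%j::int. (a [^] j, w ^[cunits] j))"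
 have I: "(a [^] j, w ^[cunits] j) : \<Gamma>" for j :: int by (simp add: \<Gamma>_def)
 have wc: "w : carrier cunits" using w by simp
 have pos: "w ^[cunits] j = 1" if "a [^] j = \<one>" "0 < j" for j :: int
 proof -
  have "a [^] nat j = \<one>" using that by simp
  hence "w ^[cunits] nat j = 1" using w(2)[of "nat j"] that(2) by simp
  moreover have "w ^[cunits] nat j = w ^[cunits] j" using that(2) by (intro pow_nat) simp
  ultimately show ?thesis by (simp only:)
 qed
 interpret hom_graph G cunits \<Gamma>
 proof
  show "\<Gamma> <= carrier G \<times> carrier cunits" using a wc cunits.int_pow_closed[OF wc] by (auto simp: \<Gamma>_def)
  show "(\<one>, 1[cunits]) : \<Gamma>" using I[of 0] by (simp add: int_pow_def2)
  fix x y assume "(x, y) : \<Gamma>"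
  then obtain j where j: "x = a [^] (j::int)" "y = w ^[cunits] j" by (auto simp: \<Gamma>_def)
  show "(inv x, inv[cunits] y) : \<Gamma>" using I[of "- j"] j int_pow_neg[OF a] cunits.int_pow_neg[OF wc] by simp
  fix x' y' assume "(x', y') : \<Gamma>"
  then obtain j' where j': "x' = a [^] (j'::int)" "y' = w ^[cunits] j'" by (auto simp: \<Gamma>_def)
  show "(x \<otimes> x', y *[cunits] y') : \<Gamma>"
   using I[of "j + j'"] j j' int_pow_mult[OF a] cunits.int_pow_mult[OF wc] by simp
 next
  fix y assume "(\<one>, y) : \<Gamma>"
  then obtain j where j: "a [^] (j::int) = \<one>" "y = w ^[cunits] j" by (auto simp: \<Gamma>_def)
  consider "0 < j" | "j = 0" | "0 < - j" by linarith
  thus "y = 1[cunits]"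
  proof cases
   case 3
   have "a [^] (- j) = \<one>" using j a by (simp add: int_pow_neg)
   hence "w ^[cunits] (- j) = 1" using pos[of "- j"] 3 by blast
   hence "inv[cunits] y = 1[cunits]" using j(2) cunits.int_pow_neg[OF wc, of j] by simp
   thus ?thesis using cunits.inv_eq_1_iff[of y] j(2) cunits.int_pow_closed[OF wc, of j] by simp
  next
   case 1
   thus ?thesis using pos[OF j(1)] j(2) by simp
  next
   case 2
   thus ?thesis using j(2) by simp
  qed
 qed
 obtain \<xi> where \<xi>: "\<xi> : hom G cunits" "ALL (x, y):\<Gamma>. \<xi> x = y" using extend[OF cunits_divisible] by auto
 have "(a, w) : \<Gamma>" using I[of 1] a wc cunits.int_pow_1[OF wc] by simp
 thus ?thesis using \<xi> by auto
qed

text \<open>If the character found so far is 1 at a new element \<open>a\<close> of order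
  \<open>p\<close>, then no element of \<open>Q\<close> has order \<open>p\<close>: it would be a
  power of \<open>a\<close>, as there are at most \<open>p\<close> solutions of
  \<open>x^p = 1\<close>. So the character can be corrected at \<open>a\<close> by a factor that is
  trivial on \<open>Q\<close>.\<close>

lemma prime_order_characters:
 assumes tors: "!!N. 0 < N ==> finite {x : carrier G. x [^] (N::nat) = \<one>} &
   card {x : carrier G. x [^] N = \<one>} <= N"
  and Q: "finite Q" "!!a. a : Q ==> a : carrier G & a ~= \<one> & (EX p. Factorial_Ring.prime (p::nat) & a [^] p = \<one>)"
 shows "\<exists>\<xi>\<in>hom G cunits. ALL a:Q. \<xi> a ~= 1" using Q
proof (induction Q rule: finite_induct)
 case empty
 have "(%x. 1) : hom G cunits" by (auto simp: hom_def)
 thus ?case by auto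
next
 case (insert a Q)
 then obtain \<xi> where \<xi>: "\<xi> : hom G cunits" "ALL a:Q. \<xi> a ~= 1" by auto
 obtain p :: nat where p: "Factorial_Ring.prime p" "a [^] p = \<one>" "a : carrier G" "a ~= \<one>" using insert.prems by auto
 show ?case
 proof (cases "\<xi> a = 1")
  case True
  have ordp: "ord a = p" using p pow_eq_id[OF p(3), of p] prime_nat_iff ord_eq_1[OF p(3)] by metis
  have no: "b [^] p ~= \<one>" if b: "b : Q" for b
  proof
   assume bp: "b [^] p = \<one>"
   have bG: "b : carrier G" using insert.prems b by auto
   let ?T = "{x : carrier G. x [^] p = \<one>}"
   have "inj_on (%i. a [^] i) {..<p}"
    using prime_gt_0_nat[OF p(1)] by (intro inj_on_subset[OF ord_inj[OF p(3), unfolded ordp]]) auto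
   hence card: "card ((%i. a [^] i) ` {..<p}) = p" by (simp add: card_image)
   have "(%i. a [^] i) ` {..<p} <= ?T"
   proof
    fix x assume "x : (%i. a [^] i) ` {..<p}"
    then obtain i :: nat where i: "x = a [^] i" by auto
    have "x [^] p = (a [^] p) [^] i" using i p(3) by (simp add: nat_pow_pow mult.commute)
    thus "x : ?T" using i p(2,3) by simp
   qed
   hence "(%i. a [^] i) ` {..<p} = ?T" using tors[of p] prime_gt_0_nat[OF p(1)] card by (metis card_seteq)
   moreover have "b : ?T" using bp bG by simp
   ultimately obtain i where "b = a [^] (i::nat)" by blast
   hence "\<xi> b = 1" using hom_cunits_pow[OF \<xi>(1) p(3)] True by simp
   thus False using \<xi>(2) b by simp
  qed
  have "ALL b:Q. EX q. Factorial_Ring.prime (q::nat) & b [^] q = \<one>" using insert.prems by auto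
  then obtain q where q: "!!b. b : Q ==> Factorial_Ring.prime (q b :: nat) & b [^] q b = \<one>" by metis
  \<comment> \<open>The exponent \<open>m\<close> kills every element of \<open>Q\<close> and is
    prime to \<open>p\<close>, so the \<open>m\<close>-th power of a character with a nontrivial
    root of unity at \<open>a\<close> is trivial on \<open>Q\<close> but not at
    \<open>a\<close>.\<close>
  define m where "m = (\<Prod>b\<in>Q. q b)"
  have "coprime m p" unfolding m_def
  proof (rule prod_coprime_left)
   fix b assume b: "b : Q"
   hence "q b ~= p" using no q by auto
   thus "coprime (q b) p" using q[OF b] p(1) primes_coprime by blast
  qed
  have "card {z::complex. z ^ p = 1} = p" using card_roots_unity_eq prime_gt_0_nat[OF p(1)] by simp
  moreover have "~ p <= 1" using prime_gt_1_nat[OF p(1)] by simp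
  ultimately have "~ {z::complex. z ^ p = 1} <= {1}" 
   by (metis card.empty card.insert_remove card_mono empty_Diff finite.emptyI finite.insertI One_nat_def)
  then obtain w :: complex where w: "w ^ p = 1" "w ~= 1" by auto
  have w0: "w ~= 0" using w(1) prime_gt_0_nat[OF p(1)] by (metis power_0_left zero_neq_one neq0_conv)
  have "w ^ m ~= 1"
  proof
   assume wm: "w ^ m = 1"
   obtain x y where "m * x = p * y + 1"
   proof -
    have "m ~= 0" using \<open>coprime m p\<close> prime_gt_1_nat[OF p(1)] by (intro notI) simp
    moreover have "gcd m p = 1" using \<open>coprime m p\<close> by simp
    ultimately show ?thesis using bezout_nat[of m p] that by metis
   qed
   hence "(w ^ m) ^ x = (w ^ p) ^ y * w" by (simp add: power_mult[symmetric])
   thus False using wm w by simp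
  qed
  have "w ^ n = 1" if "a [^] n = \<one>" for n :: nat
  proof -
   have "p dvd n" using that pow_eq_id[OF p(3)] ordp by simp
   thus ?thesis using w by (auto simp: power_mult)
  qed
  then obtain \<psi> where \<psi>: "\<psi> : hom G cunits" "\<psi> a = w" using character_at[OF p(3) w0] by auto
  have "(%x. \<xi> x * \<psi> x ^ m) : hom G cunits"
   using \<xi>(1) \<psi>(1) by (auto simp: hom_def power_mult_distrib)
  moreover have "\<xi> b * \<psi> b ^ m ~= 1" if b: "b : Q" for b
  proof -
   have bG: "b : carrier G" using insert.prems b by auto
   obtain r where r: "m = q b * r" unfolding m_def using insert.hyps(1) b by (metis dvdE dvd_prodI)
   have "b [^] m = \<one>" using q[OF b] bG r by (metis nat_pow_one nat_pow_pow)
   hence "\<psi> b ^ m = 1" using hom_cunits_pow[OF \<psi>(1) bG, of m] hom_cunits_one[OF \<psi>(1)] by simp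
   thus ?thesis using \<xi>(2) b by simp
  qed
  moreover have "\<xi> a * \<psi> a ^ m ~= 1" using True \<psi>(2) \<open>w ^ m ~= 1\<close> by simp
  ultimately show ?thesis by (intro bexI[of _ "%x. \<xi> x * \<psi> x ^ m"]) auto
 qed (use \<xi> in auto)
qed

text \<open>Twisting a character by powers of \<open>\<bar>\<psi>\<bar>\<close> keeps it nontrivial on given elements for all but
 finitely many exponents.\<close>

lemma twist_characters:
 assumes P: "finite P" "P <= carrier G" "\<xi>0 : hom G cunits" "ALL a:P. \<xi>0 a ~= 1"
  and Q: "finite Q" "!!a. a : Q ==> a : carrier G & (ALL n::nat. 0 < n --> a [^] n ~= \<one>)"
 shows "\<exists>\<xi>\<in>hom G cunits. ALL a:P Un Q. \<xi> a ~= 1" using Q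
proof (induction Q rule: finite_induct)
 case empty
 thus ?case using P by auto
next
 case (insert a Q)
 then obtain \<xi> where \<xi>: "\<xi> : hom G cunits" "ALL a:P Un Q. \<xi> a ~= 1" by auto
 have a: "a : carrier G" "!!n::nat. 0 < n ==> a [^] n ~= \<one>" using insert.prems by auto
 \<comment> \<open>The value 2 makes the logarithm \<open>\<rho> a\<close> nonzero. An element with
   \<open>\<rho> b = 0\<close> keeps its old value, and any other element excludes a single
   \<open>t\<close>.\<close>
 obtain \<psi> where \<psi>: "\<psi> : hom G cunits" "\<psi> a = 2" using character_at[of a 2] a by auto
 define \<rho> where "\<rho> x = ln (norm (\<psi> x))" for x
 define \<theta> where "\<theta> t x = \<xi> x * of_real (exp (t * \<rho> x))" for t x
 have \<theta>: "\<theta> t : hom G cunits" for t using hom_cunits[OF \<xi>(1)] hom_cunits[OF \<psi>(1)]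
  by (auto simp: hom_def \<theta>_def \<rho>_def norm_mult ln_mult distrib_left exp_add)
 have sub: "insert a (P Un Q) <= carrier G" using P(2) insert.prems by auto
 define bad where "bad = (%b. - ln (norm (\<xi> b)) / \<rho> b) ` insert a (P Un Q)"
 have "finite bad" unfolding bad_def using P(1) insert.hyps by simp
 then obtain t where t: "t ~: bad" using ex_new_if_finite infinite_UNIV_char_0 by metis
 have "\<theta> t b ~= 1" if b: "b : insert a (P Un Q)" for b
 proof
  assume eq: "\<theta> t b = 1"
  have bG: "b : carrier G" using b sub by auto
  show False
  proof (cases "\<rho> b = 0")
   case True
   hence "b : P Un Q" using b \<psi>(2) by (auto simp: \<rho>_def)
   thus False using eq True \<xi>(2) by (simp add: \<theta>_def)
  next
   case False
   have "norm (\<xi> b) * exp (t * \<rho> b) = 1" using arg_cong[OF eq, of norm] by (simp add: \<theta>_def norm_mult)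
   hence "ln (norm (\<xi> b)) + t * \<rho> b = 0"
    using hom_cunits(1)[OF \<xi>(1) bG] ln_mult[of "norm (\<xi> b)" "exp (t * \<rho> b)"] by simp
   hence "t = - ln (norm (\<xi> b)) / \<rho> b" using False by (simp add: field_simps)
   thus False using t b by (auto simp: bad_def)
  qed
 qed
 thus ?case using \<theta>[of t] by (intro bexI[of _ "\<theta> t"]) auto
qed

text \<open>A torsion element has a power of prime order, and a character that is nontrivial at the
  power is nontrivial at the element. The elements of infinite order are then handled by
  \<open>twist_characters\<close>.\<close>

lemma separating_character:
 assumes tors: "!!N. 0 < N ==> finite {x : carrier G. x [^] (N::nat) = \<one>} &
   card {x : carrier G. x [^] N = \<one>} <= N"
  and P: "finite P" "P <= carrier G - {\<one>}"
 shows "\<exists>\<xi>\<in>hom G cunits. ALL a:P. \<xi> a ~= 1"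
proof -
 define T where "T = {a : P. EX n::nat. 0 < n & a [^] n = \<one>}"
 have "EX m::nat. a [^] m ~= \<one> & (EX p. Factorial_Ring.prime (p::nat) & (a [^] m) [^] p = \<one>)" if "a : T" for a
 proof -
  have a: "a : carrier G" "a ~= \<one>" "ord a ~= 0" using that P(2) pow_eq_id[of a] by (auto simp: T_def)
  hence "ord a ~= 1" using ord_eq_1 by simp
  then obtain p where p: "Factorial_Ring.prime p" "p dvd ord a" using prime_factor_nat by auto
  then obtain m where m: "ord a = p * m" by auto
  have "a [^] m ~= \<one>"
  proof
   assume "a [^] m = \<one>"
   hence "p * m dvd m" using pow_eq_id[OF a(1), of m] m by simp
   thus False using a(3) m prime_gt_1_nat[OF p(1)] by (metis dvd_mult_cancel2 mult_is_0 nat_dvd_1_iff_1 neq0_conv not_prime_1 p(1))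
  qed
  moreover have "(a [^] m) [^] p = \<one>" using a pow_ord_eq_1[OF a(1)] m by (simp add: nat_pow_pow mult.commute)
  ultimately show ?thesis using p by blast
 qed
 then obtain m where m: "!!a. a : T ==> a [^] (m a :: nat) ~= \<one> & (EX p. Factorial_Ring.prime (p::nat) & (a [^] m a) [^] p = \<one>)" by metis
 have TG: "T <= carrier G" "finite T" using P by (auto simp: T_def)
 have "\<exists>\<xi>\<in>hom G cunits. ALL a:(%a. a [^] m a) ` T. \<xi> a ~= 1"
  by (rule prime_order_characters[OF tors]) (use m TG in auto)
 then obtain \<xi>0 where \<xi>0: "\<xi>0 : hom G cunits" "ALL a:T. \<xi>0 (a [^] m a) ~= 1" by auto
 have "ALL a:T. \<xi>0 a ~= 1"
 proof
  fix a assume "a : T"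
  thus "\<xi>0 a ~= 1" using \<xi>0 hom_cunits_pow[OF \<xi>0(1), of a "m a"] TG by auto
 qed
 hence "\<exists>\<xi>\<in>hom G cunits. ALL a:T Un (P - T). \<xi> a ~= 1"
 proof (rule twist_characters[OF TG(2,1) \<xi>0(1)])
  fix a assume "a : P - T"
  hence "a : P" "~ (EX n::nat. 0 < n & a [^] n = \<one>)" by (auto simp: T_def)
  thus "a : carrier G & (ALL n::nat. 0 < n --> a [^] n ~= \<one>)" using P(2) by blast
 qed (use P in auto)
 moreover have "T Un (P - T) = P" by (auto simp: T_def)
 ultimately show ?thesis by simp
qed

text \<open>A pointed monoid that maps to a group, with a prime ideal \<open>Z\<close> sent to zero. The group embeds
 into the units of a field.\<close>

lemma field_hom_of_group:
 assumes tors: "!!N. 0 < N ==> finite {x : carrier G. x [^] (N::nat) = \<one>} &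
   card {x : carrier G. x [^] N = \<one>} <= N"
  and A: "pointed_monoid A"
  and v: "!!x. x : carrier A - Z ==> v x : carrier G"
   "!!x y. x : carrier A - Z ==> y : carrier A - Z ==> v (x *[A] y) = v x \<otimes> v y"
   "v 1[A] = \<one>"
  and Z: "1[A] ~: Z" "pzero A : Z"
   "!!x y. x : carrier A ==> y : carrier A ==> x *[A] y : Z \<longleftrightarrow> x : Z \<or> y : Z"
 shows "EX (L :: (('a => complex) => complex) set ring) g. field L & g : pmon_hom A (ring_pmonoid L) &
  (ALL x:carrier A. ALL y:carrier A. g x = g y \<longleftrightarrow> (x : Z & y : Z) \<or> (x ~: Z & y ~: Z & v x = v y))"
proof -
 define c where "c = {(x, y). (x : Z & y : Z) \<or> (x ~: Z & y ~: Z & v x = v y)}"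
 define h where "h \<xi> x = (if x : Z then 0 else \<xi> (v x))" for \<xi> :: "'a => complex" and x
 have "EX (L :: (('a => complex) => complex) set ring) g. field L & g : pmon_hom A (ring_pmonoid L) &
  (ALL x:carrier A. ALL y:carrier A. g x = g y \<longleftrightarrow> (x, y) : c)"
 proof (rule ultraproduct_hom[where I = "hom G cunits" and K = "%_. cfield" and h = h])
  fix \<xi> assume \<xi>: "\<xi> : hom G cunits"
  show "h \<xi> : pmon_hom A (ring_pmonoid cfield)"
  proof (rule pmon_homI)
   fix x y assume "x : carrier A" "y : carrier A"
   thus "h \<xi> (x *[A] y) = h \<xi> x *[ring_pmonoid cfield] h \<xi> y"
    using Z(3) v hom_cunits(2)[OF \<xi>] by (auto simp: h_def cfield_def)
  qed (use Z v(3) hom_cunits_one[OF \<xi>] in \<open>auto simp: h_def cfield_def\<close>)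
  show "h \<xi> x = h \<xi> y" if "(x, y) : c" for x y using that by (auto simp: c_def h_def)
 next
  fix P assume P: "finite P" "P <= carrier A \<times> carrier A - c"
  \<comment> \<open>Only pairs with both entries outside \<open>Z\<close> have to be separated by a
    suitable character; pairs with one entry in \<open>Z\<close> are separated by every character,
    since characters have no zeros.\<close>
  define P' where "P' = (%(x, y). v x \<otimes> inv v y) ` {(x, y) : P. x ~: Z & y ~: Z}"
  have "finite P'" unfolding P'_def using P(1) by (intro finite_imageI finite_subset[OF _ P(1)]) auto
  moreover have "P' <= carrier G - {\<one>}"
  proof
   fix a assume "a : P'"
   then obtain x y where xy: "(x, y) : P" "x ~: Z" "y ~: Z" "a = v x \<otimes> inv v y" by (auto simp: P'_def)
   hence vv: "v x : carrier G" "v y : carrier G" "v x ~= v y" using P v(1) by (auto simp: c_def)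
   thus "a : carrier G - {\<one>}" using xy(4) inv_equality[of "v x" "inv v y"] by auto
  qed
  ultimately obtain \<xi> where \<xi>: "\<xi> : hom G cunits" "ALL a:P'. \<xi> a ~= 1"
   using separating_character[OF tors] by blast
  have "h \<xi> x ~= h \<xi> y" if p: "(x, y) : P" for x y
  proof -
   have xy: "x : carrier A" "y : carrier A" "(x, y) ~: c" using p P by auto
   show ?thesis
   proof (cases "x ~: Z & y ~: Z")
    case True
    hence vv: "v x : carrier G" "v y : carrier G" using v(1) xy by auto
    have "v x \<otimes> inv v y : P'" using p True by (auto simp: P'_def)
    hence "\<xi> (v x \<otimes> inv v y) ~= 1" using \<xi>(2) by auto
    moreover have "\<xi> (v x \<otimes> inv v y) * \<xi> (v y) = \<xi> (v x)"
     using hom_cunits(2)[OF \<xi>(1), of "v x \<otimes> inv v y" "v y"] vv by (simp add: m_assoc)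
    ultimately have "\<xi> (v x) ~= \<xi> (v y)" using hom_cunits(1)[OF \<xi>(1) vv(2)] by auto
    thus ?thesis using True by (simp add: h_def)
   next
    case False
    thus ?thesis using xy v(1) hom_cunits(1)[OF \<xi>(1)] by (auto simp: c_def h_def)
   qed
  qed
  thus "EX i:hom G cunits. ALL (x, y):P. h i x ~= h i y" using \<xi>(1) by auto
 qed (use field_cfield A in simp_all)
 thus ?thesis by (simp add: c_def)
qed

end

section \<open>Linear relations and integral Farkas lemma\<close>

text \<open>Elimination by cross multiplication stays inside the domain, so that the lemma yields
  integral relations between functionals as well as complex relations between monomials.\<close>

lemma exists_linear_relation:
 fixes x :: "'i => 'b => 'a::idom"
 assumes "finite B" "finite J" "card B < card J"
 shows "EX a. (EX i:J. a i ~= 0) & (ALL b:B. (SUM i:J. a i * x i b) = 0)" using assms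
proof (induction B arbitrary: J x rule: finite_induct)
 case empty
 hence "J ~= {}" by auto
 thus ?case by (intro exI[of _ "%_. 1"]) auto
next
 case (insert b B)
 show ?case
 proof (cases "EX j:J. x j b ~= 0")
  case False
  have "card B < card J" using insert by simp
  from insert.IH[OF insert.prems(1) this, of x] obtain a where
   a: "EX i:J. a i ~= 0" "ALL b:B. (SUM i:J. a i * x i b) = 0" by blast
  moreover have "(SUM i:J. a i * x i b) = 0" using False by (intro sum.neutral) auto
  ultimately show ?thesis by blast
 next
  case True
  then obtain j where j: "j : J" "x j b ~= 0" by auto
  define J' where "J' = J - {j}"
  have J': "finite J'" "J = insert j J'" "j ~: J'" using insert.prems j by (auto simp: J'_def)
  have "card B < card J'" using insert.prems insert.hyps J' by simp
  from insert.IH[OF J'(1) this, of "%i c. x j b * x i c - x i b * x j c"] obtain a where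
   a: "EX i:J'. a i ~= 0" "!!c. c : B ==> (SUM i:J'. a i * (x j b * x i c - x i b * x j c)) = 0" by blast
  \<comment> \<open>The coefficient of the pivot \<open>j\<close> is the one that cancels coordinate
    \<open>b\<close>.\<close>
  define a' where "a' i = (if i = j then - (SUM i:J'. a i * x i b) else a i * x j b)" for i
  have *: "(SUM i:J. a' i * x i c) = (SUM i:J'. a i * (x j b * x i c - x i b * x j c))" for c
  proof -
   have "(SUM i:J. a' i * x i c) = a' j * x j c + (SUM i:J'. a' i * x i c)"
    unfolding J'(2) using J'(1,3) by simp
   also have "(SUM i:J'. a' i * x i c) = (SUM i:J'. a i * x j b * x i c)"
    using J'(3) by (intro sum.cong) (auto simp: a'_def)
   also have "a' j * x j c = - (SUM i:J'. a i * x i b * x j c)" by (simp add: a'_def sum_distrib_right)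
   finally show ?thesis by (simp add: sum_subtractf right_diff_distrib mult.assoc)
  qed
  have "EX i:J. a' i ~= 0" using a(1) j(2) J' by (auto simp: a'_def)
  moreover have "(SUM i:J. a' i * x i c) = 0" if "c : insert b B" for c using that a(2) by (auto simp: *)
  ultimately show ?thesis by blast
 qed
qed

definition zcomb :: "int => ('v => real) => int => ('v => real) => 'v => real" where
 "zcomb a x b y = (%v. of_int a * x v + of_int b * y v)"

definition zsubgroup :: "('v => real) set => bool" where
 "zsubgroup W \<longleftrightarrow> 0 : W & (ALL x:W. ALL y:W. ALL a b. zcomb a x b y : W)"

definition zlinear_on :: "('v => real) set => (('v => real) => int) => bool" where
 "zlinear_on W g \<longleftrightarrow> (ALL x:W. ALL y:W. ALL a b. g (zcomb a x b y) = a * g x + b * g y)"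

lemma zsubgroup_zcomb: "zsubgroup W ==> x : W ==> y : W ==> zcomb a x b y : W" by (simp add: zsubgroup_def)

lemma zlinear_onD: "zlinear_on W g ==> x : W ==> y : W ==> g (zcomb a x b y) = a * g x + b * g y"
 by (simp add: zlinear_on_def)

text \<open>Induction on the number of inequalities. If inequality \<open>k\<close> is needed, some
  \<open>x0\<close> satisfies the others but violates the claim and inequality \<open>k\<close>.
  Projecting to the kernel of \<open>g k\<close> along \<open>x0\<close> leaves a statement with one
  inequality less. The factor \<open>n\<close> absorbs denominators.\<close>

lemma int_farkas:
 assumes "finite J" and W: "zsubgroup W"
  and "!!i. i : J ==> zlinear_on W (g i)" "zlinear_on W f"
  and "!!x. x : W ==> (!!i. i : J ==> 0 <= g i x) ==> 0 <= f x"
 shows "EX n>0. EX c. (ALL i:J. 0 <= c i) & (ALL x:W. n * f x = (SUM i:J. c i * g i x))" using assms(1,3-5)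
proof (induction J arbitrary: f g rule: finite_induct)
 case empty
 have "f x = 0" if x: "x : W" for x
 proof -
  have W0: "0 : W" using W by (simp add: zsubgroup_def)
  have "f (zcomb (-1) x 0 x) = - f x" using zlinear_onD[OF empty(2) x x, of "-1" 0] by simp
  thus ?thesis using empty(3)[OF x] empty(3)[OF zsubgroup_zcomb[OF W x x, of "-1" 0]] by simp
 qed
 thus ?case by (intro exI[of _ 1]) auto
next
 case (insert k J)
 show ?case
 proof (cases "ALL x:W. (ALL i:J. 0 <= g i x) --> 0 <= f x")
  case True
  then obtain n c where n: "n > 0" "ALL i:J. 0 <= c i" "ALL x:W. n * f x = (SUM i:J. c i * g i x)"
   using insert.IH[of g f] insert.prems by auto
  have "(SUM i:insert k J. (c(k := 0)) i * g i x) = (SUM i:J. c i * g i x)" for x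
   using insert.hyps by (simp, intro sum.cong) auto
  thus ?thesis using n by (intro exI[of _ n] conjI exI[of _ "c(k := 0)"]) auto
 next
  case False
  then obtain x0 where x0: "x0 : W" "!!i. i : J ==> 0 <= g i x0" "f x0 < 0" by auto
  have gk: "g k x0 < 0" 
  proof (rule ccontr)
   assume "~ g k x0 < 0"
   hence "0 <= g i x0" if "i : insert k J" for i using that x0(2) by auto
   thus False using insert.prems(3)[OF x0(1)] x0(3) by auto
  qed
  define p where "p = - g k x0"
  have p: "p > 0" "g k x0 = - p" using gk by (auto simp: p_def)
  \<comment> \<open>These are \<open>g i\<close> and \<open>f\<close> after \<open>y\<close> is
    replaced by \<open>p y + g k(y) x0\<close>, a multiple of the projection that has integral
    coefficients. The new vector lies in the kernel of \<open>g k\<close>.\<close>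
  define g' where "g' i y = p * g i y + g i x0 * g k y" for i y
  define f' where "f' y = p * f y + f x0 * g k y" for y
  have lin: "zlinear_on W (g i)" if "i : insert k J" for i using insert.prems(1)[OF that] .
  have "EX n>0. EX c. (ALL i:J. 0 <= c i) & (ALL x:W. n * f' x = (SUM i:J. c i * g' i x))"
  proof (rule insert.IH)
   show "zlinear_on W (g' i)" if "i : J" for i
    using lin[of i] lin[of k] that unfolding zlinear_on_def g'_def by (simp add: algebra_simps)
   show "zlinear_on W f'"
    using lin[of k] insert.prems(2) unfolding zlinear_on_def f'_def by (simp add: algebra_simps)
   fix y assume y: "y : W" "!!i. i : J ==> 0 <= g' i y"
   let ?z = "zcomb p y (g k y) x0"
   have "0 <= f ?z"
   proof (rule insert.prems(3)[OF zsubgroup_zcomb[OF W y(1) x0(1)]])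
    fix i assume i: "i : insert k J"
    have "g i ?z = p * g i y + g k y * g i x0" using zlinear_onD[OF lin[OF i] y(1) x0(1)] .
    thus "0 <= g i ?z" using i y(2)[of i] p(2) by (auto simp: g'_def mult.commute)
   qed
   thus "0 <= f' y"
    using zlinear_onD[OF insert.prems(2) y(1) x0(1), of p "g k y"] by (simp add: f'_def mult.commute)
  qed
  then obtain n c where n: "n > 0" "ALL i:J. 0 <= c i"
   "!!x. x : W ==> n * f' x = (SUM i:J. c i * g' i x)" by blast
  \<comment> \<open>The coefficient of \<open>g k\<close> collects what the projection contributed.
    It is nonnegative because \<open>f\<close> is negative at \<open>x0\<close> and the other
    \<open>g i\<close> are not.\<close>
  define c' where "c' i = (if i = k then (SUM i:J. c i * g i x0) - n * f x0 else c i * p)" for i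
  have "0 <= (SUM i:J. c i * g i x0)" using n(2) x0(2) by (intro sum_nonneg) simp
  moreover have "n * f x0 < 0" using n(1) x0(3) by (rule mult_pos_neg)
  ultimately have "0 <= c' k" by (simp add: c'_def)
  hence "ALL i:insert k J. 0 <= c' i" using n(2) p(1) by (auto simp: c'_def)
  moreover have "(n * p) * f x = (SUM i:insert k J. c' i * g i x)" if x: "x : W" for x
  proof -
   have "(SUM i:J. c' i * g i x) = (SUM i:J. c i * p * g i x)"
    using insert.hyps by (intro sum.cong) (auto simp: c'_def)
   hence "(SUM i:insert k J. c' i * g i x) =
    ((SUM i:J. c i * g i x0) - n * f x0) * g k x + (SUM i:J. c i * p * g i x)"
    using insert.hyps by (simp add: c'_def)
   also have "\<dots> = (SUM i:J. c i * g' i x) - n * f x0 * g k x"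
    by (simp add: g'_def algebra_simps sum.distrib sum_distrib_left)
   also have "\<dots> = n * p * f x" using n(3)[OF x] by (simp add: f'_def algebra_simps)
   finally show ?thesis by simp
  qed
  ultimately show ?thesis using n(1) p(1) by (intro exI[of _ "n * p"] conjI exI[of _ c']) auto
 qed
qed

section \<open>Ranks in lattices of functionals\<close>

definition zmul :: "int => ('v => real) => 'v => real" where
 "zmul n x = (%v. of_int n * x v)"

definition zsum :: "'i set => ('i => int) => ('i => 'v => real) => 'v => real" where
 "zsum J a x = (%v. SUM i:J. of_int (a i) * x i v)"

lemma zsubgroupD:
 assumes "zsubgroup W"
 shows zsubgroup_zero: "0 : W" and zsubgroup_mul: "x : W ==> zmul n x : W"
  and zsubgroup_add: "x : W ==> y : W ==> x + y : W"
  and zsubgroup_diff: "x : W ==> y : W ==> x - y : W"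
  and zsubgroup_uminus: "x : W ==> - x : W"
proof -
 show "0 : W" using assms by (simp add: zsubgroup_def)
 show "zmul n x : W" if "x : W"
  using zsubgroup_zcomb[OF assms that that, of n 0] by (simp add: zcomb_def zmul_def)
 show "x + y : W" if "x : W" "y : W"
  using zsubgroup_zcomb[OF assms that, of 1 1] by (simp add: zcomb_def plus_fun_def)
 show "x - y : W" if "x : W" "y : W"
  using zsubgroup_zcomb[OF assms that, of 1 "-1"] by (simp add: zcomb_def fun_diff_def)
 show "- x : W" if "x : W"
  using zsubgroup_zcomb[OF assms that that, of "-1" 0] by (simp add: zcomb_def fun_Compl_def)
qed

lemma zcomb_alt: "zcomb a x b y = zmul a x + zmul b y" by (simp add: zcomb_def zmul_def plus_fun_def)

lemma zsubgroupI:
 assumes "0 : W" "!!x y. x : W ==> y : W ==> x + y : W" "!!x n. x : W ==> zmul n x : W"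
 shows "zsubgroup W" using assms by (simp add: zsubgroup_def zcomb_alt)

lemma zsum_mem:
 assumes W: "zsubgroup W" and "finite J" "!!i. i : J ==> x i : W"
 shows "zsum J a x : W" using assms(2,3)
proof (induction J rule: finite_induct)
 case empty
 thus ?case using zsubgroup_zero[OF W] by (simp add: zsum_def zero_fun_def)
next
 case (insert j J)
 have eq: "zsum (insert j J) a x = zmul (a j) (x j) + zsum J a x"
  using insert.hyps by (simp add: zsum_def zmul_def plus_fun_def)
 show ?case unfolding eq
  by (intro zsubgroup_add[OF W] zsubgroup_mul[OF W] insert.prems insert.IH insertI1) (rule insertI2)
qed

lemma zmul_simps [simp]: "zmul 1 x = x" "zmul 0 x = 0" "zmul n 0 = 0" by (simp_all add: zmul_def zero_fun_def)

lemma zmul_algebra: "zmul n (zmul m x) = zmul (n * m) x" "zmul n (x + y) = zmul n x + zmul n y"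
  "zmul n (x - y) = zmul n x - zmul n y" "zmul (n + m) x = zmul n x + zmul m x"
  "zmul (n - m) x = zmul n x - zmul m x" "zmul (- n) x = - zmul n x" "zmul n (- x) = - zmul n x"
 by (simp_all add: zmul_def plus_fun_def fun_diff_def fun_Compl_def algebra_simps)

lemma zmul_zsum: "zmul n (zsum J a x) = zsum J (%i. n * a i) x"
 by (simp add: zmul_def zsum_def sum_distrib_left mult.assoc)

lemma zsum_insert: "finite J ==> j ~: J ==> zsum (insert j J) a x = zmul (a j) (x j) + zsum J a x"
 by (simp add: zsum_def zmul_def plus_fun_def)

lemma zsum_cong: "(!!i. i : J ==> a i = b i) ==> (!!i. i : J ==> x i = y i) ==> zsum J a x = zsum J b y"
 by (simp add: zsum_def cong: sum.cong)

lemma zsum_diff: "zsum J a x - zsum J b x = zsum J (%i. a i - b i) x"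
 by (simp add: zsum_def fun_diff_def sum_subtractf left_diff_distrib)

lemma zsum_zmul: "zsum J a (%i. zmul (n i) (x i)) = zsum J (%i. a i * n i) x"
 by (simp add: zsum_def zmul_def mult.assoc)

lemma zsum_add: "zsum J a (%i. x i + y i) = zsum J a x + zsum J a y"
 by (simp add: zsum_def plus_fun_def distrib_left sum.distrib)

text \<open>Linear independence over the integers modulo \<open>L\<close>. Families are used rather
  than sets, so that a repeated element counts as a dependence.\<close>

definition zindep :: "('v => real) set => 'i set => ('i => 'v => real) => bool" where
 "zindep L J x \<longleftrightarrow> (ALL a. zsum J a x : L --> (ALL i:J. a i = 0))"

lemma zindepI: "(!!a i. zsum J a x : L ==> i : J ==> a i = 0) ==> zindep L J x" by (simp add: zindep_def)

lemma zindepD: "zindep L J x ==> zsum J a x : L ==> i : J ==> a i = 0" by (simp add: zindep_def)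

text \<open>The rank of \<open>G / (G \<inter> L)\<close>.\<close>

definition zrank :: "('v => real) set => ('v => real) set => nat" where
 "zrank G L = Max (card ` {J :: nat set. finite J & (EX x. (ALL i:J. x i : G) & zindep L J x)})"

text \<open>The image of \<open>G\<close> in the quotient by \<open>L\<close> is
  torsion-free.\<close>

definition zsaturated :: "('v => real) set => ('v => real) set => bool" where
 "zsaturated G L \<longleftrightarrow> (ALL x:G. ALL n. n ~= 0 --> zmul n x : L --> x : L)"

text \<open>Evaluation at the elements of \<open>B\<close> embeds \<open>M\<close> into the integral
  vectors of length \<open>card B\<close>; every bound on ranks comes from this embedding.\<close>

locale functional_lattice =
 fixes M :: "('v => real) set" and B :: "'v set"
 assumes M: "zsubgroup M" and B: "finite B"
  and int_on_B: "m : M ==> b : B ==> m b : \<int>"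
  and det_on_B: "m : M ==> (!!b. b : B ==> m b = 0) ==> m = 0"
begin

lemma zindep_card_le:
 assumes J: "finite J" and x: "!!i. i : J ==> x i : M" and L: "0 : L" and ind: "zindep L J x"
 shows "card J <= card B"
proof (rule ccontr)
 assume "~ ?thesis"
 then obtain a where a: "EX i:J. a i ~= 0" "ALL b:B. (SUM i:J. a i * \<lfloor>x i b\<rfloor>) = 0"
  using exists_linear_relation[OF B J, of "%i b. \<lfloor>x i b\<rfloor>"] by auto
 have "zsum J a x = 0"
 proof (rule det_on_B)
  show "zsum J a x : M" by (rule zsum_mem[OF M J x])
  fix b assume b: "b : B"
  have "zsum J a x b = (SUM i:J. of_int (a i) * of_int \<lfloor>x i b\<rfloor>)"
   unfolding zsum_def using int_on_B[OF x b] by (intro sum.cong refl) (metis floor_of_int Ints_cases)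
  also have "\<dots> = of_int (SUM i:J. a i * \<lfloor>x i b\<rfloor>)" by simp
  finally show "zsum J a x b = 0" using a(2) b by simp
 qed
 thus False using ind L a(1) by (auto simp: zindep_def)
qed

context
 fixes G L :: "('v => real) set"
 assumes G: "G <= M" and L: "0 : L"
begin

lemma finite_zrank_set:
 "finite (card ` {J :: nat set. finite J & (EX x. (ALL i:J. x i : G) & zindep L J x)})"
proof (rule finite_subset)
 show "card ` {J :: nat set. finite J & (EX x. (ALL i:J. x i : G) & zindep L J x)} <= {..card B}"
  using zindep_card_le L G by (auto, meson subsetD)
qed simp

lemma zrank_attained:
 obtains J :: "nat set" and x where "finite J" "!!i. i : J ==> x i : G" "zindep L J x" "card J = zrank G L"
proof -
 have "zrank G L : card ` {J :: nat set. finite J & (EX x. (ALL i:J. x i : G) & zindep L J x)}"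
  unfolding zrank_def
 proof (rule Max_in[OF finite_zrank_set])
  have "({} :: nat set) : {J. finite J & (EX x. (ALL i:J. x i : G) & zindep L J x)}" by (simp add: zindep_def)
  thus "card ` {J :: nat set. finite J & (EX x. (ALL i:J. x i : G) & zindep L J x)} ~= {}" by blast
 qed
 then obtain J :: "nat set" where "zrank G L = card J"
  "J : {J :: nat set. finite J & (EX x. (ALL i:J. x i : G) & zindep L J x)}" by (rule imageE)
 hence J: "finite J" "card J = zrank G L" "EX x. (ALL i:J. x i : G) & zindep L J x" by simp_all
 then obtain x where "ALL i:J. x i : G" "zindep L J x" by blast
 thus thesis using that[of J x] J by blast
qed

lemma zrank_ge:
 fixes J :: "nat set"
 assumes "finite J" "!!i. i : J ==> x i : G" "zindep L J x"
 shows "card J <= zrank G L" unfolding zrank_def by (rule Max_ge[OF finite_zrank_set]) (use assms in blast)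

lemma zrank_le_card: "zrank G L <= card B"
proof -
 obtain J :: "nat set" and x where J: "finite J" "!!i. i : J ==> x i : G" "zindep L J x"
  "card J = zrank G L" using zrank_attained by metis
 have "card J <= card B" by (rule zindep_card_le[OF J(1) _ L J(3)]) (use J(2) G in auto)
 thus ?thesis using J(4) by simp
qed

end

text \<open>A family in \<open>G1\<close> that is independent modulo \<open>L1\<close> stays
  independent modulo \<open>L\<close> after \<open>s\<close> is added: by \<open>ext\<close>, a
  relation has its \<open>G1\<close>-part in \<open>L1\<close>, hence trivial, and then the
  coefficient of \<open>s\<close> is 0. The form of \<open>ext\<close> covers both a growing
  subgroup and a shrinking face.\<close>

lemma zrank_insert:
 assumes G: "G <= M" "G1 <= G" and L: "zsubgroup L" "0 : L1" and G1: "zsubgroup G1" and s: "s : G"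
  and ext: "!!a y. y : G1 ==> zmul a s + y : L ==> y : L1 & (y = 0 --> a = 0)"
 shows "Suc (zrank G1 L1) <= zrank G L"
proof -
 have G1M: "G1 <= M" using G by auto
 obtain J :: "nat set" and x where J: "finite J" "!!i. i : J ==> x i : G1" "zindep L1 J x"
  "card J = zrank G1 L1" using zrank_attained[OF G1M L(2)] by metis
 obtain j where j: "j ~: J" using ex_new_if_finite[OF _ J(1)] infinite_UNIV_nat by blast
 define x' where "x' = x(j := s)"
 have "card (insert j J) <= zrank G L"
 proof (rule zrank_ge[OF G(1) zsubgroup_zero[OF L(1)]])
  show "finite (insert j J)" using J by simp
  show "x' i : G" if "i : insert j J" for i using that J(2) s G(2) by (auto simp: x'_def)
  show "zindep L (insert j J) x'"
  proof (rule zindepI)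
   fix a i assume mem: "zsum (insert j J) a x' : L" and i: "i : insert j J"
   have eq: "zsum (insert j J) a x' = zmul (a j) s + zsum J a x"
   proof -
    have "zsum J a x' = zsum J a x" by (rule zsum_cong) (use j in \<open>auto simp: x'_def\<close>)
    thus ?thesis using zsum_insert[OF J(1) j, of a x'] by (simp add: x'_def)
   qed
   have e: "zsum J a x : L1 & (zsum J a x = 0 --> a j = 0)"
    by (rule ext[OF zsum_mem[OF G1 J(1,2)]]) (use mem eq in simp_all)
   hence z: "a i = 0" if "i : J" for i using zindepD[OF J(3)] that by blast
   hence "zsum J a x = 0" by (simp add: zsum_def zero_fun_def)
   thus "a i = 0" using e z i by auto
  qed
 qed
 thus ?thesis using J(1,4) j by simp
qed

text \<open>Up to multiples, \<open>L'\<close> is contained in the subgroup generated by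
  \<open>L\<close> and \<open>y\<close>. If a family independent modulo \<open>L\<close> has a
  relation modulo \<open>L'\<close> that involves \<open>j\<close>, then the family without
  \<open>j\<close> is independent modulo \<open>L'\<close>.\<close>

lemma zrank_drop:
 assumes G: "G <= M" and L: "zsubgroup L" "0 : L'"
  and gen: "!!z. z : L' ==> EX n k. n ~= 0 & zmul n z - zmul k y : L"
 shows "zrank G L <= Suc (zrank G L')"
proof -
 obtain J :: "nat set" and x where J: "finite J" "!!i. i : J ==> x i : G" "zindep L J x"
  "card J = zrank G L" using zrank_attained[OF G zsubgroup_zero[OF L(1)]] by metis
 show ?thesis
 proof (cases "zindep L' J x")
  case True
  thus ?thesis using zrank_ge[OF G L(2) J(1,2) True] J(4) by simp
 next
  case False
  then obtain a j where a: "zsum J a x : L'" "j : J" "a j ~= 0" by (auto simp: zindep_def)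
  obtain n k where n: "n ~= 0" "zmul n (zsum J a x) - zmul k y : L" using gen[OF a(1)] by auto
  have "card (J - {j}) <= zrank G L'"
  proof (rule zrank_ge[OF G L(2)])
   show "zindep L' (J - {j}) x"
   proof (rule zindepI)
    fix b i assume b: "zsum (J - {j}) b x : L'" and i: "i : J - {j}"
    define b' where "b' = b(j := 0)"
    have b': "zsum J b' x = zsum (J - {j}) b x"
     using zsum_insert[of "J - {j}" j b' x] J(1) a(2) zsum_cong[of "J - {j}" b' b x x]
     by (simp add: b'_def insert_absorb)
    obtain n' k' where n': "n' ~= 0" "zmul n' (zsum J b' x) - zmul k' y : L" using gen[OF b] b' by auto
    \<comment> \<open>Eliminating \<open>y\<close> from two relations modulo \<open>L'\<close> gives
      one modulo \<open>L\<close>. Its coefficient at \<open>j\<close> shows that \<open>k'\<close>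
      is 0.\<close>
    have "zmul k' (zmul n (zsum J a x) - zmul k y) - zmul k (zmul n' (zsum J b' x) - zmul k' y) : L"
     by (intro zsubgroup_diff[OF L(1)] zsubgroup_mul[OF L(1)] n n')
    also have "zmul k' (zmul n (zsum J a x) - zmul k y) - zmul k (zmul n' (zsum J b' x) - zmul k' y) =
     zsum J (%i. k' * (n * a i) - k * (n' * b' i)) x"
     by (simp add: zmul_algebra zmul_zsum zsum_diff mult.assoc mult.commute[of k k'] mult.left_commute)
    finally have z: "k' * (n * a i) - k * (n' * b' i) = 0" if "i : J" for i
     using zindepD[OF J(3)] that by blast
    hence "k' = 0" using z[OF a(2)] a(3) n(1) by (simp add: b'_def)
    hence "zsum J (%i. n' * b' i) x : L" using n'(2) by (simp add: zmul_zsum)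
    hence "n' * b' i = 0" using zindepD[OF J(3)] i by blast
    thus "b i = 0" using n'(1) i by (auto simp: b'_def)
   qed
  qed (use J in auto)
  thus ?thesis using J(1,4) a(2) by simp
 qed
qed

text \<open>Passing to the kernel of \<open>u\<close> costs at most one in rank. If every kernel
  element had a nonzero multiple in \<open>G1 + L\<close>, the \<open>G1\<close>-parts of these
  multiples would be independent modulo \<open>L Int G1\<close>, so the two ranks would differ by at
  most one.\<close>

lemma zrank_kernel_element:
 assumes G: "zsubgroup G" "G <= M" "G1 <= G" and L: "zsubgroup L" "zsubgroup G1" and u: "zlinear_on M u"
  and rk: "zrank G1 (L Int G1) + 2 <= zrank G L"
 shows "EX g:G. u g = 0 & (ALL n y l. n ~= 0 --> y : G1 --> l : L --> zmul n g ~= y + l)"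
proof (rule ccontr)
 assume no: "~ ?thesis"
 have u_comb: "u (zmul a x - zmul b y) = a * u x - b * u y" if "x : M" "y : M" for a b x y
  using zlinear_onD[OF u that, of a "- b"] by (simp add: zcomb_alt zmul_algebra)
 obtain J :: "nat set" and x where J: "finite J" "!!i. i : J ==> x i : G" "zindep L J x"
  "card J = zrank G L" using zrank_attained[OF G(2) zsubgroup_zero[OF L(1)]] by metis
 have "EX J' :: nat set. EX x'. finite J' & (ALL i:J'. x' i : G & u (x' i) = 0) & zindep L J' x' & card J <= Suc (card J')"
 proof (cases "ALL i:J. u (x i) = 0")
  case True
  thus ?thesis using J by (intro exI[of _ J] exI[of _ x] conjI ballI) simp_all
 next
  case False
  then obtain j where j: "j : J" "u (x j) ~= 0" by auto
  \<comment> \<open>Combining each member with the pivot \<open>x j\<close> moves it into the kernel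
    of \<open>u\<close>.\<close>
  define x' where "x' i = zmul (u (x j)) (x i) - zmul (u (x i)) (x j)" for i
  have xM: "x i : M" if "i : J" for i using that J(2) G(2) by auto
  have "zindep L (J - {j}) x'"
  proof (rule zindepI)
   fix a i assume a: "zsum (J - {j}) a x' : L" and i: "i : J - {j}"
   define a' where "a' i = (if i = j then - (SUM i:J - {j}. a i * u (x i)) else a i * u (x j))" for i
   have "zsum J a' x = zmul (a' j) (x j) + zsum (J - {j}) a' x"
    using zsum_insert[of "J - {j}" j a' x] J(1) j(1) by (simp add: insert_absorb)
   also have "zsum (J - {j}) a' x = zsum (J - {j}) (%i. a i * u (x j)) x"
    by (rule zsum_cong) (auto simp: a'_def)
   also have "zmul (a' j) (x j) + \<dots> = zsum (J - {j}) a x'"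
    by (simp add: a'_def x'_def zsum_def zmul_def plus_fun_def fun_diff_def right_diff_distrib
      sum_subtractf sum_distrib_right mult.assoc)
   finally have "a' i = 0" using zindepD[OF J(3)] a i by auto
   thus "a i = 0" using i j(2) by (auto simp: a'_def)
  qed
  moreover have "x' i : G & u (x' i) = 0" if i: "i : J - {j}" for i
  proof
   show "x' i : G" unfolding x'_def
    by (intro zsubgroup_diff[OF G(1)] zsubgroup_mul[OF G(1)] J(2)) (use i j(1) in auto)
   show "u (x' i) = 0" unfolding x'_def using u_comb[OF xM xM, of i j "u (x j)" "u (x i)"] i j(1) by simp
  qed
  moreover have "card J <= Suc (card (J - {j}))" "finite (J - {j})" using J(1) j(1) by simp_all
  ultimately show ?thesis by (intro exI[of _ "J - {j}"] exI[of _ x'] conjI ballI) blast+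
 qed
 then obtain J' :: "nat set" and x' where J': "finite J'" "!!i. i : J' ==> x' i : G & u (x' i) = 0"
  "zindep L J' x'" "card J <= Suc (card J')" by blast
 have "ALL i:J'. EX n y l. n ~= 0 & y : G1 & l : L & zmul n (x' i) = y + l" using no J'(2) by blast
 then obtain n y l where n: "!!i. i : J' ==> n i ~= 0 & y i : G1 & l i : L & zmul (n i) (x' i) = y i + l i"
  by metis
 have "zindep (L Int G1) J' y"
 proof (rule zindepI)
  fix a i assume a: "zsum J' a y : L Int G1" and i: "i : J'"
  have "zsum J' (%i. a i * n i) x' = zsum J' a (%i. y i + l i)"
   unfolding zsum_zmul[symmetric] using n by (intro zsum_cong) auto
  also have "\<dots> = zsum J' a y + zsum J' a l" by (rule zsum_add)
  also have "\<dots> : L"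
  proof (rule zsubgroup_add[OF L(1)])
   show "zsum J' a y : L" using a by simp
   show "zsum J' a l : L" by (rule zsum_mem[OF L(1) J'(1)]) (use n in simp)
  qed
  finally have "a i * n i = 0" using zindepD[OF J'(3)] i by blast
  thus "a i = 0" using n[OF i] by simp
 qed
 hence "card J' <= zrank G1 (L Int G1)"
  using zrank_ge[of G1 "L Int G1" J' y] G zsubgroup_zero[OF L(1)] zsubgroup_zero[OF L(2)] J'(1) n by auto
 thus False using rk J(4) J'(4) by simp
qed

end

section \<open>Faces of the monoid of a cone\<close>

definition diff_group :: "('v => real) set => ('v => real) set" where
 "diff_group S = {s - t | s t. s : S & t : S}"

text \<open>A submonoid whose complement in \<open>S\<close> is a prime ideal;
  \<open>prime_face_ideal\<close> is based on this.\<close>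

definition monoid_face :: "('v => real) set => ('v => real) set => bool" where
 "monoid_face S T \<longleftrightarrow> T <= S & 0 : T & (ALL s:S. ALL t:S. s + t : T \<longleftrightarrow> s : T & t : T)"

lemma monoid_faceD:
 assumes "monoid_face S T"
 shows "T <= S" "0 : T" "s : T ==> t : T ==> s + t : T"
  "s : S ==> t : S ==> s + t : T ==> s : T & t : T" using assms unfolding monoid_face_def by auto

lemma monoid_face_zmul: "monoid_face S T ==> s : T ==> zmul (int n) s : T"
 by (induction n) (simp_all add: monoid_faceD zmul_algebra)

lemma diff_groupI: "s : S ==> t : S ==> s - t : diff_group S" by (auto simp: diff_group_def)

lemma zsubgroup_diff_group:
 assumes T: "monoid_face S T"
 shows "zsubgroup (diff_group T)"
proof (rule zsubgroupI)
 show "0 : diff_group T" using diff_groupI[OF monoid_faceD(2)[OF T] monoid_faceD(2)[OF T]] by simp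
 fix x assume "x : diff_group T"
 then obtain s t where x: "x = s - t" "s : T" "t : T" by (auto simp: diff_group_def)
 show "zmul n x : diff_group T" for n
 proof (cases "0 <= n")
  case True
  have "zmul (int (nat n)) s - zmul (int (nat n)) t : diff_group T"
   by (intro diff_groupI monoid_face_zmul[OF T] x)
  thus ?thesis using True x by (simp add: zmul_algebra)
 next
  case False
  have "zmul (int (nat (- n))) t - zmul (int (nat (- n))) s : diff_group T"
   by (intro diff_groupI monoid_face_zmul[OF T] x)
  thus ?thesis using False x by (simp add: zmul_algebra)
 qed
 fix y assume "y : diff_group T"
 then obtain s' t' where y: "y = s' - t'" "s' : T" "t' : T" by (auto simp: diff_group_def)
 have "(s + s') - (t + t') : diff_group T" by (intro diff_groupI monoid_faceD(3)[OF T] x y)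
 moreover have "x + y = (s + s') - (t + t')" using x(1) y(1) by simp
 ultimately show "x + y : diff_group T" by (simp only:)
qed

lemma diff_group_mono: "T <= S ==> diff_group T <= diff_group S" by (auto simp: diff_group_def)

lemma subset_diff_group: "monoid_face S T ==> T <= diff_group T"
 using diff_groupI[of _ T 0] monoid_faceD(2) by force

locale cone_lattice = functional_lattice M B for M :: "('v => real) set" and B :: "'v set" +
 fixes G :: "'v set" and S :: "('v => real) set"
 assumes G: "finite G" and int_on_G: "m : M ==> v : G ==> m v : \<int>"
  and S_def: "S = {m : M. ALL v:G. 0 <= m v}"
begin

lemma SD: "s : S ==> s : M" "s : S ==> v : G ==> 0 <= s v" by (auto simp: S_def)

lemma S_zero: "0 : S" and S_add: "s : S ==> t : S ==> s + t : S"
 using zsubgroup_zero[OF M] zsubgroup_add[OF M] by (auto simp: S_def)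

lemma monoid_face_self: "monoid_face S S" using S_zero S_add by (auto simp: monoid_face_def)

definition vanishing :: "('v => real) set => 'v set" where
 "vanishing T = {v : G. ALL m:T. m v = 0}"

text \<open>For each generator on which \<open>T\<close> does not vanish, some element of
  \<open>T\<close> is positive there. All elements are nonnegative on \<open>G\<close>, so the sum
  of finitely many of them works.\<close>

lemma face_positive_element:
 assumes T: "monoid_face S T"
 shows "EX h:T. ALL v:G - vanishing T. 0 < h v"
proof -
 have "EX h:T. ALL v:V. 0 < h v" if "finite V" "V <= G - vanishing T" for V using that
 proof (induction V rule: finite_induct)
  case empty
  thus ?case using monoid_faceD(2)[OF T] by auto
 next
  case (insert v V)
  then obtain h where h: "h : T" "ALL v:V. 0 < h v" by auto
  obtain m where m: "m : T" "m v ~= 0" using insert.prems by (auto simp: vanishing_def)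
  have nn: "0 <= h w" "0 <= m w" if "w : G" for w using h m monoid_faceD(1)[OF T] SD(2) that by auto
  have "0 < (h + m) w" if "w : insert v V" for w
  proof -
   have w: "w : G" using that insert.prems by auto
   show ?thesis
   proof (cases "w = v")
    case True
    thus ?thesis using nn[OF w] m(2) by simp
   next
    case False
    thus ?thesis using nn[OF w] h(2) that by (simp add: add_pos_nonneg)
   qed
  qed
  thus ?case using monoid_faceD(3)[OF T h(1) m(1)] by blast
 qed
 thus ?thesis using G by auto
qed

text \<open>Values at the generators are integers, so \<open>h\<close> is at least 1 wherever it is
  not 0. A multiple of \<open>h\<close> by the sum of all rounded absolute values of
  \<open>m\<close> outweighs \<open>m\<close> there.\<close>

lemma scale_dominates:
 assumes m: "m : M" and h: "h : M" "!!v. v : G ==> 0 <= h v" "!!v. v : G ==> h v = 0 ==> 0 <= m v"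
 shows "EX n::nat. m + zmul (int n) h : S"
proof -
 define n where "n = nat (SUM v:G. \<lceil>\<bar>m v\<bar>\<rceil>)"
 have "0 <= m v + of_nat n * h v" if v: "v : G" for v
 proof (cases "h v = 0")
  case False
  obtain i where i: "h v = of_int i" using int_on_G[OF h(1) v] by (auto elim: Ints_cases)
  have "0 < i" using False h(2)[OF v] i by (cases "i = 0") auto
  hence "1 <= h v" using i by simp
  have "\<lceil>\<bar>m v\<bar>\<rceil> <= (SUM v:G. \<lceil>\<bar>m v\<bar>\<rceil>)" using G v by (intro member_le_sum) (auto simp: order_trans[OF _ ceiling_mono[of 0]])
  hence "\<bar>m v\<bar> <= of_nat n" unfolding n_def by linarith
  also have "\<dots> <= of_nat n * h v" using \<open>1 <= h v\<close> by (simp add: mult_le_cancel_left1)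
  finally show ?thesis by simp
 qed (use h(3)[OF v] in simp)
 moreover have "m + zmul (int n) h : M" using m h(1) zsubgroup_add[OF M] zsubgroup_mul[OF M] by simp
 ultimately show ?thesis by (auto simp: S_def zmul_def intro!: exI[of _ n])
qed

text \<open>If \<open>m\<close> vanishes where \<open>T\<close> does, some multiple of a positive
  element \<open>h\<close> minus \<open>m\<close> lies in \<open>S\<close>. Added to
  \<open>m\<close> this gives an element of \<open>T\<close>, and a face contains the summands of
  its elements.\<close>

lemma face_eq_vanishing:
 assumes T: "monoid_face S T"
 shows "T = {m : S. ALL v:vanishing T. m v = 0}"
proof (intro equalityI subsetI)
 show "m : {m : S. ALL v:vanishing T. m v = 0}" if "m : T" for m
  using that monoid_faceD(1)[OF T] by (auto simp: vanishing_def)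
 fix m assume m: "m : {m : S. ALL v:vanishing T. m v = 0}"
 obtain h where h: "h : T" "!!v. v : G - vanishing T ==> 0 < h v" using face_positive_element[OF T] by auto
 have hS: "h : S" using h(1) monoid_faceD(1)[OF T] by auto
 have "EX n::nat. - m + zmul (int n) h : S"
 proof (rule scale_dominates)
  show "- m : M" "h : M" using m SD(1) hS zsubgroup_uminus[OF M] by auto
  show "0 <= h v" if "v : G" for v using SD(2)[OF hS that] .
  show "0 <= (- m) v" if "v : G" "h v = 0" for v using h(2)[of v] that m by fastforce
 qed
 then obtain n :: nat where n: "- m + zmul (int n) h : S" by auto
 have "m + (- m + zmul (int n) h) = zmul (int n) h" by simp
 hence "m + (- m + zmul (int n) h) : T" using monoid_face_zmul[OF T h(1)] by simp
 thus "m : T" using monoid_faceD(4)[OF T _ n] m by auto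
qed

text \<open>Stiemke's alternative: a functional that vanishes exactly on the face \<open>T'\<close> of \<open>T\<close> and on \<open>L\<close>.\<close>

lemma supporting_functional:
 assumes T: "monoid_face S T" "monoid_face S T'" "T' <= T" and L: "zsubgroup L" "L <= diff_group T"
  and pull: "!!s t. s : T ==> t : T ==> s - t : L ==> t : T' ==> s : T'"
 shows "EX u. zlinear_on M u & (ALL x:L. u x = 0) & (ALL x:diff_group T'. u x = 0) &
  (ALL s:T. u s = 0 \<longleftrightarrow> s : T')"
proof -
 let ?I = "vanishing T'"
 define W where "W = {y + l | y l. y : diff_group T' & l : L}"
 have G1: "zsubgroup (diff_group T')" by (rule zsubgroup_diff_group[OF T(2)])
 have WI: "y + l : W" if "y : diff_group T'" "l : L" for y l using that by (auto simp: W_def)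
 have W: "zsubgroup W"
 proof (rule zsubgroupI)
  show "0 : W" using WI[OF zsubgroup_zero[OF G1] zsubgroup_zero[OF L(1)]] by simp
  fix x assume "x : W"
  then obtain y l where x: "x = y + l" "y : diff_group T'" "l : L" by (auto simp: W_def)
  show "zmul n x : W" for n
   using WI[OF zsubgroup_mul[OF G1 x(2)] zsubgroup_mul[OF L(1) x(3)], of n n] x(1) by (simp add: zmul_algebra)
  fix x' assume "x' : W"
  then obtain y' l' where x': "x' = y' + l'" "y' : diff_group T'" "l' : L" by (auto simp: W_def)
  show "x + x' : W"
   using WI[OF zsubgroup_add[OF G1 x(2) x'(2)] zsubgroup_add[OF L(1) x(3) x'(3)]] x x' by (simp add: algebra_simps)
 qed
 have TM: "T <= M" "T' <= M" using monoid_faceD(1)[OF T(1)] monoid_faceD(1)[OF T(2)] SD(1) by auto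
 have GM: "diff_group T <= M" using TM by (auto simp: diff_group_def intro!: zsubgroup_diff[OF M])
 have WG: "W <= diff_group T"
 proof
  fix x assume "x : W"
  then obtain y l where "x = y + l" "y : diff_group T'" "l : L" by (auto simp: W_def)
  thus "x : diff_group T"
   using zsubgroup_add[OF zsubgroup_diff_group[OF T(1)]] diff_group_mono[OF T(3)] L(2) by blast
 qed
 obtain h where h: "h : T'" "!!v. v : G - ?I ==> 0 < h v" using face_positive_element[OF T(2)] by auto
 have hS: "h : S" using h(1) monoid_faceD(1)[OF T(2)] by auto
 \<comment> \<open>This is the hypothesis of Farkas' lemma on \<open>W\<close>. Adding a multiple of
   \<open>h\<close> moves \<open>w\<close> into \<open>T\<close>; modulo \<open>L\<close> it comes
   from \<open>T'\<close>, so \<open>pull\<close> moves it into \<open>T'\<close>, where everything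
   vanishes at \<open>v\<close>.\<close>
 have key: "w v = 0" if w: "w : W" "!!v. v : ?I ==> 0 <= w v" and v: "v : ?I" for w v
 proof -
  obtain y l where yl: "w = y + l" "y : diff_group T'" "l : L" using w(1) by (auto simp: W_def)
  then obtain a b where ab: "y = a - b" "a : T'" "b : T'" by (auto simp: diff_group_def)
  have "EX n::nat. w + zmul (int n) h : S"
  proof (rule scale_dominates)
   show "w : M" "h : M" using w(1) WG GM hS SD(1) by auto
   show "0 <= h v" if "v : G" for v using SD(2)[OF hS that] .
   show "0 <= w v" if "v : G" "h v = 0" for v using h(2)[of v] that w(2) by fastforce
  qed
  then obtain n :: nat where n: "w + zmul (int n) h : S" by auto
  have "(w + zmul (int n) h) v = 0" if v: "v : vanishing T" for v
  proof -
   obtain s t where "w = s - t" "s : T" "t : T" using w(1) WG by (auto simp: diff_group_def)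
   moreover have "h : T" using h(1) T(3) by auto
   ultimately have "s v = 0" "t v = 0" "h v = 0" using v by (auto simp: vanishing_def)
   thus ?thesis using \<open>w = s - t\<close> by (simp add: zmul_def)
  qed
  hence nT: "w + zmul (int n) h : T" using n face_eq_vanishing[OF T(1)] by blast
  have nh: "zmul (int n) h : T'" by (rule monoid_face_zmul[OF T(2) h(1)])
  have "(w + zmul (int n) h + b) - (a + zmul (int n) h) = l" using yl(1) ab(1) by (simp add: algebra_simps)
  moreover have "a + zmul (int n) h : T'" by (rule monoid_faceD(3)[OF T(2) ab(2) nh])
  ultimately have "w + zmul (int n) h + b : T'"
   using pull[of "w + zmul (int n) h + b" "a + zmul (int n) h"] monoid_faceD(3)[OF T(1) nT] ab T(3) yl(3) by auto
  hence "w + zmul (int n) h : T'" using monoid_faceD(4)[OF T(2) n] ab(3) monoid_faceD(1)[OF T(2)] by blast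
  hence "(w + zmul (int n) h) v = 0" "h v = 0" using v h(1) unfolding vanishing_def by blast+
  thus "w v = 0" by (simp add: zmul_def)
 qed
 have fin: "finite ?I" using G by (auto simp: vanishing_def)
 have fl: "of_int \<lfloor>x v\<rfloor> = x v" if "x : M" "v : G" for x v using int_on_G[OF that] by (auto elim: Ints_cases)
 have lin: "zlinear_on M (%x. \<lfloor>x v\<rfloor>)" if v: "v : G" for v unfolding zlinear_on_def
 proof (intro ballI allI)
  fix x y a b assume xy: "x : M" "y : M"
  have "of_int \<lfloor>zcomb a x b y v\<rfloor> = (of_int (a * \<lfloor>x v\<rfloor> + b * \<lfloor>y v\<rfloor>) :: real)"
   unfolding of_int_add of_int_mult fl[OF zsubgroup_zcomb[OF M xy] v] fl[OF xy(1) v] fl[OF xy(2) v]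
   by (simp add: zcomb_def)
  thus "\<lfloor>zcomb a x b y v\<rfloor> = a * \<lfloor>x v\<rfloor> + b * \<lfloor>y v\<rfloor>" by (simp only: of_int_eq_iff)
 qed
 have IG: "v : G" if "v : ?I" for v using that by (auto simp: vanishing_def)
 have WM: "W <= M" using WG GM by auto
 have linW: "zlinear_on W (%x. \<lfloor>x v\<rfloor>)" if "v : G" for v using lin[OF that] WM unfolding zlinear_on_def by blast
 \<comment> \<open>By \<open>key\<close> the functional with the opposite sign of evaluation at
   \<open>k\<close> is also nonnegative, hence on \<open>W\<close> it is a nonnegative combination
   of evaluations up to a positive factor.\<close>
 have "EX n>0. EX c. (ALL v:?I. 0 <= c v) & (ALL x:W. n * (- \<lfloor>x k\<rfloor>) = (SUM v:?I. c v * \<lfloor>x v\<rfloor>))" if k: "k : ?I" for k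
 proof (rule int_farkas[OF fin W])
  show "zlinear_on W (%x. - \<lfloor>x k\<rfloor>)" using linW[OF IG[OF k]] unfolding zlinear_on_def by simp
  show "zlinear_on W (%x. \<lfloor>x v\<rfloor>)" if "v : ?I" for v by (rule linW[OF IG[OF that]])
  fix x assume x: "x : W" "!!v. v : ?I ==> 0 <= \<lfloor>x v\<rfloor>"
  hence "x k = 0" by (intro key[OF x(1) _ k]) simp
  thus "0 <= - \<lfloor>x k\<rfloor>" by simp
 qed
 hence "ALL k:?I. EX p. 0 < fst p & (ALL v:?I. 0 <= snd p v) &
  (ALL x:W. fst p * (- \<lfloor>x k\<rfloor>) = (SUM v:?I. snd p v * \<lfloor>x v\<rfloor>))"
  unfolding split_paired_Ex fst_conv snd_conv by blast
 from bchoice[OF this] obtain p where p: "ALL k:?I. 0 < fst (p k) & (ALL v:?I. 0 <= snd (p k) v) &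
  (ALL x:W. fst (p k) * (- \<lfloor>x k\<rfloor>) = (SUM v:?I. snd (p k) v * \<lfloor>x v\<rfloor>))" ..
 define n c where "n k = fst (p k)" and "c k = snd (p k)" for k
 have n: "!!k. k : ?I ==> 0 < n k" "!!k v. k : ?I ==> v : ?I ==> 0 <= c k v"
  "!!k x. k : ?I ==> x : W ==> n k * (- \<lfloor>x k\<rfloor>) = (SUM v:?I. c k v * \<lfloor>x v\<rfloor>)"
  using p by (simp_all add: n_def c_def)
 \<comment> \<open>Each summand is zero on \<open>W\<close> by the Farkas relation and nonnegative
   on \<open>S\<close>. As every \<open>n k\<close> is positive, \<open>u\<close> vanishes at an
   element of \<open>S\<close> only if the element vanishes at all generators in
   \<open>vanishing T'\<close>.\<close>
 define u where "u x = (SUM k:?I. n k * \<lfloor>x k\<rfloor> + (SUM v:?I. c k v * \<lfloor>x v\<rfloor>))" for x :: "'v => real"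
 have uW: "u x = 0" if "x : W" for x  unfolding u_def
 proof (rule sum.neutral, rule ballI)
  show "n k * \<lfloor>x k\<rfloor> + (SUM v:?I. c k v * \<lfloor>x v\<rfloor>) = 0" if "k : ?I" for k
   using n(3)[OF that \<open>x : W\<close>] by simp
 qed
 have "zlinear_on M u" unfolding zlinear_on_def
 proof (intro ballI allI)
  fix x y a b assume xy: "x : M" "y : M"
  have l: "\<lfloor>zcomb a x b y v\<rfloor> = a * \<lfloor>x v\<rfloor> + b * \<lfloor>y v\<rfloor>" if "v : ?I" for v
   using zlinear_onD[OF lin[OF IG[OF that]] xy] .
  have "u (zcomb a x b y) = (SUM k:?I. n k * (a * \<lfloor>x k\<rfloor> + b * \<lfloor>y k\<rfloor>) + (SUM v:?I. c k v * (a * \<lfloor>x v\<rfloor> + b * \<lfloor>y v\<rfloor>)))"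
   unfolding u_def using l by (intro sum.cong refl arg_cong2[of _ _ _ _ "(+)"]) (auto intro!: sum.cong)
  also have "\<dots> = a * u x + b * u y" by (simp add: u_def algebra_simps sum.distrib sum_distrib_left)
  finally show "u (zcomb a x b y) = a * u x + b * u y" .
 qed
 moreover have "u x = 0" if "x : L" for x using uW WI[OF zsubgroup_zero[OF G1] that] by simp
 moreover have "u x = 0" if "x : diff_group T'" for x using uW WI[OF that zsubgroup_zero[OF L(1)]] by simp
 moreover have "u s = 0 \<longleftrightarrow> s : T'" if s: "s : T" for s
 proof
  assume "s : T'"
  thus "u s = 0" using calculation(3) subset_diff_group[OF T(2)] by auto
 next
  assume u0: "u s = 0"
  have sS: "s : S" using s monoid_faceD(1)[OF T(1)] by auto
  have nn: "0 <= \<lfloor>s v\<rfloor>" if "v : ?I" for v using SD(2)[OF sS IG[OF that]] by simp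
  have nn': "0 <= n k * \<lfloor>s k\<rfloor>" "0 <= (SUM v:?I. c k v * \<lfloor>s v\<rfloor>)" if "k : ?I" for k
   using n(1)[OF that] nn n(2)[OF that] that by (auto intro!: sum_nonneg mult_nonneg_nonneg)
  have "s k = 0" if k: "k : ?I" for k
  proof -
   have "ALL k:?I. n k * \<lfloor>s k\<rfloor> + (SUM v:?I. c k v * \<lfloor>s v\<rfloor>) = 0"
    using u0 sum_nonneg_eq_0_iff[OF fin, of "%k. n k * \<lfloor>s k\<rfloor> + (SUM v:?I. c k v * \<lfloor>s v\<rfloor>)"] nn'
    by (simp add: u_def)
   hence "n k * \<lfloor>s k\<rfloor> + (SUM v:?I. c k v * \<lfloor>s v\<rfloor>) = 0" using k by blast
   hence "n k * \<lfloor>s k\<rfloor> = 0" using nn'[OF k] by linarith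
   hence "\<lfloor>s k\<rfloor> = 0" using n(1)[OF k] by simp
   thus ?thesis using fl[OF SD(1)[OF sS] IG[OF k]] by simp
  qed
  thus "s : T'" using face_eq_vanishing[OF T(2)] sS by blast
 qed
 ultimately show ?thesis by blast
qed

end

section \<open>Pointed groups and monoid algebras\<close>

lemma (in field) roots_of_unity_bound:
 assumes n: "0 < n"
 shows "finite {x : carrier R. x [^] (n::nat) = \<one>} & card {x : carrier R. x [^] n = \<one>} <= n"
proof -
 define p where "p = poly_add (monom \<one> n) [\<ominus> \<one>]"
 have car: "monom \<one> n : carrier (poly_ring R)" "[\<ominus> \<one>] : carrier (poly_ring R)"
  using monom_is_polynomial[OF carrier_is_subring, of \<one> n]
  by (simp_all add: univ_poly_carrier[symmetric] polynomial_def)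
 have len: "length (monom \<one> n) = Suc n" by (simp add: monom_def)
 have p: "p : carrier (poly_ring R)"
  using poly_add_closed[OF carrier_is_subring] car unfolding p_def univ_poly_carrier[symmetric] by blast
 have "degree p <= max (degree (monom \<one> n)) (degree [\<ominus> \<one>])" unfolding p_def by (rule poly_add_degree)
 hence deg: "degree p <= n" using len by simp
 have ev: "eval p x = \<zero> \<longleftrightarrow> x [^] n = \<one>" if x: "x : carrier R" for x
 proof -
  have "eval p x = eval (monom \<one> n) x \<oplus> eval [\<ominus> \<one>] x"
   unfolding p_def using car x by (intro eval_poly_add polynomial_incl) (auto simp: univ_poly_carrier)
  also have "\<dots> = x [^] n \<ominus> \<one>" using x by (simp add: eval_monom minus_eq)
  finally show ?thesis using x by simp
 qed
 have "eval p \<zero> ~= \<zero>" using ev[OF zero_closed] n by (simp add: nat_pow_zero)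
 hence "p ~= []" by auto
 have "{x : carrier R. x [^] n = \<one>} = set_mset (roots p)"
  using roots_mem_iff_is_root[OF p] ev \<open>p ~= []\<close> by (auto simp: is_root_def)
 moreover have "card (set_mset (roots p)) <= size (roots p)"
  by (metis size_mset_set mset_set_set_mset_msubset size_mset_mono finite_set_mset)
 ultimately show ?thesis using size_roots_le_degree[OF p] deg by simp
qed

locale acl_pgroup =
 fixes F :: "'k pmonoid"
 assumes acl: "alg_closed_pgroup F"
begin

sublocale F: pointed_monoid F using acl by (simp add: alg_closed_pgroup_def pointed_group_def)

lemma Units_eq: "Units F = carrier F - {pzero F}"
 using acl by (simp add: alg_closed_pgroup_def pointed_group_def)

lemma Units_nonzero: "l : Units F ==> l ~= pzero F" and Units_carrier: "l : Units F ==> l : carrier F"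
 by (auto simp: Units_eq)

lemma card_roots:
 assumes "\<alpha> : Units F" "0 < n"
 shows "card {x : carrier F. x ^[F] (n::nat) = \<alpha>} = n"
 using acl assms by (simp add: alg_closed_pgroup_def)

lemma zero_pow: "0 < n ==> pzero F ^[F] (n::nat) = pzero F"
 by (cases n) (simp_all add: F.pzero_closed F.m_comm[of _ "pzero F"] F.pzero_absorb)

lemma root_Units:
 assumes "\<alpha> : Units F" "0 < n" "x : carrier F" "x ^[F] (n::nat) = \<alpha>"
 shows "x : Units F" using assms zero_pow Units_eq by auto

lemma exists_root:
 assumes "\<alpha> : Units F" "0 < n"
 shows "EX x:Units F. x ^[F] (n::nat) = \<alpha>"
proof -
 have "{x : carrier F. x ^[F] n = \<alpha>} ~= {}" using card_roots[OF assms] assms(2) by (metis card.empty less_irrefl)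
 thus ?thesis using root_Units[OF assms] by auto
qed

lemma Units_inv_cancel:
 assumes "a : Units F" "b : carrier F"
 shows "a *[F] (inv[F] a *[F] b) = b" "inv[F] a *[F] (a *[F] b) = b"
 using assms by (simp_all add: F.m_assoc[symmetric] Units_carrier)

lemma inv_mult_Units:
 assumes "a : Units F" "b : Units F"
 shows "inv[F] (a *[F] b) = inv[F] a *[F] inv[F] b"
proof (rule F.inv_unique'[symmetric])
 have "a *[F] b *[F] (inv[F] a *[F] inv[F] b) = (a *[F] inv[F] a) *[F] (b *[F] inv[F] b)"
  using assms by (simp only: F.m_ac Units_carrier F.Units_inv_closed F.m_closed)
 thus one: "a *[F] b *[F] (inv[F] a *[F] inv[F] b) = 1[F]" using assms by simp
 thus "inv[F] a *[F] inv[F] b *[F] (a *[F] b) = 1[F]"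
  using assms F.m_comm[of "inv[F] a *[F] inv[F] b" "a *[F] b"] by (simp add: Units_carrier)
qed (use assms in \<open>simp_all add: Units_carrier\<close>)

lemma units_pow: "x : Units F ==> x ^[units_of F] (n::nat) = x ^[F] n" by (rule F.units_of_pow)

lemma units_comm_group: "comm_group (units_of F)" by (rule F.units_comm_group)

lemma units_divisible:
 assumes "y : carrier (units_of F)" "0 < n"
 shows "EX z:carrier (units_of F). z ^[units_of F] (n::nat) = y"
 using exists_root[of y n] assms units_pow by (auto simp: units_of_carrier)

lemma monoid_alg_carrier: "carrier (monoid_alg F S) = insert None (Some ` (Units F \<times> S))"
 by (simp add: monoid_alg_def Units_eq)

lemma monoid_alg_Some [simp]: "Some (l, s) : carrier (monoid_alg F S) \<longleftrightarrow> l : Units F & s : S"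
 and monoid_alg_None [simp]: "None : carrier (monoid_alg F S)" by (auto simp: monoid_alg_carrier)

lemma monoid_alg_cases:
 assumes "x : carrier (monoid_alg F S)"
 obtains "x = None" | l s where "x = Some (l, s)" "l : Units F" "s : S"
 using assms by (auto simp: monoid_alg_carrier)

lemma monoid_alg_ops [simp]:
 "l : Units F ==> m : Units F ==> Some (l, s) *[monoid_alg F S] Some (m, t) = Some (l *[F] m, s + t)"
 "None *[monoid_alg F S] y = None" "x *[monoid_alg F S] None = None"
 "1[monoid_alg F S] = Some (1[F], 0)" "pzero (monoid_alg F S) = None"
 using Units_nonzero[of "l *[F] m"] Units_nonzero[of "1[F]"]
 by (auto simp: monoid_alg_def split: option.splits)

lemma monoid_alg_pointed_monoid:
 assumes S: "0 : S" "!!s t. s : S ==> t : S ==> s + t : S"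
 shows "pointed_monoid (monoid_alg F S)"
proof
 fix x y z
 assume x: "x : carrier (monoid_alg F S)"
 show "1[monoid_alg F S] *[monoid_alg F S] x = x" "x *[monoid_alg F S] 1[monoid_alg F S] = x"
  using x by (cases rule: monoid_alg_cases; simp add: Units_carrier)+
 show "pzero (monoid_alg F S) *[monoid_alg F S] x = pzero (monoid_alg F S)" by simp
 assume y: "y : carrier (monoid_alg F S)"
 show "x *[monoid_alg F S] y : carrier (monoid_alg F S)" using x y S by (auto elim!: monoid_alg_cases)
 show "x *[monoid_alg F S] y = y *[monoid_alg F S] x"
  using x y by (auto elim!: monoid_alg_cases simp: F.m_comm Units_carrier add.commute)
 assume z: "z : carrier (monoid_alg F S)"
 show "x *[monoid_alg F S] y *[monoid_alg F S] z = x *[monoid_alg F S] (y *[monoid_alg F S] z)"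
  using x y z by (auto elim!: monoid_alg_cases simp: F.m_assoc Units_carrier add.assoc)
qed (use S in simp_all)

lemma const_closed: "0 : S ==> l : carrier F ==> monoid_alg_const F l : carrier (monoid_alg F S)"
 by (auto simp: monoid_alg_const_def Units_eq)

lemma kalgebra_monoid_alg:
 assumes S: "0 : S" "!!s t. s : S ==> t : S ==> s + t : S"
 shows "kalgebra F (monoid_alg_const F) (monoid_alg F S)"
 using monoid_alg_pointed_monoid[OF S] const_closed[OF S(1)] by (simp add: kalgebra_def kalgebra_axioms_def)

end

lemma zsubgroupI':
 assumes "0 : W" "!!x y. x : W ==> y : W ==> x + y : W" "!!x. x : W ==> - x : W"
 shows "zsubgroup W"
proof (rule zsubgroupI[OF assms(1,2)])
 fix x n assume x: "x : W"
 have nat: "zmul (int k) x : W" for k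
 proof (induction k)
  case (Suc k)
  have "zmul (int (Suc k)) x = zmul (int k) x + x" by (simp add: zmul_algebra)
  thus ?case using assms(2)[OF Suc x] by (simp only:)
 next
  case 0
  show ?case using assms(1) by (simp only: of_nat_0 zmul_simps)
 qed
 show "zmul n x : W"
 proof (cases "0 <= n")
  case True
  thus ?thesis using nat[of "nat n"] by simp
 next
  case False
  thus ?thesis using assms(3)[OF nat[of "nat (- n)"]] by (simp add: zmul_algebra)
 qed
qed

section \<open>The points of the congruence space of a monoid algebra\<close>

locale toric_algebra = cone_lattice M B G S + acl_pgroup F
 for M :: "('v => real) set" and B :: "'v set" and G S and F :: "'k pmonoid"
begin

abbreviation "A \<equiv> monoid_alg F S"
abbreviation "Pts \<equiv> SCong F (monoid_alg_const F) A"

sublocale A: kalgebra F "monoid_alg_const F" A by (rule kalgebra_monoid_alg[OF S_zero S_add])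

definition supp :: "('v => real) set => ('k \<times> ('v => real)) option => bool" where
 "supp T x \<longleftrightarrow> (EX l s. x = Some (l, s) & s : T)"

lemma supp_simps [simp]: "supp T (Some (l, s)) \<longleftrightarrow> s : T" "~ supp T None"
 by (simp_all add: supp_def)

text \<open>Exponents outside \<open>T\<close> become zero, and for \<open>g\<close> in
  \<open>L\<close> the character of \<open>g\<close> becomes the constant
  \<open>\<phi> g\<close>.\<close>

definition tcong :: "('v => real) set => ('v => real) set => (('v => real) => 'k)
  => (('k \<times> ('v => real)) option \<times> ('k \<times> ('v => real)) option) set" where
 "tcong T L \<phi> = {(x, y). x : carrier A & y : carrier A & (~ supp T x & ~ supp T y \<or>
  (EX l s m t. x = Some (l, s) & y = Some (m, t) & s : T & t : T & s - t : L & m = l *[F] \<phi> (s - t)))}"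

text \<open>The homomorphism is stored as a total function \<phi>; it is constrained on
  \<open>L\<close>, where \<open>tcong\<close> evaluates it.\<close>

definition tdata :: "('v => real) set => ('v => real) set => (('v => real) => 'k) => bool" where
 "tdata T L \<phi> \<longleftrightarrow> monoid_face S T & zsubgroup L & L <= diff_group T &
  zsaturated (diff_group T) L & (ALL x:L. \<phi> x : Units F) &
  (ALL x:L. ALL y:L. \<phi> (x + y) = \<phi> x *[F] \<phi> y)"

lemma tdataD:
 assumes "tdata T L \<phi>"
 shows "monoid_face S T" "zsubgroup L" "L <= diff_group T" "zsaturated (diff_group T) L"
  "x : L ==> \<phi> x : Units F" "x : L ==> y : L ==> \<phi> (x + y) = \<phi> x *[F] \<phi> y"
 using assms unfolding tdata_def by auto

lemma tdata_zero:
 assumes "tdata T L \<phi>"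
 shows "\<phi> 0 = 1[F]"
proof -
 have z: "0 : L" using zsubgroup_zero[OF tdataD(2)[OF assms]] .
 hence "\<phi> 0 = \<phi> 0 *[F] \<phi> 0" using tdataD(6)[OF assms z z] by simp
 hence "\<phi> 0 *[F] 1[F] = \<phi> 0 *[F] \<phi> 0" using tdataD(5)[OF assms z] by (simp add: Units_carrier)
 thus ?thesis
  using F.Units_l_cancel[OF tdataD(5)[OF assms z] F.one_closed Units_carrier[OF tdataD(5)[OF assms z]]] by simp
qed

lemma tdata_uminus:
 assumes d: "tdata T L \<phi>" and x: "x : L"
 shows "\<phi> (- x) = inv[F] (\<phi> x)"
proof -
 have mx: "- x : L" using zsubgroup_uminus[OF tdataD(2)[OF d] x] .
 have "\<phi> (- x) *[F] \<phi> x = 1[F]" using tdataD(6)[OF d mx x] tdata_zero[OF d] by simp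
 thus ?thesis using tdataD(5)[OF d x] tdataD(5)[OF d mx] by (metis F.Units_closed F.inv_char F.m_comm)
qed

lemma tcong_Some:
 assumes "l : Units F" "m : Units F" "s : S" "t : S"
 shows "(Some (l, s), Some (m, t)) : tcong T L \<phi> \<longleftrightarrow>
  s ~: T & t ~: T \<or> s : T & t : T & s - t : L & m = l *[F] \<phi> (s - t)"
 using assms by (auto simp: tcong_def)

lemma tcong_None:
 assumes "l : Units F" "s : S"
 shows "(Some (l, s), None) : tcong T L \<phi> \<longleftrightarrow> s ~: T" "(None, Some (l, s)) : tcong T L \<phi> \<longleftrightarrow> s ~: T"
  "(None, None) : tcong T L \<phi>" using assms by (simp_all add: tcong_def)

text \<open>The units of the monoid algebra over \<open>F\<close> of the group spanned by
  \<open>T\<close>.\<close>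

definition tgroup :: "('v => real) set => ('k \<times> ('v => real)) monoid" where
 "tgroup T = \<lparr>carrier = Units F \<times> diff_group T,
   mult = (%(a, g) (b, h). (a *[F] b, g + h)), one = (1[F], 0)\<rparr>"

lemma tgroup_simps [simp]:
 "carrier (tgroup T) = Units F \<times> diff_group T" "1[tgroup T] = (1[F], 0)"
 "(a, g) *[tgroup T] (b, h) = (a *[F] b, g + h)" by (simp_all add: tgroup_def)

lemma comm_group_tgroup:
 assumes T: "monoid_face S T"
 shows "comm_group (tgroup T)"
proof (rule comm_groupI)
 note W = zsubgroup_diff_group[OF T]
 fix x assume x: "x : carrier (tgroup T)"
 thus "EX y:carrier (tgroup T). y *[tgroup T] x = 1[tgroup T]"
  by (intro bexI[of _ "(inv[F] fst x, - snd x)"]) (auto simp: zsubgroup_uminus[OF W])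
qed (use zsubgroup_zero[OF zsubgroup_diff_group[OF T]] zsubgroup_add[OF zsubgroup_diff_group[OF T]]
  in \<open>auto simp: F.m_ac Units_carrier algebra_simps\<close>)

lemma tgroup_pow: "(a, g) ^[tgroup T] (n::nat) = (a ^[F] n, zmul (int n) g)"
proof (induction n)
 case (Suc n)
 have "zmul (int (Suc n)) g = zmul (int n) g + g" by (simp add: zmul_algebra)
 thus ?case using Suc by (simp only: nat_pow_Suc tgroup_simps)
next
 case 0
 show ?case by (simp only: of_nat_0 zmul_simps nat_pow_0 tgroup_simps)
qed

lemma zmul_difference_mem:
 "zsaturated Q L ==> x : Q ==> n ~= 0 ==> zmul n x : L ==> x : L" by (auto simp: zsaturated_def)

text \<open>In the quotient of \<open>tgroup T\<close> by the relations, an element killed by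
  \<open>n\<close> has its exponent in \<open>L\<close> by saturation. It is then the class of a
  constant, and this constant is an \<open>n\<close>-th root of unity of \<open>F\<close>. So there
  are at most \<open>n\<close> such elements and \<open>field_hom_of_group\<close> applies.\<close>

lemma tcong_point:
 assumes d: "tdata T L \<phi>"
 shows "tcong T L \<phi> : Pts"
proof -
 note T = tdataD(1)[OF d] and L = tdataD(2)[OF d] and LG = tdataD(3)[OF d]
 interpret E: comm_group "tgroup T" by (rule comm_group_tgroup[OF T])
 \<comment> \<open>The elements that have to become 1: the character of \<open>g\<close> divided by
   the constant \<open>\<phi> g\<close>.\<close>
 define H where "H = {(inv[F] (\<phi> g), g) | g. g : L}"
 have H_iff: "(a, g) : H \<longleftrightarrow> g : L & a = inv[F] (\<phi> g)" for a g by (auto simp: H_def)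
 have inv_E: "inv[tgroup T] (a, g) = (inv[F] a, - g)" if "a : Units F" "g : diff_group T" for a g
  by (rule E.inv_equality) (use that zsubgroup_uminus[OF zsubgroup_diff_group[OF T]] in auto)
 have H: "subgroup H (tgroup T)"
 proof (rule E.subgroupI)
  show "H <= carrier (tgroup T)" using tdataD(5)[OF d] LG by (auto simp: H_def)
  show "H ~= {}" using zsubgroup_zero[OF L] by (auto simp: H_def)
  fix a assume "a : H"
  then obtain g where g: "a = (inv[F] (\<phi> g), g)" "g : L" by (auto simp: H_def)
  show "inv[tgroup T] a : H"
   using g tdataD(5)[OF d g(2)] LG zsubgroup_uminus[OF L g(2)] tdata_uminus[OF d g(2)]
   by (simp add: inv_E H_iff subsetD)
  fix b assume "b : H"
  then obtain h where h: "b = (inv[F] (\<phi> h), h)" "h : L" by (auto simp: H_def)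
  have "inv[F] (\<phi> g *[F] \<phi> h) = inv[F] (\<phi> g) *[F] inv[F] (\<phi> h)"
   using tdataD(5)[OF d g(2)] tdataD(5)[OF d h(2)] by (rule inv_mult_Units)
  thus "a *[tgroup T] b : H"
   using g h tdataD(6)[OF d g(2) h(2)] zsubgroup_add[OF L g(2) h(2)] by (simp add: H_iff)
 qed
 interpret D: comm_group "tgroup T Mod H" by (rule E.abelian_FactGroup[OF H])
 interpret N: normal H "tgroup T" by (rule E.subgroup_imp_normal[OF H])
 let ?q = "%x. H #>\<^bsub>tgroup T\<^esub> x"
 have q_eq: "?q (a, g) = ?q (b, h) \<longleftrightarrow> g - h : L & b = a *[F] \<phi> (g - h)"
  if ab: "a : Units F" "b : Units F" "g : diff_group T" "h : diff_group T" for a b g h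
 proof -
  have c: "(a, g) : carrier (tgroup T)" "(b, h) : carrier (tgroup T)" using ab by auto
  have "?q (a, g) = ?q (b, h) \<longleftrightarrow> (a, g) *[tgroup T] inv[tgroup T] (b, h) : H"
   using E.repr_independence[OF _ c(2) H] E.repr_independenceD[OF H c(1)] subgroup.rcos_module[OF H E.group_axioms c(2,1)]
   by metis
  also have "\<dots> \<longleftrightarrow> g - h : L & a *[F] inv[F] b = inv[F] (\<phi> (g - h))"
   using ab by (simp add: inv_E H_iff)
  also have "\<dots> \<longleftrightarrow> g - h : L & b = a *[F] \<phi> (g - h)"
  proof (rule conj_cong[OF refl])
   assume "g - h : L"
   hence p: "\<phi> (g - h) : Units F" by (rule tdataD(5)[OF d])
   show "a *[F] inv[F] b = inv[F] (\<phi> (g - h)) \<longleftrightarrow> b = a *[F] \<phi> (g - h)"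
   proof
    assume eq: "a *[F] inv[F] b = inv[F] (\<phi> (g - h))"
    have "a = (a *[F] inv[F] b) *[F] b" using ab p by (simp add: Units_carrier F.m_assoc)
    hence "a = inv[F] (\<phi> (g - h)) *[F] b" by (simp only: eq)
    hence "a *[F] \<phi> (g - h) = \<phi> (g - h) *[F] (inv[F] (\<phi> (g - h)) *[F] b)"
     using ab p by (simp add: F.m_comm Units_carrier)
    thus "b = a *[F] \<phi> (g - h)" using ab p by (simp add: Units_inv_cancel Units_carrier)
   next
    assume "b = a *[F] \<phi> (g - h)"
    hence "inv[F] b = inv[F] a *[F] inv[F] (\<phi> (g - h))" using ab p by (simp add: inv_mult_Units)
    thus "a *[F] inv[F] b = inv[F] (\<phi> (g - h))" using ab p by (simp add: Units_inv_cancel)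
   qed
  qed
  finally show ?thesis .
 qed
 have q_hom: "?q x *[tgroup T Mod H] ?q y = ?q (x *[tgroup T] y)"
  if "x : carrier (tgroup T)" "y : carrier (tgroup T)" for x y
  using N.rcos_sum[OF that] by (simp add: FactGroup_def)
 have q_one: "1[tgroup T Mod H] = ?q 1[tgroup T]"
  using E.coset_mult_one[OF subgroup.subset[OF H]] by (simp add: FactGroup_def del: tgroup_simps)
 have q_unit: "?q (1[F], 0) = H" using E.coset_mult_one[OF subgroup.subset[OF H]] by simp
 have q_pow: "?q x ^[tgroup T Mod H] (n::nat) = ?q (x ^[tgroup T] n)" if x: "x : carrier (tgroup T)" for x n
 proof (induction n)
  case (Suc n)
  thus ?case using q_hom[OF E.nat_pow_closed[OF x, of n] x] by simp
 qed (simp add: q_unit)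
 have q_car: "?q x : carrier (tgroup T Mod H)" if "x : carrier (tgroup T)" for x
  using that by (auto simp: FactGroup_def RCOSETS_def)
 have zG: "0 : diff_group T" using zsubgroup_zero[OF zsubgroup_diff_group[OF T]] .
 have tors: "finite {Y : carrier (tgroup T Mod H). Y ^[tgroup T Mod H] n = 1[tgroup T Mod H]} &
   card {Y : carrier (tgroup T Mod H). Y ^[tgroup T Mod H] n = 1[tgroup T Mod H]} <= n"
  if n: "0 < n" for n :: nat
 proof -
  let ?R = "{x : carrier F. x ^[F] n = 1[F]}"
  have cR: "card ?R = n" using card_roots[OF _ n] by simp
  have "{Y : carrier (tgroup T Mod H). Y ^[tgroup T Mod H] n = 1[tgroup T Mod H]} <= (%b. ?q (b, 0)) ` ?R"
  proof
   fix Y assume "Y : {Y : carrier (tgroup T Mod H). Y ^[tgroup T Mod H] n = 1[tgroup T Mod H]}"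
   then obtain a g where ag: "a : Units F" "g : diff_group T" "Y = ?q (a, g)"
    and Y: "Y ^[tgroup T Mod H] n = 1[tgroup T Mod H]" by (auto simp: FactGroup_def RCOSETS_def)
   have "?q (a ^[F] n, zmul (int n) g) = ?q (1[F], 0)"
    using Y q_pow[of "(a, g)" n] ag q_one by (simp add: tgroup_pow)
   hence z: "zmul (int n) g : L" and one: "1[F] = a ^[F] n *[F] \<phi> (zmul (int n) g)"
    using q_eq[of "a ^[F] n" "1[F]" "zmul (int n) g" 0] ag zG
     zsubgroup_mul[OF zsubgroup_diff_group[OF T]] F.Units_pow_closed by auto
   \<comment> \<open>This is the place where saturation of \<open>L\<close> is needed.\<close>
   have gL: "g : L" using zmul_difference_mem[OF tdataD(4)[OF d] ag(2) _ z] n by simp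
   have p: "\<phi> g : Units F" by (rule tdataD(5)[OF d gL])
   have pn: "\<phi> (zmul (int k) g) = \<phi> g ^[F] k" for k :: nat
   proof (induction k)
    case (Suc k)
    have "zmul (int (Suc k)) g = zmul (int k) g + g" by (simp add: zmul_algebra)
    thus ?case using Suc tdataD(6)[OF d zsubgroup_mul[OF L gL] gL] by (simp only: nat_pow_Suc)
   next
    case 0
    show ?case by (simp only: of_nat_0 zmul_simps tdata_zero[OF d] nat_pow_0)
   qed
   have "(a *[F] \<phi> g) ^[F] n = 1[F]" using one ag p by (simp add: pn F.nat_pow_distrib Units_carrier)
   moreover have "Y = ?q (a *[F] \<phi> g, 0)" using q_eq[of a "a *[F] \<phi> g" g 0] ag p gL zG by simp
   ultimately show "Y : (%b. ?q (b, 0)) ` ?R" using ag p by (auto simp: Units_carrier)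
  qed
  moreover have "finite ?R" using cR n by (metis card.infinite less_irrefl)
  ultimately show ?thesis
   using cR by (metis (no_types, lifting) card_image_le card_mono finite_imageI finite_subset le_trans)
 qed
 define Z where "Z = {x. ~ supp T x}"
 define v where "v x = ?q (the x)" for x
 have TG: "T <= diff_group T" by (rule subset_diff_group[OF T])
 have mem: "EX l s. x = Some (l, s) & l : Units F & s : T" if "x : carrier A - Z" for x
  using that by (auto simp: Z_def elim!: monoid_alg_cases)
 obtain K :: "((('k \<times> ('v => real)) set => complex) => complex) set ring" and g where
  K: "field K" "g : pmon_hom A (ring_pmonoid K)"
  and ker: "ALL x:carrier A. ALL y:carrier A. g x = g y \<longleftrightarrow> (x : Z & y : Z) \<or> (x ~: Z & y ~: Z & v x = v y)"
 proof (atomize_elim, rule D.field_hom_of_group[OF tors A.A.pointed_monoid_axioms])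
  fix x assume x: "x : carrier A - Z"
  show "v x : carrier (tgroup T Mod H)" using mem[OF x] TG by (auto simp: v_def intro!: q_car)
  fix y assume y: "y : carrier A - Z"
  show "v (x *[A] y) = v x *[tgroup T Mod H] v y"
   using mem[OF x] mem[OF y] TG q_hom by (auto simp: v_def subsetD)
 next
  show "v 1[A] = 1[tgroup T Mod H]" by (simp add: v_def q_unit)
  show "1[A] ~: Z" "pzero A : Z" using monoid_faceD(2)[OF T] by (auto simp: Z_def)
  fix x y assume x: "x : carrier A" and y: "y : carrier A"
  show "x *[A] y : Z \<longleftrightarrow> x : Z \<or> y : Z"
  proof (cases rule: monoid_alg_cases[OF x])
   case xs: (2 l s)
   show ?thesis
   proof (cases rule: monoid_alg_cases[OF y])
    case (2 m t)
    hence "s + t : T \<longleftrightarrow> s : T & t : T" using T xs by (auto simp: monoid_face_def)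
    thus ?thesis using xs 2 by (simp add: Z_def)
   qed (simp add: Z_def)
  qed (simp add: Z_def)
 qed auto
 have "(x, y) : pkernel A g \<longleftrightarrow> (x, y) : tcong T L \<phi>" for x y
 proof (cases "x : carrier A & y : carrier A")
  case True
  hence "(x, y) : pkernel A g \<longleftrightarrow> (x : Z & y : Z) \<or> (x ~: Z & y ~: Z & v x = v y)"
   using ker by (simp add: pkernel_iff)
  also have "\<dots> \<longleftrightarrow> (x, y) : tcong T L \<phi>"
  proof (cases "supp T x & supp T y")
   case s: True
   then obtain l s m t where xy: "x = Some (l, s)" "y = Some (m, t)" "s : T" "t : T" by (auto simp: supp_def)
   hence "l : Units F" "m : Units F" "s : S" "t : S" using True by auto
   thus ?thesis using xy TG q_eq[of l m s t] by (simp add: Z_def v_def tcong_Some subsetD)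
  next
   case False
   thus ?thesis using True by (auto simp: Z_def tcong_def)
  qed
  finally show ?thesis .
 qed (auto simp: pkernel_iff tcong_def)
 hence eq: "pkernel A g = tcong T L \<phi>" by auto
 have "inj_on (g \<circ> monoid_alg_const F) (carrier F)"
 proof (rule inj_onI)
  fix l m assume lm: "l : carrier F" "m : carrier F" "(g \<circ> monoid_alg_const F) l = (g \<circ> monoid_alg_const F) m"
  hence "(monoid_alg_const F l, monoid_alg_const F m) : tcong T L \<phi>"
   unfolding eq[symmetric] pkernel_iff using A.\<eta>_closed by simp
  thus "l = m" using lm monoid_faceD(2)[OF T] S_zero tdata_zero[OF d]
   by (cases "l = pzero F"; cases "m = pzero F") (auto simp: monoid_alg_const_def tcong_Some tcong_None Units_eq)
 qed
 thus ?thesis using A.A.SCong_kernelI[OF K A.\<eta>_closed] eq by simp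
qed

end

section \<open>Every point of the congruence space comes from a triple (face, subgroup,
  homomorphism)\<close>

context toric_algebra
begin

lemma kernel_units:
 fixes K :: "'b ring"
 assumes K: "field K" and h: "h : pmon_hom A (ring_pmonoid K)" and s: "(l, s) : Units F \<times> S"
 shows "h (Some (l, 0)) ~= 0[K]"
  "h (Some (l, s)) = h (Some (l, 0)) *[K] h (Some (1[F], s))"
proof -
 interpret K: field K by (rule K)
 have "h (Some (l, 0) *[A] Some (inv[F] l, 0)) = h (Some (l, 0)) *[K] h (Some (inv[F] l, 0))"
  using pmon_homD(4)[OF h, of "Some (l, 0)" "Some (inv[F] l, 0)"] s S_zero by simp
 moreover have "h (Some (l, 0) *[A] Some (inv[F] l, 0)) = 1[K]" using pmon_homD(2)[OF h] s by simp
 moreover have "h (Some (inv[F] l, 0)) : carrier K"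
  using pmon_homD(1)[OF h, of "Some (inv[F] l, 0)"] s S_zero by simp
 ultimately show "h (Some (l, 0)) ~= 0[K]" by auto
 show "h (Some (l, s)) = h (Some (l, 0)) *[K] h (Some (1[F], s))"
  using pmon_homD(4)[OF h, of "Some (l, 0)" "Some (1[F], s)"] s S_zero by (simp add: Units_carrier)
qed

text \<open>Roots of unity of a field containing \<open>F\<close> lie in \<open>F\<close>.\<close>

lemma kernel_roots:
 fixes K :: "'b ring"
 assumes K: "field K" and h: "h : pmon_hom A (ring_pmonoid K)"
  and inj: "inj_on (h \<circ> monoid_alg_const F) (carrier F)"
  and w: "w : carrier K" and n: "0 < n" and l: "l : Units F"
  and wn: "w ^[K] (n::nat) = h (Some (l, 0))"
 shows "EX m:Units F. w = h (Some (m, 0))"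
proof -
 interpret K: field K by (rule K)
 define i where "i l = h (Some (l, 0))" for l
 have i_car: "i l : carrier K" if "l : Units F" for l
  using pmon_homD(1)[OF h, of "Some (l, 0)"] that S_zero by (simp add: i_def)
 have i_mult: "i (l *[F] m) = i l *[K] i m" if "l : Units F" "m : Units F" for l m
  using pmon_homD(4)[OF h, of "Some (l, 0)" "Some (m, 0)"] that S_zero by (simp add: i_def)
 have i_one: "i 1[F] = 1[K]" using pmon_homD(2)[OF h] by (simp add: i_def)
 have i_pow: "i (l ^[F] k) = i l ^[K] k" if "l : Units F" for l and k :: nat
  by (induction k) (use that in \<open>auto simp: i_one i_mult F.Units_pow_closed\<close>)
 have i_unit: "i l : Units K" if "l : Units F" for l
  using kernel_units(1)[OF K h, of l 0] that S_zero i_car[OF that] by (simp add: K.field_Units i_def)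
 have i_inj: "inj_on i (Units F)"
 proof (rule inj_onI)
  fix l m assume "l : Units F" "m : Units F" "i l = i m"
  thus "l = m" using inj_onD[OF inj, of l m] by (simp add: monoid_alg_const_def Units_nonzero Units_carrier i_def)
 qed
 obtain a where a: "a : Units F" "a ^[F] n = l" using exists_root[OF l n] by auto
 \<comment> \<open>Dividing by the image of an \<open>n\<close>-th root of \<open>l\<close> in
   \<open>F\<close> turns \<open>w\<close> into a root of unity.\<close>
 define z where "z = w *[K] inv[K] (i a)"
 have zc: "z : carrier K" unfolding z_def using w i_unit[OF a(1)] by simp
 have wz: "w = z *[K] i a" unfolding z_def using w i_unit[OF a(1)] i_car[OF a(1)] by (simp add: K.m_assoc)
 have "w ^[K] n = z ^[K] n *[K] i l"
  using zc i_car[OF a(1)] i_pow[OF a(1), of n] a(2) by (simp add: wz K.nat_pow_distrib)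
 hence "i l *[K] z ^[K] n = i l *[K] 1[K]" using wn zc i_car[OF l] by (simp add: K.m_comm i_def)
 hence zn: "z ^[K] n = 1[K]" using K.Units_l_cancel[OF i_unit[OF l]] zc by simp
 \<comment> \<open>\<open>F\<close> has \<open>n\<close> roots of unity of exponent
   \<open>n\<close>, and the field can have no more.\<close>
 define R where "R = {x : carrier F. x ^[F] n = 1[F]}"
 have RU: "R <= Units F" using root_Units[OF _ n] by (auto simp: R_def)
 have "card (i ` R) = n"
  using card_image[OF inj_on_subset[OF i_inj RU]] card_roots[OF _ n, of "1[F]"] by (simp add: R_def)
 moreover have "i ` R <= {x : carrier K. x ^[K] n = 1[K]}"
 proof
  fix y assume "y : i ` R"
  then obtain x where x: "x : R" "y = i x" by auto
  thus "y : {x : carrier K. x ^[K] n = 1[K]}" using RU i_car[of x] i_pow[of x n] i_one by (auto simp: R_def)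
 qed
 ultimately have "i ` R = {x : carrier K. x ^[K] n = 1[K]}"
  using K.roots_of_unity_bound[OF n] by (intro card_seteq) simp_all
 hence "z : i ` R" using zc zn by simp
 then obtain b where b: "b : Units F" "z = i b" using RU by auto
 hence "w = i (b *[F] a)" using wz i_mult[OF b(1) a(1)] by simp
 thus ?thesis using a b by (auto simp: i_def)
qed

text \<open>Take a homomorphism into a field with kernel \<open>c\<close>. \<open>T\<close> consists
  of the exponents with nonzero image, \<open>L\<close> of the differences \<open>s - t\<close>
  whose quotient of images is a constant from \<open>F\<close>, and \<phi> gives this
  constant.\<close>

lemma point_tcong:
 assumes c: "c : Pts"
 shows "EX T L \<phi>. tdata T L \<phi> & c = tcong T L \<phi>"
proof -
 obtain K :: "(nat \<times> ('k \<times> ('v => real)) option set) ring" and h where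
  K: "field K" and h: "h : pmon_hom A (ring_pmonoid K)"
  and c_eq: "c = pkernel A h" and inj: "inj_on (h \<circ> monoid_alg_const F) (carrier F)"
  by (rule A.A.SCong_kernelE[OF c A.\<eta>_closed])
 interpret K: field K by (rule K)
 define i where "i l = h (Some (l, 0))" for l
 define v where "v s = h (Some (1[F], s))" for s
 have i_car: "i l : carrier K" and i_nz: "i l ~= 0[K]" if "l : Units F" for l
  using pmon_homD(1)[OF h, of "Some (l, 0)"] kernel_units(1)[OF K h, of l 0] that S_zero by (auto simp: i_def)
 have i_mult: "i (l *[F] m) = i l *[K] i m" if "l : Units F" "m : Units F" for l m
  using pmon_homD(4)[OF h, of "Some (l, 0)" "Some (m, 0)"] that S_zero by (simp add: i_def)
 have i_one: "i 1[F] = 1[K]" using pmon_homD(2)[OF h] by (simp add: i_def)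
 have i_inj: "l = m" if "l : Units F" "m : Units F" "i l = i m" for l m
  using inj_onD[OF inj, of l m] that by (simp add: monoid_alg_const_def Units_nonzero Units_carrier i_def)
 have v_car: "v s : carrier K" if "s : S" for s
  using pmon_homD(1)[OF h, of "Some (1[F], s)"] that by (simp add: v_def)
 have v_add: "v (s + t) = v s *[K] v t" if "s : S" "t : S" for s t
  using pmon_homD(4)[OF h, of "Some (1[F], s)" "Some (1[F], t)"] that by (simp add: v_def)
 have v_zero: "v 0 = 1[K]" using pmon_homD(2)[OF h] by (simp add: v_def)
 have h_eq: "h (Some (l, s)) = i l *[K] v s" if "l : Units F" "s : S" for l s
  using kernel_units(2)[OF K h, of l s] that by (simp add: i_def v_def)
 define T where "T = {s : S. v s ~= 0[K]}"
 have TS: "T <= S" by (auto simp: T_def)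
 have T: "monoid_face S T" unfolding monoid_face_def
 proof (intro conjI ballI)
  fix s t assume "s : S" "t : S"
  thus "s + t : T \<longleftrightarrow> s : T & t : T" using v_car v_add K.integral_iff S_add by (auto simp: T_def)
 qed (use S_zero v_zero in \<open>auto simp: T_def\<close>)
 have Tadd: "s + t : T" if "s : T" "t : T" for s t using monoid_faceD(3)[OF T that] .
 have v_unit: "v s : Units K" if "s : T" for s using that v_car by (auto simp: T_def K.field_Units)
 have vT: "v s : carrier K" if "s : T" for s using v_car that TS by auto
 \<comment> \<open>The quotient of the images of \<open>s\<close> and \<open>t\<close> depends only
   on \<open>s - t\<close>, so that \<open>\<R>\<close> may be tested on any representation of the
   difference.\<close>
 have key: "v s' = i l *[K] v t'"
  if st: "s : T" "t : T" "s' : T" "t' : T" "s - t = s' - t'" and l: "l : Units F" "v s = i l *[K] v t" for s t s' t' l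
 proof -
  have "s + t' = s' + t" using st(5) by (metis add_diff_eq diff_add_cancel diff_eq_eq add.commute)
  hence "v s *[K] v t' = v s' *[K] v t" using v_add st TS by (metis subsetD)
  hence "v t *[K] v s' = v t *[K] (i l *[K] v t')" using l(2) vT st i_car[OF l(1)] by (simp add: K.m_ac)
  thus ?thesis using K.Units_l_cancel[OF v_unit[OF st(2)]] vT st i_car[OF l(1)] by simp
 qed
 define \<R> where "\<R> x l \<longleftrightarrow> l : Units F & (EX s t. s : T & t : T & x = s - t & v s = i l *[K] v t)" for x l
 define L where "L = {x. EX l. \<R> x l}"
 define \<phi> where "\<phi> x = (THE l. \<R> x l)" for x
 have R_iff: "\<R> (s - t) l \<longleftrightarrow> v s = i l *[K] v t" if "s : T" "t : T" "l : Units F" for s t l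
  using that key[of _ _ s t l] by (auto simp: \<R>_def)
 have R_uniq: "l = m" if R: "\<R> x l" "\<R> x m" for x l m
 proof -
  obtain s t where st: "s : T" "t : T" "x = s - t" "l : Units F" "m : Units F"
   using R unfolding \<R>_def by blast
  hence "v t *[K] i l = v t *[K] i m" using R R_iff[of s t] vT i_car by (metis K.m_comm)
  hence "i l = i m" using K.Units_l_cancel[OF v_unit[OF st(2)]] i_car st by simp
  thus ?thesis using i_inj st by simp
 qed
 have \<phi>: "\<phi> x = l" if "\<R> x l" for x l unfolding \<phi>_def using that R_uniq by (intro the_equality)
 have R_add: "\<R> (x + y) (l *[F] m)" if xy: "\<R> x l" "\<R> y m" for x y l m
 proof -
  obtain s t s' t' where st: "s : T" "t : T" "x = s - t" "l : Units F" "v s = i l *[K] v t"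
   and st': "s' : T" "t' : T" "y = s' - t'" "m : Units F" "v s' = i m *[K] v t'"
   using xy by (auto simp: \<R>_def)
  have "v (s + s') = i (l *[F] m) *[K] v (t + t')"
   using st st' TS vT i_car by (simp add: v_add i_mult subsetD K.m_ac)
  hence "\<R> ((s + s') - (t + t')) (l *[F] m)"
   using R_iff[OF Tadd[OF st(1) st'(1)] Tadd[OF st(2) st'(2)]] st(4) st'(4) by blast
  moreover have "x + y = (s + s') - (t + t')" using st(3) st'(3) by simp
  ultimately show ?thesis by (simp only:)
 qed
 have R_uminus: "\<R> (- x) (inv[F] l)" if x: "\<R> x l" for x l
 proof -
  obtain s t where st: "s : T" "t : T" "x = s - t" "l : Units F" "v s = i l *[K] v t"
   using x by (auto simp: \<R>_def)
  have "i (inv[F] l) *[K] v s = (i (inv[F] l) *[K] i l) *[K] v t" using st vT i_car by (simp add: K.m_assoc)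
  also have "i (inv[F] l) *[K] i l = 1[K]" using i_mult[of "inv[F] l" l] st(4) i_one by simp
  finally have "v t = i (inv[F] l) *[K] v s" using vT st(2) by simp
  hence "\<R> (t - s) (inv[F] l)" using R_iff st by simp
  thus ?thesis using st(3) by simp
 qed
 have L: "zsubgroup L"
 proof (rule zsubgroupI')
  have "\<R> (0 - 0) 1[F]" using R_iff[of 0 0 "1[F]"] monoid_faceD(2)[OF T] i_one v_zero by simp
  thus "0 : L" unfolding L_def by auto
  show "x + y : L" if "x : L" "y : L" for x y using that R_add unfolding L_def by blast
  show "- x : L" if "x : L" for x using that R_uminus unfolding L_def by blast
 qed
 have v_mul: "v (zmul (int n) s) = v s ^[K] n" if s: "s : T" for s and n :: nat
 proof (induction n)
  case 0
  show ?case by (simp only: of_nat_0 zmul_simps v_zero nat_pow_0)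
 next
  case (Suc n)
  have "zmul (int (Suc n)) s = zmul (int n) s + s" by (simp add: zmul_algebra)
  thus ?case using Suc v_add[of "zmul (int n) s" s] monoid_face_zmul[OF T s, of n] s TS
   by (simp only: nat_pow_Suc subsetD)
 qed
 \<comment> \<open>If a power of a quotient of images is constant, the quotient itself is, by
   \<open>kernel_roots\<close>.\<close>
 have sat: "zsaturated (diff_group T) L" unfolding zsaturated_def
 proof (intro ballI allI impI)
  fix x n assume "x : diff_group T" and n: "n ~= 0" and nx: "zmul n x : L"
  then obtain s t where st: "x = s - t" "s : T" "t : T" by (auto simp: diff_group_def)
  define k where "k = nat \<bar>n\<bar>"
  have k: "0 < k" using n by (simp add: k_def)
  have "zmul (int k) x : L"
   using nx zsubgroup_uminus[OF L nx] by (cases "0 <= n") (simp_all add: k_def zmul_algebra)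
  then obtain l where "\<R> (zmul (int k) x) l" by (auto simp: L_def)
  moreover have "zmul (int k) x = zmul (int k) s - zmul (int k) t" using st(1) by (simp add: zmul_algebra)
  ultimately have "v (zmul (int k) s) = i l *[K] v (zmul (int k) t)" and l: "l : Units F"
   using R_iff[of "zmul (int k) s" "zmul (int k) t" l] monoid_face_zmul[OF T] st by (auto simp: \<R>_def)
  hence vk: "v s ^[K] k = i l *[K] v t ^[K] k" using v_mul st by simp
  define w where "w = v s *[K] inv[K] (v t)"
  have wc: "w : carrier K" unfolding w_def using v_unit[OF st(3)] vT st by simp
  have vw: "v s = w *[K] v t" unfolding w_def using v_unit[OF st(3)] vT st by (simp add: K.m_assoc)
  have "v t ^[K] k *[K] w ^[K] k = v t ^[K] k *[K] i l"
   using vk vw vT[OF st(3)] wc i_car[OF l] by (simp add: K.nat_pow_distrib K.m_comm)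
  hence "w ^[K] k = i l"
   using K.Units_l_cancel[OF K.Units_pow_closed[OF v_unit[OF st(3)]]] wc i_car[OF l] by simp
  then obtain m where m: "m : Units F" "w = i m" using kernel_roots[OF K h inj wc k l] by (auto simp: i_def)
  hence "\<R> (s - t) m" using R_iff st vw by simp
  thus "x : L" using st(1) by (auto simp: L_def)
 qed
 have d: "tdata T L \<phi>" unfolding tdata_def
 proof (intro conjI ballI)
  show "L <= diff_group T" by (auto simp: L_def \<R>_def diff_group_def)
  fix x assume "x : L"
  then obtain l where l: "\<R> x l" by (auto simp: L_def)
  thus "\<phi> x : Units F" using \<phi>[OF l] by (simp add: \<R>_def)
  fix y assume "y : L"
  then obtain m where m: "\<R> y m" by (auto simp: L_def)
  show "\<phi> (x + y) = \<phi> x *[F] \<phi> y" using \<phi>[OF l] \<phi>[OF m] \<phi>[OF R_add[OF l m]] by simp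
 qed (use T L sat in auto)
 have zero: "i l *[K] v s = 0[K] \<longleftrightarrow> s ~: T" if "l : Units F" "s : S" for l s
  using that i_car[OF that(1)] i_nz[OF that(1)] v_car[OF that(2)] K.integral_iff by (auto simp: T_def)
 have h0: "h None = 0[K]" using pmon_homD(3)[OF h] by simp
 have SS: "(Some (l, s), Some (m, t)) : c \<longleftrightarrow> (Some (l, s), Some (m, t)) : tcong T L \<phi>"
  if ls: "l : Units F" "s : S" "m : Units F" "t : S" for l s m t
 proof -
  have 1: "(Some (l, s), Some (m, t)) : c \<longleftrightarrow> i l *[K] v s = i m *[K] v t"
   using ls by (simp add: c_eq pkernel_iff h_eq)
  show ?thesis
  proof (cases "s : T & t : T")
   case True
   have u: "i l : Units K" using i_car i_nz ls by (simp add: K.field_Units)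
   have ml: "inv[F] l *[F] m : Units F" using ls by simp
   have "i l *[K] i (inv[F] l *[F] m) = i m"
    using i_mult[OF ls(1) ml] ls by (simp add: Units_inv_cancel Units_carrier)
   hence "i m *[K] v t = i l *[K] (i (inv[F] l *[F] m) *[K] v t)"
    using i_car[OF ls(1)] i_car[OF ml] v_car[OF ls(4)] by (simp add: K.m_assoc[symmetric])
   hence "i l *[K] v s = i m *[K] v t \<longleftrightarrow> v s = i (inv[F] l *[F] m) *[K] v t"
    using K.Units_l_cancel[OF u] i_car[OF ml] v_car ls by simp
   also have "\<dots> \<longleftrightarrow> \<R> (s - t) (inv[F] l *[F] m)" using R_iff True ml by simp
   also have "\<dots> \<longleftrightarrow> s - t : L & m = l *[F] \<phi> (s - t)"
   proof
    assume r: "\<R> (s - t) (inv[F] l *[F] m)"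
    thus "s - t : L & m = l *[F] \<phi> (s - t)"
     using \<phi>[OF r] ls by (auto simp: L_def Units_inv_cancel Units_carrier)
   next
    assume a: "s - t : L & m = l *[F] \<phi> (s - t)"
    then obtain p where p: "\<R> (s - t) p" by (auto simp: L_def)
    hence "inv[F] l *[F] m = p" using a \<phi>[OF p] ls by (simp add: Units_inv_cancel Units_carrier \<R>_def)
    thus "\<R> (s - t) (inv[F] l *[F] m)" using p by simp
   qed
   finally show ?thesis using 1 ls True by (simp add: tcong_Some)
  next
   case False
   thus ?thesis using 1 zero[OF ls(1,2)] zero[OF ls(3,4)] ls by (simp add: tcong_Some) metis
  qed
 qed
 have SN: "(Some (l, s), None) : c \<longleftrightarrow> s ~: T" "(None, Some (l, s)) : c \<longleftrightarrow> s ~: T"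
  if ls: "l : Units F" "s : S" for l s
  using ls zero[OF ls] by (simp_all add: c_eq pkernel_iff h_eq h0 eq_commute[of "0[K]"])
 have "(x, y) : c \<longleftrightarrow> (x, y) : tcong T L \<phi>" for x y
 proof (cases "x : carrier A & y : carrier A")
  case True
  thus ?thesis by (elim conjE monoid_alg_cases[of x] monoid_alg_cases[of y])
    (simp_all add: SS SN tcong_None(1,2), simp add: c_eq pkernel_iff tcong_def)
 qed (auto simp: c_eq pkernel_iff tcong_def)
 hence "c = tcong T L \<phi>" by auto
 thus ?thesis using d by blast
qed

section \<open>The grading by rank\<close>

text \<open>It suffices to test the pairs of a character with zero and of two characters related by
  \<open>L\<close>. Together with \<open>tcong_subsetI\<close> this describes inclusion:
  \<open>T'\<close> shrinks to a union of classes of \<open>T\<close> modulo \<open>L\<close>, and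
  on the group of \<open>T'\<close> the new data extend the old ones.\<close>

lemma tcong_subsetD:
 assumes d: "tdata T L \<phi>" "tdata T' L' \<phi>'" and sub: "tcong T L \<phi> <= tcong T' L' \<phi>'"
 shows "T' <= T" "s : T ==> t : T ==> s - t : L ==> s : T' \<longleftrightarrow> t : T'"
  "x : L ==> x : diff_group T' ==> x : L' & \<phi>' x = \<phi> x"
proof -
 note T = monoid_faceD(1)[OF tdataD(1)[OF d(1)]] and T' = monoid_faceD(1)[OF tdataD(1)[OF d(2)]]
 show TT: "T' <= T"
 proof
  fix s assume s: "s : T'"
  show "s : T"
  proof (rule ccontr)
   assume "s ~: T"
   hence "(Some (1[F], s), None) : tcong T L \<phi>" using s T' by (subst tcong_None) auto
   hence "(Some (1[F], s), None) : tcong T' L' \<phi>'" using sub by auto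
   thus False using s T' tcong_None(1)[of "1[F]" s T' L' \<phi>'] by auto
  qed
 qed
 have rel: "(Some (1[F], s), Some (\<phi> (s - t), t)) : tcong T' L' \<phi>'" if "s : T" "t : T" "s - t : L" for s t
 proof -
  have "\<phi> (s - t) : Units F" "s : S" "t : S" using tdataD(5)[OF d(1)] that T by auto
  hence "(Some (1[F], s), Some (\<phi> (s - t), t)) : tcong T L \<phi>"
   using that by (simp add: tcong_Some Units_carrier)
  thus ?thesis using sub by auto
 qed
 show "s : T' \<longleftrightarrow> t : T'" if st: "s : T" "t : T" "s - t : L" for s t
 proof -
  have "\<phi> (s - t) : Units F" "s : S" "t : S" using tdataD(5)[OF d(1)] st T by auto
  thus ?thesis using rel[OF st] by (auto simp: tcong_Some)
 qed
 show "x : L' & \<phi>' x = \<phi> x" if x: "x : L" "x : diff_group T'" for x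
 proof -
  obtain s t where st: "x = s - t" "s : T'" "t : T'" using x(2) by (auto simp: diff_group_def)
  hence st': "s : T" "t : T" "s - t : L" using TT x(1) by auto
  have u: "\<phi> (s - t) : Units F" "s : S" "t : S" using tdataD(5)[OF d(1)] st' T by auto
  hence "s - t : L' & \<phi> (s - t) = 1[F] *[F] \<phi>' (s - t)"
   using rel[OF st'] st by (auto simp: tcong_Some)
  thus ?thesis using st(1) tdataD(5)[OF d(2)] by (auto simp: Units_carrier)
 qed
qed

lemma tcong_subsetI:
 assumes d: "tdata T L \<phi>" "tdata T' L' \<phi>'" and TT: "T' <= T"
  and pull: "!!s t. s : T ==> t : T ==> s - t : L ==> s : T' \<longleftrightarrow> t : T'"
  and L: "!!x. x : L ==> x : diff_group T' ==> x : L' & \<phi>' x = \<phi> x"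
 shows "tcong T L \<phi> <= tcong T' L' \<phi>'"
proof (rule subrelI)
 fix x y assume xy: "(x, y) : tcong T L \<phi>"
 hence car: "x : carrier A" "y : carrier A" by (auto simp: tcong_def)
 consider "~ supp T x" "~ supp T y" | l s m t where "x = Some (l, s)" "y = Some (m, t)" "s : T" "t : T"
   "s - t : L" "m = l *[F] \<phi> (s - t)" using xy by (auto simp: tcong_def)
 thus "(x, y) : tcong T' L' \<phi>'"
 proof cases
  case 1
  hence "~ supp T' x" "~ supp T' y" using TT by (auto simp: supp_def)
  thus ?thesis using car by (simp add: tcong_def)
 next
  case 2
  show ?thesis
  proof (cases "s : T'")
   case True
   hence t: "t : T'" using pull[OF 2(3,4,5)] by simp
   hence "s - t : L' & \<phi>' (s - t) = \<phi> (s - t)" using L[OF 2(5)] True by (auto intro: diff_groupI)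
   thus ?thesis using 2 car True t by (simp add: tcong_Some)
  next
   case False
   hence "t ~: T'" using pull[OF 2(3,4,5)] by simp
   thus ?thesis using 2 car False by (simp add: tcong_Some)
  qed
 qed
qed

lemma tcong_inject:
 assumes d: "tdata T L \<phi>" "tdata T' L' \<phi>'" and eq: "tcong T L \<phi> = tcong T' L' \<phi>'"
 shows "T = T'" "L = L'"
proof -
 show T: "T = T'" using tcong_subsetD(1)[OF d] tcong_subsetD(1)[OF d(2,1)] eq by blast
 show "L = L'"
  using tcong_subsetD(3)[OF d] tcong_subsetD(3)[OF d(2,1)] eq tdataD(3)[OF d(1)] tdataD(3)[OF d(2)] T by blast
qed

text \<open>By \<open>tcong_inject\<close> at most one pair \<open>(T, L)\<close> qualifies, so the
  choice is determined.\<close>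

definition point_rank where
 "point_rank c = (let (T, L) = SOME (T, L). \<exists>\<phi>. tdata T L \<phi> & c = tcong T L \<phi> in zrank (diff_group T) L)"

lemma point_rank_tcong:
 assumes d: "tdata T L \<phi>"
 shows "point_rank (tcong T L \<phi>) = zrank (diff_group T) L"
proof -
 have "(SOME (T', L'). \<exists>\<phi>'. tdata T' L' \<phi>' & tcong T L \<phi> = tcong T' L' \<phi>') = (T, L)"
 proof (rule some_equality)
  show "case (T, L) of (T', L') => \<exists>\<phi>'. tdata T' L' \<phi>' & tcong T L \<phi> = tcong T' L' \<phi>'" using d by auto
  show "p = (T, L)" if "case p of (T', L') => \<exists>\<phi>'. tdata T' L' \<phi>' & tcong T L \<phi> = tcong T' L' \<phi>'" for p
   using that tcong_inject[OF d] by (cases p) auto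
 qed
 thus ?thesis by (simp add: point_rank_def)
qed

lemma diff_group_M: "monoid_face S T ==> diff_group T <= M"
 using monoid_faceD(1) SD(1) by (fastforce simp: diff_group_def intro: zsubgroup_diff[OF M])

text \<open>No nonzero multiple of an element of \<open>T\<close> outside \<open>T'\<close> lies in
  the group of \<open>T'\<close> modulo \<open>L\<close>: \<open>pull\<close> would put the multiple
  plus an element of \<open>T'\<close> into \<open>T'\<close>, and a face contains the summands of
  its elements.\<close>

lemma face_independent:
 assumes T: "monoid_face S T" "monoid_face S T'" "T' <= T" and L: "zsubgroup L"
  and pull: "!!s t. s : T ==> t : T ==> s - t : L ==> t : T' ==> s : T'"
  and s: "s : T" "s ~: T'" and n: "n ~= 0" "y : diff_group T'" "zmul n s + y : L"
 shows False
proof -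
 have pos: False if k: "0 < k" and y: "y : diff_group T'" "zmul (int k) s + y : L" for k :: nat and y
 proof -
  obtain a b where ab: "y = a - b" "a : T'" "b : T'" using y(1) by (auto simp: diff_group_def)
  have ks: "zmul (int k) s : T" by (rule monoid_face_zmul[OF T(1) s(1)])
  have "zmul (int k) s + a : T'"
  proof (rule pull[of _ b])
   show "zmul (int k) s + a : T" using monoid_faceD(3)[OF T(1) ks] ab T(3) by auto
   have "zmul (int k) s + a - b = zmul (int k) s + y" by (simp add: ab(1) add_diff_eq)
   thus "zmul (int k) s + a - b : L" using y(2) by (simp only:)
  qed (use ab T(3) in auto)
  hence "zmul (int k) s : T'"
   using monoid_faceD(4)[OF T(2), of "zmul (int k) s" a] ks ab(2) monoid_faceD(1)[OF T(1)] T(3) by auto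
  moreover have "zmul (int k) s = s + zmul (int (k - 1)) s"
  proof -
   have "int k = 1 + int (k - 1)" using k by simp
   thus ?thesis by (metis zmul_algebra(4) zmul_simps(1))
  qed
  ultimately have "s + zmul (int (k - 1)) s : T'" by (simp only:)
  thus False
   using monoid_faceD(4)[OF T(2), of s "zmul (int (k - 1)) s"] monoid_face_zmul[OF T(1) s(1), of "k - 1"]
    s monoid_faceD(1)[OF T(1)] by auto
 qed
 show False
 proof (cases "0 < n")
  case True
  thus False using pos[of "nat n" y] n by simp
 next
  case False
  have "- (zmul n s + y) = zmul (int (nat (- n))) s + - y" using False by (simp add: zmul_algebra)
  hence "zmul (int (nat (- n))) s + - y : L" using zsubgroup_uminus[OF L n(3)] by (simp only:)
  thus False
   using pos[of "nat (- n)" "- y"] False n(1) zsubgroup_uminus[OF zsubgroup_diff_group[OF T(2)] n(2)] by simp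
 qed
qed

text \<open>The extra direction for \<open>zrank_insert\<close> is an element of \<open>L'\<close>
  outside \<open>L\<close> if the faces agree, and an element of \<open>T\<close> outside
  \<open>T'\<close> if they do not.\<close>

lemma point_rank_mono:
 assumes "c : Pts" "c' : Pts" "c < c'"
 shows "point_rank c' < point_rank c"
proof -
 obtain T L \<phi> where d: "tdata T L \<phi>" "c = tcong T L \<phi>" using point_tcong[OF assms(1)] by auto
 obtain T' L' \<phi>' where d': "tdata T' L' \<phi>'" "c' = tcong T' L' \<phi>'" using point_tcong[OF assms(2)] by auto
 have sub: "tcong T L \<phi> <= tcong T' L' \<phi>'" using assms(3) d d' by auto
 note D = tcong_subsetD[OF d(1) d'(1) sub]
 note T = tdataD(1)[OF d(1)] and T' = tdataD(1)[OF d'(1)]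
 have "EX s:diff_group T. ALL a. ALL y:diff_group T'. zmul a s + y : L --> y : L' & (y = 0 --> a = 0)"
 proof (cases "T = T'")
  case True
  hence LL: "L <= L'" using D(3) tdataD(3)[OF d(1)] by auto
  have "L ~= L'"
  proof
   assume "L = L'"
   hence "tcong T' L' \<phi>' <= tcong T L \<phi>"
    using True D(3) tdataD(3)[OF d'(1)] by (intro tcong_subsetI[OF d'(1) d(1)]) auto
   thus False using assms(3) d d' by auto
  qed
  then obtain x where x: "x : L'" "x ~: L" using LL by auto
  have xT: "x : diff_group T" using x tdataD(3)[OF d'(1)] True by auto
  show ?thesis
  proof (intro bexI[OF _ xT] allI ballI impI)
   fix a y assume y: "y : diff_group T'" and mem: "zmul a x + y : L"
   have "zmul a x + y - zmul a x : L'"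
    using mem LL x(1) zsubgroup_diff[OF tdataD(2)[OF d'(1)]] zsubgroup_mul[OF tdataD(2)[OF d'(1)]] by blast
   hence "y : L'" by simp
   moreover have "a = 0" if "y = 0"
    using zmul_difference_mem[OF tdataD(4)[OF d(1)] xT, of a] mem that x(2) by (cases "a = 0") auto
   ultimately show "y : L' & (y = 0 --> a = 0)" by blast
  qed
 next
  case False
  then obtain s where s: "s : T" "s ~: T'" using D(1) by auto
  show ?thesis
  proof (intro bexI[of _ s] allI ballI impI)
   show "s : diff_group T" using s subset_diff_group[OF T] by auto
   fix a y assume y: "y : diff_group T'" and mem: "zmul a s + y : L"
   have a: "a = 0" using face_independent[OF T T' D(1) tdataD(2)[OF d(1)] _ s _ y mem] D(2) by blast
   hence "y : L" using mem by simp
   thus "y : L' & (y = 0 --> a = 0)" using a D(3) y by blast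
  qed
 qed
 then obtain s where s: "s : diff_group T"
  "!!a y. y : diff_group T' ==> zmul a s + y : L ==> y : L' & (y = 0 --> a = 0)" by blast
 have "Suc (zrank (diff_group T') L') <= zrank (diff_group T) L"
  by (rule zrank_insert[OF diff_group_M[OF T] diff_group_mono[OF D(1)] tdataD(2)[OF d(1)]
    zsubgroup_zero[OF tdataD(2)[OF d'(1)]] zsubgroup_diff_group[OF T'] s])
 thus ?thesis using point_rank_tcong d d' by simp
qed


text \<open>For \<open>g\<close> in \<open>Q\<close>, the saturation in \<open>Q\<close> of the
  subgroup generated by \<open>L\<close> and \<open>g\<close>. It corresponds to imposing one
  further relation.\<close>

definition sat_closure :: "('v => real) set => ('v => real) set => ('v => real) => ('v => real) set" where
 "sat_closure Q L g = {z : Q. EX n k. n ~= 0 & zmul n z - zmul k g : L}"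

lemma sat_closure:
 assumes Q: "zsubgroup Q" and L: "zsubgroup L" "L <= Q" and g: "g : Q"
 shows "zsubgroup (sat_closure Q L g)" "L <= sat_closure Q L g" "g : sat_closure Q L g"
  "sat_closure Q L g <= Q" "zsaturated Q (sat_closure Q L g)"
proof -
 show "sat_closure Q L g <= Q" by (auto simp: sat_closure_def)
 show sub: "L <= sat_closure Q L g"
 proof
  fix x assume "x : L"
  hence "EX n k. n ~= 0 & zmul n x - zmul k g : L" by (intro exI[of _ 1] exI[of _ 0]) simp
  thus "x : sat_closure Q L g" unfolding sat_closure_def using \<open>x : L\<close> L(2) by auto
 qed
 have "EX n k. n ~= 0 & zmul n g - zmul k g : L" by (intro exI[of _ 1]) (use zsubgroup_zero[OF L(1)] in simp)
 thus "g : sat_closure Q L g" unfolding sat_closure_def using g by auto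
 show "zsaturated Q (sat_closure Q L g)" unfolding zsaturated_def
 proof (intro ballI allI impI)
  fix x m assume x: "x : Q" "(m::int) ~= 0" "zmul m x : sat_closure Q L g"
  then obtain n k where n: "n ~= 0" "zmul n (zmul m x) - zmul k g : L" by (auto simp: sat_closure_def)
  hence "n * m ~= 0 & zmul (n * m) x - zmul k g : L" using x(2) by (simp add: zmul_algebra)
  thus "x : sat_closure Q L g" using x(1) unfolding sat_closure_def by blast
 qed
 show "zsubgroup (sat_closure Q L g)"
 proof (rule zsubgroupI')
  show "0 : sat_closure Q L g" using sub zsubgroup_zero[OF L(1)] by blast
  fix x assume "x : sat_closure Q L g"
  then obtain n k where x: "x : Q" "n ~= 0" "zmul n x - zmul k g : L" by (auto simp: sat_closure_def)
  have "- (zmul n x - zmul k g) : L" by (rule zsubgroup_uminus[OF L(1) x(3)])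
  moreover have "- (zmul n x - zmul k g) = zmul n (- x) - zmul (- k) g" by (simp add: zmul_algebra)
  ultimately have "zmul n (- x) - zmul (- k) g : L" by (simp only:)
  thus "- x : sat_closure Q L g" unfolding sat_closure_def using zsubgroup_uminus[OF Q x(1)] x(2) by blast
  fix y assume "y : sat_closure Q L g"
  then obtain m j where y: "y : Q" "m ~= 0" "zmul m y - zmul j g : L" by (auto simp: sat_closure_def)
  have "zmul m (zmul n x - zmul k g) + zmul n (zmul m y - zmul j g) : L"
   by (intro zsubgroup_add[OF L(1)] zsubgroup_mul[OF L(1)] x y)
  moreover have "zmul m (zmul n x - zmul k g) + zmul n (zmul m y - zmul j g) =
   zmul (m * n) (x + y) - zmul (m * k + n * j) g" by (simp add: zmul_algebra mult.commute[of n m])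
  ultimately have "zmul (m * n) (x + y) - zmul (m * k + n * j) g : L" by (simp only:)
  moreover have "m * n ~= 0" using x(2) y(2) by simp
  ultimately show "x + y : sat_closure Q L g"
   unfolding sat_closure_def using zsubgroup_add[OF Q x(1) y(1)] by blast
 qed
qed

text \<open>The units of \<open>F\<close> form a divisible group, so \<open>hom_graph.extend\<close>
  applies to the graph of \<phi>.\<close>

lemma extend_phi:
 assumes d: "tdata T L \<phi>" and Q: "zsubgroup Q" "L <= Q"
 shows "\<exists>\<psi>. (ALL x:Q. \<psi> x : Units F) & (ALL x:Q. ALL y:Q. \<psi> (x + y) = \<psi> x *[F] \<psi> y) & (ALL x:L. \<psi> x = \<phi> x)"
proof -
 define D where "D = \<lparr>carrier = Q, mult = (+), one = 0 :: 'v => real\<rparr>"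
 have D_simps: "carrier D = Q" "x *[D] y = x + y" "1[D] = 0" for x y by (simp_all add: D_def)
 have D: "comm_group D"
 proof (rule comm_groupI)
  show "EX y:carrier D. y *[D] x = 1[D]" if "x : carrier D" for x
   using that zsubgroup_uminus[OF Q(1)] by (intro bexI[of _ "- x"]) (simp_all add: D_simps)
 qed (simp_all add: D_simps zsubgroup_zero[OF Q(1)] zsubgroup_add[OF Q(1)] add.assoc add.commute)
 interpret D: comm_group D by (rule D)
 interpret U: comm_group "units_of F" by (rule units_comm_group)
 define \<Gamma> where "\<Gamma> = {(x, \<phi> x) | x. x : L}"
 interpret hom_graph D "units_of F" \<Gamma>
 proof
  show "\<Gamma> <= carrier D \<times> carrier (units_of F)"
   using Q(2) tdataD(5)[OF d] by (auto simp: \<Gamma>_def D_simps units_of_carrier)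
  show "(1[D], 1[units_of F]) : \<Gamma>"
   using zsubgroup_zero[OF tdataD(2)[OF d]] tdata_zero[OF d] by (auto simp: \<Gamma>_def D_simps units_of_one)
  show "y = 1[units_of F]" if "(1[D], y) : \<Gamma>" for y
   using that tdata_zero[OF d] by (auto simp: \<Gamma>_def D_simps units_of_one)
  fix x y assume "(x, y) : \<Gamma>"
  hence x: "x : L" "y = \<phi> x" by (auto simp: \<Gamma>_def)
  have "inv[D] x = - x"
   by (rule D.inv_equality) (use x Q zsubgroup_uminus[OF Q(1)] in \<open>auto simp: D_simps\<close>)
  thus "(inv[D] x, inv[units_of F] y) : \<Gamma>"
   using x zsubgroup_uminus[OF tdataD(2)[OF d] x(1)] tdata_uminus[OF d x(1)] F.units_of_inv[OF tdataD(5)[OF d x(1)]]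
   by (simp add: \<Gamma>_def)
  fix x' y' assume "(x', y') : \<Gamma>"
  hence x': "x' : L" "y' = \<phi> x'" by (auto simp: \<Gamma>_def)
  show "(x *[D] x', y *[units_of F] y') : \<Gamma>"
   using x x' zsubgroup_add[OF tdataD(2)[OF d] x(1) x'(1)] tdataD(6)[OF d x(1) x'(1)]
   by (simp add: \<Gamma>_def D_simps units_of_mult)
 qed
 obtain \<psi> where \<psi>: "\<psi> : hom D (units_of F)" "ALL (x, y):\<Gamma>. \<psi> x = y" using extend[OF units_divisible] by auto
 have "\<psi> x : Units F" if "x : Q" for x
  using \<psi>(1) that by (auto simp: hom_def D_simps units_of_carrier)
 moreover have "\<psi> (x + y) = \<psi> x *[F] \<psi> y" if "x : Q" "y : Q" for x y
  using hom_mult[OF \<psi>(1), of x y] that by (simp add: D_simps units_of_mult)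
 moreover have "\<psi> x = \<phi> x" if "x : L" for x using \<psi>(2) that by (auto simp: \<Gamma>_def)
 ultimately show ?thesis by blast
qed

text \<open>Adding one element of \<open>L'\<close> to \<open>L\<close> and saturating costs at most
  one in rank, so the result cannot reach \<open>L'\<close>.\<close>

lemma point_gap_same_face:
 assumes d: "tdata T L \<phi>" and d': "tdata T L' \<phi>'"
  and sub: "tcong T L \<phi> < tcong T L' \<phi>'"
  and rk: "point_rank (tcong T L' \<phi>') + 2 <= point_rank (tcong T L \<phi>)"
 shows "EX s:Pts. tcong T L \<phi> < s & s < tcong T L' \<phi>'"
proof -
 note D = tcong_subsetD[OF d d' psubset_imp_subset[OF sub]]
 note T = tdataD(1)[OF d] and Q = zsubgroup_diff_group[OF tdataD(1)[OF d]]
 have LL: "L <= L'" and eq: "!!x. x : L ==> \<phi>' x = \<phi> x" using D(3) tdataD(3)[OF d] by auto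
 have "L ~= L'" using rk point_rank_tcong[OF d] point_rank_tcong[OF d'] by auto
 then obtain g where g: "g : L'" "g ~: L" using LL by auto
 have gQ: "g : diff_group T" using g(1) tdataD(3)[OF d'] by auto
 define L1 where "L1 = sat_closure (diff_group T) L g"
 note S = sat_closure[OF Q tdataD(2)[OF d] tdataD(3)[OF d] gQ, folded L1_def]
 have L1L': "L1 <= L'"
 proof
  fix z assume "z : L1"
  then obtain n k where z: "z : diff_group T" "n ~= 0" "zmul n z - zmul k g : L"
   by (auto simp: L1_def sat_closure_def)
  have "(zmul n z - zmul k g) + zmul k g : L'"
   using z(3) LL by (intro zsubgroup_add[OF tdataD(2)[OF d']] zsubgroup_mul[OF tdataD(2)[OF d']] g) auto
  hence "zmul n z : L'" by simp
  thus "z : L'" using zmul_difference_mem[OF tdataD(4)[OF d'] z(1,2)] by simp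
 qed
 have d1: "tdata T L1 \<phi>'" unfolding tdata_def
 proof (intro conjI ballI T S)
  show "\<phi>' x : Units F" if "x : L1" for x using tdataD(5)[OF d'] that L1L' by auto
  show "\<phi>' (x + y) = \<phi>' x *[F] \<phi>' y" if "x : L1" "y : L1" for x y
   using tdataD(6)[OF d'] that L1L' by auto
 qed
 have "tcong T L \<phi> <= tcong T L1 \<phi>'" by (rule tcong_subsetI[OF d d1]) (use S eq in auto)
 moreover have "tcong T L \<phi> ~= tcong T L1 \<phi>'" using tcong_inject(2)[OF d d1] S(3) g(2) by auto
 moreover have "tcong T L1 \<phi>' <= tcong T L' \<phi>'" by (rule tcong_subsetI[OF d1 d']) (use L1L' in auto)
 moreover have "tcong T L1 \<phi>' ~= tcong T L' \<phi>'"
 proof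
  assume e: "tcong T L1 \<phi>' = tcong T L' \<phi>'"
  have "zrank (diff_group T) L <= Suc (zrank (diff_group T) L1)"
  proof (rule zrank_drop[OF diff_group_M[OF T] tdataD(2)[OF d] zsubgroup_zero[OF S(1)]])
   show "EX n k. n ~= 0 & zmul n z - zmul k g : L" if "z : L1" for z
    using that by (auto simp: L1_def sat_closure_def)
  qed
  thus False using rk e point_rank_tcong[OF d] point_rank_tcong[OF d1] by simp
 qed
 ultimately show ?thesis using tcong_point[OF d1] by blast
qed

text \<open>For different faces there are two candidates. One passes to \<open>T'\<close> with the
  relations of \<open>L\<close> that live there. If this is already the larger point, the other
  keeps \<open>T\<close> and adds to \<open>L\<close> an element \<open>g\<close> of the kernel of a
  supporting functional that is independent of \<open>L\<close> and \<open>T'\<close> together; the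
  constants for the new relations come from \<open>extend_phi\<close>.\<close>

lemma point_gap:
 assumes "c : Pts" "c' : Pts" and cc: "c < c'" and rk: "point_rank c' + 2 <= point_rank c"
 shows "EX s:Pts. c < s & s < c'"
proof -
 obtain T L \<phi> where d: "tdata T L \<phi>" "c = tcong T L \<phi>" using point_tcong[OF assms(1)] by auto
 obtain T' L' \<phi>' where d': "tdata T' L' \<phi>'" "c' = tcong T' L' \<phi>'" using point_tcong[OF assms(2)] by auto
 have sub: "tcong T L \<phi> <= tcong T' L' \<phi>'" using cc d d' by auto
 note D = tcong_subsetD[OF d(1) d'(1) sub]
 note T = tdataD(1)[OF d(1)] and T' = tdataD(1)[OF d'(1)]
 note Q = zsubgroup_diff_group[OF T] and Q' = zsubgroup_diff_group[OF T']
 note L = tdataD(2)[OF d(1)]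
 show ?thesis
 proof (cases "T = T'")
  case True
  thus ?thesis using point_gap_same_face[OF d(1), of L' \<phi>'] d d' cc rk by simp
 next
  case False
  \<comment> \<open>The smallest point above \<open>c\<close> with face \<open>T'\<close>.\<close>
  define L0 where "L0 = L Int diff_group T'"
  have L0: "zsubgroup L0"
   by (rule zsubgroupI) (auto simp: L0_def zsubgroup_zero[OF L] zsubgroup_zero[OF Q'] zsubgroup_add[OF L]
     zsubgroup_add[OF Q'] zsubgroup_mul[OF L] zsubgroup_mul[OF Q'])
  have QQ: "diff_group T' <= diff_group T" by (rule diff_group_mono[OF D(1)])
  have d0: "tdata T' L0 \<phi>" unfolding tdata_def
  proof (intro conjI ballI)
   show "zsaturated (diff_group T') L0" unfolding zsaturated_def
   proof (intro ballI allI impI)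
    fix x n assume x: "x : diff_group T'" "n ~= 0" "zmul n x : L0"
    hence "x : L" using zmul_difference_mem[OF tdataD(4)[OF d(1)], of x n] QQ by (auto simp: L0_def)
    thus "x : L0" using x by (simp add: L0_def)
   qed
  qed (use T' L0 tdataD(5,6)[OF d(1)] in \<open>auto simp: L0_def\<close>)
  have c0: "tcong T L \<phi> <= tcong T' L0 \<phi>" by (rule tcong_subsetI[OF d(1) d0 D(1,2)]) (auto simp: L0_def)
  have n0: "tcong T L \<phi> ~= tcong T' L0 \<phi>" using tcong_inject(1)[OF d(1) d0] False by auto
  have c0': "tcong T' L0 \<phi> <= tcong T' L' \<phi>'"
   by (rule tcong_subsetI[OF d0 d'(1)]) (use D(3) in \<open>auto simp: L0_def\<close>)
  show ?thesis
  proof (cases "tcong T' L0 \<phi> = tcong T' L' \<phi>'")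
   case False
   thus ?thesis using c0 n0 c0' tcong_point[OF d0] d d' by blast
  next
   case True
   hence rk0: "zrank (diff_group T') L0 + 2 <= zrank (diff_group T) L"
    using rk point_rank_tcong[OF d(1)] point_rank_tcong[OF d0] True d(2) d'(2) by simp
   have pull: "s : T'" if "s : T" "t : T" "s - t : L" "t : T'" for s t using D(2)[OF that(1-3)] that(4) by simp
   have "EX u. zlinear_on M u & (ALL x:L. u x = 0) & (ALL x:diff_group T'. u x = 0) & (ALL s:T. u s = 0 \<longleftrightarrow> s : T')"
    by (rule supporting_functional[OF T T' D(1) L tdataD(3)[OF d(1)]]) (rule pull)
   then obtain u where u: "zlinear_on M u" "!!x. x : L ==> u x = 0" "!!x. x : diff_group T' ==> u x = 0"
    "!!s. s : T ==> u s = 0 \<longleftrightarrow> s : T'" by blast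
   \<comment> \<open>Such a \<open>g\<close> exists because the ranks differ by two, while one is
     lost to the equation \<open>u g = 0\<close>.\<close>
   obtain g where g: "g : diff_group T" "u g = 0"
    "!!n y l. n ~= 0 ==> y : diff_group T' ==> l : L ==> zmul n g ~= y + l"
    using zrank_kernel_element[OF Q diff_group_M[OF T] QQ L Q' u(1) rk0[unfolded L0_def]] by blast
   define L1 where "L1 = sat_closure (diff_group T) L g"
   note S = sat_closure[OF Q L tdataD(3)[OF d(1)] g(1), folded L1_def]
   obtain \<psi> where \<psi>: "!!x. x : L1 ==> \<psi> x : Units F" "!!x y. x : L1 ==> y : L1 ==> \<psi> (x + y) = \<psi> x *[F] \<psi> y"
    "!!x. x : L ==> \<psi> x = \<phi> x" using extend_phi[OF d(1) S(1,2)] by blast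
   have d1: "tdata T L1 \<psi>" unfolding tdata_def using T S \<psi>(1,2) by blast
   have QM: "diff_group T <= M" by (rule diff_group_M[OF T])
   have lin: "u (zmul n x - zmul k y) = n * u x - k * u y" if "x : M" "y : M" for n x k y
    using zlinear_onD[OF u(1) that, of n "- k"] by (simp add: zcomb_alt zmul_algebra)
   have uL1: "u z = 0" if "z : L1" for z
   proof -
    obtain n k where z: "z : diff_group T" "n ~= 0" "zmul n z - zmul k g : L"
     using \<open>z : L1\<close> by (auto simp: L1_def sat_closure_def)
    have "n * u z - k * u g = 0" using u(2)[OF z(3)] lin[of z g n k] z(1) g(1) QM by auto
    thus ?thesis using g(2) z(2) by simp
   qed
   have "tcong T L \<phi> <= tcong T L1 \<psi>" by (rule tcong_subsetI[OF d(1) d1]) (use S \<psi>(3) in auto)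
   moreover have "tcong T L \<phi> ~= tcong T L1 \<psi>"
   proof
    assume "tcong T L \<phi> = tcong T L1 \<psi>"
    hence "g : L" using tcong_inject(2)[OF d(1) d1] S(3) by simp
    thus False using g(3)[of 1 0 g] zsubgroup_zero[OF Q'] by simp
   qed
   moreover have "tcong T L1 \<psi> <= tcong T' L0 \<phi>"
   proof (rule tcong_subsetI[OF d1 d0 D(1)])
    fix s t assume st: "s : T" "t : T" "s - t : L1"
    \<comment> \<open>Elements related by \<open>L1\<close> have the same value of \<open>u\<close>,
      and this value decides about membership in \<open>T'\<close>.\<close>
    hence "u s = u t" using uL1[OF st(3)] lin[of s t 1 1] monoid_faceD(1)[OF T] SD(1) by auto
    thus "s : T' \<longleftrightarrow> t : T'" using u(4) st by metis
   next
    fix x assume x: "x : L1" "x : diff_group T'"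
    then obtain n k where n: "n ~= 0" "zmul n x - zmul k g : L" by (auto simp: L1_def sat_closure_def)
    \<comment> \<open>Otherwise a nonzero multiple of \<open>g\<close> would lie in the group of
      \<open>T'\<close> plus \<open>L\<close>, against the choice of \<open>g\<close>. So
      \<open>L1\<close> adds no relation between elements of \<open>T'\<close>.\<close>
    have "k = 0"
    proof (rule ccontr)
     assume k: "k ~= 0"
     have "zmul k g = zmul n x + - (zmul n x - zmul k g)" by simp
     thus False using g(3)[OF k zsubgroup_mul[OF Q' x(2), of n] zsubgroup_uminus[OF L n(2)]] by simp
    qed
    hence "x : L" using n zmul_difference_mem[OF tdataD(4)[OF d(1)], of x n] x(2) QQ by auto
    thus "x : L0 & \<phi> x = \<psi> x" using \<psi>(3) x(2) by (simp add: L0_def)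
   qed
   moreover have "tcong T L1 \<psi> ~= tcong T' L0 \<phi>" using tcong_inject(1)[OF d1 d0] False by auto
   ultimately show ?thesis using tcong_point[OF d1] d d' True by blast
  qed
 qed
qed

lemma point_rank_le: "c : Pts ==> point_rank c <= card B"
 using point_tcong point_rank_tcong zrank_le_card[OF diff_group_M zsubgroup_zero] tdataD(1,2) by metis

lemma SCong_grading:
 "\<exists>\<rho>. grading (SCong_top F (monoid_alg_const F) A) \<rho> {T. irreducible_closed (SCong_top F (monoid_alg_const F) A) T}"
 unfolding A.SCong_top_avoid using A.grading_points[of point_rank, OF point_rank_mono point_gap] by blast

lemma SCong_krull_dim_le: "krull_dim (SCong_top F (monoid_alg_const F) A) <= ereal (card B)"
 unfolding A.SCong_top_avoid by (rule A.krull_dim_le_points[OF point_rank_mono point_rank_le])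

text \<open>With \<open>G\<close> empty, \<open>S\<close> is all of \<open>M\<close>, as for the
  zero cone. The chain consists of the full face with the functionals that vanish at the first
  \<open>i\<close> basis vectors and trivial constants; elements of a dual basis make the inclusions
  strict.\<close>

lemma SCong_krull_dim_ge:
 assumes top: "G = {}" and n: "card B = n" and b: "bij_betw b {..<n} B"
  and dual: "!!i. i < n ==> EX m:M. ALL j<n. m (b j) = (if j = i then 1 else 0)"
 shows "ereal (card B) <= krull_dim (SCong_top F (monoid_alg_const F) A)" unfolding A.SCong_top_avoid n
proof (rule A.krull_dim_ge_points)
 have SM: "S = M" using S_def top by simp
 have QM: "diff_group M = M" using zsubgroup_diff[OF M] zsubgroup_zero[OF M] by (force simp: diff_group_def)
 define L where "L i = {m : M. ALL j<i. m (b j) = 0}" for i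
 have d: "tdata M (L i) (%_. 1[F])" for i unfolding tdata_def
 proof (intro conjI ballI)
  show "monoid_face S M" using monoid_face_self SM by simp
  show "zsubgroup (L i)"
   by (rule zsubgroupI) (auto simp: L_def zmul_def zsubgroup_zero[OF M] zsubgroup_add[OF M]
     zsubgroup_mul[OF M, unfolded zmul_def])
  show "L i <= diff_group M" by (auto simp: L_def QM)
  show "zsaturated (diff_group M) (L i)" by (auto simp: zsaturated_def L_def zmul_def QM)
 qed auto
 show "tcong M (L i) (%_. 1[F]) : Pts" for i by (rule tcong_point[OF d])
 fix i assume i: "i < n"
 have "L (Suc i) <= L i" by (auto simp: L_def)
 hence "tcong M (L (Suc i)) (%_. 1[F]) <= tcong M (L i) (%_. 1[F])" by (intro tcong_subsetI[OF d d]) auto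
 moreover obtain m where m: "m : M" "ALL j<n. m (b j) = (if j = i then 1 else 0)" using dual[OF i] by auto
 hence "m : L i" "m ~: L (Suc i)" using i by (auto simp: L_def)
 hence "tcong M (L (Suc i)) (%_. 1[F]) ~= tcong M (L i) (%_. 1[F])" using tcong_inject(2)[OF d d] by metis
 ultimately show "tcong M (L (Suc i)) (%_. 1[F]) < tcong M (L i) (%_. 1[F])" by blast
qed

end

section \<open>Cones and fans\<close>

definition cone_hull :: "'v::real_vector set => 'v set" where
 "cone_hull G = {SUM g:G. c g *\<^sub>R g | c. ALL g:G. c g >= 0}"

lemma cone_hull_mem:
 assumes "finite G" "g : G"
 shows "g : cone_hull G"
proof -
 have "(SUM x:G. (if x = g then 1 else 0) *\<^sub>R x) = (SUM x:G. if x = g then x else 0)"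
  by (intro sum.cong) auto
 also have "\<dots> = g" using assms by simp
 finally show ?thesis unfolding cone_hull_def by (intro CollectI exI[of _ "%x. if x = g then 1 else 0"]) auto
qed

lemma linear_cone_sum: "linear m ==> m (SUM g:G. c g *\<^sub>R g) = (SUM g:G. c g * m g)" for m :: "'v::real_vector => real"
 by (simp add: linear_sum linear_scale)

lemma cone_hull_nonneg:
 assumes "linear (m :: 'v::real_vector => real)" "!!g. g : G ==> 0 <= m g" "u : cone_hull G"
 shows "0 <= m u" using assms by (auto simp: cone_hull_def linear_cone_sum intro!: sum_nonneg)

text \<open>A sum of nonnegative terms vanishes only if each term does, so generators outside the
  kernel of \<open>m\<close> occur with coefficient 0.\<close>

lemma cone_hull_face:
 assumes G: "finite G" and m: "linear (m :: 'v::real_vector => real)" "!!g. g : G ==> 0 <= m g"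
 shows "cone_hull G Int {u. m u = 0} = cone_hull {g : G. m g = 0}"
proof (intro equalityI subsetI)
 fix u assume "u : cone_hull G Int {u. m u = 0}"
 then obtain c where c: "u = (SUM g:G. c g *\<^sub>R g)" "ALL g:G. c g >= 0" "m u = 0" by (auto simp: cone_hull_def)
 have "(SUM g:G. c g * m g) = 0" using c linear_cone_sum[OF m(1)] by simp
 hence z: "c g * m g = 0" if "g : G" for g
  using sum_nonneg_eq_0_iff[OF G, of "%g. c g * m g"] c(2) m(2) that by auto
 have "u = (SUM g:{g : G. m g = 0}. c g *\<^sub>R g)"
  unfolding c(1) using z G by (intro sum.mono_neutral_right) auto
 thus "u : cone_hull {g : G. m g = 0}" using c(2) by (auto simp: cone_hull_def)
next
 fix u assume "u : cone_hull {g : G. m g = 0}"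
 then obtain c where c: "u = (SUM g:{g : G. m g = 0}. c g *\<^sub>R g)" "ALL g:{g : G. m g = 0}. c g >= 0"
  by (auto simp: cone_hull_def)
 define c' where "c' g = (if m g = 0 then c g else 0)" for g
 have "u = (SUM g:G. c' g *\<^sub>R g)"
  unfolding c(1) using G by (intro sum.mono_neutral_cong_left) (auto simp: c'_def)
 moreover have "ALL g:G. c' g >= 0" using c(2) by (auto simp: c'_def)
 ultimately show "u : cone_hull G Int {u. m u = 0}"
  using linear_cone_sum[OF m(1), of c' G] by (auto simp: cone_hull_def c'_def intro!: sum.neutral)
qed

lemma cone_face_hull:
 assumes "finite G"
 shows "cone_face D (cone_hull G) \<longleftrightarrow>
  (EX m :: 'v::real_vector => real. linear m & (ALL g:G. 0 <= m g) & D = cone_hull G Int {u. m u = 0})"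
proof -
 have "m : dual_cone (cone_hull G) \<longleftrightarrow> linear m & (ALL g:G. 0 <= m g)" for m :: "'v => real"
  unfolding dual_cone_def using cone_hull_nonneg[of m G] cone_hull_mem[OF assms] by blast
 thus ?thesis by (simp add: cone_face_def Bex_def conj_assoc)
qed

locale lattice_basis =
 fixes N :: "'v::real_vector set" and B :: "'v set"
 assumes B_finite: "finite B" and B_indep: "independent B" and B_span: "span B = UNIV"
  and N_def: "N = {SUM b:B. of_int (c b) *\<^sub>R b | c :: 'v => int. True}"
begin

abbreviation "M \<equiv> dual_lattice N"

lemma M_linear: "m : M ==> linear m" by (simp add: dual_lattice_def)
lemma M_int: "m : M ==> v : N ==> m v : \<int>" by (auto simp: dual_lattice_def)

lemma B_subset_N: "B <= N"
proof
 fix b assume b: "b : B"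
 have "(SUM x:B. of_int (if x = b then 1 else 0) *\<^sub>R x) = (SUM x:B. if x = b then x else 0)"
  by (intro sum.cong) auto
 also have "\<dots> = b" using B_finite b by simp
 finally show "b : N" unfolding N_def by (intro CollectI exI[of _ "%x. if x = b then 1 else 0"]) auto
qed

lemma M_iff: "m : M \<longleftrightarrow> linear m & (ALL b:B. m b : \<int>)"
proof
 assume "m : M"
 thus "linear m & (ALL b:B. m b : \<int>)" using M_linear M_int B_subset_N by blast
next
 assume m: "linear m & (ALL b:B. m b : \<int>)"
 have "m (SUM b:B. of_int (c b) *\<^sub>R b) : \<int>" for c
  using m linear_cone_sum[of m "%b. of_int (c b)" B] by (auto intro!: Ints_sum Ints_mult)
 thus "m : M" using m by (auto simp: dual_lattice_def N_def)
qed

lemma functional_lattice: "functional_lattice M B"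
proof
 show "zsubgroup M"
 proof (rule zsubgroupI)
  show "0 : M" by (auto simp: M_iff zero_fun_def linear_zero)
  show "x + y : M" if "x : M" "y : M" for x y using that by (auto simp: M_iff plus_fun_def linear_compose_add)
  show "zmul n x : M" if "x : M" for x n
   using that linear_compose_scale_right[of x "of_int n"] by (auto simp: M_iff zmul_def)
 qed
 show "m = 0" if m: "m : M" "!!b. b : B ==> m b = 0" for m
 proof
  fix v
  have "v : span B" using B_span by simp
  thus "m v = 0 v" using linear_eq_0_on_span[OF M_linear[OF m(1)] m(2)] by simp
 qed
qed (use B_finite M_int B_subset_N in auto)

sublocale functional_lattice M B by (rule functional_lattice)

lemma dual_basis:
 assumes "b : B"
 shows "EX m:M. ALL b':B. m b' = (if b' = b then 1 else 0)"
proof -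
 obtain m :: "'v => real" where m: "linear m" "ALL x:B. m x = (if x = b then 1 else 0)"
  using linear_independent_extend[OF B_indep, of "%x. if x = b then 1 else 0"] by auto
 hence "m : M" by (auto simp: M_iff)
 thus ?thesis using m by blast
qed

lemma M_separates:
 assumes "!!m. m : M ==> m v = 0"
 shows "v = 0"
proof -
 obtain c where c: "v = (SUM b:B. c b *\<^sub>R b)"
  using B_span span_finite[OF B_finite] by (metis (no_types, lifting) UNIV_I imageE)
 have "c b = 0" if b: "b : B" for b
 proof -
  obtain m where m: "m : M" "ALL b':B. m b' = (if b' = b then 1 else 0)" using dual_basis[OF b] by auto
  have "m v = (SUM b':B. if b' = b then c b' else 0)"
   unfolding c linear_cone_sum[OF M_linear[OF m(1)]] using m(2) by (intro sum.cong) auto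
  also have "\<dots> = c b" using b B_finite by simp
  finally show ?thesis using assms[OF m(1)] by simp
 qed
 thus ?thesis unfolding c by (intro sum.neutral) auto
qed

text \<open>By Farkas' lemma, the only obstruction to a lattice functional that is zero on \<open>I\<close> and
 positive on the other generators is that the inverse of one of these lies in the cone
 generated by \<open>G\<close> and \<open>- I\<close>.\<close>

lemma positive_functional:
 assumes G: "finite G" "G <= N" and I: "I <= G"
  and no: "!!k n c c'. k : G - I ==> (n::real) > 0 ==> (!!v. v : G ==> (c v :: real) >= 0) ==>
   - n *\<^sub>R k = (SUM v:G. c v *\<^sub>R v) - (SUM v:I. c' v *\<^sub>R v) ==> False"
 shows "EX h:M. (ALL v:G. 0 <= h v) & (ALL v:I. h v = 0) & (ALL v:G - I. 0 < h v)"
proof -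
 have fl: "of_int \<lfloor>m v\<rfloor> = m v" if "m : M" "v : N" for m v using M_int[OF that] by (auto elim: Ints_cases)
 have lin: "zlinear_on M (%m. \<lfloor>m v\<rfloor>)" if v: "v : N" for v unfolding zlinear_on_def
 proof (intro ballI allI)
  fix x y a b assume xy: "x : M" "y : M"
  have "of_int \<lfloor>zcomb a x b y v\<rfloor> = (of_int (a * \<lfloor>x v\<rfloor> + b * \<lfloor>y v\<rfloor>) :: real)"
   unfolding of_int_add of_int_mult fl[OF zsubgroup_zcomb[OF M xy] v] fl[OF xy(1) v] fl[OF xy(2) v]
   by (simp add: zcomb_def)
  thus "\<lfloor>zcomb a x b y v\<rfloor> = a * \<lfloor>x v\<rfloor> + b * \<lfloor>y v\<rfloor>" by (simp only: of_int_eq_iff)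
 qed
 have ex: "EX h:M. (ALL v:G. 0 <= h v) & (ALL v:I. h v = 0) & 0 < h k" if k: "k : G - I" for k
 proof (rule ccontr)
  assume none: "~ ?thesis"
  \<comment> \<open>The tag \<open>False\<close> adds the reversed inequalities on \<open>I\<close>,
    so that the constraints there become equations.\<close>
  define J where "J = {True} \<times> G Un {False} \<times> I"
  define g where "g = (%(s, v) (m :: 'v => real). if s then \<lfloor>m v\<rfloor> else - \<lfloor>m v\<rfloor>)"
  have I': "finite I" using I G(1) finite_subset by blast
  have "EX n>0. EX c. (ALL i:J. 0 <= c i) & (ALL m:M. n * (- \<lfloor>m k\<rfloor>) = (SUM i:J. c i * g i m))"
  proof (rule int_farkas[OF _ M])
   show "finite J" using G(1) I' by (simp add: J_def)
   show "zlinear_on M (%m. - \<lfloor>m k\<rfloor>)" using lin[of k] k G(2) unfolding zlinear_on_def by auto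
   show "zlinear_on M (g i)" if "i : J" for i
    using lin[of "snd i"] that G(2) I unfolding zlinear_on_def g_def J_def by (cases i) auto
   fix m assume m: "m : M" "!!i. i : J ==> 0 <= g i m"
   have "0 <= m v" if "v : G" for v using m(2)[of "(True, v)"] that by (auto simp: J_def g_def)
   moreover have "m v = 0" if "v : I" for v
   proof -
    have "(True, v) : J" "(False, v) : J" using that I by (auto simp: J_def)
    from m(2)[OF this(1)] m(2)[OF this(2)] have "0 <= \<lfloor>m v\<rfloor>" "0 <= - \<lfloor>m v\<rfloor>" unfolding g_def by (simp_all only: prod.case if_True if_False)
    hence "\<lfloor>m v\<rfloor> = 0" by linarith
    thus ?thesis using fl[OF m(1), of v] that I G(2) by auto
   qed
   ultimately have "~ 0 < m k" using none m(1) by blast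
   hence "m k <= 0" by simp
   thus "0 <= - \<lfloor>m k\<rfloor>" by (simp add: floor_le_iff)
  qed
  then obtain n c where n0: "n > 0" "ALL i:J. 0 <= c i" "ALL m:M. n * (- \<lfloor>m k\<rfloor>) = (SUM i:J. c i * g i m)"
   by (elim exE conjE)
  have n: "n > 0" "!!i. i : J ==> 0 <= c i" "!!m. m : M ==> n * (- \<lfloor>m k\<rfloor>) = (SUM i:J. c i * g i m)"
   using n0 by simp_all
  \<comment> \<open>Farkas' relation says that every lattice functional kills this vector. Hence it
    is 0, which is the obstruction excluded by \<open>no\<close>.\<close>
  define w where "w = of_int n *\<^sub>R k + (SUM v:G. of_int (c (True, v)) *\<^sub>R v) - (SUM v:I. of_int (c (False, v)) *\<^sub>R v)"
  have "m w = 0" if m: "m : M" for m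
  proof -
   have "(SUM i:J. c i * g i m) = (SUM i:{True} \<times> G. c i * g i m) + (SUM i:{False} \<times> I. c i * g i m)"
    unfolding J_def using G(1) I' by (intro sum.union_disjoint) auto
   also have "(SUM i:{True} \<times> G. c i * g i m) = (SUM v:G. c (True, v) * \<lfloor>m v\<rfloor>)"
    by (rule sum.reindex_bij_witness[of _ "Pair True" snd]) (auto simp: g_def)
   also have "(SUM i:{False} \<times> I. c i * g i m) = (SUM v:I. c (False, v) * - \<lfloor>m v\<rfloor>)"
    by (rule sum.reindex_bij_witness[of _ "Pair False" snd]) (auto simp: g_def)
   finally have "n * (- \<lfloor>m k\<rfloor>) = (SUM v:G. c (True, v) * \<lfloor>m v\<rfloor>) + (SUM v:I. c (False, v) * - \<lfloor>m v\<rfloor>)"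
    using n(3)[OF m] by simp
   hence "(of_int (n * (- \<lfloor>m k\<rfloor>)) :: real) = of_int ((SUM v:G. c (True, v) * \<lfloor>m v\<rfloor>) + (SUM v:I. c (False, v) * - \<lfloor>m v\<rfloor>))"
    by (simp only:)
   moreover have "(of_int (n * (- \<lfloor>m k\<rfloor>)) :: real) = - (of_int n * m k)" using fl[OF m, of k] k G(2) by auto
   moreover have "(of_int (SUM v:G. c (True, v) * \<lfloor>m v\<rfloor>) :: real) = (SUM v:G. of_int (c (True, v)) * m v)"
    using fl[OF m] G(2) by (auto intro!: sum.cong)
   moreover have "(of_int (SUM v:I. c (False, v) * - \<lfloor>m v\<rfloor>) :: real) = - (SUM v:I. of_int (c (False, v)) * m v)"
    using fl[OF m] G(2) I by (auto intro!: sum.cong simp: sum_negf[symmetric])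
   moreover have "m w = of_int n * m k + (SUM v:G. of_int (c (True, v)) * m v) - (SUM v:I. of_int (c (False, v)) * m v)"
    unfolding w_def linear_diff[OF M_linear[OF m]] linear_add[OF M_linear[OF m]] linear_cone_sum[OF M_linear[OF m]]
    by (simp add: linear_scale[OF M_linear[OF m]])
   ultimately show ?thesis unfolding of_int_add by linarith
  qed
  hence "w = 0" by (rule M_separates)
  hence "- of_int n *\<^sub>R k = (SUM v:G. of_int (c (True, v)) *\<^sub>R v) - (SUM v:I. of_int (c (False, v)) *\<^sub>R v)"
   unfolding w_def by (simp add: algebra_simps)
  thus False using no[OF k, of "of_int n" "%v. of_int (c (True, v))" "%v. of_int (c (False, v))"] n(1,2)
   by (auto simp: J_def)
 qed
 have "EX h:M. (ALL v:G. 0 <= h v) & (ALL v:I. h v = 0) & (ALL v:K. 0 < h v)" if "finite K" "K <= G - I" for K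
  using that
 proof (induction K rule: finite_induct)
  case empty
  show ?case using zsubgroup_zero[OF M] by (intro bexI[of _ 0]) auto
 next
  case (insert k K)
  then obtain h where h: "h : M" "ALL v:G. 0 <= h v" "ALL v:I. h v = 0" "ALL v:K. 0 < h v" by auto
  obtain h' where h': "h' : M" "ALL v:G. 0 <= h' v" "ALL v:I. h' v = 0" "0 < h' k" using ex[of k] insert.prems by auto
  have "0 < (h + h') v" if "v : insert k K" for v
  proof (cases "v = k")
   case True
   thus ?thesis using h(2) h'(4) insert.prems by (auto intro!: add_nonneg_pos)
  next
   case False
   hence "v : K" "v : G" using that insert.prems by auto
   thus ?thesis using h(4) h'(2) by (auto intro!: add_pos_nonneg)
  qed
  thus ?case using zsubgroup_add[OF M h(1) h'(1)] h h' by (intro bexI[of _ "h + h'"]) auto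
 qed
 from this[of "G - I"] show ?thesis using G(1) by auto
qed

end

locale toric_fan = lattice_basis N B for N :: "'v::real_vector set" and B :: "'v set" +
 fixes \<Sigma> :: "'v set set"
 assumes fan: "fan N \<Sigma>"
begin

lemma fan_face: "C : \<Sigma> ==> cone_face D C ==> D : \<Sigma>" using fan unfolding fan_def by blast

lemma fan_Int: "C : \<Sigma> ==> D : \<Sigma> ==> cone_face (C Int D) C & cone_face (C Int D) D"
 using fan unfolding fan_def by blast

lemma face_subset: "cone_face D C ==> D <= C" by (auto simp: cone_face_def)

text \<open>If one cone of a fan contains another, their intersection is the smaller one and hence a
  face. Replacing the face relation by inclusion makes transitivity immediate.\<close>

lemma face_rel_iff: "(D, C) : face_rel \<Sigma> \<longleftrightarrow> D : \<Sigma> & C : \<Sigma> & D <= C"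
proof -
 have "cone_face D C" if "D : \<Sigma>" "C : \<Sigma>" "D <= C"
  using fan_Int[OF that(1,2)] that(3) by (simp add: Int_absorb2)
 thus ?thesis using face_subset by (auto simp: face_rel_def)
qed

lemma fan_Int_mem: "C : \<Sigma> ==> D : \<Sigma> ==> C Int D : \<Sigma>" using fan_Int fan_face by blast

abbreviation "CM \<equiv> cone_monoid N"

definition gens :: "'v set => 'v set" where
 "gens C = (SOME G. finite G & G <= N & C = cone_hull G)"

lemma gens:
 assumes "C : \<Sigma>"
 shows "finite (gens C)" "gens C <= N" "C = cone_hull (gens C)"
proof -
 have "EX G. finite G & G <= N & C = cone_hull G"
  using fan assms unfolding fan_def rational_polyhedral_cone_def cone_hull_def by blast
 from someI_ex[OF this] show "finite (gens C)" "gens C <= N" "C = cone_hull (gens C)"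
  by (simp_all add: gens_def)
qed

lemma gens_subset: "C : \<Sigma> ==> gens C <= C" using cone_hull_mem[OF gens(1)] gens(3) by blast

lemma cone_monoid_hull:
 assumes "finite G"
 shows "CM (cone_hull G) = {m : M. ALL v:G. 0 <= m v}"
proof -
 have "m : dual_cone (cone_hull G) \<longleftrightarrow> (ALL v:G. 0 <= m v)" if m: "m : M" for m
  unfolding dual_cone_def using cone_hull_nonneg[OF M_linear[OF m], of G] cone_hull_mem[OF assms] M_linear[OF m] by blast
 thus ?thesis unfolding cone_monoid_def by blast
qed

lemma cone_monoid_eq: "C : \<Sigma> ==> CM C = {m : M. ALL v:gens C. 0 <= m v}"
 by (subst gens(3), assumption, rule cone_monoid_hull[OF gens(1)])

lemma cone_lattice: "C : \<Sigma> ==> cone_lattice M B (gens C) (CM C)"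
 using gens(1) M_int subsetD[OF gens(2)] cone_monoid_eq
 by (intro cone_lattice.intro cone_lattice_axioms.intro functional_lattice) auto

lemma CM_zero: "C : \<Sigma> ==> 0 : CM C" and CM_add: "C : \<Sigma> ==> s : CM C ==> t : CM C ==> s + t : CM C"
 using cone_lattice.S_zero[OF cone_lattice] cone_lattice.S_add[OF cone_lattice] by blast+

lemma CM_subset: "CM C <= M" by (auto simp: cone_monoid_def)

lemma CM_antimono: "D <= C ==> CM C <= CM D" by (auto simp: cone_monoid_def dual_cone_def)

text \<open>Inverting the character of \<open>h\<close> means passing to the face on which
  \<open>h\<close> vanishes: functionals that are nonnegative there become nonnegative on the whole
  cone after adding a multiple of \<open>h\<close>, by \<open>scale_dominates\<close>.\<close>

lemma CM_localization:
 assumes C: "C : \<Sigma>" and h: "h : CM C"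
 shows "C Int {u. h u = 0} : \<Sigma>"
  and "CM (C Int {u. h u = 0}) = {m : M. EX k::nat. m + zmul (int k) h : CM C}"
proof -
 interpret cone_lattice M B "gens C" "CM C" by (rule cone_lattice[OF C])
 have hM: "h : M" and hl: "linear h" and h0: "!!v. v : gens C ==> 0 <= h v" using SD h M_linear by auto
 have "cone_face (C Int {u. h u = 0}) C" using h unfolding cone_face_def cone_monoid_def by blast
 thus "C Int {u. h u = 0} : \<Sigma>" using fan_face[OF C] by blast
 have "C Int {u. h u = 0} = cone_hull {g : gens C. h g = 0}"
  using cone_hull_face[OF gens(1)[OF C] hl h0] gens(3)[OF C] by simp
 hence eq: "CM (C Int {u. h u = 0}) = {m : M. ALL v:gens C. h v = 0 --> 0 <= m v}"
  using cone_monoid_hull[of "{g : gens C. h g = 0}"] gens(1)[OF C] by auto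
 show "CM (C Int {u. h u = 0}) = {m : M. EX k::nat. m + zmul (int k) h : CM C}"
 proof (intro equalityI subsetI)
  fix m assume "m : CM (C Int {u. h u = 0})"
  thus "m : {m : M. EX k::nat. m + zmul (int k) h : CM C}" using scale_dominates[of m h] eq hM h0 by blast
 next
  fix m assume "m : {m : M. EX k::nat. m + zmul (int k) h : CM C}"
  then obtain k :: nat where k: "m : M" "m + zmul (int k) h : CM C" by auto
  have "0 <= m v" if "v : gens C" "h v = 0" for v using SD(2)[OF k(2) that(1)] that(2) by (simp add: zmul_def)
  thus "m : CM (C Int {u. h u = 0})" using eq k(1) by blast
 qed
qed

text \<open>The real functional \<open>m\<close> of the face is replaced by an integral one with the
  same zeros among the generators. The obstruction of \<open>positive_functional\<close> cannot
  occur, since \<open>m\<close> is negative on its left side and nonnegative on its right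
  side.\<close>

lemma face_lattice_functional:
 assumes C: "C : \<Sigma>" and D: "D : \<Sigma>" "D <= C"
 shows "EX h:CM C. D = C Int {u. h u = 0}"
proof -
 have "cone_face D C" using face_rel_iff C D by (auto simp: face_rel_def)
 hence "cone_face D (cone_hull (gens C))" using gens(3)[OF C] by simp
 then obtain m :: "'v => real" where m0: "linear m" "ALL g:gens C. 0 <= m g" "D = cone_hull (gens C) Int {u. m u = 0}"
  unfolding cone_face_hull[OF gens(1)[OF C]] by (elim exE conjE)
 have m: "linear m" "!!g. g : gens C ==> 0 <= m g" "D = C Int {u. m u = 0}" using m0 gens(3)[OF C] by auto
 define I where "I = {g : gens C. m g = 0}"
 have "EX h:M. (ALL v:gens C. 0 <= h v) & (ALL v:I. h v = 0) & (ALL v:gens C - I. 0 < h v)"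
 proof (rule positive_functional[OF gens(1,2)[OF C]])
  show "I <= gens C" by (auto simp: I_def)
  fix k n c c' assume k: "k : gens C - I" and n: "(n::real) > 0" "!!v. v : gens C ==> (c v :: real) >= 0"
   and eq: "- n *\<^sub>R k = (SUM v:gens C. c v *\<^sub>R v) - (SUM v:I. c' v *\<^sub>R v)"
  have "m (- n *\<^sub>R k) = (SUM v:gens C. c v * m v) - (SUM v:I. c' v * m v)"
   unfolding eq using m(1) by (simp add: linear_diff linear_cone_sum)
  also have "(SUM v:I. c' v * m v) = 0" by (intro sum.neutral) (auto simp: I_def)
  finally have "- n * m k = (SUM v:gens C. c v * m v)" using m(1) by (simp add: linear_neg linear_scale)
  moreover have "0 <= (SUM v:gens C. c v * m v)" using n(2) m(2) by (intro sum_nonneg) simp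
  moreover have "0 < m k" using k m(2)[of k] by (auto simp: I_def)
  ultimately show False using mult_pos_pos[OF n(1), of "m k"] by linarith
 qed
 then obtain h where h: "h : M" "!!v. v : gens C ==> 0 <= h v" "!!v. v : I ==> h v = 0"
  "!!v. v : gens C - I ==> 0 < h v" by blast
 have I_eq: "{g : gens C. h g = 0} = I" using h(3,4) by (force simp: I_def)
 have "D = cone_hull I" using m cone_hull_face[OF gens(1)[OF C] m(1,2)] gens(3)[OF C] by (simp add: I_def)
 also have "\<dots> = C Int {u. h u = 0}"
  using cone_hull_face[OF gens(1)[OF C] M_linear[OF h(1)] h(2)] gens(3)[OF C] I_eq by simp
 finally show ?thesis using cone_monoid_eq[OF C] h(1,2) by blast
qed

text \<open>Here \<open>I\<close> contains at most the generator 0. The obstruction of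
  \<open>positive_functional\<close> would put the line through a nonzero generator into the cone,
  which strong convexity forbids.\<close>

lemma zero_cone_mem:
 assumes C: "C : \<Sigma>"
 shows "{0} : \<Sigma>"
proof -
 have sc: "V = {0}" if "subspace V" "V <= C" for V
  using fan C that unfolding fan_def strongly_convex_def by blast
 define I where "I = {g : gens C. g = 0}"
 have "EX h:M. (ALL v:gens C. 0 <= h v) & (ALL v:I. h v = 0) & (ALL v:gens C - I. 0 < h v)"
 proof (rule positive_functional[OF gens(1,2)[OF C]])
  show "I <= gens C" by (auto simp: I_def)
  fix k n c c' assume k: "k : gens C - I" and n: "(n::real) > 0" "!!v. v : gens C ==> (c v :: real) >= 0"
   and eq: "- n *\<^sub>R k = (SUM v:gens C. c v *\<^sub>R v) - (SUM v:I. c' v *\<^sub>R v)"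
  have scale: "r *\<^sub>R u : C" if "u : C" "0 <= r" for u r
  proof -
   have "u : cone_hull (gens C)" using that(1) gens(3)[OF C] by simp
   then obtain a where "u = (SUM g:gens C. a g *\<^sub>R g)" "ALL g:gens C. 0 <= a g" by (auto simp: cone_hull_def)
   hence "r *\<^sub>R u = (SUM g:gens C. (r * a g) *\<^sub>R g)" "ALL g:gens C. 0 <= r * a g"
    using that(2) by (simp_all add: scaleR_sum_right)
   hence "r *\<^sub>R u : cone_hull (gens C)"
    unfolding cone_hull_def by (intro CollectI exI[of _ "%g. r * a g"] conjI)
   thus ?thesis using gens(3)[OF C] by simp
  qed
  have kc: "k : C" using k gens_subset[OF C] by auto
  have "(SUM v:I. c' v *\<^sub>R v) = 0" by (intro sum.neutral) (auto simp: I_def)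
  hence "- n *\<^sub>R k = (SUM v:gens C. c v *\<^sub>R v)" using eq by simp
  hence "- n *\<^sub>R k : cone_hull (gens C)"
   unfolding cone_hull_def using n(2) by (intro CollectI exI[of _ c] conjI) auto
  hence nk: "- n *\<^sub>R k : C" using gens(3)[OF C] by simp
  have "range (%r. r *\<^sub>R k) <= C"
  proof
   fix x assume "x : range (%r. r *\<^sub>R k)"
   then obtain r where r: "x = r *\<^sub>R k" by auto
   show "x : C"
   proof (cases "0 <= r")
    case False
    have "x = (- r / n) *\<^sub>R (- n *\<^sub>R k)" using n(1) r by simp
    moreover have "0 <= - r / n" using False n(1) by (intro divide_nonneg_pos) auto
    ultimately show ?thesis using scale[OF nk, of "- r / n"] by (simp only:)
   qed (use scale[OF kc] r in simp)
  qed
  moreover have "subspace (range (%r. r *\<^sub>R k))"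
   using subspace_span[of "{k}"] by (simp add: span_singleton)
  ultimately have "range (%r. r *\<^sub>R k) = {0}" using sc by blast
  hence "1 *\<^sub>R k = 0" by blast
  thus False using k by (simp add: I_def)
 qed
 then obtain h where h: "h : M" "!!v. v : gens C ==> 0 <= h v" "!!v. v : I ==> h v = 0"
  "!!v. v : gens C - I ==> 0 < h v" by blast
 have hC: "h : CM C" using cone_monoid_eq[OF C] h(1,2) by blast
 have "{g : gens C. h g = 0} = I" using h(3,4) by (force simp: I_def)
 hence "C Int {u. h u = 0} = cone_hull I"
  using cone_hull_face[OF gens(1)[OF C] M_linear[OF h(1)] h(2)] gens(3)[OF C] by simp
 also have "\<dots> = {0}" by (auto simp: cone_hull_def I_def intro!: sum.neutral exI[of _ "%_. 0"])
 finally show ?thesis using CM_localization(1)[OF C hC] by simp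
qed

lemma CM_zero_cone: "CM {0} = M" using M_linear by (auto simp: cone_monoid_def dual_cone_def linear_0)

text \<open>A face of the monoid consists of the elements that become invertible on a face of the
  cone; \<open>h\<close> is an element of \<open>T\<close> that is positive on all generators where
  \<open>T\<close> does not vanish.\<close>

lemma monoid_face_cone:
 assumes C: "C : \<Sigma>" and T: "monoid_face (CM C) T"
 shows "EX h:T. ALL m:CM C. m : T \<longleftrightarrow> - m : CM (C Int {u. h u = 0})"
proof -
 interpret cone_lattice M B "gens C" "CM C" by (rule cone_lattice[OF C])
 obtain h where h: "h : T" "!!v. v : gens C - vanishing T ==> 0 < h v" using face_positive_element[OF T] by auto
 have hC: "h : CM C" using h(1) monoid_faceD(1)[OF T] by auto
 have "m : T \<longleftrightarrow> - m : CM (C Int {u. h u = 0})" if m: "m : CM C" for m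
 proof
  assume mT: "m : T"
  have "EX k::nat. - m + zmul (int k) h : CM C"
  proof (rule scale_dominates)
   show "- m : M" "h : M" using m hC SD(1) zsubgroup_uminus[OF M] by auto
   show "0 <= h v" if "v : gens C" for v using SD(2)[OF hC that] .
   fix v assume v: "v : gens C" "h v = 0"
   hence "v : vanishing T" using h(2)[of v] by force
   thus "0 <= (- m) v" using mT by (auto simp: vanishing_def)
  qed
  moreover have "- m : M" using m SD(1) zsubgroup_uminus[OF M] by auto
  ultimately show "- m : CM (C Int {u. h u = 0})" using CM_localization(2)[OF C hC] by blast
 next
  assume "- m : CM (C Int {u. h u = 0})"
  then obtain k :: nat where k: "- m + zmul (int k) h : CM C" using CM_localization(2)[OF C hC] by blast
  have "m + (- m + zmul (int k) h) = zmul (int k) h" by simp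
  hence "m + (- m + zmul (int k) h) : T" using monoid_face_zmul[OF T h(1)] by simp
  thus "m : T" using monoid_faceD(4)[OF T m k] by blast
 qed
 thus ?thesis using h(1) by blast
qed

end

section \<open>Gluing along a fan\<close>

text \<open>The conditions are shared by the primes and the congruences of the monoid algebras and
  by the primes of the complex monoid rings. A point avoids \<open>el h\<close> when the character
  of \<open>h\<close> is not zero there, that is, when the point comes from the face cut out by
  \<open>h\<close>.\<close>

lemma (in toric_fan) fan_gluing:
 fixes P :: "'v set => 'e set set" and E :: "'v set => 'e set" and el :: "('v => real) => 'e"
 assumes avoid: "!!C. C : \<Sigma> ==> avoid_space (P C) (E C)"
  and mono: "!!C D. C : \<Sigma> ==> D : \<Sigma> ==> D <= C ==> E C <= E D"
  and el: "!!C h. C : \<Sigma> ==> h : CM C ==> el h : E C"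
  and el_add: "!!C h h' y. C : \<Sigma> ==> h : CM C ==> h' : CM C ==> y : P C ==> el h ~: y ==> el h' ~: y ==>
   el (h + h') ~: y"
  and restr: "!!C h x. C : \<Sigma> ==> h : CM C ==> x : P (C Int {u. h u = 0}) ==> x Int E C : P C & el h ~: x"
  and surj: "!!C h y. C : \<Sigma> ==> h : CM C ==> y : P C ==> el h ~: y ==>
   EX x:P (C Int {u. h u = 0}). x Int E C = y"
  and up: "!!C h e. C : \<Sigma> ==> h : CM C ==> e : E (C Int {u. h u = 0}) ==>
   EX e':E C. ALL x:P (C Int {u. h u = 0}). e : x \<longleftrightarrow> e' : x"
 shows "gluing \<Sigma> (face_rel \<Sigma>) (%C. avoid_top (P C) (E C)) (%D C x. x Int E C)"
proof -
 have top: "topspace (avoid_top (P C) (E C)) = P C" if "C : \<Sigma>" for C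
  using avoid_space.topspace_avoid[OF avoid[OF that]] .
 have face: "EX h:CM C. D = C Int {u. h u = 0}" if "(D, C) : face_rel \<Sigma>" for D C
  using face_lattice_functional that face_rel_iff by auto
 have inj: "x = y" if h: "C : \<Sigma>" "h : CM C" and xy: "x : P (C Int {u. h u = 0})" "y : P (C Int {u. h u = 0})"
  and eq: "x Int E C = y Int E C" for C h x y
 proof -
  have sub: "x <= E (C Int {u. h u = 0})" "y <= E (C Int {u. h u = 0})"
   using avoid_space.points_sub[OF avoid[OF CM_localization(1)[OF h]]] xy by auto
  have "e : x \<longleftrightarrow> e : y" if e: "e : E (C Int {u. h u = 0})" for e
  proof -
   obtain e' where e': "e' : E C" "ALL x:P (C Int {u. h u = 0}). e : x \<longleftrightarrow> e' : x" using up[OF h e] by auto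
   have "e' : x \<longleftrightarrow> e' : y" using eq e'(1) by blast
   thus ?thesis using e'(2) xy by simp
  qed
  thus ?thesis using sub by blast
 qed
 have emb: "continuous_map (avoid_top (P D) (E D)) (avoid_top (P C) (E C)) (%x. x Int E C) &
   open_map (avoid_top (P D) (E D)) (avoid_top (P C) (E C)) (%x. x Int E C)"
  if R: "(D, C) : face_rel \<Sigma>" for D C
 proof -
  have s: "C : \<Sigma>" "D : \<Sigma>" "D <= C" using R face_rel_iff by auto
  obtain h where h: "h : CM C" and D: "D = C Int {u. h u = 0}" using face[OF R] by auto
  show ?thesis
  proof (rule avoid_open_embedding[OF avoid[OF s(1)] avoid[OF s(2)]])
   show "inj_on (%x. x Int E C) (P D)" using inj[OF s(1) h] unfolding D by (intro inj_onI)
   show "el h : E C" by (rule el[OF s(1) h])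
   show "(%x. x Int E C) ` P D = {x : P C. el h ~: x}"
   proof (intro equalityI subsetI)
    fix y assume "y : (%x. x Int E C) ` P D"
    thus "y : {x : P C. el h ~: x}" using restr[OF s(1) h] unfolding D by auto
   next
    fix y assume "y : {x : P C. el h ~: x}"
    then obtain x where "x : P D" "x Int E C = y" using surj[OF s(1) h, of y] unfolding D by auto
    thus "y : (%x. x Int E C) ` P D" by (rule image_eqI[rotated, OF _ sym])
   qed
   show "EX e':E C. ALL x:P D. e : x \<longleftrightarrow> e' : x Int E C" if "e : E D" for e
    using up[OF s(1) h, of e] that unfolding D by auto
   show "EX e':E D. ALL x:P D. e : x Int E C \<longleftrightarrow> e' : x" if "e : E C" for e
    using mono[OF s] that by (intro bexI[of _ e]) auto
  qed
 qed
 show ?thesis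
 proof
  show "face_rel \<Sigma> <= \<Sigma> \<times> \<Sigma>" by (auto simp: face_rel_iff)
  show "(C, C) : face_rel \<Sigma>" if "C : \<Sigma>" for C using that by (simp add: face_rel_iff)
  show "(k, i) : face_rel \<Sigma>" if "(k, j) : face_rel \<Sigma>" "(j, i) : face_rel \<Sigma>" for k j i
   using that by (auto simp: face_rel_iff)
  show "x Int E i = x" if "i : \<Sigma>" "x : topspace (avoid_top (P i) (E i))" for i x
   using that avoid_space.points_sub[OF avoid[OF that(1)]] top by auto
  show "x Int E j Int E i = x Int E i" if "(k, j) : face_rel \<Sigma>" "(j, i) : face_rel \<Sigma>" for k j i x
   using that mono[of i j] by (auto simp: face_rel_iff)
  fix i j k x y
  assume R: "(j, i) : face_rel \<Sigma>" "(k, i) : face_rel \<Sigma>"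
   and "x : topspace (avoid_top (P j) (E j))" "y : topspace (avoid_top (P k) (E k))" and eq: "x Int E i = y Int E i"
  hence s: "i : \<Sigma>" "j : \<Sigma>" "k : \<Sigma>" and x: "x : P j" and y: "y : P k" using top by (auto simp: face_rel_iff)
  obtain h h' where h: "h : CM i" "j = i Int {u. h u = 0}" and h': "h' : CM i" "k = i Int {u. h' u = 0}"
   using face[OF R(1)] face[OF R(2)] by auto
  \<comment> \<open>Both functionals are nonnegative on \<open>i\<close>, so their sum vanishes
    exactly on the intersection of the two faces. This gives the common piece for
    \<open>amalg\<close>.\<close>
  let ?h = "h + h'"
  have hh: "?h : CM i" using CM_add[OF s(1) h(1) h'(1)] .
  have nn: "0 <= h u" "0 <= h' u" if "u : i" for u using h(1) h'(1) that by (auto simp: cone_monoid_def dual_cone_def)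
  have m: "j Int k = i Int {u. ?h u = 0}"
  proof (intro equalityI subsetI)
   fix u assume "u : i Int {u. ?h u = 0}"
   hence "u : i" "h u + h' u = 0" by auto
   hence "u : i" "h u = 0" "h' u = 0" using nn[of u] by linarith+
   thus "u : j Int k" using h(2) h'(2) by simp
  qed (auto simp: h(2) h'(2))
  have mS: "j Int k : \<Sigma>" using fan_Int_mem s by blast
  have xi: "x Int E i : P i" "el h ~: x" using restr[OF s(1) h(1), of x] x h(2) by auto
  have yi: "el h' ~: y" using restr[OF s(1) h'(1), of y] y h'(2) by auto
  have "el h ~: x Int E i" "el h' ~: x Int E i" using xi yi eq by auto
  hence "el ?h ~: x Int E i" by (rule el_add[OF s(1) h(1) h'(1) xi(1)])
  then obtain z where z: "z : P (j Int k)" "z Int E i = x Int E i" using surj[OF s(1) hh xi(1)] m by auto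
  have Rjk: "(j Int k, j) : face_rel \<Sigma>" "(j Int k, k) : face_rel \<Sigma>" using mS s by (auto simp: face_rel_iff)
  have pr: "z Int E l : P l" if "(j Int k, l) : face_rel \<Sigma>" for l
  proof -
   have l: "l : \<Sigma>" using that by (simp add: face_rel_iff)
   show ?thesis using continuous_map_image_subset_topspace[OF conjunct1[OF emb[OF that]]] z(1)
    unfolding top[OF mS] top[OF l] by blast
  qed
  have ij: "E i <= E j" "E i <= E k" using mono[OF s(1,2)] mono[OF s(1,3)] h(2) h'(2) by auto
  have "z Int E j = x"
  proof (rule inj[OF s(1) h(1)])
   show "z Int E j Int E i = x Int E i" using z(2) ij by blast
  qed (use pr[OF Rjk(1)] x h(2) in auto)
  moreover have "z Int E k = y"
  proof (rule inj[OF s(1) h'(1)])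
   show "z Int E k Int E i = y Int E i" using z(2) ij eq by blast
  qed (use pr[OF Rjk(2)] y h'(2) in auto)
  ultimately show "EX m z. (m, j) : face_rel \<Sigma> & (m, k) : face_rel \<Sigma> & z : topspace (avoid_top (P m) (E m)) &
    z Int E j = x & z Int E k = y" using Rjk z(1) top[OF mS] by blast
 qed (use emb in blast)+
qed

section \<open>Prime ideals and congruences of toric algebras\<close>

context acl_pgroup
begin

definition face_ideal :: "('v => real) set => ('v => real) set => ('k \<times> ('v => real)) option set" where
 "face_ideal S T = insert None (Some ` (Units F \<times> (S - T)))"

lemma face_ideal_iff [simp]: "Some (l, s) : face_ideal S T \<longleftrightarrow> l : Units F & s : S & s ~: T"
  "None : face_ideal S T" by (auto simp: face_ideal_def)

lemma face_ideal_prime: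
 fixes S T :: "('v => real) set"
 assumes S: "!!s t. s : S ==> t : S ==> s + t : S" and T: "monoid_face S T"
 shows "prime_pideal (face_ideal S T) (monoid_alg F S)" unfolding prime_pideal_def
proof (intro conjI ballI impI)
 have "0 : S" "0 : T" using monoid_faceD(1,2)[OF T] by auto
 hence "Some (1[F], 0) : carrier (monoid_alg F S)" "Some (1[F], 0) ~: face_ideal S T" by simp_all
 thus "face_ideal S T ~= carrier (monoid_alg F S)" by metis
 show "face_ideal S T <= carrier (monoid_alg F S)" by (auto simp: face_ideal_def)
 fix a p assume a: "a : carrier (monoid_alg F S)"
 show "a *[monoid_alg F S] p : face_ideal S T" if p: "p : face_ideal S T"
 proof (cases "a = None \<or> p = None")
  case False
  then obtain l s m t where as: "a = Some (l, s)" "p = Some (m, t)" by auto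
  hence "l : Units F" "s : S" "m : Units F" "t : S" "t ~: T" using a p by simp_all
  moreover from this have "s + t ~: T" using monoid_faceD(4)[OF T] by blast
  ultimately show ?thesis using S by (simp add: as)
 qed auto
 show "a : face_ideal S T \<or> p : face_ideal S T"
  if p: "p : carrier (monoid_alg F S)" and "a *[monoid_alg F S] p : face_ideal S T"
 proof (cases "a = None \<or> p = None")
  case False
  then obtain l s m t where as: "a = Some (l, s)" "p = Some (m, t)" by auto
  thus ?thesis using a that monoid_faceD(3)[OF T] by auto
 qed auto
qed simp

text \<open>Multiplication by units of \<open>F\<close> shows that membership in an ideal depends on
  the exponent alone; primality says that the exponents outside form a face.\<close>

lemma prime_face_ideal:
 fixes S :: "('v => real) set"
 assumes S: "0 : S" "!!s t. s : S ==> t : S ==> s + t : S"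
  and P: "prime_pideal P (monoid_alg F S)"
 shows "EX T. monoid_face S T & P = face_ideal S T"
proof -
 note Pd = P[unfolded prime_pideal_def]
 have sub: "P <= carrier (monoid_alg F S)" and N: "None : P" using Pd by auto
 have ideal: "a *[monoid_alg F S] p : P" if "a : carrier (monoid_alg F S)" "p : P" for a p using Pd that by blast
 have prime: "a : P \<or> b : P" if "a : carrier (monoid_alg F S)" "b : carrier (monoid_alg F S)"
  "a *[monoid_alg F S] b : P" for a b using Pd that by blast
 have unit: "Some (m, s) : P" if "Some (l, s) : P" "l : Units F" "m : Units F" for l m s
  using ideal[of "Some (m *[F] inv[F] l, 0)" "Some (l, s)"] that S(1) by (simp add: F.m_assoc Units_carrier)
 define T where "T = {s : S. Some (1[F], s) ~: P}"
 have "monoid_face S T" unfolding monoid_face_def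
 proof (intro conjI ballI)
  have "Some (1[F], 0) ~: P"
  proof
   assume o: "Some (1[F], 0) : P"
   have "a : P" if a: "a : carrier (monoid_alg F S)" for a
    using a ideal[OF a o] by (cases rule: monoid_alg_cases) (auto simp: Units_carrier)
   thus False using Pd by blast
  qed
  thus "0 : T" using S(1) by (simp add: T_def)
  fix s t assume st: "s : S" "t : S"
  have "Some (1[F], s + t) : P \<longleftrightarrow> Some (1[F], s) : P \<or> Some (1[F], t) : P"
   using ideal[of "Some (1[F], s)" "Some (1[F], t)"] ideal[of "Some (1[F], t)" "Some (1[F], s)"]
    prime[of "Some (1[F], s)" "Some (1[F], t)"] st by (auto simp: add.commute)
  thus "s + t : T \<longleftrightarrow> s : T & t : T" using st S(2) by (auto simp: T_def)
 qed (auto simp: T_def)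
 moreover have "x : P \<longleftrightarrow> x : face_ideal S T" for x
 proof (cases x)
  case (Some p)
  obtain l s where p: "p = (l, s)" by force
  show ?thesis using sub unit[of l s "1[F]"] unit[of "1[F]" s l] unfolding Some p by (auto simp: T_def)
 qed (simp add: N)
 ultimately show ?thesis by blast
qed

lemma face_ideal_restrict:
 assumes "S <= S'" "T' <= S'"
 shows "face_ideal S' T' Int carrier (monoid_alg F S) = face_ideal S (T' Int S)"
 using assms by (auto simp: face_ideal_def monoid_alg_carrier)

lemma monoid_face_restrict:
 assumes "monoid_face S' T'" "S <= S'" "0 : S" "!!s t. s : S ==> t : S ==> s + t : S"
 shows "monoid_face S (T' Int S)" using assms unfolding monoid_face_def by (auto simp: subset_iff)

end

locale toric_scheme_fan = toric_fan N B \<Sigma> + acl_pgroup F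
 for N :: "'v::real_vector set" and B \<Sigma> and F :: "'k pmonoid"
begin

abbreviation A :: "'v set => ('k \<times> ('v => real)) option pmonoid" where "A C \<equiv> monoid_alg F (CM C)"

abbreviation \<xi> :: "('v => real) => ('k \<times> ('v => real)) option" where "\<xi> m \<equiv> Some (1[F], m)"

lemma A_pointed_monoid: "C : \<Sigma> ==> pointed_monoid (A C)"
 by (rule monoid_alg_pointed_monoid) (auto intro: CM_zero CM_add)

lemma A_mult_closed:
 assumes "C : \<Sigma>" "x : carrier (A C)" "y : carrier (A C)"
 shows "x *[A C] y : carrier (A C)"
proof -
 interpret pointed_monoid "A C" by (rule A_pointed_monoid[OF assms(1)])
 show ?thesis using assms by simp
qed

lemma A_kalgebra: "C : \<Sigma> ==> kalgebra F (monoid_alg_const F) (A C)"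
 by (rule kalgebra_monoid_alg) (auto intro: CM_zero CM_add)

lemma CM_zmul: "C : \<Sigma> ==> h : CM C ==> zmul (int n) h : CM C"
 by (induction n) (simp_all add: CM_zero CM_add zmul_algebra)

lemma A_mono: "D <= C ==> carrier (A C) <= carrier (A D)"
 using CM_antimono[of D C] by (auto simp: monoid_alg_carrier)

abbreviation primes :: "'v set => ('k \<times> ('v => real)) option set set" where
 "primes C \<equiv> {P. prime_pideal P (A C)}"

lemma prime_iff: "C : \<Sigma> ==> prime_pideal P (A C) \<longleftrightarrow> (EX T. monoid_face (CM C) T & P = face_ideal (CM C) T)"
 using prime_face_ideal[OF CM_zero CM_add] face_ideal_prime[OF CM_add] by meson

lemma prime_restrict:
 assumes "C : \<Sigma>" "D : \<Sigma>" "D <= C" "P : primes D"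
 shows "P Int carrier (A C) : primes C"
proof -
 obtain T where T: "monoid_face (CM D) T" "P = face_ideal (CM D) T" using assms(2,4) prime_iff by auto
 have "P Int carrier (A C) = face_ideal (CM C) (T Int CM C)"
  unfolding T(2) by (rule face_ideal_restrict[OF CM_antimono[OF assms(3)] monoid_faceD(1)[OF T(1)]])
 moreover have "monoid_face (CM C) (T Int CM C)"
  by (rule monoid_face_restrict[OF T(1) CM_antimono[OF assms(3)] CM_zero[OF assms(1)] CM_add[OF assms(1)]])
 ultimately show ?thesis using prime_iff[OF assms(1)] by auto
qed

lemma MSpec_avoid: "MSpec_top (A C) = avoid_top (primes C) (carrier (A C))"
 unfolding MSpec_top_def avoid_top_def by (rule arg_cong[of _ _ topology_generated_by]) auto

lemma primes_avoid_space:
 assumes "C : \<Sigma>"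
 shows "avoid_space (primes C) (carrier (A C))" by unfold_locales (auto simp: prime_pideal_def)

lemma CM_localization_unit:
 assumes C: "C : \<Sigma>" and h: "h : CM C"
 shows "h : CM (C Int {u. h u = 0})" "- h : CM (C Int {u. h u = 0})"
proof -
 show "h : CM (C Int {u. h u = 0})" using h CM_antimono[of "C Int {u. h u = 0}" C] by auto
 have "- h + zmul (int 1) h : CM C" using CM_zero[OF C] by simp
 moreover have "- h : M" using zsubgroup_uminus[OF M] CM_subset h by blast
 ultimately show "- h : CM (C Int {u. h u = 0})" unfolding CM_localization(2)[OF C h] by blast
qed

lemma prime_localization:
 assumes C: "C : \<Sigma>" and h: "h : CM C" and P: "P : primes (C Int {u. h u = 0})"
 shows "Some (l, m + zmul (int k) h) : P \<longleftrightarrow> Some (l, m) : P" "\<xi> h ~: P"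
proof -
 let ?D = "C Int {u. h u = 0}"
 note D = CM_localization(1)[OF C h]
 obtain T where T: "monoid_face (CM ?D) T" "P = face_ideal (CM ?D) T" using P prime_iff[OF D] by auto
 note hh = CM_localization_unit[OF C h]
 have "h + - h : T" using monoid_faceD(2)[OF T(1)] by simp
 hence hT: "h : T" "- h : T" using monoid_faceD(4)[OF T(1) hh] by blast+
 thus "\<xi> h ~: P" by (simp add: T(2))
 have kh: "zmul (int k) h : T" "zmul (int k) (- h) : T" using monoid_face_zmul[OF T(1)] hT by auto
 have eq: "m + zmul (int k) h + zmul (int k) (- h) = m" by (simp add: zmul_algebra)
 have C: "m + zmul (int k) h : CM ?D \<longleftrightarrow> m : CM ?D"
  using CM_add[OF D, of m "zmul (int k) h"] CM_add[OF D, of "m + zmul (int k) h" "zmul (int k) (- h)"]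
   kh monoid_faceD(1)[OF T(1)] eq by auto
 have "m + zmul (int k) h : T \<longleftrightarrow> m : T" if "m : CM ?D"
  using monoid_faceD(3)[OF T(1), of m "zmul (int k) h"] kh
   monoid_faceD(4)[OF T(1) that, of "zmul (int k) h"] monoid_faceD(1)[OF T(1)] by auto
 thus "Some (l, m + zmul (int k) h) : P \<longleftrightarrow> Some (l, m) : P" using C by (auto simp: T(2))
qed

lemma prime_extend:
 assumes C: "C : \<Sigma>" and h: "h : CM C" and P: "P : primes C" "\<xi> h ~: P"
 shows "EX Q:primes (C Int {u. h u = 0}). Q Int carrier (A C) = P"
proof -
 let ?D = "C Int {u. h u = 0}"
 note D = CM_localization[OF C h]
 obtain T where T: "monoid_face (CM C) T" "P = face_ideal (CM C) T" using P(1) prime_iff[OF C] by auto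
 have hT: "h : T" using P(2) h by (simp add: T(2))
 \<comment> \<open>The localization of \<open>T\<close> at \<open>h\<close>: multiples of
   \<open>h\<close> may be subtracted from its elements.\<close>
 define T' where "T' = {m : M. EX k::nat. m + zmul (int k) h : T}"
 have face: "monoid_face (CM ?D) T'" unfolding monoid_face_def
 proof (intro conjI ballI)
  show "T' <= CM ?D" using monoid_faceD(1)[OF T(1)] unfolding D(2) T'_def by blast
  have "0 + zmul (int 0) h : T" using monoid_faceD(2)[OF T(1)] by simp
  thus "0 : T'" using zsubgroup_zero[OF M] unfolding T'_def by blast
  fix s t assume "s : CM ?D" "t : CM ?D"
  then obtain i j :: nat where ij: "s : M" "t : M" "s + zmul (int i) h : CM C" "t + zmul (int j) h : CM C"
   unfolding D(2) by blast
  show "s + t : T' \<longleftrightarrow> s : T' & t : T'"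
  proof
   assume "s + t : T'"
   then obtain k :: nat where k: "s + t + zmul (int k) h : T" by (auto simp: T'_def)
   have "s + t + zmul (int k) h + zmul (int (i + j)) h : T"
    by (rule monoid_faceD(3)[OF T(1) k monoid_face_zmul[OF T(1) hT]])
   also have "s + t + zmul (int k) h + zmul (int (i + j)) h
     = (s + zmul (int i) h) + (t + zmul (int j) h + zmul (int k) h)" by (simp add: zmul_algebra)
   finally have a: "s + zmul (int i) h : T" "t + zmul (int j) h + zmul (int k) h : T"
    using monoid_faceD(4)[OF T(1) ij(3) CM_add[OF C ij(4) CM_zmul[OF C h]]] by blast+
   have "t + zmul (int j) h : T" using monoid_faceD(4)[OF T(1) ij(4) CM_zmul[OF C h] a(2)] by blast
   thus "s : T' & t : T'" using a(1) ij(1,2) unfolding T'_def by blast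
  next
   assume "s : T' & t : T'"
   then obtain i j :: nat where k: "s + zmul (int i) h : T" "t + zmul (int j) h : T" by (auto simp: T'_def)
   have "s + t + zmul (int (i + j)) h = (s + zmul (int i) h) + (t + zmul (int j) h)" by (simp add: zmul_algebra)
   hence "s + t + zmul (int (i + j)) h : T" using monoid_faceD(3)[OF T(1) k] by (simp only:)
   thus "s + t : T'" using zsubgroup_add[OF M ij(1,2)] unfolding T'_def by blast
  qed
 qed
 have eq: "T' Int CM C = T"
 proof (intro equalityI subsetI)
  fix m assume "m : T' Int CM C"
  then obtain k :: nat where "m : CM C" "m + zmul (int k) h : T" by (auto simp: T'_def)
  thus "m : T" using monoid_faceD(4)[OF T(1) _ CM_zmul[OF C h]] by blast
 next
  fix m assume m: "m : T"
  hence "m + zmul (int 0) h : T" "m : CM C" using monoid_faceD(1)[OF T(1)] by auto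
  thus "m : T' Int CM C" using CM_subset unfolding T'_def by blast
 qed
 have "face_ideal (CM ?D) T' Int carrier (A C) = P" unfolding T(2) eq[symmetric]
  by (rule face_ideal_restrict[OF CM_antimono monoid_faceD(1)[OF face]]) auto
 moreover have "face_ideal (CM ?D) T' : primes ?D" using face prime_iff[OF D(1)] by auto
 ultimately show ?thesis by blast
qed

text \<open>Multiplication by the character of \<open>m\<close>, which clears denominators.\<close>

definition shift :: "('v => real) => ('k \<times> ('v => real)) option => ('k \<times> ('v => real)) option" where
 "shift m = map_option (map_prod id (%s. s + m))"

lemma shift_simps [simp]: "shift m None = None" "shift m (Some (l, s)) = Some (l, s + m)"
 by (simp_all add: shift_def)

text \<open>The claim holds for all large \<open>j\<close>, so that the two entries of a pair can be
  cleared with one exponent.\<close>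

lemma shift_clear:
 assumes C: "C : \<Sigma>" and h: "h : CM C" and e: "e : carrier (A (C Int {u. h u = 0}))"
 shows "EX k. ALL j>=k. shift (zmul (int j) h) e : carrier (A C)"
proof (cases e)
 case (Some p)
 obtain l m where p: "p = (l, m)" by force
 obtain k :: nat where k: "m : M" "m + zmul (int k) h : CM C" "l : Units F"
  using e unfolding Some p CM_localization(2)[OF C h] by auto
 have "m + zmul (int j) h : CM C" if "k <= j" for j
 proof -
  have "m + zmul (int j) h = (m + zmul (int k) h) + zmul (int (j - k)) h"
   using that by (simp add: of_nat_diff zmul_algebra)
  thus ?thesis using CM_add[OF C k(2) CM_zmul[OF C h]] by (simp only:)
 qed
 thus ?thesis using k(3) unfolding Some p by auto
qed simp

lemma MSpec_gluing:
 "gluing \<Sigma> (face_rel \<Sigma>) (%C. avoid_top (primes C) (carrier (A C))) (%D C P. P Int carrier (A C))"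
proof (rule fan_gluing[where el = \<xi>])
 fix C assume C: "C : \<Sigma>"
 show "avoid_space (primes C) (carrier (A C))" by (rule primes_avoid_space[OF C])
 show "carrier (A C) <= carrier (A D)" if "D <= C" for D by (rule A_mono[OF that])
 fix h assume h: "h : CM C"
 let ?D = "C Int {u. h u = 0}"
 note D = CM_localization(1)[OF C h]
 show "\<xi> h : carrier (A C)" using h by simp
 show "\<xi> (h + h') ~: y" if "h' : CM C" "y : primes C" "\<xi> h ~: y" "\<xi> h' ~: y" for h' y
 proof -
  have "prime_pideal y (A C)" using that by simp
  then obtain T where "monoid_face (CM C) T" "y = face_ideal (CM C) T" using prime_iff[OF C] by auto
  thus ?thesis using that h monoid_faceD(3)[of "CM C" T h h'] by auto
 qed
 show "x Int carrier (A C) : primes C & \<xi> h ~: x" if "x : primes ?D" for x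
  using prime_restrict[OF C D _ that] prime_localization(2)[OF C h that] by blast
 show "EX x:primes ?D. x Int carrier (A C) = y" if "y : primes C" "\<xi> h ~: y" for y
  by (rule prime_extend[OF C h that])
 fix e assume "e : carrier (A ?D)"
 then obtain k where k: "shift (zmul (int k) h) e : carrier (A C)" using shift_clear[OF C h] by blast
 have "e : x \<longleftrightarrow> shift (zmul (int k) h) e : x" if x: "x : primes ?D" for x
 proof (cases e)
  case None
  thus ?thesis by simp
 next
  case (Some p)
  thus ?thesis using prime_localization(1)[OF C h x] by (cases p) simp
 qed
 thus "EX e':carrier (A C). ALL x:primes ?D. e : x \<longleftrightarrow> e' : x" using k by blast
qed

abbreviation congs :: "'v set => (('k \<times> ('v => real)) option \<times> ('k \<times> ('v => real)) option) set set" where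
 "congs C \<equiv> SCong F (monoid_alg_const F) (A C)"

lemma congsE:
 assumes "C : \<Sigma>" "c : congs C"
 obtains K :: "(nat \<times> ('k \<times> ('v => real)) option set) ring" and f
 where "field K" "f : pmon_hom (A C) (ring_pmonoid K)" "c = pkernel (A C) f"
  "inj_on (f \<circ> monoid_alg_const F) (carrier F)"
 using pointed_monoid.SCong_kernelE[OF A_pointed_monoid[OF assms(1)] assms(2) kalgebra.\<eta>_closed[OF A_kalgebra[OF assms(1)]]]
 by metis

lemma congsI:
 assumes "C : \<Sigma>" "field K" "f : pmon_hom (A C) (ring_pmonoid K)" "inj_on (f \<circ> monoid_alg_const F) (carrier F)"
 shows "pkernel (A C) f : congs C"
 using pointed_monoid.SCong_kernelI[OF A_pointed_monoid[OF assms(1)] assms(2,3) kalgebra.\<eta>_closed[OF A_kalgebra[OF assms(1)]] assms(4)]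
 by metis

lemma hom_nonzero_unit:
 assumes C: "C : \<Sigma>" and h: "h : CM C" and K: "field K"
  and f: "f : pmon_hom (A (C Int {u. h u = 0})) (ring_pmonoid K)"
 shows "f (\<xi> h) ~= 0[K]"
proof
 interpret K: field K by fact
 assume z: "f (\<xi> h) = 0[K]"
 note hh = CM_localization_unit[OF C h]
 have "f (\<xi> h *[A (C Int {u. h u = 0})] \<xi> (- h)) = f (\<xi> h) *[K] f (\<xi> (- h))"
  using pmon_homD(4)[OF f, of "\<xi> h" "\<xi> (- h)"] hh by simp
 moreover have "f (\<xi> 0) = 1[K]" using pmon_homD(2)[OF f] by simp
 moreover have "f (\<xi> (- h)) : carrier K" using pmon_homD(1)[OF f, of "\<xi> (- h)"] hh by simp
 ultimately show False using z by simp
qed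

text \<open>A homomorphism into a field with \<open>u = f (\<xi> h)\<close> nonzero extends to the
  localization: multiply by a power of the character of \<open>h\<close>, apply \<open>f\<close> and
  divide by the same power of \<open>u\<close>.\<close>

lemma cong_extend:
 assumes C: "C : \<Sigma>" and h: "h : CM C" and y: "y : congs C" "(\<xi> h, None) ~: y"
 shows "EX x:congs (C Int {u. h u = 0}). x Int (carrier (A C) \<times> carrier (A C)) = y"
proof -
 let ?D = "C Int {u. h u = 0}"
 note D = CM_localization[OF C h]
 have sub: "carrier (A C) <= carrier (A ?D)" by (rule A_mono) blast
 obtain K :: "(nat \<times> ('k \<times> ('v => real)) option set) ring" and f
  where K: "field K" and f: "f : pmon_hom (A C) (ring_pmonoid K)" and yk: "y = pkernel (A C) f"
  and fi: "inj_on (f \<circ> monoid_alg_const F) (carrier F)" using congsE[OF C y(1)] by metis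
 interpret K: field K by fact
 note fc = pmon_homD(1)[OF f, unfolded ring_pmonoid_simps] and fz = pmon_homD(3)[OF f]
  and fm = pmon_homD(4)[OF f, unfolded ring_pmonoid_simps]
 define u where "u = f (\<xi> h)"
 have "u ~= 0[K]" using y(2) h fz by (auto simp: yk pkernel_iff u_def)
 moreover have uc: "u : carrier K" using fc[of "\<xi> h"] h by (simp add: u_def)
 ultimately have uU: "u : Units K" by (simp add: K.field_Units)
 let ?sh = "%k. shift (zmul (int k) h)"
 have sh_Suc: "?sh (Suc k) e = ?sh k e *[A C] \<xi> h" if "e : carrier (A ?D)" for k e
  using that by (cases rule: monoid_alg_cases) (simp_all add: zmul_algebra Units_carrier ac_simps)
 have sh_u: "?sh (k + j) e : carrier (A C) & f (?sh (k + j) e) = f (?sh k e) *[K] u ^[K] j"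
  if e: "e : carrier (A ?D)" "?sh k e : carrier (A C)" for k j e
 proof (induction j)
  case (Suc j)
  have hc: "\<xi> h : carrier (A C)" using h by simp
  have "?sh (k + Suc j) e = ?sh (k + j) e *[A C] \<xi> h" using sh_Suc[OF e(1), of "k + j"] by simp
  thus ?case
   using Suc fm[of "?sh (k + j) e" "\<xi> h"] fc[OF e(2)] uc hc A_mult_closed[OF C _ hc, of "?sh (k + j) e"]
   by (simp add: K.m_assoc u_def[symmetric])
 qed (use e fc in simp)
 \<comment> \<open>Some exponent that clears the denominator of \<open>e\<close>. The fact
   \<open>g\<close> below shows that any other clearing exponent gives the same value.\<close>
 define kk where "kk e = (SOME k. ?sh k e : carrier (A C))" for e
 have kk: "?sh (kk e) e : carrier (A C)" if "e : carrier (A ?D)" for e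
  unfolding kk_def by (rule someI_ex) (use shift_clear[OF C h that] in blast)
 define g where "g e = f (?sh (kk e) e) *[K] inv[K] (u ^[K] kk e)" for e
 have gc: "g e : carrier K" if "e : carrier (A ?D)" for e
  using fc[OF kk[OF that]] K.Units_pow_closed[OF uU] by (simp add: g_def)
 have g: "g e *[K] u ^[K] k = f (?sh k e)" if e: "e : carrier (A ?D)" "?sh k e : carrier (A C)" for k e
 proof -
  let ?U = "%n. u ^[K] (n :: nat)"
  have Uc: "?U n : carrier K" "?U n : Units K" for n using K.Units_pow_closed[OF uU] uc by simp_all
  have ke: "f (?sh (kk e) e) : carrier K" by (rule fc[OF kk[OF e(1)]])
  have "g e *[K] ?U k *[K] ?U (kk e) = f (?sh (kk e) e) *[K] ?U k *[K] (inv[K] (?U (kk e)) *[K] ?U (kk e))"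
   unfolding g_def using ke Uc by (simp only: K.m_ac K.m_closed K.Units_inv_closed)
  also have "\<dots> = f (?sh (kk e) e) *[K] ?U k" using ke Uc by (simp add: K.Units_l_inv)
  also have "\<dots> = f (?sh (kk e + k) e)" using sh_u[OF e(1) kk[OF e(1)], of k] by simp
  also have "\<dots> = f (?sh k e) *[K] ?U (kk e)" using sh_u[OF e, of "kk e"] by (simp add: add.commute)
  finally have "(g e *[K] ?U k) *[K] ?U (kk e) = f (?sh k e) *[K] ?U (kk e)" .
  thus ?thesis using gc[OF e(1)] fc[OF e(2)] Uc K.field_Units K.m_rcancel by auto
 qed
 have gf: "g e = f e" if "e : carrier (A C)" for e
 proof -
  have "?sh 0 e = e" by (cases e) (auto simp: shift_def)
  thus ?thesis using g[of e 0] that sub gc[of e] by auto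
 qed
 have hom: "g : pmon_hom (A ?D) (ring_pmonoid K)"
 proof (rule pmon_homI)
  show "g x : carrier (ring_pmonoid K)" if "x : carrier (A ?D)" for x using gc that by simp
  have "1[A C] : carrier (A C)" "pzero (A C) : carrier (A C)" using CM_zero[OF C] by simp_all
  hence "g 1[A C] = 1[K]" "g (pzero (A C)) = 0[K]" using gf pmon_homD(2,3)[OF f] by simp_all
  thus "g 1[A ?D] = 1[ring_pmonoid K]" "g (pzero (A ?D)) = pzero (ring_pmonoid K)" by simp_all
  fix x y assume x: "x : carrier (A ?D)" and y: "y : carrier (A ?D)"
  obtain k where k: "?sh k x : carrier (A C)" "?sh k y : carrier (A C)"
  proof -
   obtain i j where "ALL k>=i. ?sh k x : carrier (A C)" "ALL k>=j. ?sh k y : carrier (A C)"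
    using shift_clear[OF C h x] shift_clear[OF C h y] by metis
   thus thesis by (intro that[of "max i j"]) auto
  qed
  have xy: "x *[A ?D] y : carrier (A ?D)" by (rule A_mult_closed[OF D(1) x y])
  have eq: "?sh k x *[A C] ?sh k y = ?sh (k + k) (x *[A ?D] y)"
  proof -
   have "zmul (int (k + k)) h = zmul (int k) h + zmul (int k) h" by (simp only: of_nat_add zmul_algebra)
   thus ?thesis using x y by (elim monoid_alg_cases) (simp_all only: monoid_alg_ops shift_simps ac_simps)
  qed
  have kk': "?sh (k + k) (x *[A ?D] y) : carrier (A C)"
   unfolding eq[symmetric] by (rule A_mult_closed[OF C k])
  let ?U = "%n. u ^[K] (n :: nat)"
  have Uc: "?U n : carrier K" "?U n : Units K" for n using K.Units_pow_closed[OF uU] uc by simp_all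
  have "g (x *[A ?D] y) *[K] ?U (k + k) = f (?sh k x) *[K] f (?sh k y)"
   unfolding g[OF xy kk'] eq[symmetric] by (rule fm[OF k])
  also have "\<dots> = (g x *[K] ?U k) *[K] (g y *[K] ?U k)" using g[OF x k(1)] g[OF y k(2)] by simp
  also have "\<dots> = (g x *[K] g y) *[K] (?U k *[K] ?U k)"
   using gc[OF x] gc[OF y] Uc by (simp only: K.m_ac K.m_closed)
  also have "?U k *[K] ?U k = ?U (k + k)" using uc by (simp add: K.nat_pow_mult)
  finally have "g (x *[A ?D] y) *[K] ?U (k + k) = (g x *[K] g y) *[K] ?U (k + k)" .
  thus "g (x *[A ?D] y) = g x *[ring_pmonoid K] g y"
   using gc[OF xy] gc[OF x] gc[OF y] Uc K.field_Units K.m_rcancel by auto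
 qed
 have "inj_on (g \<circ> monoid_alg_const F) (carrier F)"
  using fi gf kalgebra.\<eta>_closed[OF A_kalgebra[OF C]] by (simp cong: inj_on_cong)
 hence "pkernel (A ?D) g : congs ?D" by (rule congsI[OF D(1) K hom])
 moreover have "pkernel (A ?D) g Int (carrier (A C) \<times> carrier (A C)) = y"
  using sub gf by (auto simp: yk pkernel_iff)
 ultimately show ?thesis by blast
qed

lemma SCong_gluing:
 "gluing \<Sigma> (face_rel \<Sigma>) (%C. avoid_top (congs C) (carrier (A C) \<times> carrier (A C)))
  (%D C c. c Int (carrier (A C) \<times> carrier (A C)))"
proof (rule fan_gluing[where el = "%h. (\<xi> h, None)"])
 fix C assume C: "C : \<Sigma>"
 interpret kalgebra F "monoid_alg_const F" "A C" by (rule A_kalgebra[OF C])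
 show "avoid_space (congs C) (carrier (A C) \<times> carrier (A C))" by (rule avoid_space_axioms)
 show "carrier (A C) \<times> carrier (A C) <= carrier (A D) \<times> carrier (A D)" if "D <= C" for D
  using A_mono[OF that] by blast
 fix h assume h: "h : CM C"
 let ?D = "C Int {u. h u = 0}"
 note D = CM_localization(1)[OF C h]
 show "(\<xi> h, None) : carrier (A C) \<times> carrier (A C)" using h by simp
 show "(\<xi> (h + h'), None) ~: y" if h': "h' : CM C" and y: "y : congs C" "(\<xi> h, None) ~: y" "(\<xi> h', None) ~: y" for h' y
 proof -
  obtain K :: "(nat \<times> ('k \<times> ('v => real)) option set) ring" and f
   where K: "field K" and f: "f : pmon_hom (A C) (ring_pmonoid K)" and yk: "y = pkernel (A C) f"
   using congsE[OF C y(1)] by metis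
  interpret K: field K by fact
  have c: "\<xi> h : carrier (A C)" "\<xi> h' : carrier (A C)" "None : carrier (A C)" using h h' by simp_all
  have z: "f None = 0[K]" using pmon_homD(3)[OF f] by simp
  have "f (\<xi> (h + h')) = f (\<xi> h) *[K] f (\<xi> h')" using pmon_homD(4)[OF f c(1,2)] by simp
  moreover have "f (\<xi> h) ~= 0[K]" "f (\<xi> h') ~= 0[K]" using y c z by (auto simp: yk pkernel_iff)
  moreover have "f (\<xi> h) : carrier K" "f (\<xi> h') : carrier K" using pmon_homD(1)[OF f] c by simp_all
  ultimately have "f (\<xi> (h + h')) ~= 0[K]" using K.integral_iff by simp
  thus ?thesis using z by (simp add: yk pkernel_iff)
 qed
 have sub: "carrier (A C) <= carrier (A ?D)" by (rule A_mono) blast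
 show "x Int (carrier (A C) \<times> carrier (A C)) : congs C & (\<xi> h, None) ~: x" if x: "x : congs ?D" for x
 proof -
  obtain K :: "(nat \<times> ('k \<times> ('v => real)) option set) ring" and f
   where K: "field K" and f: "f : pmon_hom (A ?D) (ring_pmonoid K)" and xk: "x = pkernel (A ?D) f"
   and fi: "inj_on (f \<circ> monoid_alg_const F) (carrier F)" using congsE[OF D x] by metis
  have "f : pmon_hom (A C) (ring_pmonoid K)"
  proof (rule pmon_homI)
   fix a b assume ab: "a : carrier (A C)" "b : carrier (A C)"
   thus "f a : carrier (ring_pmonoid K)" using pmon_homD(1)[OF f] sub by blast
   have "a *[A C] b = a *[A ?D] b" by (simp add: monoid_alg_def)
   thus "f (a *[A C] b) = f a *[ring_pmonoid K] f b"
    using pmon_homD(4)[OF f subsetD[OF sub ab(1)] subsetD[OF sub ab(2)]] by (simp only:)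
  qed (use pmon_homD(2,3)[OF f] in simp_all)
  hence "pkernel (A C) f : congs C" using congsI[OF C K _ fi] by blast
  moreover have "x Int (carrier (A C) \<times> carrier (A C)) = pkernel (A C) f"
   using sub by (auto simp: xk pkernel_iff)
  ultimately show ?thesis using hom_nonzero_unit[OF C h K f] pmon_homD(3)[OF f] by (simp add: xk pkernel_iff)
 qed
 show "EX x:congs ?D. x Int (carrier (A C) \<times> carrier (A C)) = y" if "y : congs C" "(\<xi> h, None) ~: y" for y
  by (rule cong_extend[OF C h that])
 fix e assume "e : carrier (A ?D) \<times> carrier (A ?D)"
 then obtain a b where e: "e = (a, b)" and ab: "a : carrier (A ?D)" "b : carrier (A ?D)" by blast
 obtain k where k: "shift (zmul (int k) h) a : carrier (A C)" "shift (zmul (int k) h) b : carrier (A C)"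
 proof -
  obtain i j where "ALL k>=i. shift (zmul (int k) h) a : carrier (A C)" "ALL k>=j. shift (zmul (int k) h) b : carrier (A C)"
   using shift_clear[OF C h ab(1)] shift_clear[OF C h ab(2)] by metis
  thus thesis by (intro that[of "max i j"]) auto
 qed
 let ?m = "zmul (int k) h"
 have mm: "?m : CM ?D" using CM_zmul[OF D CM_localization_unit(1)[OF C h]] .
 have "(a, b) : x \<longleftrightarrow> (shift ?m a, shift ?m b) : x" if x: "x : congs ?D" for x
 proof -
  obtain K :: "(nat \<times> ('k \<times> ('v => real)) option set) ring" and f
   where K: "field K" and f: "f : pmon_hom (A ?D) (ring_pmonoid K)" and xk: "x = pkernel (A ?D) f"
   using congsE[OF D x] by metis
  interpret K: field K by fact
  have c: "\<xi> ?m : carrier (A ?D)" using mm by simp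
  have mn: "- ?m : CM ?D" using CM_zmul[OF D CM_localization_unit(2)[OF C h], of k] by (simp add: zmul_algebra)
  have nz: "f (\<xi> ?m) ~= 0[K]"
  proof
   assume z: "f (\<xi> ?m) = 0[K]"
   have "f (\<xi> ?m *[A ?D] \<xi> (- ?m)) = f (\<xi> ?m) *[K] f (\<xi> (- ?m))"
    using pmon_homD(4)[OF f c, of "\<xi> (- ?m)"] mn by simp
   moreover have "f (\<xi> (- ?m)) : carrier K" using pmon_homD(1)[OF f, of "\<xi> (- ?m)"] mn by simp
   ultimately show False using z pmon_homD(2)[OF f] by simp
  qed
  have sh: "shift ?m e : carrier (A ?D) & f (shift ?m e) = f (\<xi> ?m) *[K] f e" if e: "e : carrier (A ?D)" for e
  proof -
   have "shift ?m e = \<xi> ?m *[A ?D] e"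
    using e by (cases rule: monoid_alg_cases) (simp_all add: Units_carrier add.commute)
   thus ?thesis using pmon_homD(4)[OF f c e] A_mult_closed[OF D c e] by simp
  qed
  have "f (shift ?m a) = f (shift ?m b) \<longleftrightarrow> f a = f b"
   using sh[OF ab(1)] sh[OF ab(2)] nz K.m_lcancel[of "f (\<xi> ?m)" "f a" "f b"] pmon_homD(1)[OF f] c ab by simp
  thus ?thesis using sh[OF ab(1)] sh[OF ab(2)] ab by (simp add: xk pkernel_iff)
 qed
 thus "EX e':carrier (A C) \<times> carrier (A C). ALL x:congs ?D. e : x \<longleftrightarrow> e' : x"
  using k unfolding e by (intro bexI[of _ "(shift ?m a, shift ?m b)"]) auto
qed

end

section \<open>Sections of affine monoid schemes\<close>

lemma (in avoid_space) open_downward: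
 assumes U: "openin (avoid_top P E) U" and x: "x : U" and y: "y : P" "y <= x"
 shows "y : U"
proof -
 obtain D where D: "D Int x = {}" "{z : P. D Int z = {}} <= U"
  using bspec[OF conjunct2[OF iffD1[OF openin_avoid U]] x] by (elim exE conjE) (rule that)
 thus ?thesis using y by blast
qed

text \<open>For a monoid that embeds into a pointed group, a fraction is the same as the set of all pairs
 whose quotient is a given element of the group.\<close>

definition germ :: "'a pmonoid => 'e pmonoid => ('a => 'e) => 'a set => 'e => ('a \<times> 'a) set" where
 "germ A E \<iota> P x = {(b, t). b : carrier A & t : carrier A - P & \<iota> b = \<iota> t *[E] x}"

text \<open>The elements of \<open>E\<close> that are regular on \<open>V\<close>: at each point
  they have a denominator outside that point.\<close>

definition germ_domain :: "'a pmonoid => 'e pmonoid => ('a => 'e) => 'a set set => 'e set" where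
 "germ_domain A E \<iota> V = {x : carrier E. ALL P:V. germ A E \<iota> P x ~= {}}"

definition germ_section :: "'a pmonoid => 'e pmonoid => ('a => 'e) => 'a set set => 'e => 'a set => ('a \<times> 'a) set" where
 "germ_section A E \<iota> V x = (\<lambda>P\<in>V. germ A E \<iota> P x)"

locale frac_monoid = A: pointed_monoid A + E: pointed_monoid E
 for A :: "'a pmonoid" and E :: "'e pmonoid" +
 fixes \<iota> :: "'a => 'e"
 assumes \<iota>: "\<iota> : pmon_hom A E" and inj: "inj_on \<iota> (carrier A)"
  and Units_E: "Units E = carrier E - {pzero E}"
begin

lemma \<iota>_simps: "x : carrier A ==> \<iota> x : carrier E" "\<iota> 1[A] = 1[E]" "\<iota> (pzero A) = pzero E"
  "x : carrier A ==> y : carrier A ==> \<iota> (x *[A] y) = \<iota> x *[E] \<iota> y"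
 using pmon_homD[OF \<iota>] by auto

lemma \<iota>_Units: "t : carrier A ==> t ~= pzero A ==> \<iota> t : Units E"
 using \<iota>_simps inj inj_onD[OF inj, of t "pzero A"] A.pzero_closed by (auto simp: Units_E)

lemma E_cancel: "u : Units E ==> x : carrier E ==> y : carrier E ==> u *[E] x = u *[E] y \<longleftrightarrow> x = y"
 by (rule E.Units_l_cancel)

lemma Units_E_mult: "u : Units E ==> v : Units E ==> u *[E] v : Units E" by (rule E.Units_m_closed)

abbreviation spec :: "'a set set" where "spec \<equiv> {P. prime_pideal P A}"

lemma MSpec_avoid_top: "MSpec_top A = avoid_top spec (carrier A)"
 unfolding MSpec_top_def avoid_top_def by (rule arg_cong[of _ _ topology_generated_by]) auto

sublocale avoid_space spec "carrier A" by unfold_locales (auto simp: prime_pideal_def)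

lemma primeD:
 assumes "P : spec"
 shows "P <= carrier A" "pzero A : P" "1[A] ~: P"
  "s : carrier A - P ==> t : carrier A - P ==> s *[A] t : carrier A - P"
  "t : carrier A - P ==> \<iota> t : Units E"
proof -
 have P: "P <= carrier A" "pzero A : P" "P ~= carrier A"
  "!!a p. a : carrier A ==> p : P ==> a *[A] p : P"
  "!!a b. a : carrier A ==> b : carrier A ==> a *[A] b : P ==> a : P \<or> b : P"
  using assms by (auto simp: prime_pideal_def)
 show "P <= carrier A" "pzero A : P" by (fact P)+
 show "1[A] ~: P" using P(1,3) P(4)[of _ "1[A]"] by force
 show "s *[A] t : carrier A - P" if "s : carrier A - P" "t : carrier A - P" using P(5)[of s t] that by auto
 show "\<iota> t : Units E" if "t : carrier A - P" using \<iota>_Units[of t] that P(2) by auto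
qed

lemma zero_prime: "{pzero A} : spec"
proof -
 have "1[E] ~= pzero E" using E.Units_one_closed by (auto simp: Units_E)
 hence "1[A] ~= pzero A" using \<iota>_simps by metis
 hence "{pzero A} ~= carrier A" using A.one_closed by blast
 moreover have "a = pzero A \<or> b = pzero A" if ab: "a : carrier A" "b : carrier A" "a *[A] b = pzero A" for a b
 proof (rule ccontr)
  assume "~ ?thesis"
  hence "\<iota> a *[E] \<iota> b : Units E" using ab Units_E_mult \<iota>_Units by auto
  hence "\<iota> (pzero A) : Units E" using ab \<iota>_simps(4)[of a b] by simp
  thus False by (simp add: \<iota>_simps Units_E)
 qed
 ultimately show ?thesis
  using A.pzero_closed A.pzero_absorb A.m_comm[OF _ A.pzero_closed] by (auto simp: prime_pideal_def)
qed

text \<open>The zero ideal is the generic point, because \<open>A\<close> embeds into a pointed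
  group and open sets are closed under passing to smaller primes.\<close>

lemma zero_in_open: "openin (MSpec_top A) V ==> V ~= {} ==> {pzero A} : V"
proof -
 assume V: "openin (MSpec_top A) V" "V ~= {}"
 then obtain P where P: "P : V" by blast
 hence "P : spec" using openin_subset[OF V(1)] unfolding MSpec_avoid_top topspace_avoid by blast
 thus ?thesis using open_downward[OF V(1)[unfolded MSpec_avoid_top] P zero_prime] primeD(2) by blast
qed

abbreviation "gm \<equiv> germ A E \<iota>"

lemma germ_iff: "(b, t) : gm P x \<longleftrightarrow> b : carrier A & t : carrier A - P & \<iota> b = \<iota> t *[E] x"
 by (simp add: germ_def)

lemma frac_germ:
 assumes P: "P : spec" and x: "x : carrier E" and as: "(a, s) : gm P x"
 shows "frac A (carrier A - P) a s = gm P x"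
proof -
 have a: "a : carrier A" "s : carrier A" "s ~: P" "\<iota> a = \<iota> s *[E] x" using as by (auto simp: germ_iff)
 have "(EX u:carrier A - P. u *[A] (t *[A] a) = u *[A] (s *[A] b)) \<longleftrightarrow> \<iota> b = \<iota> t *[E] x"
  if b: "b : carrier A" "t : carrier A - P" for b t
 proof -
  have t: "t : carrier A" using b by simp
  have "u *[A] (t *[A] a) = u *[A] (s *[A] b) \<longleftrightarrow> \<iota> b = \<iota> t *[E] x" if u: "u : carrier A - P" for u
  proof -
   have uc: "u : carrier A" using u by simp
   have "u *[A] (t *[A] a) = u *[A] (s *[A] b) \<longleftrightarrow>
     \<iota> (u *[A] (t *[A] a)) = \<iota> (u *[A] (s *[A] b))"
    using inj_on_eq_iff[OF inj] uc t a b by simp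
   also have "\<dots> \<longleftrightarrow> \<iota> t *[E] \<iota> a = \<iota> s *[E] \<iota> b"
    using uc t a b x primeD(5)[OF P u] by (simp add: \<iota>_simps E_cancel)
   also have "\<iota> t *[E] \<iota> a = \<iota> s *[E] (\<iota> t *[E] x)"
    using a t x by (simp add: \<iota>_simps E.m_lcomm)
   finally show ?thesis using primeD(5)[OF P, of s] a b t x by (auto simp: \<iota>_simps E_cancel)
  qed
  thus ?thesis using primeD(3)[OF P] by blast
 qed
 thus ?thesis using a by (auto simp: frac_def loc_rel_def germ_def)
qed

lemma frac_exists:
 assumes P: "P : spec" and as: "a : carrier A" "s : carrier A - P"
 shows "EX x:carrier E. (a, s) : gm P x"
proof (intro bexI)
 show "(a, s) : gm P (inv[E] (\<iota> s) *[E] \<iota> a)"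
  using as primeD(5)[OF P as(2)] by (simp add: germ_iff \<iota>_simps E.m_assoc[symmetric])
 show "inv[E] (\<iota> s) *[E] \<iota> a : carrier E" using as primeD(5)[OF P as(2)] by (simp add: \<iota>_simps)
qed

lemma germ_unique:
 assumes P: "P : spec" and "x : carrier E" "y : carrier E" "p : gm P x" "p : gm P y"
 shows "x = y"
proof -
 obtain b t where p: "p = (b, t)" by force
 show ?thesis using assms primeD(5)[OF P, of t] by (auto simp: p germ_iff \<iota>_simps E_cancel)
qed

lemma localization_carrier:
 assumes P: "P : spec"
 shows "carrier (localization A (carrier A - P)) = {gm P x | x. x : carrier E & gm P x ~= {}}"
proof -
 have "carrier (localization A (carrier A - P)) = {frac A (carrier A - P) a s | a s. a : carrier A & s : carrier A - P}"
  by (auto simp: localization_def quotient_def frac_def)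
 also have "\<dots> = {gm P x | x. x : carrier E & gm P x ~= {}}"
 proof (intro equalityI subsetI)
  fix Y assume "Y : {frac A (carrier A - P) a s | a s. a : carrier A & s : carrier A - P}"
  then obtain a s where Y: "Y = frac A (carrier A - P) a s" "a : carrier A" "s : carrier A - P" by blast
  then obtain x where x: "x : carrier E" "(a, s) : gm P x" using frac_exists[OF P] by blast
  hence "Y = gm P x" "gm P x ~= {}" using frac_germ[OF P x] Y(1) by auto
  thus "Y : {gm P x | x. x : carrier E & gm P x ~= {}}" using x(1) by blast
 next
  fix Y assume "Y : {gm P x | x. x : carrier E & gm P x ~= {}}"
  then obtain x a s where x: "Y = gm P x" "x : carrier E" "(a, s) : gm P x" by auto
  hence "Y = frac A (carrier A - P) a s" "a : carrier A" "s : carrier A - P"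
   using frac_germ[OF P x(2,3)] by (auto simp: germ_iff)
  thus "Y : {frac A (carrier A - P) a s | a s. a : carrier A & s : carrier A - P}" by blast
 qed
 finally show ?thesis .
qed

lemma germ_closed: "x : carrier A ==> P : spec ==> (x, 1[A]) : gm P (\<iota> x)"
 using primeD(3) by (simp add: germ_iff \<iota>_simps)

lemma localization_ops:
 assumes P: "P : spec"
 shows "1[localization A (carrier A - P)] = gm P 1[E]" "pzero (localization A (carrier A - P)) = gm P (pzero E)"
  "x : carrier E ==> y : carrier E ==> gm P x ~= {} ==> gm P y ~= {} ==>
   gm P x *[localization A (carrier A - P)] gm P y = gm P (x *[E] y) & gm P (x *[E] y) ~= {}"
proof -
 show "1[localization A (carrier A - P)] = gm P 1[E]" "pzero (localization A (carrier A - P)) = gm P (pzero E)"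
  using frac_germ[OF P _ germ_closed[OF A.one_closed P]] frac_germ[OF P _ germ_closed[OF A.pzero_closed P]]
   E.pzero_closed by (simp_all add: localization_def \<iota>_simps)
 assume xy: "x : carrier E" "y : carrier E" "gm P x ~= {}" "gm P y ~= {}"
 have mem: "(a *[A] b, s *[A] t) : gm P (x *[E] y)" if a: "(a, s) : gm P x" and b: "(b, t) : gm P y" for a s b t
 proof -
  have ab: "a : carrier A" "s : carrier A - P" "\<iota> a = \<iota> s *[E] x" "b : carrier A" "t : carrier A - P" "\<iota> b = \<iota> t *[E] y"
   using a b by (auto simp: germ_iff)
  have st: "\<iota> s : carrier E" "\<iota> t : carrier E" using ab by (auto simp: \<iota>_simps)
  have "\<iota> (a *[A] b) = \<iota> (s *[A] t) *[E] (x *[E] y)"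
   using ab st xy by (simp add: \<iota>_simps E.m_ac)
  thus ?thesis using ab primeD(4)[OF P ab(2,5)] by (simp add: germ_iff)
 qed
 have fr: "frac A (carrier A - P) (a *[A] b) (s *[A] t) = gm P (x *[E] y)"
  if "(a, s) : gm P x" "(b, t) : gm P y" for a s b t
  using frac_germ[OF P E.m_closed[OF xy(1,2)] mem[OF that]] .
 obtain a s b t where ab: "(a, s) : gm P x" "(b, t) : gm P y" using xy(3,4) by fast
 have "(UN (a, s):gm P x. UN (b, t):gm P y. frac A (carrier A - P) (a *[A] b) (s *[A] t)) = gm P (x *[E] y)"
  using fr ab by fast
 thus "gm P x *[localization A (carrier A - P)] gm P y = gm P (x *[E] y) & gm P (x *[E] y) ~= {}"
  using mem[OF ab] by (auto simp: localization_def)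
qed

abbreviation "gdom \<equiv> germ_domain A E \<iota>"
abbreviation "gsec \<equiv> germ_section A E \<iota>"

lemma gdom_iff: "x : gdom V \<longleftrightarrow> x : carrier E & (ALL P:V. gm P x ~= {})"
 by (simp add: germ_domain_def)

lemma gdom_closed:
 assumes V: "V <= spec"
 shows "1[E] : gdom V" "pzero E : gdom V" "x : gdom V ==> y : gdom V ==> x *[E] y : gdom V"
  "a : carrier A ==> \<iota> a : gdom V"
proof -
 show a: "\<iota> a : gdom V" if "a : carrier A" for a unfolding gdom_iff
 proof (intro conjI ballI)
  fix P assume "P : V"
  thus "gm P (\<iota> a) ~= {}" using germ_closed[OF that, of P] V by blast
 qed (rule \<iota>_simps(1)[OF that])
 show "1[E] : gdom V" "pzero E : gdom V" using a[OF A.one_closed] a[OF A.pzero_closed] by (simp_all add: \<iota>_simps)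
 show "x *[E] y : gdom V" if "x : gdom V" "y : gdom V"
  using that localization_ops(3) V unfolding gdom_iff by (meson E.m_closed subsetD)
qed

lemma openin_spec: "openin (MSpec_top A) V ==> V <= spec"
 using openin_subset[of "MSpec_top A" V] by (simp only: MSpec_avoid_top topspace_avoid)

lemma gsec_closed:
 assumes V: "openin (MSpec_top A) V" and x: "x : gdom V"
 shows "gsec V x : carrier (MSpec_sections A V)"
proof -
 note VS = openin_spec[OF V]
 have "EX W a h. openin (MSpec_top A) W & P : W & W <= V & a : carrier A & h : carrier A &
     (ALL Q:W. h ~: Q & gsec V x Q = frac A (carrier A - Q) a h)" if P: "P : V" for P
 proof -
  obtain a h where ah: "(a, h) : gm P x" using x P unfolding gdom_iff by fast
  let ?W = "V Int {Q : spec. h ~: Q}"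
  have h: "a : carrier A" "h : carrier A" "h ~: P" using ah by (auto simp: germ_iff)
  have "openin (MSpec_top A) ?W"
   using V openin_avoid_basic[OF h(2)] unfolding MSpec_avoid_top by (rule openin_Int)
  moreover have "P : ?W" using P VS h(3) by auto
  moreover have "h ~: Q & gsec V x Q = frac A (carrier A - Q) a h" if Q: "Q : ?W" for Q
  proof -
   have "(a, h) : gm Q x" using ah Q by (auto simp: germ_iff)
   thus ?thesis using frac_germ[of Q x a h] Q x by (auto simp: germ_section_def gdom_iff)
  qed
  ultimately show ?thesis using h by blast
 qed
 moreover have "gsec V x : (\<Pi>\<^sub>E P\<in>V. carrier (localization A (carrier A - P)))"
 proof
  fix P assume P: "P : V"
  hence "P : spec" using VS by blast
  from localization_carrier[OF this] show "gsec V x P : carrier (localization A (carrier A - P))"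
   using x P by (auto simp: germ_section_def gdom_iff)
 qed (simp add: germ_section_def)
 ultimately show ?thesis unfolding MSpec_sections_def by simp
qed

lemma gsec_hom:
 assumes V: "openin (MSpec_top A) V"
 shows "gsec V : pmon_hom (E\<lparr>carrier := gdom V\<rparr>) (MSpec_sections A V)"
proof (rule pmon_homI)
 note VS = openin_spec[OF V]
 show "gsec V x : carrier (MSpec_sections A V)" if "x : carrier (E\<lparr>carrier := gdom V\<rparr>)" for x
  using gsec_closed[OF V] that by simp
 show "gsec V 1[E\<lparr>carrier := gdom V\<rparr>] = 1[MSpec_sections A V]"
  "gsec V (pzero (E\<lparr>carrier := gdom V\<rparr>)) = pzero (MSpec_sections A V)"
  using VS localization_ops(1,2) by (auto simp: MSpec_sections_def germ_section_def intro!: restrict_ext)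
 fix x y assume "x : carrier (E\<lparr>carrier := gdom V\<rparr>)" "y : carrier (E\<lparr>carrier := gdom V\<rparr>)"
 hence xy: "x : gdom V" "y : gdom V" by simp_all
 have "gm P (x *[E] y) = gm P x *[localization A (carrier A - P)] gm P y" if P: "P : V" for P
  using localization_ops(3)[of P x y] P xy VS by (auto simp: gdom_iff)
 thus "gsec V (x *[E\<lparr>carrier := gdom V\<rparr>] y) = gsec V x *[MSpec_sections A V] gsec V y"
  by (auto simp: MSpec_sections_def germ_section_def intro!: restrict_ext)
qed

lemma gsec_inj:
 assumes V: "openin (MSpec_top A) V" "V ~= {}" and xy: "x : gdom V" "y : gdom V" "gsec V x = gsec V y"
 shows "x = y"
proof -
 note Z = zero_in_open[OF V]
 have "gsec V x {pzero A} = gm {pzero A} x" "gsec V y {pzero A} = gm {pzero A} y" using Z by (simp_all add: germ_section_def)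
 hence "gm {pzero A} x = gm {pzero A} y" using xy(3) by (simp only:)
 moreover obtain p where "p : gm {pzero A} x" using xy(1) Z unfolding gdom_iff by fast
 ultimately show ?thesis using germ_unique[OF zero_prime, of x y p] xy by (simp add: gdom_iff)
qed

text \<open>The germ at the generic point is an element \<open>x\<close> of \<open>E\<close>. Near
  any \<open>P\<close> the section is one fraction on a neighbourhood, and this neighbourhood
  contains the generic point, so the fraction represents \<open>x\<close> too.\<close>

lemma gsec_surj:
 assumes V: "openin (MSpec_top A) V" and s: "s : carrier (MSpec_sections A V)"
 shows "s : gsec V ` gdom V"
proof (cases "V = {}")
 case True
 hence "s = gsec V 1[E]" "1[E] : gdom V"
  using s gdom_closed(1)[of V] by (auto simp: MSpec_sections_def germ_section_def)
 thus ?thesis by blast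
next
 case False
 note VS = openin_spec[OF V] and Z = zero_in_open[OF V False]
 have s1: "s : (\<Pi>\<^sub>E P\<in>V. carrier (localization A (carrier A - P)))"
  and s2: "!!P. P : V ==> EX W a h. openin (MSpec_top A) W & P : W & W <= V & a : carrier A & h : carrier A &
     (ALL Q:W. h ~: Q & s Q = frac A (carrier A - Q) a h)" using s by (auto simp: MSpec_sections_def)
 have "s {pzero A} : carrier (localization A (carrier A - {pzero A}))" using PiE_mem[OF s1 Z] .
 then obtain x where x: "x : carrier E" "s {pzero A} = gm {pzero A} x"
  unfolding localization_carrier[OF zero_prime] by blast
 have "s P = gm P x & gm P x ~= {}" if P: "P : V" for P
 proof -
  obtain W a h where W: "openin (MSpec_top A) W" "P : W" "W <= V" and ah: "a : carrier A" "h : carrier A"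
   and s3: "!!Q. Q : W ==> h ~: Q & s Q = frac A (carrier A - Q) a h" using s2[OF P] by (elim exE conjE) blast
  have ZW: "{pzero A} : W" using zero_in_open[OF W(1)] W(2) by blast
  have Ps: "P : spec" using P VS by blast
  have h: "h : carrier A - P" "h : carrier A - {pzero A}" using s3[OF W(2)] s3[OF ZW] ah by auto
  obtain y where y: "y : carrier E" "(a, h) : gm {pzero A} y" using frac_exists[OF zero_prime ah(1) h(2)] by blast
  have "gm {pzero A} y = gm {pzero A} x" using frac_germ[OF zero_prime y] s3[OF ZW] x(2) by simp
  hence "x = y" using germ_unique[OF zero_prime x(1) y(1), of "(a, h)"] y(2) by simp
  moreover have "(a, h) : gm P y" using y(2) h(1) by (auto simp: germ_iff)
  ultimately show ?thesis using frac_germ[OF Ps y(1), of a h] s3[OF W(2)] by auto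
 qed
 hence "x : gdom V" "!!P. P : V ==> s P = gsec V x P" using x(1) by (auto simp: gdom_iff germ_section_def)
 moreover from this have "s = gsec V x"
  using s1 by (intro extensionalityI[of s V]) (auto simp: germ_section_def PiE_def)
 ultimately show ?thesis by blast
qed

lemma gsec_restrict: "W <= V ==> restrict (gsec V x) W = gsec W x" by (auto simp: germ_section_def fun_eq_iff)

end

lemma pmon_hom_image:
 assumes A: "pointed_monoid A" and g: "g : pmon_hom A B" "g ` carrier A = carrier B"
 shows "pointed_monoid B"
proof -
 interpret pointed_monoid A by fact
 note gs = pmon_homD[OF g(1)]
 have im: "EX a:carrier A. y = g a" if "y : carrier B" for y using that g(2) by blast
 show ?thesis
 proof
  fix x y z assume x: "x : carrier B"
  then obtain a where a: "a : carrier A" "x = g a" using im by blast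
  show "1[B] *[B] x = x" "x *[B] 1[B] = x" "pzero B *[B] x = pzero B"
   unfolding a(2) gs(2,3)[symmetric] using a(1) pzero_absorb[OF a(1)] pzero_closed by (simp_all add: gs(4)[symmetric])
  assume y: "y : carrier B"
  then obtain b where b: "b : carrier A" "y = g b" using im by blast
  show "x *[B] y : carrier B" "x *[B] y = y *[B] x"
   unfolding a(2) b(2) using a b by (simp_all add: gs(1) gs(4)[symmetric] m_comm)
  assume z: "z : carrier B"
  then obtain c where c: "c : carrier A" "z = g c" using im by blast
  show "x *[B] y *[B] z = x *[B] (y *[B] z)"
   unfolding a(2) b(2) c(2) using a b c by (simp add: gs(4)[symmetric] m_assoc)
 qed (use gs(2,3) gs(1)[OF one_closed] gs(1)[OF pzero_closed] in simp_all)
qed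

text \<open>Two images of \<open>D\<close> with the same fibres are isomorphic. With
  \<open>D\<close> the elements of \<open>E\<close> regular on an open set, this compares two
  monoids of sections; over the empty set the maps onto sections are not injective, so inverting
  bijections would not suffice.\<close>

lemma pmon_iso_quotients:
 assumes p: "p : pmon_hom D A" "p ` carrier D = carrier A" and q: "q : pmon_hom D B" "q ` carrier D = carrier B"
  and D: "1[D] : carrier D" "pzero D : carrier D" "!!x y. x : carrier D ==> y : carrier D ==> x *[D] y : carrier D"
  and eq: "!!x y. x : carrier D ==> y : carrier D ==> p x = p y \<longleftrightarrow> q x = q y"
 shows "q \<circ> inv_into (carrier D) p : pmon_iso A B"
  and "x : carrier D ==> (q \<circ> inv_into (carrier D) p) (p x) = q x"
proof -
 let ?t = "q \<circ> inv_into (carrier D) p"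
 have inv: "?t (p x) = q x" if x: "x : carrier D" for x
 proof -
  have "inv_into (carrier D) p (p x) : carrier D" "p (inv_into (carrier D) p (p x)) = p x"
   using x by (auto intro: inv_into_into f_inv_into_f)
  thus ?thesis using eq[OF _ x] by simp
 qed
 thus "x : carrier D ==> ?t (p x) = q x" .
 have im: "EX x:carrier D. a = p x" if "a : carrier A" for a using that p(2) by blast
 have "?t : pmon_hom A B"
 proof (rule pmon_homI)
  show "?t a : carrier B" if "a : carrier A" for a using im[OF that] inv pmon_homD(1)[OF q(1)] by auto
  show "?t 1[A] = 1[B]" "?t (pzero A) = pzero B"
   using inv[OF D(1)] inv[OF D(2)] pmon_homD(2,3)[OF p(1)] pmon_homD(2,3)[OF q(1)] by simp_all
  fix a b assume "a : carrier A" "b : carrier A"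
  then obtain x y where xy: "x : carrier D" "y : carrier D" "a = p x" "b = p y" using im by metis
  hence "a *[A] b = p (x *[D] y)" using pmon_homD(4)[OF p(1)] by simp
  hence "?t (a *[A] b) = q (x *[D] y)" using inv[OF D(3)[OF xy(1,2)]] by simp
  also have "\<dots> = ?t a *[B] ?t b" using inv[OF xy(1)] inv[OF xy(2)] xy pmon_homD(4)[OF q(1) xy(1,2)] by simp
  finally show "?t (a *[A] b) = ?t a *[B] ?t b" .
 qed
 moreover have "bij_betw ?t (carrier A) (carrier B)" unfolding bij_betw_def
 proof
  show "inj_on ?t (carrier A)"
  proof (rule inj_onI)
   fix a b assume ab: "a : carrier A" "b : carrier A" "?t a = ?t b"
   then obtain x y where xy: "x : carrier D" "y : carrier D" "a = p x" "b = p y" using im by metis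
   thus "a = b" using ab(3) inv eq by metis
  qed
  show "?t ` carrier A = carrier B"
   unfolding p(2)[symmetric] q(2)[symmetric] image_image by (rule image_cong) (simp_all add: inv del: comp_apply)
 qed
 ultimately show "?t : pmon_iso A B" by (simp add: pmon_iso_def)
qed

section \<open>The affine open sets of a toric monoid scheme\<close>

context toric_scheme_fan
begin

lemma M_add: "s : M ==> t : M ==> s + t : M" and M_zero: "0 : M" and M_uminus: "s : M ==> - s : M"
 using zsubgroup_add[OF M] zsubgroup_zero[OF M] zsubgroup_uminus[OF M] by auto

abbreviation E :: "('k \<times> ('v => real)) option pmonoid" where "E \<equiv> monoid_alg F M"

lemma A_sub_E: "carrier (A C) <= carrier E" using CM_subset by (auto simp: monoid_alg_carrier)

lemma E_pointed_monoid: "pointed_monoid E" by (rule monoid_alg_pointed_monoid) (rule M_zero, rule M_add)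

lemma E_ops: "x *[A C] y = x *[E] y" "1[A C] = 1[E]" "pzero (A C) = pzero E" by (simp_all add: monoid_alg_def)

lemma Units_E: "Units E = carrier E - {pzero E}"
proof (intro equalityI subsetI)
 fix x assume "x : Units E"
 then obtain y where "x : carrier E" "x *[E] y = 1[E]" by (auto simp: Units_def)
 moreover from this have "x ~= None" by (metis monoid_alg_ops(2,4) option.distinct(1))
 ultimately show "x : carrier E - {pzero E}" by simp
next
 fix x assume "x : carrier E - {pzero E}"
 then obtain l s where x: "x = Some (l, s)" "l : Units F" "s : M" by (auto simp: monoid_alg_carrier)
 hence "Some (inv[F] l, - s) : carrier E" "Some (inv[F] l, - s) *[E] x = 1[E]" "x *[E] Some (inv[F] l, - s) = 1[E]"
  using M_uminus by simp_all
 moreover have "x : carrier E" using x by simp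
 ultimately show "x : Units E" unfolding Units_def by blast
qed

lemma frac_A: "C : \<Sigma> ==> frac_monoid (A C) E id"
proof (intro frac_monoid.intro frac_monoid_axioms.intro A_pointed_monoid E_pointed_monoid Units_E)
 show "id : pmon_hom (A C) E" using A_sub_E by (intro pmon_homI) (auto simp: E_ops)
qed simp_all

abbreviation "gX C \<equiv> germ (A C) E id"

text \<open>A fraction regular at \<open>Q\<close> on the smaller cone is regular at the restricted
  prime: numerator and denominator are multiplied by a power of the character of \<open>h\<close>,
  and this does not move the denominator into \<open>Q\<close>.\<close>

lemma gX_localization:
 assumes D: "D : \<Sigma>" "C : \<Sigma>" "D <= C" and Q: "Q : primes D" and x: "x : carrier E"
 shows "gX D Q x ~= {} \<longleftrightarrow> gX C (Q Int carrier (A C)) x ~= {}"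
proof
 obtain h where h: "h : CM C" "D = C Int {u. h u = 0}" using face_lattice_functional[OF D(2,1,3)] by blast
 assume "gX D Q x ~= {}"
 then obtain b t where bt: "b : carrier (A D)" "t : carrier (A D)" "t ~: Q" "b = t *[E] x" by (auto simp: germ_def)
 obtain k where k: "shift (zmul (int k) h) b : carrier (A C)" "shift (zmul (int k) h) t : carrier (A C)"
 proof -
  obtain i j where "ALL k>=i. shift (zmul (int k) h) b : carrier (A C)" "ALL k>=j. shift (zmul (int k) h) t : carrier (A C)"
   using shift_clear[OF D(2) h(1), folded h(2)] bt(1,2) by metis
  thus thesis by (intro that[of "max i j"]) auto
 qed
 have "shift (zmul (int k) h) t : Q \<longleftrightarrow> t : Q"
  using bt(2) prime_localization(1)[OF D(2) h(1), folded h(2), OF Q]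
  by (cases rule: monoid_alg_cases) simp_all
 moreover have "shift (zmul (int k) h) b = shift (zmul (int k) h) t *[E] x"
  using bt(2) x unfolding bt(4) by (elim monoid_alg_cases) (simp_all add: ac_simps)
 ultimately have "(shift (zmul (int k) h) b, shift (zmul (int k) h) t) : gX C (Q Int carrier (A C)) x"
  using k bt(3) by (simp add: germ_def)
 thus "gX C (Q Int carrier (A C)) x ~= {}" by blast
next
 assume "gX C (Q Int carrier (A C)) x ~= {}"
 then obtain b t where "(b, t) : gX C (Q Int carrier (A C)) x" by force
 hence "(b, t) : gX D Q x" using A_mono[OF D(3)] by (auto simp: germ_def)
 thus "gX D Q x ~= {}" by blast
qed

lemma gX_loc_map:
 assumes D: "D : \<Sigma>" "C : \<Sigma>" "D <= C" and Q: "Q : primes D" and x: "x : carrier E"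
  and ne: "gX C (Q Int carrier (A C)) x ~= {}"
 shows "loc_map (A D) (carrier (A D) - Q) id (gX C (Q Int carrier (A C)) x) = gX D Q x"
proof -
 interpret frac_monoid "A D" E id by (rule frac_A[OF D(1)])
 have "frac (A D) (carrier (A D) - Q) (id a) (id s) = gX D Q x"
  if "(a, s) : gX C (Q Int carrier (A C)) x" for a s
 proof -
  have "(a, s) : gX D Q x" using that A_mono[OF D(3)] by (auto simp: germ_def)
  thus ?thesis using frac_germ[OF Q x] by simp
 qed
 thus ?thesis using ne unfolding loc_map_def by fast
qed

abbreviation "XS \<equiv> toric_scheme F N \<Sigma>"

sublocale MS: gluing \<Sigma> "face_rel \<Sigma>" "%C. avoid_top (primes C) (carrier (A C))" "%D C P. P Int carrier (A C)"
 by (rule MSpec_gluing)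

lemma MSpec_map_id: "MSpec_map (A C) id = (%P. P Int carrier (A C))" by (auto simp: MSpec_map_def fun_eq_iff)

lemma MSpec_simps: "sections (MSpec S) = MSpec_sections S" "restr (MSpec S) U V s = restrict s V"
 by (simp_all add: MSpec_def)

lemma top_primes: "C : \<Sigma> ==> topspace (avoid_top (primes C) (carrier (A C))) = primes C"
 by (rule avoid_space.topspace_avoid[OF primes_avoid_space])

definition pre :: "'v set => ('v set \<times> ('k \<times> ('v => real)) option set) set set => ('k \<times> ('v => real)) option set set" where
 "pre C U = {P : primes C. MS.chart C P : U}"

lemma pts_XS: "pts XS = MS.colim"
 by (simp add: toric_scheme_def ms_colim_def Let_def MSpec_def MSpec_map_id MSpec_avoid)

lemma topspace_XS: "topspace (pts XS) = (UN C:\<Sigma>. MS.chart C ` primes C)"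
 unfolding pts_XS MS.topspace_colim using top_primes by simp

lemma openin_XS:
 assumes "U <= topspace (pts XS)"
 shows "openin (pts XS) U \<longleftrightarrow> (ALL C:\<Sigma>. openin (MSpec_top (A C)) (pre C U))"
proof -
 have "openin (pts XS) U \<longleftrightarrow> (ALL C:\<Sigma>. openin (avoid_top (primes C) (carrier (A C)))
   {x : topspace (avoid_top (primes C) (carrier (A C))). MS.chart C x : U})"
  using assms unfolding pts_XS by (rule MS.openin_colim)
 thus ?thesis using top_primes by (simp add: pre_def MSpec_avoid)
qed

lemma pre_eq: "C : \<Sigma> ==>
  {x : topspace (pts (MSpec (A C))). colim_inj \<Sigma> (face_rel \<Sigma>) (%i. pts (MSpec (A i))) (%D C. MSpec_map (A C) id) C x : U} = pre C U"
 using top_primes[of C] by (simp add: pre_def MSpec_def MSpec_map_id MSpec_avoid)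

lemma XS_carrier:
 "s : carrier (sections XS U) \<longleftrightarrow> s : (\<Pi>\<^sub>E i\<in>\<Sigma>. carrier (MSpec_sections (A i) (pre i U))) &
  (ALL j i. (j, i) : face_rel \<Sigma> --> MSpec_map_sections (A i) (A j) id (pre i U) (s i) = s j)"
proof -
 have "(\<Pi>\<^sub>E i\<in>\<Sigma>. carrier (sections (MSpec (A i)) {x : topspace (pts (MSpec (A i))). colim_inj \<Sigma> (face_rel \<Sigma>) (%i. pts (MSpec (A i))) (%D C. MSpec_map (A C) id) i x : U}))
  = (\<Pi>\<^sub>E i\<in>\<Sigma>. carrier (MSpec_sections (A i) (pre i U)))"
  by (intro PiE_cong) (simp add: pre_eq MSpec_simps)
 thus ?thesis by (auto simp: toric_scheme_def ms_colim_def Let_def pre_eq face_rel_iff Ball_def)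
qed

lemma XS_ops:
 "s *[sections XS U] t = (\<lambda>i\<in>\<Sigma>. s i *[MSpec_sections (A i) (pre i U)] t i)"
 "1[sections XS U] = (\<lambda>i\<in>\<Sigma>. 1[MSpec_sections (A i) (pre i U)])"
 "pzero (sections XS U) = (\<lambda>i\<in>\<Sigma>. pzero (MSpec_sections (A i) (pre i U)))"
 "restr XS U V s = (\<lambda>i\<in>\<Sigma>. restrict (s i) (pre i V))"
 by (auto simp: toric_scheme_def ms_colim_def Let_def pre_eq MSpec_simps intro!: restrict_ext)

lemma pre_restrict:
 assumes "(D, C) : face_rel \<Sigma>"
 shows "{Q. prime_pideal Q (A D) & MSpec_map (A C) id Q : pre C U} = pre D U"
 using assms MS.chart_f[OF assms] prime_restrict[of C D] top_primes[of D]
 by (auto simp: face_rel_iff MSpec_map_id pre_def)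

definition domX :: "('v set \<times> ('k \<times> ('v => real)) option set) set set => ('k \<times> ('v => real)) option set" where
 "domX U = {x : carrier E. ALL C:\<Sigma>. ALL P:pre C U. gX C P x ~= {}}"

definition secX where
 "secX U x = (\<lambda>C\<in>\<Sigma>. germ_section (A C) E id (pre C U) x)"

lemma domX_germ_domain: "x : domX U ==> C : \<Sigma> ==> x : germ_domain (A C) E id (pre C U)"
 by (simp add: domX_def germ_domain_def)

lemma domX_carrier: "x : domX U ==> x : carrier E" by (simp add: domX_def)

lemma pre_sub: "pre C U <= primes C" by (auto simp: pre_def)

lemma pre_open: "openin (pts XS) U ==> C : \<Sigma> ==> openin (MSpec_top (A C)) (pre C U)"
 using openin_XS openin_subset by blast

lemma secX_closed:
 assumes U: "openin (pts XS) U" and x: "x : domX U"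
 shows "secX U x : carrier (sections XS U)" unfolding XS_carrier
proof (intro conjI allI impI)
 show "secX U x : (\<Pi>\<^sub>E i\<in>\<Sigma>. carrier (MSpec_sections (A i) (pre i U)))"
  using frac_monoid.gsec_closed[OF frac_A pre_open[OF U] domX_germ_domain[OF x]] by (auto simp: secX_def)
 fix D C assume R: "(D, C) : face_rel \<Sigma>"
 hence s: "D : \<Sigma>" "C : \<Sigma>" "D <= C" by (auto simp: face_rel_iff)
 have "loc_map (A D) (carrier (A D) - Q) id (secX U x C (MSpec_map (A C) id Q)) = secX U x D Q"
  if Q: "Q : pre D U" for Q
 proof -
  have Qs: "Q : primes D" "Q Int carrier (A C) : pre C U"
   using Q unfolding pre_restrict[OF R, symmetric] by (auto simp: MSpec_map_id)
  hence "gX C (Q Int carrier (A C)) x ~= {}" using x s(2) by (auto simp: domX_def)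
  from gX_loc_map[OF s Qs(1) domX_carrier[OF x] this] show ?thesis
   using s Q Qs(2) by (simp add: secX_def germ_section_def MSpec_map_id)
 qed
 thus "MSpec_map_sections (A C) (A D) id (pre C U) (secX U x C) = secX U x D"
  unfolding MSpec_map_sections_def pre_restrict[OF R] using s
  by (auto simp: secX_def germ_section_def fun_eq_iff)
qed

lemma domX_closed: "1[E] : domX U" "pzero E : domX U" "x : domX U ==> y : domX U ==> x *[E] y : domX U"
proof -
 interpret E: pointed_monoid E by (rule E_pointed_monoid)
 note gd = frac_monoid.gdom_closed[OF frac_A pre_sub]
 show "x *[E] y : domX U" if "x : domX U" "y : domX U"
  using gd(3)[OF _ domX_germ_domain[OF that(1)] domX_germ_domain[OF that(2)]]
   E.m_closed[OF domX_carrier[OF that(1)] domX_carrier[OF that(2)]]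
  unfolding domX_def germ_domain_def by blast+
 show "1[E] : domX U" "pzero E : domX U" using gd(1,2) E.one_closed E.pzero_closed
  unfolding domX_def germ_domain_def by blast+
qed

abbreviation "DX U \<equiv> E\<lparr>carrier := domX U\<rparr>"

lemma secX_hom:
 assumes U: "openin (pts XS) U"
 shows "secX U : pmon_hom (DX U) (sections XS U)"
proof (rule pmon_homI)
 note gh = frac_monoid.gsec_hom[OF frac_A pre_open[OF U]]
 show "secX U x : carrier (sections XS U)" if "x : carrier (DX U)" for x using secX_closed[OF U] that by simp
 show "secX U 1[DX U] = 1[sections XS U]" "secX U (pzero (DX U)) = pzero (sections XS U)"
  using pmon_homD(2,3)[OF gh] by (auto simp: secX_def XS_ops(2,3) intro!: restrict_ext)
 fix x y assume "x : carrier (DX U)" "y : carrier (DX U)"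
 hence "x : domX U" "y : domX U" by simp_all
 thus "secX U (x *[DX U] y) = secX U x *[sections XS U] secX U y"
  using pmon_homD(4)[OF gh] domX_germ_domain by (auto simp: secX_def XS_ops(1) intro!: restrict_ext)
qed

lemma zero_primes: "C : \<Sigma> ==> {None} : primes C" using frac_monoid.zero_prime[OF frac_A] by simp

text \<open>The zero cone is a face of every cone, so all charts share one generic point.\<close>

lemma generic_chart:
 assumes "C : \<Sigma>"
 shows "({0}, C) : face_rel \<Sigma>" "MS.chart C {None} = MS.chart {0} {None}"
proof -
 have 0: "0 : C" using gens(3)[OF assms] by (force simp: cone_hull_def intro: exI[of _ "%_. 0"])
 thus R: "({0}, C) : face_rel \<Sigma>" using zero_cone_mem[OF assms] assms by (simp add: face_rel_iff)
 have "{None} Int carrier (A C) = {None}" by simp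
 thus "MS.chart C {None} = MS.chart {0} {None}"
  using MS.chart_f[OF R, of "{None}"] top_primes zero_primes zero_cone_mem[OF assms] by simp
qed

lemma generic_pre:
 assumes U: "openin (pts XS) U" "U ~= {}" and C: "C : \<Sigma>"
 shows "{None} : pre C U"
proof -
 obtain y where y: "y : U" using U(2) by blast
 hence "y : topspace (pts XS)" using openin_subset[OF U(1)] by blast
 then obtain D P where D: "D : \<Sigma>" "y = MS.chart D P" "P : primes D" unfolding topspace_XS by blast
 hence "pre D U ~= {}" using y by (auto simp: pre_def)
 hence "{None} : pre D U" using frac_monoid.zero_in_open[OF frac_A[OF D(1)] pre_open[OF U(1) D(1)]] by simp
 thus ?thesis using generic_chart(2)[OF D(1)] generic_chart(2)[OF C] zero_primes[OF C] by (simp add: pre_def)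
qed

lemma secX_inj:
 assumes U: "openin (pts XS) U" "U ~= {}" and xy: "x : domX U" "y : domX U" "secX U x = secX U y"
 shows "x = y"
proof -
 obtain z where "z : U" using U(2) by blast
 hence "z : topspace (pts XS)" using openin_subset[OF U(1)] by blast
 then obtain C where C: "C : \<Sigma>" unfolding topspace_XS by blast
 show ?thesis
 proof (rule frac_monoid.gsec_inj[OF frac_A[OF C] pre_open[OF U(1) C]])
  show "pre C U ~= {}" using generic_pre[OF U C] by blast
  show "germ_section (A C) E id (pre C U) x = germ_section (A C) E id (pre C U) y"
   using fun_cong[OF xy(3), of C] C by (simp add: secX_def)
 qed (use domX_germ_domain C xy in blast)+
qed

lemma secX_empty: "secX {} x = secX {} y" by (auto simp: secX_def pre_def germ_section_def fun_eq_iff)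

text \<open>In each chart the section is given by an element of \<open>E\<close>. Compatibility
  along the inclusion of the zero cone, evaluated at the generic point, shows that all charts give
  the same element.\<close>

lemma secX_surj:
 assumes U: "openin (pts XS) U"
 shows "secX U ` domX U = carrier (sections XS U)"
proof (intro equalityI subsetI)
 fix s assume s: "s : carrier (sections XS U)"
 hence s1: "s : (\<Pi>\<^sub>E i\<in>\<Sigma>. carrier (MSpec_sections (A i) (pre i U)))"
  and s2: "!!j i. (j, i) : face_rel \<Sigma> ==> MSpec_map_sections (A i) (A j) id (pre i U) (s i) = s j"
  unfolding XS_carrier by blast+
 have "EX x:germ_domain (A C) E id (pre C U). s C = germ_section (A C) E id (pre C U) x" if C: "C : \<Sigma>" for C
  using frac_monoid.gsec_surj[OF frac_A[OF C] pre_open[OF U C] PiE_mem[OF s1 C]] by blast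
 then obtain x where x: "!!C. C : \<Sigma> ==> x C : germ_domain (A C) E id (pre C U)"
  "!!C. C : \<Sigma> ==> s C = germ_section (A C) E id (pre C U) (x C)" by metis
 show "s : secX U ` domX U"
 proof (cases "U = {}")
  case True
  have "s = secX U 1[E]"
  proof (rule extensionalityI[of s \<Sigma>])
   show "s C = secX U 1[E] C" if "C : \<Sigma>" for C
    using x(2)[OF that] that True by (auto simp: secX_def pre_def germ_section_def fun_eq_iff)
  qed (use s1 in \<open>auto simp: PiE_def secX_def\<close>)
  thus ?thesis using domX_closed(1) by blast
 next
  case False
  have eq: "x C = x {0}" if C: "C : \<Sigma>" for C
  proof -
   have z: "{0} : \<Sigma>" using zero_cone_mem[OF C] .
   note R = generic_chart(1)[OF C]
   have zs: "{0} <= C" using R by (simp add: face_rel_iff)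
   note g = generic_pre[OF U False z] generic_pre[OF U False C]
   have xc: "x C : carrier E" "x {0} : carrier E" using x(1)[OF C] x(1)[OF z] by (auto simp: germ_domain_def)
   have ne: "gX C ({None} Int carrier (A C)) (x C) ~= {}" "gX {0} {None} (x {0}) ~= {}"
    using x(1)[OF C] x(1)[OF z] g by (auto simp: germ_domain_def)
   have "s {0} {None} = loc_map (A {0}) (carrier (A {0}) - {None}) id (s C {None})"
    using fun_cong[OF s2[OF R], of "{None}"] g(1) unfolding MSpec_map_sections_def pre_restrict[OF R]
    by (simp add: MSpec_map_id)
   also have "\<dots> = gX {0} {None} (x C)"
    using gX_loc_map[OF z C zs zero_primes[OF z] xc(1) ne(1)] x(2)[OF C] g(2) by (simp add: germ_section_def)
   also have "s {0} {None} = gX {0} {None} (x {0})" using x(2)[OF z] g(1) by (simp add: germ_section_def)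
   finally have e: "gX {0} {None} (x {0}) = gX {0} {None} (x C)" .
   obtain p where "p : gX {0} {None} (x {0})" using ne(2) by blast
   thus ?thesis using frac_monoid.germ_unique[OF frac_A[OF z] zero_primes[OF z] xc] e by simp
  qed
  have xd: "x {0} : domX U"
  proof -
   obtain z where "z : U" using False by blast
   hence "z : topspace (pts XS)" using openin_subset[OF U] by blast
   then obtain C where C: "C : \<Sigma>" unfolding topspace_XS by blast
   have "x {0} : carrier E" using x(1)[OF zero_cone_mem[OF C]] by (simp add: germ_domain_def)
   moreover have "gX D P (x {0}) ~= {}" if "D : \<Sigma>" "P : pre D U" for D P
    using x(1)[OF that(1)] eq[OF that(1)] that(2) by (simp add: germ_domain_def)
   ultimately show ?thesis by (simp add: domX_def)
  qed
  have "s = secX U (x {0})"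
  proof (rule extensionalityI[of s \<Sigma>])
   show "s C = secX U (x {0}) C" if "C : \<Sigma>" for C
    using x(2)[OF that] eq[OF that] that by (simp add: secX_def)
  qed (use s1 in \<open>auto simp: PiE_def secX_def\<close>)
  thus ?thesis using xd by blast
 qed
qed (use secX_closed[OF U] in blast)

lemma secX_restr:
 assumes "V <= U"
 shows "restr XS U V (secX U x) = secX V x"
proof -
 have "pre C V <= pre C U" for C using assms by (auto simp: pre_def)
 thus ?thesis by (auto simp: XS_ops(4) secX_def germ_section_def fun_eq_iff)
qed

end

section \<open>Isomorphisms of monoids and their spectra\<close>

lemma avoid_top_iso:
 assumes "avoid_space P E" "avoid_space P' E'" and g: "bij_betw g E' E" and im: "(%x. g ` x) ` P' = P" and ne: "e0 : E" "!!x. x : P ==> e0 ~: x"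
 shows "homeomorphic_map (avoid_top P' E') (avoid_top P E) (%x. g ` x)"
proof -
 interpret A: avoid_space P E by fact
 interpret B: avoid_space P' E' by fact
 have inj: "inj_on g E'" and gE: "g ` E' = E" using g by (auto simp: bij_betw_def)
 have mem: "g e : g ` x \<longleftrightarrow> e : x" if "e : E'" "x : P'" for e x
  using inj_on_image_mem_iff[OF inj that(1) B.points_sub[OF that(2)]] .
 have ij: "inj_on (%x. g ` x) P'" using B.points_sub by (intro inj_onI) (simp add: inj_on_image_eq_iff[OF inj])
 \<comment> \<open>The image is the whole space, so the element to be avoided is one that every
   point misses.\<close>
 have "continuous_map (avoid_top P' E') (avoid_top P E) (%x. g ` x) & open_map (avoid_top P' E') (avoid_top P E) (%x. g ` x)"
 proof (rule avoid_open_embedding[OF assms(1,2) ij _ ne(1)])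
  show "(%x. g ` x) ` P' = {x : P. e0 ~: x}" using im ne(2) by auto
  show "EX e':E. ALL x:P'. e : x \<longleftrightarrow> e' : g ` x" if "e : E'" for e
   using mem[OF that] gE that by (intro bexI[of _ "g e"]) auto
  show "EX e':E'. ALL x:P'. e : g ` x \<longleftrightarrow> e' : x" if "e : E" for e
  proof -
   have "e : g ` E'" using gE that by simp
   then obtain e' where "e' : E'" "e = g e'" by blast
   thus ?thesis using mem by blast
  qed
 qed
 thus ?thesis using ij im by (intro bijective_open_imp_homeomorphic_map) simp_all
qed

lemma pmon_iso_prime:
 assumes A: "pointed_monoid A" and g: "g : pmon_iso A B"
 shows "(%P. g ` P) ` {P. prime_pideal P A} = {Q. prime_pideal Q B}"
proof -
 interpret pointed_monoid A by fact
 have gh: "g : pmon_hom A B" and inj: "inj_on g (carrier A)" and gc: "carrier B = g ` carrier A"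
  using g by (auto simp: pmon_iso_def bij_betw_def)
 note gs = pmon_homD[OF gh]
 have key: "prime_pideal (g ` P) B \<longleftrightarrow> prime_pideal P A" if P: "P <= carrier A" for P
 proof -
  have mem: "g a : g ` P \<longleftrightarrow> a : P" if "a : carrier A" for a using inj_on_image_mem_iff[OF inj that P] .
  have m: "g a *[B] g b : g ` P \<longleftrightarrow> a *[A] b : P" if "a : carrier A" "b : carrier A" for a b
   using mem[of "a *[A] b"] gs(4)[OF that] that by simp
  have "(ALL a:carrier B. ALL p:g ` P. a *[B] p : g ` P) \<longleftrightarrow> (ALL a:carrier A. ALL p:P. a *[A] p : P)"
   unfolding gc ball_simps(9) using m P by blast
  moreover have "(ALL a:carrier B. ALL b:carrier B. a *[B] b : g ` P --> a : g ` P \<or> b : g ` P) \<longleftrightarrow>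
    (ALL a:carrier A. ALL b:carrier A. a *[A] b : P --> a : P \<or> b : P)"
   unfolding gc ball_simps(9) using m mem by simp
  moreover have "g ` P = carrier B \<longleftrightarrow> P = carrier A" unfolding gc using inj_on_image_eq_iff[OF inj P order_refl] .
  moreover have "g ` P <= carrier B" "pzero B : g ` P \<longleftrightarrow> pzero A : P"
   using P gc mem[OF pzero_closed] gs(3) by auto
  ultimately show ?thesis using P unfolding prime_pideal_def by blast
 qed
 show ?thesis
 proof (intro equalityI subsetI)
  fix Q assume Q: "Q : {Q. prime_pideal Q B}"
  hence "Q <= g ` carrier A" by (simp add: prime_pideal_def gc)
  then obtain P where P: "P <= carrier A" "Q = g ` P" by (auto simp: subset_image_iff)
  hence "P : {P. prime_pideal P A}" using Q key[OF P(1)] by simp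
  thus "Q : (%P. g ` P) ` {P. prime_pideal P A}" using P(2) by (rule image_eqI[rotated])
 next
  fix Q assume "Q : (%P. g ` P) ` {P. prime_pideal P A}"
  then obtain P where "prime_pideal P A" "Q = g ` P" by auto
  thus "Q : {Q. prime_pideal Q B}" using key[of P] by (simp add: prime_pideal_def[of P])
 qed
qed

text \<open>Without addition a union of ideals is an ideal, and 1 lies in no prime. So a nonempty
  spectrum has a largest prime, its closed point.\<close>

lemma Union_primes:
 assumes "pointed_monoid A" "P0 : {P. prime_pideal P A}"
 shows "prime_pideal (\<Union>{P. prime_pideal P A}) A"
proof -
 interpret pointed_monoid A by fact
 have one: "1[A] ~: P" if "prime_pideal P A" for P
 proof
  assume "1[A] : P"
  hence "carrier A <= P" using that by (metis prime_pideal_def r_one subsetI)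
  thus False using that by (auto simp: prime_pideal_def)
 qed
 have z: "pzero A : P0" using assms(2) by (simp add: prime_pideal_def)
 show ?thesis unfolding prime_pideal_def[of "\<Union>_"]
 proof (intro conjI ballI impI)
  show "\<Union>{P. prime_pideal P A} <= carrier A" by (auto simp: prime_pideal_def)
  show "pzero A : \<Union>{P. prime_pideal P A}" using z assms(2) by blast
  show "\<Union>{P. prime_pideal P A} ~= carrier A" using one one_closed by blast
  show "a *[A] p : \<Union>{P. prime_pideal P A}" if ap: "a : carrier A" "p : \<Union>{P. prime_pideal P A}" for a p
  proof -
   obtain P where P: "prime_pideal P A" "p : P" using ap by blast
   hence "a *[A] p : P" using ap(1) by (simp add: prime_pideal_def)
   thus ?thesis using P(1) by blast
  qed
  show "a : \<Union>{P. prime_pideal P A} \<or> b : \<Union>{P. prime_pideal P A}"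
   if ab: "a : carrier A" "b : carrier A" "a *[A] b : \<Union>{P. prime_pideal P A}" for a b
  proof -
   obtain P where P: "prime_pideal P A" "a *[A] b : P" using ab by blast
   hence "a : P \<or> b : P" using ab(1,2) by (simp add: prime_pideal_def)
   thus ?thesis using P(1) by blast
  qed
 qed
qed

section \<open>The nonempty affine open sets are the charts of the cones\<close>

context toric_scheme_fan
begin

definition Uo :: "'v set => ('v set \<times> ('k \<times> ('v => real)) option set) set set" where
 "Uo C = MS.chart C ` primes C"

lemma open_embedding_chart': "C : \<Sigma> ==> open_embedding (avoid_top (primes C) (carrier (A C))) (pts XS) (MS.chart C)"
 unfolding pts_XS by (rule MS.open_embedding_chart)

lemma Uo_open: "C : \<Sigma> ==> openin (pts XS) (Uo C)"
proof -
 assume C: "C : \<Sigma>"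
 have "openin (pts XS) (MS.chart C ` topspace (avoid_top (primes C) (carrier (A C))))"
  using open_embedding.opn[OF open_embedding_chart'[OF C]] openin_topspace unfolding open_map_def by blast
 thus ?thesis unfolding top_primes[OF C] Uo_def .
qed

lemma pre_Uo: "C : \<Sigma> ==> pre C (Uo C) = primes C" by (auto simp: pre_def Uo_def)

lemma chart_eq:
 assumes "C : \<Sigma>" "P : primes C" "D : \<Sigma>" "Q : primes D" "MS.chart C P = MS.chart D Q"
 obtains \<rho> Z where "\<rho> : \<Sigma>" "\<rho> <= C" "\<rho> <= D" "Z : primes \<rho>" "Z Int carrier (A C) = P" "Z Int carrier (A D) = Q"
proof -
 have "\<exists>\<rho> Z. (\<rho>, C) : face_rel \<Sigma> & (\<rho>, D) : face_rel \<Sigma> & Z : topspace (avoid_top (primes \<rho>) (carrier (A \<rho>))) &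
   Z Int carrier (A C) = P & Z Int carrier (A D) = Q"
  using MS.chart_eq_iff[of C P D Q] assms top_primes by simp
 thus thesis using that top_primes by (auto simp: face_rel_iff)
qed

text \<open>A point of another chart that lies in \<open>Uo C\<close> comes from a common face, and
  \<open>gX_localization\<close> carries regularity through that face.\<close>

lemma domX_Uo_sub:
 assumes C: "C : \<Sigma>" and U: "U <= Uo C"
 shows "domX U = {x : carrier E. ALL P:pre C U. gX C P x ~= {}}"
proof -
 have "gX D Q x ~= {}" if x: "x : carrier E" "ALL P:pre C U. gX C P x ~= {}" and D: "D : \<Sigma>" and Q: "Q : pre D U" for x D Q
 proof -
  have Qp: "Q : primes D" "MS.chart D Q : U" using Q by (auto simp: pre_def)
  then obtain P where P: "P : primes C" "MS.chart C P = MS.chart D Q" using U unfolding Uo_def by force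
  hence "P : pre C U" using Qp by (simp add: pre_def)
  hence ne: "gX C P x ~= {}" using x(2) by blast
  obtain \<rho> Z where Z: "\<rho> : \<Sigma>" "\<rho> <= C" "\<rho> <= D" "Z : primes \<rho>" "Z Int carrier (A C) = P" "Z Int carrier (A D) = Q"
   using chart_eq[OF C P(1) D Qp(1) P(2)] by blast
  show ?thesis
   using gX_localization[OF Z(1) C Z(2,4) x(1)] gX_localization[OF Z(1) D Z(3,4) x(1)] ne Z(5,6) by simp
 qed
 thus ?thesis using C unfolding domX_def by blast
qed

text \<open>The complement of the units of the algebra of \<open>C\<close>, which is the closed
  point of the chart.\<close>

definition mx :: "'v set => ('k \<times> ('v => real)) option set" where
 "mx C = face_ideal (CM C) {m : CM C. - m : CM C}"

lemma mx_prime: "C : \<Sigma> ==> mx C : primes C"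
proof -
 assume C: "C : \<Sigma>"
 have "monoid_face (CM C) {m : CM C. - m : CM C}" unfolding monoid_face_def
 proof (intro conjI ballI)
  fix s t assume st: "s : CM C" "t : CM C"
  have "- s : CM C" "- t : CM C" if "- (s + t) : CM C"
  proof -
   have "- s = - (s + t) + t" "- t = - (s + t) + s" by simp_all
   thus "- s : CM C" "- t : CM C" using CM_add[OF C that] st by metis+
  qed
  moreover have "- (s + t) : CM C" if "- s : CM C" "- t : CM C"
  proof -
   have "- (s + t) = - s + - t" by simp
   thus ?thesis using CM_add[OF C that] by (simp only:)
  qed
  ultimately show "s + t : {m : CM C. - m : CM C} \<longleftrightarrow> s : {m : CM C. - m : CM C} & t : {m : CM C. - m : CM C}"
   using st CM_add[OF C st] by (auto simp del: minus_add_distrib)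
 qed (use CM_zero[OF C] in simp_all)
 thus ?thesis using prime_iff[OF C] by (auto simp: mx_def)
qed

text \<open>Denominators outside the closed point \<open>mx C\<close> are units, so an element
  regular there lies in the algebra of \<open>C\<close>.\<close>

lemma domX_Uo:
 assumes C: "C : \<Sigma>"
 shows "domX (Uo C) = carrier (A C)"
proof (intro equalityI subsetI)
 interpret frac_monoid "A C" E id by (rule frac_A[OF C])
 fix x assume "x : carrier (A C)"
 thus "x : domX (Uo C)" unfolding domX_Uo_sub[OF C order_refl] pre_Uo[OF C]
  using germ_closed[of x] A_sub_E by auto
next
 fix x assume "x : domX (Uo C)"
 hence x: "x : carrier E" "gX C (mx C) x ~= {}"
  unfolding domX_Uo_sub[OF C order_refl] pre_Uo[OF C] using mx_prime[OF C] by blast+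
 then obtain b t where bt: "b : carrier (A C)" "t : carrier (A C)" "t ~: mx C" "b = t *[E] x" by (auto simp: germ_def)
 then obtain l m where t: "t = Some (l, m)" "l : Units F" "m : CM C" "- m : CM C"
  by (auto simp: mx_def face_ideal_def monoid_alg_carrier)
 show "x : carrier (A C)"
 proof (cases x)
  case (Some p)
  then obtain j s where x': "x = Some (j, s)" "j : Units F" using x(1) by (cases p) simp
  have "m + s : CM C" using bt(1) t x' bt(4) by simp
  hence "m + s + - m : CM C" using CM_add[OF C _ t(4)] by blast
  thus ?thesis using x' by simp
 qed simp
qed

text \<open>If the closed point of \<open>C\<close> lies in \<open>Uo D\<close>, it comes from a
  common face cut out of \<open>C\<close> by some \<open>h\<close>. The character of
  \<open>h\<close> is then a unit, so \<open>h\<close> vanishes on \<open>C\<close> and the face is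
  \<open>C\<close> itself.\<close>

lemma Uo_subset_iff:
 assumes s: "C : \<Sigma>" "D : \<Sigma>"
 shows "Uo C <= Uo D \<longleftrightarrow> C <= D"
proof
 assume sub: "C <= D"
 hence R: "(C, D) : face_rel \<Sigma>" using s by (simp add: face_rel_iff)
 show "Uo C <= Uo D"
 proof
  fix y assume "y : Uo C"
  then obtain P where P: "P : primes C" "y = MS.chart C P" by (auto simp: Uo_def)
  hence "y = MS.chart D (P Int carrier (A D))" using MS.chart_f[OF R] top_primes[OF s(1)] by simp
  thus "y : Uo D" using prime_restrict[OF s(2,1) sub P(1)] by (simp add: Uo_def)
 qed
next
 assume sub: "Uo C <= Uo D"
 have "MS.chart C (mx C) : Uo C" using mx_prime[OF s(1)] by (simp add: Uo_def)
 then obtain Q where Q: "Q : primes D" "MS.chart C (mx C) = MS.chart D Q" using sub unfolding Uo_def by blast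
 obtain \<rho> Z where Z: "\<rho> : \<Sigma>" "\<rho> <= C" "\<rho> <= D" "Z : primes \<rho>" "Z Int carrier (A C) = mx C"
  "Z Int carrier (A D) = Q" by (rule chart_eq[OF s(1) mx_prime[OF s(1)] s(2) Q])
 obtain h where h: "h : CM C" "\<rho> = C Int {u. h u = 0}" using face_lattice_functional[OF s(1) Z(1,2)] by blast
 have "\<xi> h ~: Z" using prime_localization(2)[OF s(1) h(1), folded h(2), OF Z(4)] .
 hence "\<xi> h ~: mx C" using Z(5) by blast
 hence "- h : CM C" using h(1) by (simp add: mx_def)
 hence "h u = 0" if "u : C" for u using h(1) that by (fastforce simp: cone_monoid_def dual_cone_def)
 thus "C <= D" using h(2) Z(3) by auto
qed

text \<open>Let \<open>P\<close> belong to the face \<open>T\<close>, and let \<open>D\<close> be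
  the face of \<open>C\<close> on which the elements of \<open>T\<close> become units. Every prime
  of the algebra of \<open>D\<close> restricts to a subset of \<open>P\<close>, and open sets are
  closed under passing to smaller primes.\<close>

lemma smallest_neighbourhood:
 assumes y: "y : topspace (pts XS)"
 shows "EX D:\<Sigma>. y : Uo D & (ALL V. openin (pts XS) V & y : V --> Uo D <= V)"
proof -
 obtain C P where C: "C : \<Sigma>" and P: "y = MS.chart C P" "P : primes C" using y unfolding topspace_XS by blast
 obtain T where T: "monoid_face (CM C) T" "P = face_ideal (CM C) T" using P(2) prime_iff[OF C] by auto
 obtain h where h: "h : T" "!!m. m : CM C ==> m : T \<longleftrightarrow> - m : CM (C Int {u. h u = 0})"
  using monoid_face_cone[OF C T(1)] by blast
 have hC: "h : CM C" using h(1) monoid_faceD(1)[OF T(1)] by blast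
 let ?D = "C Int {u. h u = 0}"
 note D = CM_localization(1)[OF C hC]
 have R: "(?D, C) : face_rel \<Sigma>" using C D by (simp add: face_rel_iff)
 have ch: "MS.chart C (Q Int carrier (A C)) = MS.chart ?D Q" if "Q : primes ?D" for Q
  using MS.chart_f[OF R] top_primes[OF D] that by simp
 have "\<xi> h ~: P" using h(1) T(2) by simp
 then obtain Q where Q: "Q : primes ?D" "Q Int carrier (A C) = P" using prime_extend[OF C hC P(2)] by blast
 have "y : Uo ?D" unfolding Uo_def by (rule image_eqI[OF _ Q(1)]) (simp add: P(1) ch[OF Q(1), symmetric] Q(2))
 moreover have "Uo ?D <= V" if V: "openin (pts XS) V" "y : V" for V
 proof
  fix z assume "z : Uo ?D"
  then obtain Q where Q: "Q : primes ?D" "z = MS.chart ?D Q" by (auto simp: Uo_def)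
  obtain T' where T': "monoid_face (CM ?D) T'" "Q = face_ideal (CM ?D) T'" using Q(1) prime_iff[OF D] by auto
  have sub: "Q Int carrier (A C) <= P"
  proof
   fix e assume e: "e : Q Int carrier (A C)"
   show "e : P"
   proof (cases e)
    case None
    thus ?thesis by (simp add: T(2))
   next
    case (Some p)
    obtain l m where p: "p = (l, m)" by force
    have m: "l : Units F" "m : CM C" "m : CM ?D" "m ~: T'" using e by (auto simp: Some p T'(2))
    have "m ~: T"
    proof
     assume "m : T"
     hence "- m : CM ?D" using h(2)[OF m(2)] by blast
     moreover have "m + - m : T'" using monoid_faceD(2)[OF T'(1)] by simp
     ultimately show False using monoid_faceD(4)[OF T'(1) m(3)] m(4) by blast
    qed
    thus ?thesis using m by (simp add: Some p T(2))
   qed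
  qed
  have "P : pre C V" using P V(2) by (simp add: pre_def)
  hence "Q Int carrier (A C) : pre C V"
   using avoid_space.open_downward[OF primes_avoid_space[OF C] pre_open[OF V(1) C, unfolded MSpec_avoid]]
    prime_restrict[OF C D _ Q(1)] sub by blast
  thus "z : V" using ch[OF Q(1)] Q(2) by (simp add: pre_def)
 qed
 ultimately show ?thesis using D by blast
qed

text \<open>The largest prime of \<open>S\<close> has the whole spectrum as its only neighbourhood.
  The corresponding point of \<open>U\<close> has a smallest neighbourhood of the form
  \<open>Uo D\<close>, and the two must agree.\<close>

lemma affine_open_cases:
 assumes U: "affine_open XS U"
 shows "U = {} \<or> (EX C:\<Sigma>. U = Uo C)"
proof (cases "U = {}")
 case False
 obtain S :: "('v set => ('k \<times> ('v => real)) option set =>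
   (('k \<times> ('v => real)) option \<times> ('k \<times> ('v => real)) option) set) pmonoid"
  where S: "pointed_monoid S" "monoidal_space_isomorphic (open_subspace XS U) (MSpec S)" and Uo: "openin (pts XS) U"
  using U unfolding affine_open_def by blast
 obtain \<phi> where \<phi>: "homeomorphic_map (subtopology (pts XS) U) (MSpec_top S) \<phi>"
  using S(2) unfolding monoidal_space_isomorphic_def by (auto simp: open_subspace_def MSpec_def)
 have tU: "topspace (subtopology (pts XS) U) = U" using openin_subset[OF Uo] by auto
 note tS = topspace_MSpec_top[OF S(1)]
 have im: "\<phi> ` U = {P. prime_pideal P S}" using homeomorphic_imp_surjective_map[OF \<phi>] tU tS by simp
 obtain u where "u : U" using False by blast
 hence "\<phi> u : {P. prime_pideal P S}" using im by blast
 hence P0: "\<Union>{P. prime_pideal P S} : {P. prime_pideal P S}" using Union_primes[OF S(1)] by blast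
 then obtain y where y: "y : U" "\<phi> y = \<Union>{P. prime_pideal P S}" using im by (metis imageE)
 have "y : topspace (pts XS)" using y(1) openin_subset[OF Uo] by blast
 from smallest_neighbourhood[OF this] obtain D where D: "D : \<Sigma>" "y : Uo D" "Uo D <= U"
  using y(1) Uo by auto
 have "openin (subtopology (pts XS) U) (Uo D)"
  using Uo_open[OF D(1)] D(3) by (simp add: openin_open_subtopology[OF Uo])
 hence op: "openin (MSpec_top S) (\<phi> ` Uo D)"
  using homeomorphic_imp_open_map[OF \<phi>] by (simp add: open_map_def)
 interpret avoid_space "{P. prime_pideal P S}" "carrier S" by unfold_locales (auto simp: prime_pideal_def)
 have av: "MSpec_top S = avoid_top {P. prime_pideal P S} (carrier S)"
  unfolding MSpec_top_def avoid_top_def by (rule arg_cong[of _ _ topology_generated_by]) auto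
 have "{P. prime_pideal P S} <= \<phi> ` Uo D"
 proof
  fix P assume "P : {P. prime_pideal P S}"
  thus "P : \<phi> ` Uo D" using open_downward[OF op[unfolded av], of "\<phi> y" P] D(2) y(2) by blast
 qed
 hence "\<phi> ` U <= \<phi> ` Uo D" using im by simp
 moreover have "inj_on \<phi> U" using homeomorphic_imp_injective_map[OF \<phi>] tU by simp
 ultimately have "U <= Uo D" using D(3) by (metis inj_on_image_subset_iff order_refl)
 thus ?thesis using D by blast
qed simp

abbreviation "\<Gamma> C \<equiv> sections XS (Uo C)"
abbreviation "\<kappa> C \<equiv> secX (Uo C)"

lemma \<kappa>_iso:
 assumes C: "C : \<Sigma>"
 shows "\<kappa> C : pmon_iso (A C) (\<Gamma> C)" "pointed_monoid (\<Gamma> C)"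
proof -
 have op: "openin (pts XS) (Uo C)" "Uo C ~= {}" using Uo_open[OF C] mx_prime[OF C] by (auto simp: Uo_def)
 have D: "A C = DX (Uo C)" unfolding domX_Uo[OF C] by (simp add: monoid_alg_def)
 have "bij_betw (\<kappa> C) (carrier (A C)) (carrier (\<Gamma> C))"
  using secX_inj[OF op] secX_surj[OF op(1)] unfolding domX_Uo[OF C] by (simp add: bij_betw_def inj_on_def)
 moreover have "\<kappa> C : pmon_hom (A C) (\<Gamma> C)" unfolding D by (rule secX_hom[OF op(1)])
 ultimately show "\<kappa> C : pmon_iso (A C) (\<Gamma> C)" by (simp add: pmon_iso_def)
 thus "pointed_monoid (\<Gamma> C)"
  by (intro pmon_hom_image[OF A_pointed_monoid[OF C]]) (auto simp: pmon_iso_def bij_betw_def)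
qed

text \<open>\<open>affine_open\<close> asks for a monoid in the type of the sections, so the witness
  is \<open>\<Gamma> C\<close>, a copy of the algebra of \<open>C\<close>. On both sides the
  sections over an open set are images of the same elements of \<open>E\<close>.\<close>

lemma affine_open_Uo:
 assumes C: "C : \<Sigma>"
 shows "affine_open XS (Uo C)"
proof -
 have op: "openin (pts XS) (Uo C)" using Uo_open[OF C] .
 have kb: "bij_betw (\<kappa> C) (carrier (A C)) (carrier (\<Gamma> C))" and kh: "\<kappa> C : pmon_hom (A C) (\<Gamma> C)"
  using \<kappa>_iso(1)[OF C] by (auto simp: pmon_iso_def)
 define \<iota> where "\<iota> = inv_into (carrier (A C)) (\<kappa> C)"
 have \<iota>\<kappa>: "\<iota> (\<kappa> C a) = a" if "a : carrier (A C)" for a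
  unfolding \<iota>_def using that kb by (simp add: bij_betw_def inv_into_f_f)
 have ks: "EX a:carrier (A C). b = \<kappa> C a" if "b : carrier (\<Gamma> C)" for b
  using kb that unfolding bij_betw_def by blast
 have kc: "\<kappa> C a : carrier (\<Gamma> C)" if "a : carrier (A C)" for a using pmon_homD(1)[OF kh that] .
 interpret AA: pointed_monoid "A C" by (rule A_pointed_monoid[OF C])
 interpret G: frac_monoid "\<Gamma> C" E \<iota>
 proof (intro frac_monoid.intro frac_monoid_axioms.intro \<kappa>_iso(2)[OF C] E_pointed_monoid Units_E)
  show "\<iota> : pmon_hom (\<Gamma> C) E"
  proof (rule pmon_homI)
   show "\<iota> b : carrier E" if b: "b : carrier (\<Gamma> C)" for b
   proof -
    obtain a where "a : carrier (A C)" "b = \<kappa> C a" using ks[OF b] by blast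
    thus ?thesis using \<iota>\<kappa>[of a] subsetD[OF A_sub_E, of a] by simp
   qed
   show "\<iota> 1[\<Gamma> C] = 1[E]" "\<iota> (pzero (\<Gamma> C)) = pzero E"
    using \<iota>\<kappa>[OF AA.one_closed] \<iota>\<kappa>[OF AA.pzero_closed] unfolding pmon_homD(2,3)[OF kh] by (simp_all add: E_ops)
   fix x y assume "x : carrier (\<Gamma> C)" "y : carrier (\<Gamma> C)"
   then obtain a b where ab: "a : carrier (A C)" "x = \<kappa> C a" "b : carrier (A C)" "y = \<kappa> C b" using ks by metis
   have "\<iota> (x *[\<Gamma> C] y) = a *[A C] b"
    unfolding ab(2,4) pmon_homD(4)[OF kh ab(1,3), symmetric] using \<iota>\<kappa>[OF AA.m_closed[OF ab(1,3)]] .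
   thus "\<iota> (x *[\<Gamma> C] y) = \<iota> x *[E] \<iota> y" using \<iota>\<kappa>[OF ab(1)] \<iota>\<kappa>[OF ab(3)] ab(2,4) by (simp add: E_ops)
  qed
  show "inj_on \<iota> (carrier (\<Gamma> C))"
  proof (rule inj_onI)
   fix x y assume xy: "x : carrier (\<Gamma> C)" "y : carrier (\<Gamma> C)" "\<iota> x = \<iota> y"
   then obtain a b where ab: "a : carrier (A C)" "x = \<kappa> C a" "b : carrier (A C)" "y = \<kappa> C b" using ks by metis
   thus "x = y" using \<iota>\<kappa>[OF ab(1)] \<iota>\<kappa>[OF ab(3)] xy(3) by simp
  qed
 qed
 have primes_eq: "(%P. \<kappa> C ` P) ` primes C = G.spec"
  by (rule pmon_iso_prime[OF A_pointed_monoid[OF C] \<kappa>_iso(1)[OF C]])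
 have push: "homeomorphic_map (avoid_top (primes C) (carrier (A C))) (MSpec_top (\<Gamma> C)) (%P. \<kappa> C ` P)"
  unfolding G.MSpec_avoid_top
  by (rule avoid_top_iso[OF G.avoid_space_axioms primes_avoid_space[OF C] kb primes_eq G.A.one_closed G.primeD(3)])
 interpret ch: open_embedding "avoid_top (primes C) (carrier (A C))" "pts XS" "MS.chart C"
  by (rule open_embedding_chart'[OF C])
 have "homeomorphic_map (avoid_top (primes C) (carrier (A C))) (subtopology (pts XS) (Uo C)) (MS.chart C)"
 proof (rule bijective_open_imp_homeomorphic_map)
  show "continuous_map (avoid_top (primes C) (carrier (A C))) (subtopology (pts XS) (Uo C)) (MS.chart C)"
   using ch.cont by (auto simp: continuous_map_in_subtopology top_primes[OF C] Uo_def)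
  show "open_map (avoid_top (primes C) (carrier (A C))) (subtopology (pts XS) (Uo C)) (MS.chart C)"
   unfolding open_map_def openin_open_subtopology[OF op]
  proof (intro allI impI conjI)
   fix V assume V: "openin (avoid_top (primes C) (carrier (A C))) V"
   show "openin (pts XS) (MS.chart C ` V)" using ch.opn V by (simp add: open_map_def)
   show "MS.chart C ` V <= Uo C" using openin_subset[OF V] unfolding top_primes[OF C] Uo_def by blast
  qed
  show "MS.chart C ` topspace (avoid_top (primes C) (carrier (A C))) = topspace (subtopology (pts XS) (Uo C))"
   using openin_subset[OF op] unfolding top_primes[OF C] topspace_subtopology Uo_def by blast
 qed (rule ch.inj)
 then obtain g where g: "homeomorphic_maps (avoid_top (primes C) (carrier (A C))) (subtopology (pts XS) (Uo C)) (MS.chart C) g"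
  unfolding homeomorphic_map_maps by blast
 have gc: "g (MS.chart C P) = P" if "P : primes C" for P
  using g that unfolding homeomorphic_maps_def top_primes[OF C] by blast
 define \<phi> where "\<phi> = (%P. \<kappa> C ` P) \<circ> g"
 have "homeomorphic_map (subtopology (pts XS) (Uo C)) (avoid_top (primes C) (carrier (A C))) g"
  using g homeomorphic_maps_sym homeomorphic_map_maps by blast
 hence \<phi>: "homeomorphic_map (subtopology (pts XS) (Uo C)) (MSpec_top (\<Gamma> C)) \<phi>"
  unfolding \<phi>_def by (rule homeomorphic_map_compose[OF _ push])
 have tU: "topspace (subtopology (pts XS) (Uo C)) = Uo C" using openin_subset[OF op] by auto
 define pr where "pr V = {x : Uo C. \<phi> x : V}" for V
 have pr_sub: "pr V <= Uo C" for V by (auto simp: pr_def)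
 have pr_open: "openin (pts XS) (pr V)" if "openin (MSpec_top (\<Gamma> C)) V" for V
 proof -
  have "openin (subtopology (pts XS) (Uo C)) {x : topspace (subtopology (pts XS) (Uo C)). \<phi> x : V}"
   by (rule openin_continuous_map_preimage[OF homeomorphic_imp_continuous_map[OF \<phi>] that])
  thus ?thesis unfolding tU openin_open_subtopology[OF op] pr_def by blast
 qed
 have pre_pr: "pre C (pr V) = {P : primes C. \<kappa> C ` P : V}" for V
  using gc by (auto simp: pre_def pr_def Uo_def \<phi>_def)
 have germ_ne: "germ (\<Gamma> C) E \<iota> (\<kappa> C ` P) x ~= {} \<longleftrightarrow> gX C P x ~= {}" if P: "P : primes C" for P x
 proof -
  have PA: "P <= carrier (A C)" using P by (simp add: prime_pideal_def)
  have mem: "\<kappa> C t : \<kappa> C ` P \<longleftrightarrow> t : P" if "t : carrier (A C)" for t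
   using inj_on_image_mem_iff[OF bij_betw_imp_inj_on[OF kb] that PA] .
  have iff: "(\<kappa> C b, \<kappa> C t) : germ (\<Gamma> C) E \<iota> (\<kappa> C ` P) x \<longleftrightarrow> (b, t) : gX C P x"
   if "b : carrier (A C)" "t : carrier (A C)" for b t
   using that by (simp add: germ_def kc mem \<iota>\<kappa>)
  show ?thesis
  proof
   assume "gX C P x ~= {}"
   then obtain b t where "(b, t) : gX C P x" by force
   thus "germ (\<Gamma> C) E \<iota> (\<kappa> C ` P) x ~= {}" using iff[of b t] by (auto simp: germ_def[of "A C"])
  next
   assume "germ (\<Gamma> C) E \<iota> (\<kappa> C ` P) x ~= {}"
   then obtain b' t' where bt: "(b', t') : germ (\<Gamma> C) E \<iota> (\<kappa> C ` P) x" by force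
   hence "b' : carrier (\<Gamma> C)" "t' : carrier (\<Gamma> C)" by (auto simp: germ_def)
   then obtain b t where "b : carrier (A C)" "b' = \<kappa> C b" "t : carrier (A C)" "t' = \<kappa> C t" using ks by metis
   thus "gX C P x ~= {}" using iff[of b t] bt by auto
  qed
 qed
 have dom: "G.gdom V = domX (pr V)" if V: "openin (MSpec_top (\<Gamma> C)) V" for V
 proof -
  have "V <= (%P. \<kappa> C ` P) ` primes C" using G.openin_spec[OF V] unfolding primes_eq .
  hence "(ALL Q:V. germ (\<Gamma> C) E \<iota> Q x ~= {}) \<longleftrightarrow> (ALL P:pre C (pr V). germ (\<Gamma> C) E \<iota> (\<kappa> C ` P) x ~= {})" for x
   unfolding pre_pr by blast
  also have "\<dots> x \<longleftrightarrow> (ALL P:pre C (pr V). gX C P x ~= {})" for x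
   using germ_ne pre_sub by blast
  finally show ?thesis unfolding domX_Uo_sub[OF C pr_sub] germ_domain_def by blast
 qed
 \<comment> \<open>For nonempty \<open>V\<close> both sides say \<open>x = y\<close>; for empty
   \<open>V\<close> both hold.\<close>
 have eq: "G.gsec V x = G.gsec V y \<longleftrightarrow> secX (pr V) x = secX (pr V) y"
  if V: "openin (MSpec_top (\<Gamma> C)) V" and xy: "x : G.gdom V" "y : G.gdom V" for V x y
 proof (cases "V = {}")
  case True
  thus ?thesis using secX_empty[of x y] by (simp add: pr_def germ_section_def restrict_def)
 next
  case False
  have im: "\<phi> ` Uo C = topspace (MSpec_top (\<Gamma> C))" using homeomorphic_imp_surjective_map[OF \<phi>] unfolding tU .
  obtain Q where "Q : V" "Q : \<phi> ` Uo C" using openin_subset[OF V] False unfolding im by blast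
  hence ne: "pr V ~= {}" by (auto simp: pr_def)
  show ?thesis using G.gsec_inj[OF V False xy] secX_inj[OF pr_open[OF V] ne] xy unfolding dom[OF V] by blast
 qed
 define \<theta> where "\<theta> V = secX (pr V) \<circ> inv_into (G.gdom V) (G.gsec V)" for V
 have \<theta>: "\<theta> V : pmon_iso (MSpec_sections (\<Gamma> C) V) (sections XS (pr V)) &
   (ALL x:G.gdom V. \<theta> V (G.gsec V x) = secX (pr V) x)" if V: "openin (MSpec_top (\<Gamma> C)) V" for V
 proof -
  note q = pmon_iso_quotients[of "G.gsec V" "E\<lparr>carrier := G.gdom V\<rparr>" "MSpec_sections (\<Gamma> C) V" "secX (pr V)" "sections XS (pr V)"]
  have a: "G.gsec V ` carrier (E\<lparr>carrier := G.gdom V\<rparr>) = carrier (MSpec_sections (\<Gamma> C) V)"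
   using G.gsec_surj[OF V] G.gsec_closed[OF V] by auto
  have b: "secX (pr V) : pmon_hom (E\<lparr>carrier := G.gdom V\<rparr>) (sections XS (pr V))"
   unfolding dom[OF V] by (rule secX_hom[OF pr_open[OF V]])
  have c: "secX (pr V) ` carrier (E\<lparr>carrier := G.gdom V\<rparr>) = carrier (sections XS (pr V))"
   using secX_surj[OF pr_open[OF V]] by (simp add: dom[OF V])
  have d: "1[E\<lparr>carrier := G.gdom V\<rparr>] : carrier (E\<lparr>carrier := G.gdom V\<rparr>)"
   "pzero (E\<lparr>carrier := G.gdom V\<rparr>) : carrier (E\<lparr>carrier := G.gdom V\<rparr>)"
   "!!x y. x : carrier (E\<lparr>carrier := G.gdom V\<rparr>) ==> y : carrier (E\<lparr>carrier := G.gdom V\<rparr>) ==>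
    x *[E\<lparr>carrier := G.gdom V\<rparr>] y : carrier (E\<lparr>carrier := G.gdom V\<rparr>)"
   using G.gdom_closed(1-3)[OF G.openin_spec[OF V]] by simp_all
  have e: "G.gsec V x = G.gsec V y \<longleftrightarrow> secX (pr V) x = secX (pr V) y"
   if "x : carrier (E\<lparr>carrier := G.gdom V\<rparr>)" "y : carrier (E\<lparr>carrier := G.gdom V\<rparr>)" for x y
   using eq[OF V] that by simp
  show ?thesis using q[OF G.gsec_hom[OF V] a b c d e] by (simp add: \<theta>_def)
 qed
 have "monoidal_space_isomorphic (open_subspace XS (Uo C)) (MSpec (\<Gamma> C))"
  unfolding monoidal_space_isomorphic_def Let_def
 proof (intro exI[of _ \<phi>] exI[of _ \<theta>] conjI allI impI ballI)
  have pts: "pts (open_subspace XS (Uo C)) = subtopology (pts XS) (Uo C)" "pts (MSpec (\<Gamma> C)) = MSpec_top (\<Gamma> C)"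
   "sections (open_subspace XS (Uo C)) = sections XS" "restr (open_subspace XS (Uo C)) = restr XS"
   by (simp_all add: open_subspace_def MSpec_def)
  have prs: "{x : topspace (pts (open_subspace XS (Uo C))). \<phi> x : V} = pr V" for V
   unfolding pts tU pr_def ..
  show "homeomorphic_map (pts (open_subspace XS (Uo C))) (pts (MSpec (\<Gamma> C))) \<phi>" using \<phi> by (simp only: pts)
  show "\<theta> V : pmon_iso (sections (MSpec (\<Gamma> C)) V) (sections (open_subspace XS (Uo C)) {x : topspace (pts (open_subspace XS (Uo C))). \<phi> x : V})"
   if "openin (pts (MSpec (\<Gamma> C))) V" for V
   unfolding prs pts(3) MSpec_simps using conjunct1[OF \<theta>] that unfolding pts(2) by simp
  fix V W s assume VW: "openin (pts (MSpec (\<Gamma> C))) V & openin (pts (MSpec (\<Gamma> C))) W & W <= V"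
   and s: "s : carrier (sections (MSpec (\<Gamma> C)) V)"
  have V: "openin (MSpec_top (\<Gamma> C)) V" and W: "openin (MSpec_top (\<Gamma> C)) W" and sub: "W <= V" using VW by (simp_all add: pts)
  obtain x where x: "x : G.gdom V" "s = G.gsec V x" using G.gsec_surj[OF V] s unfolding MSpec_simps by blast
  have xW: "x : G.gdom W" using x(1) sub by (auto simp: germ_domain_def)
  have prsub: "pr W <= pr V" using sub by (auto simp: pr_def)
  have "\<theta> W (restrict s W) = secX (pr W) x" using G.gsec_restrict[OF sub, of x] \<theta>[OF W] xW x(2) by simp
  also have "\<dots> = restr XS (pr V) (pr W) (\<theta> V s)" using secX_restr[OF prsub, of x] \<theta>[OF V] x by simp
  finally show "\<theta> W (restr (MSpec (\<Gamma> C)) V W s) = restr (open_subspace XS (Uo C))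
    {x : topspace (pts (open_subspace XS (Uo C))). \<phi> x : V}
    {x : topspace (pts (open_subspace XS (Uo C))). \<phi> x : W} (\<theta> V s)"
   unfolding prs pts(4) MSpec_simps .
 qed
 thus ?thesis unfolding affine_open_def using op \<kappa>_iso(2)[OF C] by (intro conjI exI[of _ "\<Gamma> C"])
qed

end

section \<open>The strong congruence space\<close>

lemma homeomorphic_transport_embedding:
 assumes \<Phi>: "homeomorphic_map Z Z' \<Phi>" and \<Psi>: "homeomorphic_map Y Y' \<Psi>"
  and f': "continuous_map Z' Y' f'" "open_map Z' Y' f'"
  and f: "!!x. x : topspace Z ==> f x : topspace Y & \<Psi> (f x) = f' (\<Phi> x)"
 shows "continuous_map Z Y f & open_map Z Y f"
proof -
 obtain g where g: "homeomorphic_maps Y Y' \<Psi> g" using \<Psi> homeomorphic_map_maps by blast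
 hence gY: "homeomorphic_map Y' Y g" using homeomorphic_maps_sym homeomorphic_map_maps by blast
 have "open_map Z Y (g \<circ> f' \<circ> \<Phi>)"
  by (rule open_map_compose[OF homeomorphic_imp_open_map[OF \<Phi>] open_map_compose[OF f'(2) homeomorphic_imp_open_map[OF gY]]])
 moreover have "continuous_map Z Y (g \<circ> f' \<circ> \<Phi>)"
  by (rule continuous_map_compose[OF homeomorphic_imp_continuous_map[OF \<Phi>]
   continuous_map_compose[OF f'(1) homeomorphic_imp_continuous_map[OF gY]]])
 moreover have eq: "(g \<circ> f' \<circ> \<Phi>) x = f x" if "x : topspace Z" for x
 proof -
  have "(g \<circ> f' \<circ> \<Phi>) x = g (\<Psi> (f x))" using f[OF that] by simp
  also have "\<dots> = f x" using g f[OF that] by (auto simp: homeomorphic_maps_def)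
  finally show ?thesis .
 qed
 moreover have "open_map Z Y f" unfolding open_map_def
 proof (intro allI impI)
  fix U assume U: "openin Z U"
  have "f ` U = (g \<circ> f' \<circ> \<Phi>) ` U" using eq openin_subset[OF U] by (intro image_cong) auto
  thus "openin Y (f ` U)" using \<open>open_map Z Y (g \<circ> f' \<circ> \<Phi>)\<close> U by (simp add: open_map_def)
 qed
 ultimately show ?thesis using continuous_map_eq[of Z Y "g \<circ> f' \<circ> \<Phi>" f] by blast
qed

text \<open>Spaces without points may be added to a gluing diagram; the empty open set is affine.\<close>

lemma gluing_transport:
 assumes G: "gluing I' R' Z' f'"
  and R: "R <= I \<times> I" "!!i. i : I ==> (i, i) : R" "!!i j k. (k, j) : R ==> (j, i) : R ==> (k, i) : R"
  and d: "!!i. i : I' ==> d i : I" "!!i j. i : I' ==> j : I' ==> (d j, d i) : R \<longleftrightarrow> (j, i) : R'"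
  and cov: "!!i. i : I ==> i : d ` I' \<or> topspace (Z i) = {}"
  and emp: "!!i j. (j, i) : R ==> topspace (Z i) = {} ==> topspace (Z j) = {}"
  and \<Phi>: "!!i. i : I' ==> homeomorphic_map (Z (d i)) (Z' i) (\<Phi> i)"
  and f: "!!i j x. (j, i) : R' ==> x : topspace (Z (d j)) ==> f (d j) (d i) x : topspace (Z (d i)) &
   \<Phi> i (f (d j) (d i) x) = f' j i (\<Phi> j x)"
 shows "gluing I R Z f"
proof -
 interpret G: gluing I' R' Z' f' by fact
 have \<Phi>t: "\<Phi> i x : topspace (Z' i)" if "i : I'" "x : topspace (Z (d i))" for i x
  using homeomorphic_imp_surjective_map[OF \<Phi>[OF that(1)]] that(2) by blast
 have \<Phi>i: "x = y" if "i : I'" "x : topspace (Z (d i))" "y : topspace (Z (d i))" "\<Phi> i x = \<Phi> i y" for i x y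
  using homeomorphic_imp_injective_map[OF \<Phi>[OF that(1)]] that(2-4) by (auto dest: inj_onD)
 have R'I: "j : I'" "i : I'" if "(j, i) : R'" for i j using G.R_sub that by auto
 have idx: "EX j' i'. j' : I' & i' : I' & j = d j' & i = d i' & (j', i') : R'"
  if "(j, i) : R" "x : topspace (Z j)" for j i x
 proof -
  have "j : I" "i : I" using R(1) that(1) by auto
  moreover have "topspace (Z j) ~= {}" "topspace (Z i) ~= {}" using that emp by blast+
  ultimately obtain j' i' where "j' : I'" "i' : I'" "j = d j'" "i = d i'" using cov by blast
  thus ?thesis using d(2) that(1) by blast
 qed
 have emb: "continuous_map (Z j) (Z i) (f j i) & open_map (Z j) (Z i) (f j i)" if R: "(j, i) : R" for j i
 proof (cases "topspace (Z j) = {}")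
  case True
  thus ?thesis by (auto simp: continuous_map_def open_map_def dest: openin_subset)
 next
  case False
  then obtain j' i' where "j' : I'" "i' : I'" "j = d j'" "i = d i'" "(j', i') : R'" using idx[OF R] by blast
  thus ?thesis using homeomorphic_transport_embedding[OF \<Phi> \<Phi> G.f_cont G.f_open] f by blast
 qed
 show ?thesis
 proof
  show "f i i x = x" if ix: "i : I" "x : topspace (Z i)" for i x
  proof -
   obtain i' where i': "i' : I'" "i = d i'" using cov[OF ix(1)] ix(2) by auto
   have "f i i x : topspace (Z i)" "\<Phi> i' (f i i x) = f' i' i' (\<Phi> i' x)"
    using f[OF G.R_refl[OF i'(1)], of x] ix i'(2) by auto
   thus ?thesis using \<Phi>i[OF i'(1)] G.f_id[OF i'(1) \<Phi>t[OF i'(1)]] ix(2) i'(2) by auto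
  qed
  show "f j i (f k j x) = f k i x" if kj: "(k, j) : R" "(j, i) : R" "x : topspace (Z k)" for k j i x
  proof -
   obtain k' j' where 1: "k' : I'" "j' : I'" "k = d k'" "j = d j'" "(k', j') : R'" using idx[OF kj(1,3)] by blast
   have x: "x : topspace (Z (d k'))" using kj(3) 1(3) by simp
   have y: "f k j x : topspace (Z (d j'))" "\<Phi> j' (f k j x) = f' k' j' (\<Phi> k' x)"
    using f[OF 1(5) x] by (simp_all add: 1(3,4))
   have "topspace (Z i) ~= {}" using emp[OF kj(2)] y(1) 1(4) by auto
   then obtain i' where 2: "i' : I'" "i = d i'" using cov[of i] R(1) kj(2) by blast
   have ji: "(j', i') : R'" using d(2)[OF 2(1) 1(2)] kj(2) 1(4) 2(2) by simp
   have ki: "(k', i') : R'" using G.R_trans[OF 1(5) ji] .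
   have "\<Phi> i' (f j i (f k j x)) = f' j' i' (f' k' j' (\<Phi> k' x))" "f j i (f k j x) : topspace (Z (d i'))"
    using f[OF ji y(1)] y(2) by (simp_all add: 1(4) 2(2))
   moreover have "\<Phi> i' (f k i x) = f' k' i' (\<Phi> k' x)" "f k i x : topspace (Z (d i'))"
    using f[OF ki x] by (simp_all add: 1(3) 2(2))
   ultimately show ?thesis using \<Phi>i[OF 2(1)] G.f_comp[OF 1(5) ji \<Phi>t[OF 1(1) x]] by simp
  qed
  fix i j k x y
  assume R': "(j, i) : R" "(k, i) : R" "x : topspace (Z j)" "y : topspace (Z k)" "f j i x = f k i y"
  obtain j' i' where 1: "j' : I'" "i' : I'" "j = d j'" "i = d i'" "(j', i') : R'" using idx[OF R'(1,3)] by blast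
  obtain k' where 2: "k' : I'" "k = d k'" using idx[OF R'(2,4)] by blast
  have ki: "(k', i') : R'" using d(2)[OF 1(2) 2(1)] R'(2) 1(4) 2(2) by simp
  have x: "x : topspace (Z (d j'))" and y: "y : topspace (Z (d k'))" using R'(3,4) 1(3) 2(2) by simp_all
  have "f' j' i' (\<Phi> j' x) = f' k' i' (\<Phi> k' y)" using f[OF 1(5) x] f[OF ki y] R'(5) by (simp add: 1(3,4) 2(2))
  then obtain m z where m: "(m, j') : R'" "(m, k') : R'" "z : topspace (Z' m)" "f' m j' z = \<Phi> j' x" "f' m k' z = \<Phi> k' y"
   using G.amalg[OF 1(5) ki \<Phi>t[OF 1(1) x] \<Phi>t[OF 2(1) y]] by blast
  have mI: "m : I'" using R'I[OF m(1)] by blast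
  obtain w where w: "w : topspace (Z (d m))" "z = \<Phi> m w"
   using homeomorphic_imp_surjective_map[OF \<Phi>[OF mI]] m(3) by blast
  have "f (d m) j w = x" "f (d m) k w = y"
   using f[OF m(1) w(1)] f[OF m(2) w(1)] m(4,5) w(2) \<Phi>i[OF 1(1) _ x] \<Phi>i[OF 2(1) _ y] by (simp_all add: 1(3) 2(2))
  moreover have "(d m, j) : R" "(d m, k) : R" using d(2) mI m(1,2) 1(1,3) 2 by auto
  ultimately show "EX m z. (m, j) : R & (m, k) : R & z : topspace (Z m) & f m j z = x & f m k z = y"
   using w(1) by blast
 qed (use R emb in blast)+
qed

text \<open>\<open>SCong_scheme\<close> takes inclusions between arbitrary sets as transitions,
  whereas \<open>gluing\<close> wants a relation on the index set.\<close>

lemma top_colim_restrict: "top_colim I R Z f = top_colim I (R Int I \<times> I) Z f"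
 unfolding top_colim_def colim_rel_def by (simp add: conj_ac cong: conj_cong)

lemma SCong_pullback_iso:
 assumes A: "kalgebra k \<eta> A" and B: "kalgebra k \<eta>' B" and g: "g : pmon_iso A B"
  and \<eta>: "!!l. l : carrier k ==> \<eta>' l = g (\<eta> l)" and d: "d : SCong k \<eta>' B"
 shows "cong_pullback A g d : SCong k \<eta> A"
proof -
 interpret A: kalgebra k \<eta> A by fact
 interpret B: kalgebra k \<eta>' B by fact
 obtain K :: "(nat \<times> 'c set) ring" and h where K: "field K" "h : pmon_hom B (ring_pmonoid K)"
  "d = pkernel B h" "inj_on (h \<circ> \<eta>') (carrier k)" using B.A.SCong_kernelE[OF d B.\<eta>_closed] by metis
 have gh: "g : pmon_hom A B" using g by (simp add: pmon_iso_def)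
 have "cong_pullback A g d = pkernel A (h \<circ> g)"
  using pmon_homD(1)[OF gh] by (auto simp: cong_pullback_def K(3) pkernel_iff pkernel_def[of A])
 moreover have "inj_on (h \<circ> g \<circ> \<eta>) (carrier k)" using K(4) \<eta> by (simp add: inj_on_def)
 ultimately show ?thesis using A.A.SCong_kernelI[OF K(1) pmon_hom_comp[OF gh K(2)] A.\<eta>_closed, of k] by simp
qed

lemma pmon_iso_inverse:
 assumes A: "pointed_monoid A" and g: "g : pmon_iso A B"
 shows "inv_into (carrier A) g : pmon_iso B A"
proof -
 interpret pointed_monoid A by fact
 have gh: "g : pmon_hom A B" and inj: "inj_on g (carrier A)" and gc: "g ` carrier A = carrier B"
  using g by (auto simp: pmon_iso_def bij_betw_def)
 have "id : pmon_hom A A" by (rule pmon_homI) simp_all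
 hence "id \<circ> inv_into (carrier A) g : pmon_iso B A"
  using gh gc pzero_closed inj by (intro pmon_iso_quotients) (auto simp: inj_on_eq_iff)
 thus ?thesis by simp
qed

lemma SCong_iso_homeomorphic:
 assumes A: "kalgebra k \<eta> A" and B: "kalgebra k \<eta>' B" and g: "g : pmon_iso A B"
  and \<eta>: "!!l. l : carrier k ==> \<eta>' l = g (\<eta> l)"
 shows "homeomorphic_map (SCong_top k \<eta>' B) (SCong_top k \<eta> A) (cong_pullback A g)"
proof -
 interpret A: kalgebra k \<eta> A by fact
 interpret B: kalgebra k \<eta>' B by fact
 let ?i = "inv_into (carrier A) g"
 let ?f = "cong_pullback A g"
 have inj: "inj_on g (carrier A)" and gc: "g ` carrier A = carrier B"
  using g by (auto simp: pmon_iso_def bij_betw_def)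
 have ig: "?i (g a) = a" if "a : carrier A" for a using inv_into_f_f[OF inj that] .
 have gi: "g (?i b) = b" "?i b : carrier A" if "b : carrier B" for b
  using that gc by (auto intro: f_inv_into_f inv_into_into)
 note inv = pmon_iso_inverse[OF A.A.pointed_monoid_axioms g]
 have gA: "g a : carrier B" if "a : carrier A" for a using gc that by blast
 have fg: "?f (cong_pullback B ?i c) = c" if "c : SCong k \<eta> A" for c
  using A.SCong_subset[OF that] ig gA by (auto simp: cong_pullback_def)
 have gf: "cong_pullback B ?i (?f d) = d" if "d : SCong k \<eta>' B" for d
  using B.SCong_subset[OF that] gi by (auto simp: cong_pullback_def)
 have pb: "cong_pullback B ?i c : SCong k \<eta>' B" if "c : SCong k \<eta> A" for c
  using SCong_pullback_iso[OF B A inv _ that] \<eta> ig A.\<eta>_closed by simp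
 have f: "?f d : SCong k \<eta> A" if "d : SCong k \<eta>' B" for d
  using SCong_pullback_iso[OF A B g \<eta> that] .
 have im: "?f ` SCong k \<eta>' B = SCong k \<eta> A"
 proof (intro equalityI subsetI)
  fix c assume c: "c : SCong k \<eta> A"
  thus "c : ?f ` SCong k \<eta>' B" using fg[OF c] pb[OF c] by (metis imageI)
 qed (use f in blast)
 have inj_f: "inj_on ?f (SCong k \<eta>' B)" by (rule inj_on_inverseI[of _ "cong_pullback B ?i"]) (rule gf)
 have mem: "(g a, g b) : d \<longleftrightarrow> (a, b) : ?f d" if "a : carrier A" "b : carrier A" for a b d
  using that by (simp add: cong_pullback_def)
 \<comment> \<open>No point contains the pair of 0 and 1, so this pair can serve as the element to
   be avoided.\<close>
 have "continuous_map (SCong_top k \<eta>' B) (SCong_top k \<eta> A) ?f & open_map (SCong_top k \<eta>' B) (SCong_top k \<eta> A) ?f"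
  unfolding A.SCong_top_avoid B.SCong_top_avoid
 proof (rule avoid_open_embedding[OF A.avoid_space_axioms B.avoid_space_axioms inj_f])
  show "?f ` SCong k \<eta>' B = {x : SCong k \<eta> A. (pzero A, 1[A]) ~: x}" using im A.SCong_zero_one by auto
  show "(pzero A, 1[A]) : carrier A \<times> carrier A" using A.A.pzero_closed by simp
  show "EX e':carrier A \<times> carrier A. ALL x:SCong k \<eta>' B. e : x \<longleftrightarrow> e' : ?f x" if e: "e : carrier B \<times> carrier B" for e
  proof -
   obtain a b where "e = (a, b)" "a : carrier B" "b : carrier B" using e by blast
   thus ?thesis using mem[of "?i a" "?i b"] gi by (intro bexI[of _ "(?i a, ?i b)"]) auto
  qed
  show "EX e':carrier B \<times> carrier B. ALL x:SCong k \<eta>' B. e : ?f x \<longleftrightarrow> e' : x" if e: "e : carrier A \<times> carrier A" for e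
  proof -
   obtain a b where "e = (a, b)" "a : carrier A" "b : carrier A" using e by blast
   thus ?thesis using mem gA by (intro bexI[of _ "(g a, g b)"]) auto
  qed
 qed
 moreover have "topspace (SCong_top k \<eta>' B) = SCong k \<eta>' B" "topspace (SCong_top k \<eta> A) = SCong k \<eta> A"
  unfolding A.SCong_top_avoid B.SCong_top_avoid by simp_all
 ultimately show ?thesis using inj_f im by (intro bijective_open_imp_homeomorphic_map) simp_all
qed

section \<open>The congruence space is glued from the congruence spaces of the cones\<close>

context toric_scheme_fan
begin

abbreviation "\<eta>X U \<equiv> (%l. restr XS (topspace (pts XS)) U (toric_structure F N \<Sigma> l))"

lemma \<eta>X_eq:
 assumes U: "openin (pts XS) U" and l: "l : carrier F"
 shows "\<eta>X U l = secX U (monoid_alg_const F l)"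
proof -
 have pre_top: "pre C (topspace (pts XS)) = primes C" if "C : \<Sigma>" for C
  using that by (auto simp: pre_def topspace_XS)
 have "toric_structure F N \<Sigma> l = secX (topspace (pts XS)) (monoid_alg_const F l)"
  unfolding toric_structure_def secX_def Let_def
 proof (rule restrict_ext)
  fix C assume C: "C : \<Sigma>"
  interpret frac_monoid "A C" E id by (rule frac_A[OF C])
  have c: "monoid_alg_const F l : carrier (A C)" using kalgebra.\<eta>_closed[OF A_kalgebra[OF C] l] .
  show "(\<lambda>P\<in>primes C. frac (A C) (carrier (A C) - P) (monoid_alg_const F l) 1[A C]) =
    germ_section (A C) E id (pre C (topspace (pts XS))) (monoid_alg_const F l)"
   unfolding pre_top[OF C] germ_section_def
   by (rule restrict_ext) (use frac_germ[OF _ _ germ_closed[OF c]] subsetD[OF A_sub_E c] in simp)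
 qed
 thus ?thesis using secX_restr[OF openin_subset[OF U]] by simp
qed

abbreviation "YX U \<equiv> SCong_top F (\<eta>X U) (sections XS U)"

lemma YX_Uo:
 assumes C: "C : \<Sigma>"
 shows "homeomorphic_map (YX (Uo C)) (avoid_top (congs C) (carrier (A C) \<times> carrier (A C))) (cong_pullback (A C) (\<kappa> C))"
proof -
 interpret A: kalgebra F "monoid_alg_const F" "A C" by (rule A_kalgebra[OF C])
 have \<eta>: "\<eta>X (Uo C) l = \<kappa> C (monoid_alg_const F l)" if "l : carrier F" for l
  by (rule \<eta>X_eq[OF Uo_open[OF C] that])
 have "kalgebra F (\<eta>X (Uo C)) (\<Gamma> C)"
 proof (intro kalgebra.intro kalgebra_axioms.intro \<kappa>_iso(2)[OF C])
  fix l assume l: "l : carrier F"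
  show "\<eta>X (Uo C) l : carrier (\<Gamma> C)"
   unfolding \<eta>[OF l] using pmon_homD(1)[of "\<kappa> C" "A C" "\<Gamma> C"] \<kappa>_iso(1)[OF C] A.\<eta>_closed[OF l] by (simp add: pmon_iso_def)
 qed
 from SCong_iso_homeomorphic[OF A.kalgebra_axioms this \<kappa>_iso(1)[OF C] \<eta>]
 show ?thesis unfolding A.SCong_top_avoid .
qed

text \<open>Over the empty set there is one section, so 1 and 0 agree and no quotient is a
  domain.\<close>

lemma YX_empty: "topspace (YX {}) = {}"
proof -
 have triv: "x = y" if xy: "x : carrier (sections XS {})" "y : carrier (sections XS {})" for x y
  using secX_surj[of "{}"] xy secX_empty by (metis imageE openin_empty)
 have "pointed_monoid (sections XS {})"
 proof (rule pmon_hom_image[OF _ secX_hom[OF openin_empty]])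
  show "pointed_monoid (DX {})"
  proof -
   have "DX {} = E" by (auto simp: domX_def pre_def monoid_alg_def)
   thus ?thesis using E_pointed_monoid by simp
  qed
  show "secX {} ` carrier (DX {}) = carrier (sections XS {})" using secX_surj[OF openin_empty] by simp
 qed
 then interpret S: pointed_monoid "sections XS {}" .
 have "c ~: SCong F (\<eta>X {}) (sections XS {})" for c
 proof
  assume c: "c : SCong F (\<eta>X {}) (sections XS {})"
  have e: "equiv (carrier (sections XS {})) c" using c by (simp add: SCong_def congruence_def)
  have one: "1[sections XS {}] = pzero (sections XS {})" using triv S.one_closed S.pzero_closed by blast
  obtain K :: "(nat \<times> ('v set => ('k \<times> ('v => real)) option set =>
   (('k \<times> ('v => real)) option \<times> ('k \<times> ('v => real)) option) set) set) ring" and f B where K: "field K"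
   and f: "f : pmon_iso (quot_pmonoid (sections XS {}) c) ((ring_pmonoid K)\<lparr>carrier := B\<rparr>)"
   using c by (auto simp: SCong_def pmon_domain_def)
  have "f 1[quot_pmonoid (sections XS {}) c] = 1[K]" "f (pzero (quot_pmonoid (sections XS {}) c)) = 0[K]"
   using f by (auto simp: pmon_iso_def pmon_hom_def)
  hence "1[K] = 0[K]" using one by simp
  thus False using domain.one_not_zero[OF field.axioms(1)[OF K]] by simp
 qed
 thus ?thesis unfolding topspace_SCong_top[OF S.pointed_monoid_axioms] by blast
qed

abbreviation "Y \<equiv> SCong_scheme F (toric_structure F N \<Sigma>) XS"
abbreviation "affines \<equiv> {U. affine_open XS U}"
abbreviation "affines_rel \<equiv> {(U, V). U <= V} Int affines \<times> affines"

text \<open>That the pullback is a point is read off in the algebras of the cones, where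
  \<open>SCong_gluing\<close> provides it. As \<open>\<kappa> C\<close> is onto, a relation on
  \<open>\<Gamma> C\<close> is determined by its pullback along \<open>\<kappa> C\<close>.\<close>

lemma YX_restr:
 assumes R: "(D, C) : face_rel \<Sigma>" and d: "d : topspace (YX (Uo D))"
 shows "cong_pullback (\<Gamma> C) (restr XS (Uo C) (Uo D)) d : topspace (YX (Uo C)) &
   cong_pullback (A C) (\<kappa> C) (cong_pullback (\<Gamma> C) (restr XS (Uo C) (Uo D)) d) =
   cong_pullback (A D) (\<kappa> D) d Int carrier (A C) \<times> carrier (A C)"
 proof -
  have s: "D : \<Sigma>" "C : \<Sigma>" "D <= C" using R by (auto simp: face_rel_iff)
  have sub: "Uo D <= Uo C" using Uo_subset_iff[OF s(1,2)] s(3) by simp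
  have res: "restr XS (Uo C) (Uo D) (\<kappa> C a) = \<kappa> D a" for a by (rule secX_restr[OF sub])
  have kc: "\<kappa> C a : carrier (\<Gamma> C)" if "a : carrier (A C)" for a
   using \<kappa>_iso(1)[OF s(2)] that by (auto simp: pmon_iso_def dest: pmon_homD(1))
  have eq: "cong_pullback (A C) (\<kappa> C) (cong_pullback (\<Gamma> C) (restr XS (Uo C) (Uo D)) d) =
   cong_pullback (A D) (\<kappa> D) d Int carrier (A C) \<times> carrier (A C)"
   using res kc A_mono[OF s(3)] by (auto simp: cong_pullback_def)
  have hs: "homeomorphic_map (YX (Uo D)) (avoid_top (congs D) (carrier (A D) \<times> carrier (A D))) (cong_pullback (A D) (\<kappa> D))"
   "homeomorphic_map (YX (Uo C)) (avoid_top (congs C) (carrier (A C) \<times> carrier (A C))) (cong_pullback (A C) (\<kappa> C))"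
   using YX_Uo s by blast+
  have "cong_pullback (A D) (\<kappa> D) d : topspace (avoid_top (congs D) (carrier (A D) \<times> carrier (A D)))"
   using homeomorphic_imp_surjective_map[OF hs(1)] d by blast
  hence "cong_pullback (A D) (\<kappa> D) d Int carrier (A C) \<times> carrier (A C) : topspace (avoid_top (congs C) (carrier (A C) \<times> carrier (A C)))"
   using gluing.f_range[OF SCong_gluing R] by blast
  then obtain d' where d': "d' : topspace (YX (Uo C))"
   "cong_pullback (A C) (\<kappa> C) d' = cong_pullback (A D) (\<kappa> D) d Int carrier (A C) \<times> carrier (A C)"
   unfolding homeomorphic_imp_surjective_map[OF hs(2), symmetric] by (elim imageE) (rule that[OF _ sym])
  have "d' = cong_pullback (\<Gamma> C) (restr XS (Uo C) (Uo D)) d"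
  proof -
   have d's: "d' <= carrier (\<Gamma> C) \<times> carrier (\<Gamma> C)"
    using d'(1) unfolding topspace_SCong_top[OF \<kappa>_iso(2)[OF s(2)]] by (auto simp: SCong_def congruence_def equiv_def refl_on_def)
   have ks: "EX a:carrier (A C). b = \<kappa> C a" if "b : carrier (\<Gamma> C)" for b
    using \<kappa>_iso(1)[OF s(2)] that unfolding pmon_iso_def bij_betw_def by blast
   have "(\<kappa> C a, \<kappa> C b) : d' \<longleftrightarrow> (\<kappa> C a, \<kappa> C b) : cong_pullback (\<Gamma> C) (restr XS (Uo C) (Uo D)) d"
    if "a : carrier (A C)" "b : carrier (A C)" for a b
   proof -
    have "(a, b) : cong_pullback (A C) (\<kappa> C) d' \<longleftrightarrow>
      (a, b) : cong_pullback (A C) (\<kappa> C) (cong_pullback (\<Gamma> C) (restr XS (Uo C) (Uo D)) d)"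
     using d'(2) eq by simp
    thus ?thesis using that by (simp add: cong_pullback_def)
   qed
   hence "(x, y) : d' \<longleftrightarrow> (x, y) : cong_pullback (\<Gamma> C) (restr XS (Uo C) (Uo D)) d"
    if "x : carrier (\<Gamma> C)" "y : carrier (\<Gamma> C)" for x y
    using ks[OF that(1)] ks[OF that(2)] by blast
   thus ?thesis using d's unfolding cong_pullback_def[of "\<Gamma> C"] by blast
  qed
  thus ?thesis using d'(1) eq by simp
 qed

lemma Y_gluing: "gluing affines affines_rel YX (%U V. cong_pullback (sections XS V) (restr XS V U))"
proof (rule gluing_transport[OF SCong_gluing, where d = Uo and \<Phi> = "%C. cong_pullback (A C) (\<kappa> C)"])
 show "affines_rel <= affines \<times> affines" by blast
 show "(i, i) : affines_rel" if "i : affines" for i using that by blast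
 show "(k, i) : affines_rel" if "(k, j) : affines_rel" "(j, i) : affines_rel" for i j k using that by auto
 show "Uo C : affines" if "C : \<Sigma>" for C using affine_open_Uo[OF that] by blast
 show "(Uo D, Uo C) : affines_rel \<longleftrightarrow> (D, C) : face_rel \<Sigma>" if "C : \<Sigma>" "D : \<Sigma>" for C D
  using affine_open_Uo[OF that(1)] affine_open_Uo[OF that(2)] Uo_subset_iff[OF that(2,1)] that by (simp add: face_rel_iff)
 show "U : Uo ` \<Sigma> \<or> topspace (YX U) = {}" if "U : affines" for U
  using affine_open_cases[of U] that YX_empty by auto
 show "homeomorphic_map (YX (Uo C)) (avoid_top (congs C) (carrier (A C) \<times> carrier (A C))) (cong_pullback (A C) (\<kappa> C))"
  if "C : \<Sigma>" for C by (rule YX_Uo[OF that])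
 show "cong_pullback (sections XS (Uo i)) (restr XS (Uo i) (Uo j)) x : topspace (YX (Uo i)) &
   cong_pullback (A i) (\<kappa> i) (cong_pullback (\<Gamma> i) (restr XS (Uo i) (Uo j)) x) =
   cong_pullback (A j) (\<kappa> j) x Int carrier (A i) \<times> carrier (A i)"
  if "(j, i) : face_rel \<Sigma>" "x : topspace (YX (Uo j))" for i j x by (rule YX_restr[OF that])
 show "topspace (YX V) = {}" if VU: "(V, U) : affines_rel" "topspace (YX U) = {}" for U V
 proof (cases "V = {}")
  case False
  have V: "affine_open XS V" "affine_open XS U" "V <= U" using VU(1) by auto
  then obtain D C where "D : \<Sigma>" "V = Uo D" "C : \<Sigma>" "U = Uo C"
   using affine_open_cases[OF V(1)] affine_open_cases[OF V(2)] False by auto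
  moreover from this have "(D, C) : face_rel \<Sigma>" using V(3) Uo_subset_iff by (simp add: face_rel_iff)
  ultimately show ?thesis using YX_restr[of D C] VU(2) by blast
 qed (simp add: YX_empty)
qed

end

context toric_scheme_fan
begin

lemma Y_chart:
 assumes C: "C : \<Sigma>"
 shows "EX q. open_embedding (SCong_top F (monoid_alg_const F) (A C)) Y q &
  q ` topspace (SCong_top F (monoid_alg_const F) (A C)) = gluing.chart affines affines_rel YX (%U V. cong_pullback (sections XS V) (restr XS V U)) (Uo C) ` topspace (YX (Uo C))"
proof -
 interpret Y: gluing affines affines_rel YX "%U V. cong_pullback (sections XS V) (restr XS V U)" by (rule Y_gluing)
 interpret A: kalgebra F "monoid_alg_const F" "A C" by (rule A_kalgebra[OF C])
 obtain g where g: "homeomorphic_maps (YX (Uo C)) (SCong_top F (monoid_alg_const F) (A C)) (cong_pullback (A C) (\<kappa> C)) g"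
  using YX_Uo[OF C] unfolding homeomorphic_map_maps A.SCong_top_avoid by blast
 hence g: "homeomorphic_map (SCong_top F (monoid_alg_const F) (A C)) (YX (Uo C)) g"
  using homeomorphic_maps_sym homeomorphic_map_maps by blast
 have Yeq: "Y = Y.colim" unfolding SCong_scheme_def by (rule top_colim_restrict)
 interpret c: open_embedding "YX (Uo C)" Y "Y.chart (Uo C)"
  unfolding Yeq by (rule Y.open_embedding_chart) (use affine_open_Uo[OF C] in simp)
 have im: "g ` topspace (SCong_top F (monoid_alg_const F) (A C)) = topspace (YX (Uo C))"
  by (rule homeomorphic_imp_surjective_map[OF g])
 have "open_embedding (SCong_top F (monoid_alg_const F) (A C)) Y (Y.chart (Uo C) \<circ> g)"
 proof
  show "continuous_map (SCong_top F (monoid_alg_const F) (A C)) Y (Y.chart (Uo C) \<circ> g)"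
   by (rule continuous_map_compose[OF homeomorphic_imp_continuous_map[OF g] c.cont])
  show "open_map (SCong_top F (monoid_alg_const F) (A C)) Y (Y.chart (Uo C) \<circ> g)"
   by (rule open_map_compose[OF homeomorphic_imp_open_map[OF g] c.opn])
  show "inj_on (Y.chart (Uo C) \<circ> g) (topspace (SCong_top F (monoid_alg_const F) (A C)))"
   by (rule comp_inj_on[OF homeomorphic_imp_injective_map[OF g]]) (simp only: im c.inj)
 qed
 moreover have "(Y.chart (Uo C) \<circ> g) ` topspace (SCong_top F (monoid_alg_const F) (A C)) = Y.chart (Uo C) ` topspace (YX (Uo C))"
  by (simp only: image_comp[symmetric] im)
 ultimately show ?thesis by blast
qed

lemma toric_algebra_gens: "C : \<Sigma> ==> toric_algebra M B (gens C) (CM C) F"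
 by (intro toric_algebra.intro cone_lattice acl_pgroup_axioms)

lemma toric_algebra_zero: "toric_algebra M B {} M F"
 by (intro toric_algebra.intro cone_lattice.intro cone_lattice_axioms.intro functional_lattice acl_pgroup_axioms) auto

lemma Y_facts: "catenary Y" "krull_dim Y = (if \<Sigma> = {} then bot else ereal (card B))"
proof -
 interpret Y: gluing affines affines_rel YX "%U V. cong_pullback (sections XS V) (restr XS V U)" by (rule Y_gluing)
 have Yeq: "Y = Y.colim" unfolding SCong_scheme_def by (rule top_colim_restrict)
 let ?C = "%C. SCong_top F (monoid_alg_const F) (A C)"
 define q where "q C = (SOME q. open_embedding (?C C) Y q &
  q ` topspace (?C C) = Y.chart (Uo C) ` topspace (YX (Uo C)))" for C
 have q: "open_embedding (?C C) Y (q C)" "q C ` topspace (?C C) = Y.chart (Uo C) ` topspace (YX (Uo C))"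
  if "C : \<Sigma>" for C using someI_ex[OF Y_chart[OF that]] unfolding q_def by blast+
 have cov: "topspace Y <= (UN C:\<Sigma>. q C ` topspace (?C C))"
 proof
  fix y assume "y : topspace Y"
  hence "y : (UN U:affines. Y.chart U ` topspace (YX U))" unfolding Yeq Y.topspace_colim .
  then obtain U where U: "affine_open XS U" "y : Y.chart U ` topspace (YX U)" by (elim UN_E CollectE)
  hence "U ~= {}" using YX_empty by auto
  then obtain C where C: "C : \<Sigma>" "U = Uo C" using affine_open_cases[OF U(1)] by blast
  show "y : (UN C:\<Sigma>. q C ` topspace (?C C))" using U(2) unfolding C(2) q(2)[OF C(1), symmetric] by (rule UN_I[OF C(1)])
 qed
 show "catenary Y"
  by (rule catenary_open_cover[OF q(1) cov toric_algebra.SCong_grading[OF toric_algebra_gens]])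
 have kd: "krull_dim Y = (SUP C\<in>\<Sigma>. krull_dim (?C C))" by (rule krull_dim_open_cover[OF q(1) cov])
 show "krull_dim Y = (if \<Sigma> = {} then bot else ereal (card B))"
 proof (cases "\<Sigma> = {}")
  case False
  hence z: "{0} : \<Sigma>" using zero_cone_mem by blast
  obtain b where b: "bij_betw b {..<card B} B" using ex_bij_betw_nat_finite[OF B_finite] by (auto simp: lessThan_atLeast0)
  have "ereal (card B) <= krull_dim (SCong_top F (monoid_alg_const F) (monoid_alg F M))"
  proof (rule toric_algebra.SCong_krull_dim_ge[OF toric_algebra_zero refl refl b])
   fix i assume i: "i < card B"
   hence "b i : B" using b by (auto simp: bij_betw_def)
   then obtain m where m: "m : M" "ALL b':B. m b' = (if b' = b i then 1 else 0)" using dual_basis by blast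
   have "m (b j) = (if j = i then 1 else 0)" if j: "j < card B" for j
   proof -
    have "b j : B" "b j = b i \<longleftrightarrow> j = i" using b i j by (auto simp: bij_betw_def inj_on_def)
    thus ?thesis using m(2) by simp
   qed
   thus "EX m:M. ALL j<card B. m (b j) = (if j = i then 1 else 0)" using m(1) by blast
  qed
  hence "ereal (card B) <= (SUP C\<in>\<Sigma>. krull_dim (?C C))" by (intro SUP_upper2[OF z]) (simp add: CM_zero_cone)
  moreover have "(SUP C\<in>\<Sigma>. krull_dim (?C C)) <= ereal (card B)"
   by (rule SUP_least) (rule toric_algebra.SCong_krull_dim_le[OF toric_algebra_gens])
  ultimately show ?thesis using kd False by simp
 qed (use kd in simp)
qed

end

type_synonym 'v cpoly = "('v => real) \<Rightarrow>\<^sub>0 complex"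

section \<open>Prime ideals of monoid rings\<close>

abbreviation pm_monom :: "'m => 'm \<Rightarrow>\<^sub>0 'c::{zero,one}" where "pm_monom m \<equiv> Poly_Mapping.single m 1"

abbreviation pm_const :: "'c => 'm::zero \<Rightarrow>\<^sub>0 'c::zero" where "pm_const \<equiv> Poly_Mapping.single 0"

definition supported :: "'m set => ('m \<Rightarrow>\<^sub>0 'c::zero) set" where
 "supported S = {p. Poly_Mapping.keys p <= S}"

lemma carrier_monoid_ring: "carrier (monoid_ring S) = supported S" by (simp add: monoid_ring_def supported_def)

lemma Spec_top_avoid: "Spec_top (monoid_ring S :: ('m::comm_monoid_add \<Rightarrow>\<^sub>0 'c::comm_ring_1) ring) =
  avoid_top {Q. primeideal Q (monoid_ring S)} (supported S)"
 unfolding Spec_top_def avoid_top_def carrier_monoid_ring by (rule arg_cong[of _ _ topology_generated_by]) auto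

locale exponent_monoid =
 fixes S :: "'m::comm_monoid_add set"
 assumes zero: "0 : S" and add: "s : S ==> t : S ==> s + t : S"
begin

lemma supported_ops:
 fixes p q :: "'m \<Rightarrow>\<^sub>0 'c::comm_ring_1"
 shows "p : supported S ==> q : supported S ==> p + q : supported S"
  "p : supported S ==> q : supported S ==> p * q : supported S"
  "p : supported S ==> - p : supported S" "1 : (supported S :: ('m \<Rightarrow>\<^sub>0 'c) set)" "0 : (supported S :: ('m \<Rightarrow>\<^sub>0 'c) set)"
  "s : S ==> Poly_Mapping.single s c : (supported S :: ('m \<Rightarrow>\<^sub>0 'c) set)"
proof -
 show "p : supported S ==> q : supported S ==> p + q : supported S"
  using keys_add[of p q] by (auto simp: supported_def)
 show "p : supported S ==> q : supported S ==> p * q : supported S" unfolding supported_def mem_Collect_eq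
 proof
  fix k assume pq: "Poly_Mapping.keys p <= S" "Poly_Mapping.keys q <= S" and "k : Poly_Mapping.keys (p * q)"
  then obtain a b where "k = a + b" "a : Poly_Mapping.keys p" "b : Poly_Mapping.keys q" using keys_mult[of p q] by auto
  thus "k : S" using pq add by auto
 qed
 show "p : supported S ==> - p : supported S" by (simp add: supported_def)
 show "1 : (supported S :: ('m \<Rightarrow>\<^sub>0 'c) set)" "0 : (supported S :: ('m \<Rightarrow>\<^sub>0 'c) set)"
  using zero by (simp_all add: supported_def)
 show "s : S ==> Poly_Mapping.single s c : (supported S :: ('m \<Rightarrow>\<^sub>0 'c) set)" by (simp add: supported_def)
qed

lemma supported_sum:
 fixes f :: "'i => 'm \<Rightarrow>\<^sub>0 'c::comm_ring_1"
 shows "(!!i. i : I ==> f i : supported S) ==> sum f I : supported S"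
 by (induction I rule: infinite_finite_induct) (simp_all add: supported_ops)

lemma supported_power:
 fixes p :: "'m \<Rightarrow>\<^sub>0 'c::comm_ring_1"
 shows "p : supported S ==> p ^ n : supported S" by (induction n) (simp_all add: supported_ops)

lemma monoid_ring_cring: "cring (monoid_ring S :: ('m \<Rightarrow>\<^sub>0 'c::comm_ring_1) ring)"
proof (rule cringI)
 show "abelian_group (monoid_ring S :: ('m \<Rightarrow>\<^sub>0 'c) ring)"
 proof (rule abelian_groupI)
  fix x :: "'m \<Rightarrow>\<^sub>0 'c" assume "x : carrier (monoid_ring S)"
  thus "EX y:carrier (monoid_ring S). y \<oplus>\<^bsub>monoid_ring S\<^esub> x = 0[monoid_ring S]"
   using supported_ops(3)[of x] by (intro bexI[of _ "- x"]) (simp_all add: monoid_ring_def supported_def)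
 qed (use supported_ops in \<open>auto simp: monoid_ring_def supported_def[symmetric] add_ac\<close>)
 show "comm_monoid (monoid_ring S :: ('m \<Rightarrow>\<^sub>0 'c) ring)"
  by (rule comm_monoidI) (use supported_ops in \<open>auto simp: monoid_ring_def supported_def[symmetric] mult_ac\<close>)
qed (auto simp: monoid_ring_def algebra_simps)

lemma monoid_ring_simps: "x *[monoid_ring S] y = x * y" "x \<oplus>\<^bsub>monoid_ring S\<^esub> y = x + y"
  "0[monoid_ring S] = 0" "1[monoid_ring S] = 1" by (simp_all add: monoid_ring_def)

lemma primeideal_iff:
 fixes Q :: "('m \<Rightarrow>\<^sub>0 'c::comm_ring_1) set"
 shows "primeideal Q (monoid_ring S) \<longleftrightarrow> Q <= supported S & 0 : Q & (ALL p:Q. ALL q:Q. p + q : Q) &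
  (ALL a:supported S. ALL q:Q. a * q : Q) & 1 ~: Q &
  (ALL a:supported S. ALL b:supported S. a * b : Q --> a : Q \<or> b : Q)" (is "_ \<longleftrightarrow> ?r")
proof
 assume Q: "primeideal Q (monoid_ring S)"
 interpret primeideal Q "monoid_ring S" by fact
 have "1 ~: Q" using I_notcarr one_imp_carrier by (auto simp: monoid_ring_simps)
 thus ?r
  using a_subset additive_subgroup.zero_closed[OF additive_subgroup_axioms] additive_subgroup.a_closed[OF additive_subgroup_axioms]
   I_l_closed I_prime by (simp add: monoid_ring_simps carrier_monoid_ring)
next
 assume r: ?r
 interpret R: cring "monoid_ring S :: ('m \<Rightarrow>\<^sub>0 'c) ring" by (rule monoid_ring_cring)
 have neg: "- q : Q" if "q : Q" for q
 proof -
  have "- 1 * q : Q" using r that supported_ops(3,4) by blast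
  thus ?thesis by simp
 qed
 have "ideal Q (monoid_ring S)"
 proof (rule idealI)
  show "subgroup Q (add_monoid (monoid_ring S :: ('m \<Rightarrow>\<^sub>0 'c) ring))"
  proof (rule R.add.subgroupI)
   fix a assume a: "a : Q"
   have "\<ominus>\<^bsub>monoid_ring S\<^esub> a = - a"
    by (rule R.minus_equality) (use a r supported_ops(3) in \<open>auto simp: monoid_ring_simps carrier_monoid_ring\<close>)
   thus "\<ominus>\<^bsub>monoid_ring S\<^esub> a : Q" using neg[OF a] by simp
  qed (use r in \<open>auto simp: monoid_ring_simps carrier_monoid_ring\<close>)
  fix a x assume ax: "a : Q" "x : carrier (monoid_ring S :: ('m \<Rightarrow>\<^sub>0 'c) ring)"
  hence "x * a : Q" using r by (simp add: carrier_monoid_ring)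
  thus "x *[monoid_ring S] a : Q" "a *[monoid_ring S] x : Q" by (simp_all add: monoid_ring_simps mult.commute)
 qed (rule R.ring_axioms)
 thus "primeideal Q (monoid_ring S)"
  by (rule primeidealI[OF _ R.cring_axioms]) (use r supported_ops(4) in \<open>auto simp: monoid_ring_simps carrier_monoid_ring\<close>)
qed

lemma primeD:
 fixes Q :: "('m \<Rightarrow>\<^sub>0 'c::comm_ring_1) set"
 assumes "primeideal Q (monoid_ring S)"
 shows "Q <= supported S" "0 : Q" "p : Q ==> q : Q ==> p + q : Q" "a : supported S ==> q : Q ==> a * q : Q"
  "1 ~: Q" "a : supported S ==> b : supported S ==> a * b : Q ==> a : Q \<or> b : Q"
 using assms unfolding primeideal_iff by blast+

lemma prime_power:
 fixes Q :: "('m \<Rightarrow>\<^sub>0 'c::comm_ring_1) set"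
 assumes Q: "primeideal Q (monoid_ring S)" and p: "p : supported S" "p ^ n : Q"
 shows "p : Q" using p(2)
proof (induction n)
 case (Suc n)
 thus ?case using primeD(6)[OF Q p(1) supported_power[OF p(1)], of n] by auto
qed (use primeD(5)[OF Q] in simp)

lemma prime_minus:
 fixes Q :: "('m \<Rightarrow>\<^sub>0 'c::comm_ring_1) set"
 assumes Q: "primeideal Q (monoid_ring S)" and "p : Q" "q : Q"
 shows "p - q : Q"
proof -
 have "- 1 * q : Q" by (rule primeD(4)[OF Q]) (use supported_ops(3,4) assms in auto)
 thus ?thesis using primeD(3)[OF Q assms(2), of "- q"] by simp
qed

lemma spec_avoid: "avoid_space {Q. primeideal Q (monoid_ring S :: ('m \<Rightarrow>\<^sub>0 'c::comm_ring_1) ring)} (supported S)"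
 using primeD(1,5) supported_ops(4) by unfold_locales blast+

text \<open>Two elements outside the intersection are missed by a common prime in \<open>T\<close>,
  by \<open>irreducible_avoid_finite\<close>; that prime does not contain their product.\<close>

lemma spec_sober: "sober_avoid_space {Q. primeideal Q (monoid_ring S :: ('m \<Rightarrow>\<^sub>0 'c::comm_ring_1) ring)} (supported S)"
proof -
 interpret avoid_space "{Q. primeideal Q (monoid_ring S :: ('m \<Rightarrow>\<^sub>0 'c) ring)}" "supported S" by (rule spec_avoid)
 show ?thesis
 proof
  fix T assume T: "irreducible_closed (avoid_top {Q. primeideal Q (monoid_ring S :: ('m \<Rightarrow>\<^sub>0 'c) ring)} (supported S)) T"
  have TP: "primeideal Q (monoid_ring S)" if "Q : T" for Q using irreducible_closed_subset[OF T] that by auto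
  obtain Q0 where Q0: "Q0 : T" using irreducible_closed_nonempty[OF T] by blast
  have pr: "a : \<Inter>T \<or> b : \<Inter>T" if ab: "a : supported S" "b : supported S" "a * b : \<Inter>T" for a b
  proof (rule ccontr)
   assume "~ ?thesis"
   hence "EX x:T. e ~: x" if "e : {a, b}" for e using that by auto
   then obtain x where "x : T" "{a, b} Int x = {}"
    using irreducible_avoid_finite[OF T, of "{a, b}"] ab(1,2) by auto
   thus False using primeD(6)[OF TP ab(1,2)] ab(3) by auto
  qed
  show "\<Inter>T : {Q. primeideal Q (monoid_ring S)}" unfolding mem_Collect_eq primeideal_iff
  proof (intro conjI ballI impI)
   show "\<Inter>T <= supported S" using primeD(1)[OF TP[OF Q0]] Q0 by blast
   show "0 : \<Inter>T" using primeD(2)[OF TP] by blast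
   show "p + q : \<Inter>T" if "p : \<Inter>T" "q : \<Inter>T" for p q using primeD(3)[OF TP] that by blast
   show "a * q : \<Inter>T" if "a : supported S" "q : \<Inter>T" for a q
    by (rule InterI) (rule primeD(4)[OF TP that(1)], assumption, rule InterD[OF that(2)])
   show "1 ~: \<Inter>T" using primeD(5)[OF TP[OF Q0]] Q0 by blast
  qed (rule pr)
 qed
qed

end

section \<open>Dimension of monoid rings\<close>

fun list_monom :: "'a::comm_monoid_mult list => nat list => 'a" where
 "list_monom (x # xs) (a # as) = x ^ a * list_monom xs as"
| "list_monom _ _ = 1"

context exponent_monoid
begin

lemma list_monom_supported:
 fixes xs :: "('m \<Rightarrow>\<^sub>0 'c::comm_ring_1) list"
 shows "set xs <= supported S ==> list_monom xs as : supported S"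
 by (induction xs as rule: list_monom.induct) (simp_all add: supported_ops supported_power)

text \<open>Elements that witness the strict inclusions of a chain of primes are algebraically
 independent.\<close>

lemma chain_independent:
 fixes p :: "nat => ('m \<Rightarrow>\<^sub>0 'c::field) set"
 assumes "!!i. i <= length xs ==> primeideal (p i) (monoid_ring S)" "!!i. i < length xs ==> p i <= p (Suc i)"
  "!!i. i < length xs ==> xs ! i : p (Suc i) & xs ! i ~: p i"
  "finite L" "!!a. a : L ==> length a = length xs"
  "(SUM a:L. pm_const (c a) * list_monom xs a) : p 0"
 shows "ALL a:L. c a = 0" using assms
proof (induction xs arbitrary: p L c)
 case Nil
 have p0: "primeideal (p 0) (monoid_ring S)" using Nil by simp
 have L: "L <= {[]}" using Nil(5) by auto
 show ?case
 proof (rule ballI, rule ccontr)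
  fix a assume a: "a : L" "c a ~= 0"
  hence "L = {[]}" "a = []" using L by auto
  hence "pm_const (c []) : p 0" using Nil(6) by simp
  hence "pm_const (inverse (c [])) * pm_const (c []) : p 0"
   by (rule primeD(4)[OF p0, rotated]) (simp add: supported_ops zero)
  thus False using primeD(5)[OF p0] a \<open>a = []\<close> by (simp add: mult_single)
 qed
next
 case (Cons x xs)
 have p0: "primeideal (p 0) (monoid_ring S)" and p1: "primeideal (p 1) (monoid_ring S)"
  using Cons.prems(1)[of 0] Cons.prems(1)[of 1] by auto
 have sub: "p 0 <= p 1" using Cons.prems(2)[of 0] by simp
 have x: "x : p 1" "x ~: p 0" using Cons.prems(3)[of 0] by auto
 have xS: "x : supported S" using x(1) primeD(1)[OF p1] by blast
 have xsS: "set xs <= supported S"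
 proof
  fix y assume "y : set xs"
  then obtain i where i: "i < length xs" "y = xs ! i" by (auto simp: in_set_conv_nth)
  hence "y : p (Suc (Suc i))" using Cons.prems(3)[of "Suc i"] by simp
  thus "y : supported S" using primeD(1)[OF Cons.prems(1)[of "Suc (Suc i)"]] i(1) by auto
 qed
 show ?case
 proof (rule ccontr)
  assume nz: "~ (ALL a:L. c a = 0)"
  define L' where "L' = {a : L. c a ~= 0}"
  have L': "finite L'" "L' ~= {}" using Cons.prems(4) nz by (auto simp: L'_def)
  \<comment> \<open>The lowest power of \<open>x\<close> that occurs. After it is cancelled, modulo
    \<open>p 1\<close> only the terms with exact exponent \<open>j\<close> survive, and these form a
    relation between the remaining elements over the shifted chain.\<close>
  define j where "j = Min (hd ` L')"
  have jmin: "j <= hd a" if "a : L'" for a using that L' by (simp add: j_def)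
  have "j : hd ` L'" unfolding j_def by (rule Min_in) (use L' in auto)
  define K where "K = {a : L'. hd a = j}"
  have K: "K ~= {}" "finite K" using \<open>j : hd ` L'\<close> L'(1) by (auto simp: K_def)
  have shape: "a = hd a # tl a" "length (tl a) = length xs" if "a : L'" for a
   using Cons.prems(5)[of a] that by (cases a; simp add: L'_def)+
  have mono: "list_monom (x # xs) a = x ^ hd a * list_monom xs (tl a)" if "a : L'" for a
   by (subst shape(1)[OF that]) simp
  define g where "g = (SUM a:K. pm_const (c a) * list_monom xs (tl a))"
  define h where "h = (SUM a:L' - K. pm_const (c a) * (x ^ (hd a - j - 1) * list_monom xs (tl a)))"
  have gS: "g : supported S" and hS: "h : supported S" unfolding g_def h_def using xS xsS zero
   by (auto intro!: supported_sum supported_ops supported_power list_monom_supported)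
  have "(SUM a:L. pm_const (c a) * list_monom (x # xs) a) = (SUM a:L'. pm_const (c a) * list_monom (x # xs) a)"
   using Cons.prems(4) by (intro sum.mono_neutral_right) (auto simp: L'_def)
  also have "\<dots> = (SUM a:K. pm_const (c a) * list_monom (x # xs) a) + (SUM a:L' - K. pm_const (c a) * list_monom (x # xs) a)"
   using L'(1) by (subst sum.subset_diff[of K L']) (auto simp: K_def add.commute)
  also have "(SUM a:K. pm_const (c a) * list_monom (x # xs) a) = x ^ j * g" unfolding g_def sum_distrib_left
  proof (rule sum.cong)
   fix a assume a: "a : K"
   hence "a : L'" "hd a = j" by (auto simp: K_def)
   thus "pm_const (c a) * list_monom (x # xs) a = x ^ j * (pm_const (c a) * list_monom xs (tl a))"
    using mono by (simp only: mult.left_commute)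
  qed simp
  also have "(SUM a:L' - K. pm_const (c a) * list_monom (x # xs) a) = x ^ j * (x * h)"
   unfolding h_def sum_distrib_left
  proof (rule sum.cong)
   fix a assume a: "a : L' - K"
   hence "j < hd a" using jmin[of a] by (auto simp: K_def)
   hence "x ^ hd a = x ^ j * (x * x ^ (hd a - j - 1))"
    by (metis Suc_diff_Suc add_diff_inverse_nat diff_Suc_1 diff_Suc_eq_diff_pred less_imp_le_nat not_less power_Suc power_add)
   thus "pm_const (c a) * list_monom (x # xs) a = x ^ j * (x * (pm_const (c a) * (x ^ (hd a - j - 1) * list_monom xs (tl a))))"
    using mono[of a] a by (simp only: Diff_iff mult_ac)
  qed simp
  finally have "x ^ j * (g + x * h) : p 0" using Cons.prems(6) by (simp add: distrib_left)
  moreover have "x ^ j ~: p 0" using prime_power[OF p0 xS] x(2) by blast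
  ultimately have "g + x * h : p 0"
   using primeD(6)[OF p0 supported_power[OF xS] supported_ops(1)[OF gS supported_ops(2)[OF xS hS]]] by blast
  hence "g + x * h : p 1" using sub by blast
  moreover have "x * h : p 1" using primeD(4)[OF p1 hS x(1)] by (simp add: mult.commute)
  ultimately have "g + x * h - x * h : p 1" by (rule prime_minus[OF p1])
  hence g1: "g : p (Suc 0)" by simp
  have inj: "inj_on tl K"
  proof (rule inj_onI)
   fix a b assume "a : K" "b : K" "tl a = tl b"
   thus "a = b" using shape(1)[of a] shape(1)[of b] by (metis (mono_tags, lifting) K_def mem_Collect_eq)
  qed
  have "g = (SUM a:tl ` K. pm_const (c (j # a)) * list_monom xs a)"
   unfolding g_def sum.reindex[OF inj] comp_def
  proof (rule sum.cong)
   fix a assume "a : K"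
   hence "j # tl a = a" using shape(1)[of a] by (simp add: K_def)
   thus "pm_const (c a) * list_monom xs (tl a) = pm_const (c (j # tl a)) * list_monom xs (tl a)" by simp
  qed simp
  hence "(SUM a:tl ` K. pm_const (c (j # a)) * list_monom xs a) : p (Suc 0)" using g1 by simp
  hence "ALL a:tl ` K. c (j # a) = 0"
  proof (rule Cons.IH[of "%i. p (Suc i)" "tl ` K" "%a. c (j # a)", rotated -1])
   show "primeideal (p (Suc i)) (monoid_ring S)" if "i <= length xs" for i using Cons.prems(1)[of "Suc i"] that by simp
   show "p (Suc i) <= p (Suc (Suc i))" if "i < length xs" for i using Cons.prems(2)[of "Suc i"] that by simp
   show "xs ! i : p (Suc (Suc i)) & xs ! i ~: p (Suc i)" if "i < length xs" for i
    using Cons.prems(3)[of "Suc i"] that by simp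
   show "length a = length xs" if "a : tl ` K" for a using that shape(2) by (auto simp: K_def)
  qed (use K(2) in simp)
  moreover obtain a where a: "a : K" using K(1) by blast
  moreover have "j # tl a = a" "c a ~= 0" using a shape(1)[of a] by (auto simp: K_def L'_def)
  ultimately show False by (metis imageI)
 qed
qed

end

section \<open>Counting monomials bounds the length of chains of primes\<close>

context functional_lattice
begin

definition box :: "nat => ('v => real) set" where
 "box r = {s : M. ALL b:B. \<bar>s b\<bar> <= real r}"

lemma box_card: "finite (box r) & card (box r) <= (2 * r + 1) ^ card B"
proof -
 define f where "f s = (\<lambda>b\<in>B. \<lfloor>s b\<rfloor>)" for s :: "'v => real"
 have sub: "f ` box r <= (\<Pi>\<^sub>E b\<in>B. {- int r..int r})"
 proof
  fix y assume "y : f ` box r"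
  then obtain s where s: "y = f s" "s : box r" by blast
  have "\<lfloor>s b\<rfloor> : {- int r..int r}" if "b : B" for b
  proof -
   have "- real r <= s b" "s b <= real r" using s(2) that by (auto simp: box_def abs_le_iff)
   thus ?thesis by (auto simp: le_floor_iff floor_le_iff)
  qed
  thus "y : (\<Pi>\<^sub>E b\<in>B. {- int r..int r})" using s(1) by (auto simp: f_def)
 qed
 have inj: "inj_on f (box r)"
 proof (rule inj_onI)
  fix s t assume st: "s : box r" "t : box r" "f s = f t"
  hence M': "s : M" "t : M" by (auto simp: box_def)
  have "(s - t) b = 0" if b: "b : B" for b
  proof -
   have "\<lfloor>s b\<rfloor> = \<lfloor>t b\<rfloor>" using fun_cong[OF st(3), of b] b by (simp add: f_def)
   moreover obtain i j where "s b = of_int i" "t b = of_int j"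
    using int_on_B[OF M'(1) b] int_on_B[OF M'(2) b] by (elim Ints_cases)
   ultimately show ?thesis by simp
  qed
  hence "s - t = 0" using det_on_B[OF zsubgroup_diff[OF M M']] by blast
  thus "s = t" by simp
 qed
 have fin: "finite (\<Pi>\<^sub>E b\<in>B. {- int r..int r})" using B by (intro finite_PiE) auto
 have "card {- int r..int r} = 2 * r + 1" by (simp add: nat_eq_iff)
 hence "card (\<Pi>\<^sub>E b\<in>B. {- int r..int r}) = (2 * r + 1) ^ card B"
  using card_PiE[OF B, of "%_. {- int r..int r}"] by simp
 thus ?thesis
  using card_mono[OF fin sub] card_image[OF inj] finite_subset[OF sub fin] finite_imageD[OF _ inj] by simp
qed

lemma box_add: "s : box q ==> t : box r ==> s + t : box (q + r)"
proof -
 assume st: "s : box q" "t : box r"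
 have "\<bar>(s + t) b\<bar> <= real (q + r)" if "b : B" for b
  using st that abs_triangle_ineq[of "s b" "t b"] by (fastforce simp: box_def)
 thus ?thesis using zsubgroup_add[OF M] st by (auto simp: box_def)
qed

lemma box_mono: "q <= r ==> box q <= box r" by (fastforce simp: box_def)

lemma supported_box_mult:
 fixes p q :: "('v => real) \<Rightarrow>\<^sub>0 'c::comm_ring_1"
 assumes "p : supported (box i)" "q : supported (box j)"
 shows "p * q : supported (box (i + j))" unfolding supported_def mem_Collect_eq
proof
 fix k assume "k : Poly_Mapping.keys (p * q)"
 then obtain a b where "k = a + b" "a : Poly_Mapping.keys p" "b : Poly_Mapping.keys q" using keys_mult[of p q] by auto
 thus "k : box (i + j)" using assms box_add[of a i b j] by (auto simp: supported_def)
qed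

lemma one_supported_box: "(1 :: ('v => real) \<Rightarrow>\<^sub>0 'c::comm_ring_1) : supported (box 0)"
 using zsubgroup_zero[OF M] by (simp add: supported_def box_def)

lemma supported_box_power:
 fixes p :: "('v => real) \<Rightarrow>\<^sub>0 'c::comm_ring_1"
 shows "p : supported (box r) ==> p ^ a : supported (box (a * r))"
 by (induction a) (auto simp: one_supported_box intro: supported_box_mult)

lemma list_monom_box:
 fixes xs :: "(('v => real) \<Rightarrow>\<^sub>0 'c::comm_ring_1) list"
 assumes "set xs <= supported (box r)" "!!a. a : set as ==> a <= d"
 shows "list_monom xs as : supported (box (length xs * (d * r)))" using assms
proof (induction xs as rule: list_monom.induct)
 case (1 x xs a as)
 have "x ^ a * list_monom xs as : supported (box (a * r + length xs * (d * r)))"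
  using 1 by (intro supported_box_mult supported_box_power) auto
 moreover have "box (a * r + length xs * (d * r)) <= box (length (x # xs) * (d * r))"
  using 1(3)[of a] by (intro box_mono) (simp add: mult_right_mono)
 ultimately show ?case by (auto simp: supported_def)
next
 have one: "(1 :: ('v => real) \<Rightarrow>\<^sub>0 'c) : supported (box r)" for r
  using one_supported_box box_mono[of 0 r] by (auto simp: supported_def)
 {
  case ("2_1" as)
  show ?case using one by simp
 next
  case ("2_2" xs)
  show ?case using one by simp
 }
qed

text \<open>Among the monomials of degree at most \<open>d\<close> in each of more than \<open>card B\<close> elements there are
 eventually more than there are exponents in a box that contains their supports.\<close>

lemma prime_chain_bound:
 fixes p :: "nat => 'v cpoly set"
 assumes S: "exponent_monoid S" "S <= M"
  and p: "!!i. i <= m ==> primeideal (p i) (monoid_ring S)" "!!i. i < m ==> p i < p (Suc i)"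
 shows "m <= card B"
proof (rule ccontr)
 assume big: "~ m <= card B"
 define n where "n = card B"
 have nm: "n < m" using big by (simp add: n_def)
 interpret exponent_monoid S by fact
 have "ALL i. EX x. i <= n --> x : p (Suc i) & x ~: p i"
  using p(2) nm by (metis le_less_trans psubset_imp_ex_mem DiffD1 DiffD2)
 then obtain x where x: "!!i. i <= n ==> x i : p (Suc i) & x i ~: p i" by metis
 define xs where "xs = map x [0..<Suc n]"
 have lx: "length xs = Suc n" by (simp add: xs_def)
 have nth: "xs ! i = x i" if "i < Suc n" for i using that by (simp add: xs_def del: upt_Suc)
 have xS: "set xs <= supported S"
 proof
  fix y assume "y : set xs"
  then obtain i where "i <= n" "y = x i" by (auto simp: xs_def less_Suc_eq_le simp del: upt_Suc)
  thus "y : supported S" using x primeD(1)[OF p(1)[of "Suc i"]] nm by auto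
 qed
 define KK where "KK = (UN y:set xs. Poly_Mapping.keys y)"
 have KK: "finite KK" "KK <= M" using xS S(2) by (auto simp: KK_def supported_def)
 \<comment> \<open>A bound for all coordinates of all exponents that occur in the chosen
   elements.\<close>
 define C where "C = nat (SUM s:KK. SUM b:B. \<lceil>\<bar>s b\<bar>\<rceil>)"
 have "KK <= box C"
 proof
  fix s assume s: "s : KK"
  have "\<bar>s b\<bar> <= real C" if b: "b : B" for b
  proof -
   have "\<lceil>\<bar>s b\<bar>\<rceil> <= (SUM b:B. \<lceil>\<bar>s b\<bar>\<rceil>)" using B b by (intro member_le_sum) auto
   also have "\<dots> <= (SUM s:KK. SUM b:B. \<lceil>\<bar>s b\<bar>\<rceil>)" using KK(1) s by (intro member_le_sum[of s KK "%s. SUM b:B. \<lceil>\<bar>s b\<bar>\<rceil>"] sum_nonneg) auto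
   finally have "\<lceil>\<bar>s b\<bar>\<rceil> <= int C" unfolding C_def using order_trans[of 0 "\<lceil>\<bar>s b\<bar>\<rceil>"] by simp
   thus ?thesis by (simp add: ceiling_le_iff)
  qed
  thus "s : box C" using s KK(2) by (auto simp: box_def)
 qed
 hence xbox: "set xs <= supported (box C)" by (auto simp: KK_def supported_def)
 \<comment> \<open>The products lie in a box with at most \<open>(c (d + 1))^n\<close> exponents.
   Choosing \<open>d = c^n\<close> turns this into \<open>d (d + 1)^n\<close>, which is less than
   the number \<open>(d + 1)^(n + 1)\<close> of monomials.\<close>
 define c where "c = 2 * Suc n * C + 1"
 define d where "d = c ^ n"
 define L where "L = {a :: nat list. set a <= {..d} & length a = Suc n}"
 have L: "finite L" "card L = (d + 1) ^ Suc n"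
  using finite_lists_length_eq[of "{..d}" "Suc n"] card_lists_length_eq[of "{..d}" "Suc n"] by (simp_all add: L_def)
 define r where "r = Suc n * (d * C)"
 have "card (box r) <= (2 * r + 1) ^ n" using box_card by (simp add: n_def)
 also have "\<dots> <= (c * (d + 1)) ^ n" by (intro power_mono) (simp_all add: r_def c_def algebra_simps)
 also have "\<dots> = d * (d + 1) ^ n" by (simp only: power_mult_distrib d_def)
 also have "\<dots> < (d + 1) ^ Suc n" by simp
 finally have "card (box r) < card L" by (simp only: L(2))
 \<comment> \<open>There are more monomials than coordinates in the box, so the coefficient vectors
   are linearly dependent over the complex numbers.\<close>
 then obtain a where a: "EX l:L. a l ~= 0" "ALL s:box r. (SUM l:L. a l * Poly_Mapping.lookup (list_monom xs l) s) = 0"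
  using exists_linear_relation[of "box r" L "%l. Poly_Mapping.lookup (list_monom xs l)"] box_card L(1) by blast
 have lm: "Poly_Mapping.lookup (list_monom xs l) s = 0" if "l : L" "s ~: box r" for l s
 proof -
  have "list_monom xs l : supported (box r)"
   using list_monom_box[OF xbox, of l d] that(1) by (auto simp: L_def r_def lx)
  thus ?thesis using that(2) by (auto simp: supported_def in_keys_iff)
 qed
 have sc: "Poly_Mapping.lookup (pm_const z * q) s = z * Poly_Mapping.lookup q s" for z :: complex and q :: "'v cpoly" and s
  unfolding mult_map_scale_conv_mult[symmetric] by (simp add: Poly_Mapping.map.rep_eq when_def)
 have "(SUM l:L. pm_const (a l) * list_monom xs l) = 0"
 proof (rule poly_mapping_eqI)
  fix s
  show "Poly_Mapping.lookup (SUM l:L. pm_const (a l) * list_monom xs l) s = Poly_Mapping.lookup 0 s"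
   using a(2) lm by (cases "s : box r") (simp_all add: lookup_sum sc)
 qed
 hence "(SUM l:L. pm_const (a l) * list_monom xs l) : p 0" using primeD(2)[OF p(1)[of 0]] by simp
 hence "ALL l:L. a l = 0"
 proof (rule chain_independent[rotated -1])
  show "primeideal (p i) (monoid_ring S)" if "i <= length xs" for i using p(1) that nm lx by simp
  show "p i <= p (Suc i)" if "i < length xs" for i using p(2)[of i] that nm lx by auto
  show "xs ! i : p (Suc i) & xs ! i ~: p i" if "i < length xs" for i using x[of i] nth[of i] that lx by simp
  show "length l = length xs" if "l : L" for l using that lx by (simp add: L_def)
 qed (rule L(1))
 thus False using a(1) by blast
qed

lemma Spec_krull_dim_le:
 assumes S: "exponent_monoid S" "S <= M"
 shows "krull_dim (Spec_top (monoid_ring S :: 'v cpoly ring)) <= ereal (card B)"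
proof -
 interpret exponent_monoid S by fact
 let ?P = "{Q. primeideal Q (monoid_ring S :: 'v cpoly ring)}"
 interpret sober_avoid_space ?P "supported S" by (rule spec_sober)
 \<comment> \<open>The rank of a prime is the length of the longest ascending chain of primes that
   starts at it; \<open>prime_chain_bound\<close> makes this finite.\<close>
 define ch where "ch Q k \<longleftrightarrow> (EX p. p 0 = Q & (ALL i<=k. p i : ?P) & (ALL i<k. p i < p (Suc i)))" for Q and k :: nat
 have le: "k <= card B" if "ch Q k" for Q k
 proof -
  obtain p where "ALL i<=k. p i : ?P" "ALL i<k. p i < p (Suc i)" using \<open>ch Q k\<close> unfolding ch_def by blast
  thus ?thesis by (intro prime_chain_bound[OF S, of k p]) auto
 qed
 define rk where "rk Q = (GREATEST k. ch Q k)" for Q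
 have ch0: "ch Q 0" if "Q : ?P" for Q using that unfolding ch_def by (intro exI[of _ "%_. Q"]) auto
 have rk: "ch Q (rk Q)" if "Q : ?P" for Q
  unfolding rk_def by (rule GreatestI_nat[where P = "ch Q" and k = 0 and b = "card B"]) (use ch0[OF that] le in auto)
 show ?thesis unfolding Spec_top_avoid
 proof (rule krull_dim_le_points[where r = rk])
  show "rk Q <= card B" if "Q : ?P" for Q using le[OF rk[OF that]] .
  fix P Q assume PQ: "P : ?P" "Q : ?P" "P < Q"
  obtain q where q: "q 0 = Q" "ALL i<=rk Q. q i : ?P" "ALL i<rk Q. q i < q (Suc i)" using rk[OF PQ(2)] unfolding ch_def by blast
  define q' where "q' i = (case i of 0 => P | Suc j => q j)" for i
  have "ch P (Suc (rk Q))" unfolding ch_def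
  proof (intro exI[of _ q'] conjI allI impI)
   show "q' i : ?P" if "i <= Suc (rk Q)" for i using that q(2) PQ(1) by (auto simp: q'_def split: nat.split)
   show "q' i < q' (Suc i)" if "i < Suc (rk Q)" for i using that q(1,3) PQ(3) by (auto simp: q'_def split: nat.split)
  qed (simp add: q'_def)
  hence "Suc (rk Q) <= rk P" unfolding rk_def[of P] by (rule Greatest_le_nat[where P = "ch P" and b = "card B"]) (use le in auto)
  thus "rk Q < rk P" by simp
 qed
qed

end

section \<open>The complex toric variety\<close>

lemma mult_monom_supported:
 fixes p :: "'m::comm_monoid_add \<Rightarrow>\<^sub>0 'c::comm_ring_1"
 assumes "!!s. s : Poly_Mapping.keys p ==> s + t : S"
 shows "p * pm_monom t : supported S" unfolding supported_def mem_Collect_eq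
proof
 fix k assume "k : Poly_Mapping.keys (p * pm_monom t)"
 then obtain a where "k = a + t" "a : Poly_Mapping.keys p" using keys_mult[of p "pm_monom t"] by auto
 thus "k : S" using assms by simp
qed

context toric_fan
begin

lemma exponent_CM: "C : \<Sigma> ==> exponent_monoid (CM C)" using CM_zero CM_add by unfold_locales

abbreviation CR :: "'v set => 'v cpoly set" where "CR C \<equiv> supported (CM C)"

abbreviation spec :: "'v set => 'v cpoly set set" where
 "spec C \<equiv> {Q. primeideal Q (monoid_ring (CM C))}"

lemma CM_zmul': "C : \<Sigma> ==> h : CM C ==> zmul (int n) h : CM C"
 by (induction n) (simp_all add: CM_zero CM_add zmul_algebra)

lemma CR_mono: "D <= C ==> CR C <= CR D" using CM_antimono[of D C] by (auto simp: supported_def)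

lemma CR_clear:
 assumes C: "C : \<Sigma>" and h: "h : CM C" and p: "p : CR (C Int {u. h u = 0})"
 shows "EX k::nat. p * pm_monom (zmul (int k) h) : CR C"
proof -
 have "EX k::nat. ALL s:K. s + zmul (int k) h : CM C" if "finite K" "K <= CM (C Int {u. h u = 0})" for K
  using that
 proof (induction K rule: finite_induct)
  case (insert s K)
  have "K <= CM (C Int {u. h u = 0})" using insert.prems by blast
  from insert.IH[OF this] obtain k :: nat where k: "ALL s:K. s + zmul (int k) h : CM C" by (elim exE)
  obtain j :: nat where j: "s + zmul (int j) h : CM C" using insert.prems unfolding CM_localization(2)[OF C h] by auto
  have "t + zmul (int (j + k)) h : CM C" if "t : insert s K" for t
  proof -
   have e: "t + zmul (int (j + k)) h = (t + zmul (int j) h) + zmul (int k) h"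
    "t + zmul (int (j + k)) h = (t + zmul (int k) h) + zmul (int j) h"
    by (simp_all only: of_nat_add zmul_algebra add_ac)
   show ?thesis
   proof (cases "t = s")
    case True
    thus ?thesis unfolding e(1) using CM_add[OF C j CM_zmul'[OF C h]] by blast
   next
    case False
    thus ?thesis unfolding e(2) using CM_add[OF C _ CM_zmul'[OF C h]] k that by blast
   qed
  qed
  thus ?case by blast
 qed simp
 from this[of "Poly_Mapping.keys p"] p show ?thesis
  by (metis (mono_tags, lifting) finite_keys mem_Collect_eq mult_monom_supported supported_def)
qed

lemma monom_h:
 fixes h :: "'v => real"
 shows "pm_monom (zmul (int j) h) * pm_monom (zmul (int k) h) = (pm_monom (zmul (int (j + k)) h) :: 'v cpoly)"
  "pm_monom (zmul (int k) h) = (pm_monom h :: 'v cpoly) ^ k"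
proof -
 show m: "pm_monom (zmul (int j) h) * pm_monom (zmul (int k) h) = (pm_monom (zmul (int (j + k)) h) :: 'v cpoly)" for j k
  by (simp add: mult_single zmul_algebra)
 show "pm_monom (zmul (int k) h) = (pm_monom h :: 'v cpoly) ^ k"
 proof (induction k)
  case (Suc k)
  have "pm_monom (zmul (int (Suc k)) h) = pm_monom (zmul (int 1) h) * (pm_monom (zmul (int k) h) :: 'v cpoly)"
   unfolding m by simp
  thus ?case using Suc by simp
 next
  case 0
  show ?case unfolding of_nat_0 zmul_simps(2) power_0 by (rule single_one)
 qed
qed

lemma unit_not_in_prime:
 assumes C: "C : \<Sigma>" and h: "h : CM C" "- h : CM C" and Q: "Q : spec C"
 shows "pm_monom h ~: Q"
proof
 interpret exponent_monoid "CM C" by (rule exponent_CM[OF C])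
 assume "pm_monom h : Q"
 hence "pm_monom (- h) * pm_monom h : Q" using primeD(4)[of Q] Q supported_ops(6)[OF h(2)] by blast
 thus False using primeD(5)[of Q] Q by (simp add: mult_single)
qed

lemma prime_ideal_extend:
 assumes C: "C : \<Sigma>" and h: "h : CM C" and y: "y : spec C" "pm_monom h ~: y"
 shows "EX x:spec (C Int {u. h u = 0}). x Int CR C = y"
proof -
 let ?D = "C Int {u. h u = 0}"
 note D = CM_localization(1)[OF C h]
 interpret S: exponent_monoid "CM C" by (rule exponent_CM[OF C])
 interpret T: exponent_monoid "CM ?D" by (rule exponent_CM[OF D])
 have y': "primeideal y (monoid_ring (CM C))" using y(1) by simp
 note yD = S.primeD[OF y']
 let ?m = "%k::nat. pm_monom (zmul (int k) h) :: 'v cpoly"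
 have mS: "?m k : CR C" for k using S.supported_ops(6)[OF CM_zmul'[OF C h]] .
 have my: "?m k ~: y" for k
  using S.prime_power[OF y' S.supported_ops(6)[OF h], of 1 k] y(2) unfolding monom_h(2) by blast
 have sub: "CR C <= CR ?D" by (rule CR_mono) blast
 define x where "x = {p : CR ?D. EX k. p * ?m k : y}"
 have up: "p * ?m (k + j) : y" if "p * ?m k : y" for p k j
 proof -
  have "?m j * (p * ?m k) : y" by (rule yD(4)[OF mS that])
  thus ?thesis unfolding monom_h(1)[symmetric] by (simp add: mult_ac)
 qed
 have xs: "p : x \<longleftrightarrow> p : y" if "p : CR C" for p
 proof
  assume "p : x"
  then obtain k where "p * ?m k : y" by (auto simp: x_def)
  thus "p : y" using yD(6)[OF that mS] my by blast
 next
  assume "p : y"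
  hence "p * ?m 0 : y" by simp
  thus "p : x" using that sub unfolding x_def by blast
 qed
 have "primeideal x (monoid_ring (CM ?D))" unfolding T.primeideal_iff
 proof (intro conjI ballI impI)
  show "x <= CR ?D" by (auto simp: x_def)
  show "0 : x" using xs[OF S.supported_ops(5)] yD(2) by simp
  show "1 ~: x" using xs[OF S.supported_ops(4)] yD(5) by simp
  show "p + q : x" if pq: "p : x" "q : x" for p q
  proof -
   obtain i j where ij: "p * ?m i : y" "q * ?m j : y" using pq by (auto simp: x_def)
   have "p * ?m (i + j) + q * ?m (j + i) : y" by (rule yD(3)[OF up[OF ij(1)] up[OF ij(2)]])
   hence "(p + q) * ?m (i + j) : y" by (simp add: distrib_right add.commute)
   thus ?thesis using pq T.supported_ops(1) unfolding x_def by blast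
  qed
  show "a * q : x" if a: "a : CR ?D" and q: "q : x" for a q
  proof -
   obtain i where i: "a * ?m i : CR C" using CR_clear[OF C h a] by blast
   obtain j where j: "q * ?m j : y" "q : CR ?D" using q by (auto simp: x_def)
   have "(a * ?m i) * (q * ?m j) : y" by (rule yD(4)[OF i j(1)])
   hence "(a * q) * ?m (i + j) : y" unfolding monom_h(1)[symmetric] by (simp add: mult_ac)
   thus ?thesis using T.supported_ops(2)[OF a j(2)] unfolding x_def by blast
  qed
  show "a : x \<or> b : x" if a: "a : CR ?D" and b: "b : CR ?D" and ab: "a * b : x" for a b
  proof -
   obtain i j where ij: "a * ?m i : CR C" "b * ?m j : CR C" using CR_clear[OF C h] a b by metis
   obtain k where "a * b * ?m k : y" using ab by (auto simp: x_def)
   hence "a * b * ?m (k + (i + j)) : y" by (rule up)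
   hence "(a * ?m i) * ((b * ?m j) * ?m k) : y" unfolding monom_h(1)[symmetric] by (simp add: mult_ac)
   hence "a * ?m i : y \<or> b * ?m j : y"
    using yD(6)[OF ij(1) S.supported_ops(2)[OF ij(2) mS]] yD(6)[OF ij(2) mS] my by blast
   thus ?thesis using a b unfolding x_def by blast
  qed
 qed
 moreover have "x Int CR C = y" using xs yD(1) by blast
 ultimately show ?thesis by blast
qed

lemma Spec_gluing:
 "gluing \<Sigma> (face_rel \<Sigma>) (%C. avoid_top (spec C) (CR C)) (%D C Q. Q Int CR C)"
proof (rule fan_gluing[where el = pm_monom])
 fix C assume C: "C : \<Sigma>"
 interpret S: exponent_monoid "CM C" by (rule exponent_CM[OF C])
 show "avoid_space (spec C) (CR C)" by (rule S.spec_avoid)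
 show "CR C <= CR D" if "D <= C" for D by (rule CR_mono[OF that])
 fix h assume h: "h : CM C"
 let ?D = "C Int {u. h u = 0}"
 note D = CM_localization(1)[OF C h]
 interpret T: exponent_monoid "CM ?D" by (rule exponent_CM[OF D])
 have sub: "CR C <= CR ?D" by (rule CR_mono) blast
 have hh: "h : CM ?D" "- h : CM ?D"
 proof -
  show "h : CM ?D" using h CM_antimono[of ?D C] by auto
  have "- h + zmul (int 1) h : CM C" using CM_zero[OF C] by simp
  moreover have "- h : M" using zsubgroup_uminus[OF M] CM_subset h by blast
  ultimately show "- h : CM ?D" unfolding CM_localization(2)[OF C h] by blast
 qed
 show "pm_monom h : CR C" by (rule S.supported_ops(6)[OF h])
 show "pm_monom (h + h') ~: y" if "h' : CM C" "y : spec C" "pm_monom h ~: y" "pm_monom h' ~: y" for h' y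
 proof
  assume "pm_monom (h + h') : y"
  hence "pm_monom h * pm_monom h' : y" by (simp add: mult_single)
  thus False using S.primeD(6)[of y "pm_monom h" "pm_monom h'"] that S.supported_ops(6) h by blast
 qed
 show "x Int CR C : spec C & pm_monom h ~: x" if x: "x : spec ?D" for x
 proof
  have x': "primeideal x (monoid_ring (CM ?D))" using x by simp
  note xD = T.primeD[OF x']
  show "pm_monom h ~: x" by (rule unit_not_in_prime[OF D hh x])
  show "x Int CR C : spec C" unfolding mem_Collect_eq S.primeideal_iff
   using xD(2,5) xD(3,4,6) sub S.supported_ops(1,2,5) by (auto 4 3 simp: subset_iff)
 qed
 show "EX x:spec ?D. x Int CR C = y" if "y : spec C" "pm_monom h ~: y" for y
  by (rule prime_ideal_extend[OF C h that])
 fix e assume e: "e : CR ?D"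
 obtain k where k: "e * pm_monom (zmul (int k) h) : CR C" using CR_clear[OF C h e] by blast
 have "e : x \<longleftrightarrow> e * pm_monom (zmul (int k) h) : x" if x: "x : spec ?D" for x
 proof -
  have x': "primeideal x (monoid_ring (CM ?D))" using x by simp
  have kh: "zmul (int k) h : CM ?D" "- zmul (int k) h : CM ?D"
   using CM_zmul'[OF D hh(1)] CM_zmul'[OF D hh(2), of k] by (simp_all add: zmul_algebra)
  have mk: "pm_monom (zmul (int k) h) : CR ?D" by (rule T.supported_ops(6)[OF kh(1)])
  show ?thesis
   using T.primeD(6)[OF x' e mk] unit_not_in_prime[OF D kh x] T.primeD(4)[OF x' mk, of e] by (auto simp: mult.commute)
 qed
 thus "EX e':CR C. ALL x:spec ?D. e : x \<longleftrightarrow> e' : x" using k by blast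
qed

lemma krull_dim_variety:
 "krull_dim (toric_variety_top N \<Sigma>) = (SUP C\<in>\<Sigma>. krull_dim (Spec_top (monoid_ring (CM C) :: 'v cpoly ring)))"
 using gluing.krull_dim_colim[OF Spec_gluing] unfolding toric_variety_top_def carrier_monoid_ring Spec_top_avoid .

end

section \<open>A chain of primes from projections of the exponents\<close>

definition push :: "('m => 'g) => ('m \<Rightarrow>\<^sub>0 'c) => ('g \<Rightarrow>\<^sub>0 'c::comm_ring_1)" where
 "push f p = (SUM k:Poly_Mapping.keys p. Poly_Mapping.single (f k) (Poly_Mapping.lookup p k))"

lemma push_superset:
 "finite K ==> Poly_Mapping.keys p <= K ==> push f p = (SUM k:K. Poly_Mapping.single (f k) (Poly_Mapping.lookup p k))"
 unfolding push_def by (rule sum.mono_neutral_left) (auto simp: in_keys_iff)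

lemma push_add: "push f (p + q) = push f p + push f q"
proof -
 let ?K = "Poly_Mapping.keys p Un Poly_Mapping.keys q"
 have "finite ?K" "Poly_Mapping.keys (p + q) <= ?K" using keys_add[of p q] by auto
 thus ?thesis using push_superset[of ?K "p + q" f] push_superset[of ?K p f] push_superset[of ?K q f]
  by (simp add: lookup_add single_add sum.distrib)
qed

lemma push_single: "push f (Poly_Mapping.single k c) = Poly_Mapping.single (f k) c"
 using push_superset[of "{k}" "Poly_Mapping.single k c" f] by simp

lemma push_zero [simp]: "push f 0 = 0" by (simp add: push_def)

lemma push_sum: "push f (sum g I) = (SUM i:I. push f (g i))"
 by (induction I rule: infinite_finite_induct) (simp_all add: push_add)

lemma push_push: "push g (push f p) = push (g \<circ> f) p"
 unfolding push_def[of f] push_sum push_single by (simp add: push_def)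

lemma push_id: "push id p = p"
proof (rule poly_mapping_eqI)
 fix k
 have "Poly_Mapping.lookup (push id p) k = (SUM l:Poly_Mapping.keys p. if l = k then Poly_Mapping.lookup p l else 0)"
  by (auto simp: push_def lookup_sum lookup_single when_def intro!: sum.cong)
 also have "\<dots> = Poly_Mapping.lookup p k" by (simp add: in_keys_iff)
 finally show "Poly_Mapping.lookup (push id p) k = Poly_Mapping.lookup p k" .
qed

lemma push_mult:
 fixes f :: "'m::comm_monoid_add => 'g::comm_monoid_add"
 assumes "!!s t. s : S ==> t : S ==> f (s + t) = f s + f t" "p : supported S" "q : supported S"
 shows "push f (p * q) = push f p * push f q"
proof -
 let ?P = "Poly_Mapping.keys p" and ?Q = "Poly_Mapping.keys q"
 have "p * q = push id p * push id q" by (simp add: push_id)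
 also have "\<dots> = (SUM k:?P. SUM l:?Q. Poly_Mapping.single (k + l) (Poly_Mapping.lookup p k * Poly_Mapping.lookup q l))"
  by (simp add: push_def sum_product mult_single)
 finally have "push f (p * q) = (SUM k:?P. SUM l:?Q. Poly_Mapping.single (f (k + l)) (Poly_Mapping.lookup p k * Poly_Mapping.lookup q l))"
  by (simp only: push_sum push_single)
 also have "\<dots> = (SUM k:?P. SUM l:?Q. Poly_Mapping.single (f k) (Poly_Mapping.lookup p k) * Poly_Mapping.single (f l) (Poly_Mapping.lookup q l))"
  using assms by (intro sum.cong) (auto simp: mult_single supported_def subset_iff)
 also have "\<dots> = push f p * push f q" by (simp add: push_def sum_product)
 finally show ?thesis .
qed

text \<open>The exponents of the target are cancellative and linearly ordered, so its ring has no
  zero divisors and the kernel is prime.\<close>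

lemma (in exponent_monoid) push_kernel_prime:
 fixes f :: "'m => 'g::{ordered_cancel_comm_monoid_add, linorder}"
 assumes f: "!!s t. s : S ==> t : S ==> f (s + t) = f s + f t" "f 0 = 0"
 shows "primeideal {p : supported S. push f p = (0 :: 'g \<Rightarrow>\<^sub>0 'c::idom)} (monoid_ring S)"
 unfolding primeideal_iff
proof (intro conjI ballI impI)
 have "push f (1 :: 'm \<Rightarrow>\<^sub>0 'c) = 1" using push_single[of f 0 "1 :: 'c"] f(2) by simp
 thus "(1 :: 'm \<Rightarrow>\<^sub>0 'c) ~: {p : supported S. push f p = 0}" by simp
qed (auto simp: supported_ops push_add push_mult[OF f(1)])

context lattice_basis
begin

lemma exponent_M: "exponent_monoid M" using zsubgroup_zero[OF M] zsubgroup_add[OF M] by unfold_locales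

lemma Spec_krull_dim_ge: "ereal (card B) <= krull_dim (Spec_top (monoid_ring M :: 'v cpoly ring))"
proof -
 interpret exponent_monoid M by (rule exponent_M)
 interpret avoid_space "{Q. primeideal Q (monoid_ring M :: 'v cpoly ring)}" "supported M" by (rule spec_avoid)
 define n where "n = card B"
 obtain b where b: "bij_betw b {..<n} B" using ex_bij_betw_nat_finite[OF B_finite] by (auto simp: n_def lessThan_atLeast0)
 have bB: "b j : B" if "j < n" for j using b that by (auto simp: bij_betw_def)
 have dual: "EX m:M. ALL j<n. m (b j) = (if j = i then 1 else 0)" if i: "i < n" for i
 proof -
  obtain m where m: "m : M" "ALL b':B. m b' = (if b' = b i then 1 else 0)" using dual_basis[OF bB[OF i]] by blast
  have "m (b j) = (if j = i then 1 else 0)" if j: "j < n" for j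
  proof -
   have "b j = b i \<longleftrightarrow> j = i" using b i j by (auto simp: bij_betw_def inj_on_def)
   thus ?thesis using m(2) bB[OF j] by simp
  qed
  thus ?thesis using m(1) by blast
 qed
 \<comment> \<open>\<open>e i\<close> forgets the first \<open>i\<close> coordinates. The remaining
   ones are kept as a finitely supported integer sequence, because these sequences are linearly
   ordered as \<open>push_kernel_prime\<close> requires.\<close>
 define e where "e i m = (SUM j:{i..<n}. Poly_Mapping.single j \<lfloor>m (b j)\<rfloor>)" for i and m :: "'v => real"
 have lk: "Poly_Mapping.lookup (SUM j:{i..<n}. Poly_Mapping.single j (z j)) j = (if j : {i..<n} then z j else 0)" for i j and z :: "nat => int"
  by (simp add: lookup_sum lookup_single when_def)
 have e_add: "e i (s + t) = e i s + e i t" if st: "s : M" "t : M" for i s t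
 proof -
  have "\<lfloor>(s + t) (b j)\<rfloor> = \<lfloor>s (b j)\<rfloor> + \<lfloor>t (b j)\<rfloor>" if j: "j < n" for j
  proof -
   obtain u v where "s (b j) = of_int u" "t (b j) = of_int v"
    using int_on_B[OF st(1) bB[OF j]] int_on_B[OF st(2) bB[OF j]] by (elim Ints_cases)
   thus ?thesis by (simp del: of_int_add add: of_int_add[symmetric])
  qed
  thus ?thesis unfolding e_def sum.distrib[symmetric] single_add[symmetric] by (intro sum.cong) auto
 qed
 have e_zero: "e i 0 = 0" for i by (simp add: e_def)
 have e_Suc: "e (Suc i) m = (SUM j:{Suc i..<n}. Poly_Mapping.single j (Poly_Mapping.lookup (e i m) j))" for i m
  unfolding e_def lk by (intro sum.cong) auto
 define p where "p i = {q : supported M. push (e i) q = (0 :: (nat \<Rightarrow>\<^sub>0 int) \<Rightarrow>\<^sub>0 complex)}" for i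
 have p: "primeideal (p i) (monoid_ring M)" for i
  unfolding p_def by (rule push_kernel_prime) (rule e_add, assumption+, rule e_zero)
 have lt: "p i < p (Suc i)" if i: "i < n" for i
 proof
  \<comment> \<open>Forgetting one more coordinate factors through \<open>e i\<close>, hence the
    kernels increase.\<close>
  have "e (Suc i) = (%q. SUM j:{Suc i..<n}. Poly_Mapping.single j (Poly_Mapping.lookup q j)) \<circ> e i"
   using e_Suc by (simp add: fun_eq_iff)
  hence "push (e (Suc i)) q = push (%q. SUM j:{Suc i..<n}. Poly_Mapping.single j (Poly_Mapping.lookup q j)) (push (e i) q)"
   for q :: "'v cpoly" by (simp only: push_push)
  thus "p i <= p (Suc i)" by (auto simp: p_def)
  obtain m where m: "m : M" "ALL j<n. m (b j) = (if j = i then 1 else 0)" using dual[OF i] by blast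
  \<comment> \<open>The character dual to \<open>b i\<close> minus 1: its image is 0 once coordinate
    \<open>i\<close> is forgotten, and has constant term -1 before.\<close>
  define q :: "'v cpoly" where "q = pm_monom m + pm_const (- 1)"
  have qS: "q : supported M" unfolding q_def by (intro supported_ops zero m(1))
  have pq: "push (e k) q = pm_monom (e k m) + pm_const (- 1)" for k
   by (simp add: q_def push_add push_single e_zero)
  have "e (Suc i) m = 0" unfolding e_def using m(2) by (intro sum.neutral) auto
  hence "push (e (Suc i)) q = 0" unfolding pq
   by (simp only: single_add[symmetric] add.right_inverse single_zero)
  hence "q : p (Suc i)" using qS by (simp add: p_def)
  moreover have "e i m ~= 0"
  proof
   assume "e i m = 0"
   hence "Poly_Mapping.lookup (e i m) i = 0" by simp
   thus False unfolding e_def lk using i m(2) by simp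
  qed
  hence "Poly_Mapping.lookup (push (e i) q) 0 = - 1"
   unfolding pq by (simp add: lookup_add lookup_single_not_eq)
  hence "q ~: p i" by (auto simp: p_def)
  ultimately show "p i ~= p (Suc i)" by blast
 qed
 show ?thesis unfolding Spec_top_avoid n_def[symmetric]
 \<comment> \<open>The lemma takes descending chains, hence the reversed index.\<close>
 proof (rule krull_dim_ge_points[where p = "%i. p (n - i)"])
  show "p (n - i) : {Q. primeideal Q (monoid_ring M)}" for i using p by simp
  show "p (n - Suc i) < p (n - i)" if "i < n" for i using lt[of "n - Suc i"] that by (simp add: Suc_diff_Suc)
 qed
qed

end

lemma (in toric_fan) krull_dim_variety_eq:
 "krull_dim (toric_variety_top N \<Sigma>) = (if \<Sigma> = {} then bot else ereal (card B))"
proof (cases "\<Sigma> = {}")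
 case False
 let ?S = "%C. Spec_top (monoid_ring (CM C) :: 'v cpoly ring)"
 have z: "{0} : \<Sigma>" using zero_cone_mem False by blast
 have "ereal (card B) <= (SUP C\<in>\<Sigma>. krull_dim (?S C))"
  by (rule SUP_upper2[OF z]) (simp add: CM_zero_cone Spec_krull_dim_ge)
 moreover have "(SUP C\<in>\<Sigma>. krull_dim (?S C)) <= ereal (card B)"
  by (rule SUP_least) (rule Spec_krull_dim_le[OF exponent_CM CM_subset])
 ultimately show ?thesis using False krull_dim_variety by simp
qed (use krull_dim_variety in simp)

theorem theorem1:
  fixes F :: "'k pmonoid" and N :: "'v::real_vector set" and \<Sigma> :: "'v set set"
  assumes "alg_closed_pgroup F"
    and "full_lattice N"
    and "fan N \<Sigma>"
  shows "let Y = SCong_scheme F (toric_structure F N \<Sigma>) (toric_scheme F N \<Sigma>)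
    in catenary Y & krull_dim Y = krull_dim (toric_variety_top N \<Sigma>)"
proof -
 obtain B where B: "finite B" "independent B" "span B = UNIV"
  "N = {SUM b:B. of_int (c b) *\<^sub>R b | c :: 'v => int. True}"
  using assms(2) unfolding full_lattice_def by blast
 interpret toric_scheme_fan N B \<Sigma> F using assms B by unfold_locales
 show ?thesis unfolding Let_def using Y_facts krull_dim_variety_eq by simp
qed

end
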